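(* There exist absolute constants $C,c_1,c_2>0$ such that for all integers $1\le d\le n$, the Haar probability measure of the set of subspaces $E\in G_{n,d}$ satisfying $$L_{P_E B_1^n}<C\qquad\text{and}\qquad L_{P_E S_n}<C$$ is greater than $1-c_1e^{-c_2\max\{\log n,\,d\}}$.
   Context: $G_{n,d}$ is the Grassmann manifold of $d$-dimensional linear subspaces of $\mathbb{R}^n$, with its (rotation-invariant) Haar probability measure. $P_E$ denotes the orthogonal projection onto $E$. $B_1^n=\{x\in\mathbb{R}^n:\sum_i|x_i|\le1\}$ is the unit ball of $\ell_1^n$. $S_n$ is an $n$-dimensional regular simplex in $\mathbb{R}^n$ with center of mass at the origin. A convex body $K$ (compact convex set with non-empty interior) in a $d$-dimensional Euclidean space is isotropic if $\mathrm{Vol}_d(K)=1$, its barycenter is at the origin, and there is $L_K>0$ with $\int_K\langle x,\theta\rangle^2\,dx=L_K^2$ for every unit vector $\theta$. Every convex body $K$ has an isotropic image $K_1$ under an invertible affine map, and its isotropy constant is $L_K:=L_{K_1}$ (well defined). The isotropy constants of the projections are taken regarding them as convex bodies in the $d$-dimensional Euclidean space $E$. *)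

theory Defs
  imports "HOL-Analysis.Analysis" "HOL-Probability.Probability_Measure"
begin

text \<open>
  The statement quantifies over the dimension n after the absolute constants, so n cannot be the
  cardinality of an index type.  All spaces of real n-vectors are therefore placed in one inner
  product space: the finitely supported real sequences, n-space being the sequences that vanish
  from index n on.  This gives access to the library notions for \<^class>\<open>real_inner\<close>
  (\<^const>\<open>subspace\<close>, \<^const>\<open>dim\<close>, \<^const>\<open>orthogonal_transformation\<close>, \<^const>\<open>onorm\<close>, ...).
  The library type of finitely supported functions is not usable here because its norm is the sum norm.
\<close>

typedef rseq = "{f :: nat \<Rightarrow> real. finite {i. f i \<noteq> 0}}"
  morphisms coord Abs_rseq
  by (rule exI[of _ "\<lambda>_. 0"]) simp

setup_lifting type_definition_rseq

lemma rseq_eqI: "(\<And>i. coord x i = coord y i) \<Longrightarrow> x = y"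
  by (simp add: coord_inject[symmetric] fun_eq_iff)

instantiation rseq :: real_vector
begin

lift_definition zero_rseq :: rseq is "\<lambda>_. 0" by simp

lift_definition plus_rseq :: "rseq \<Rightarrow> rseq \<Rightarrow> rseq" is "\<lambda>x y i. x i + y i"
proof -
  fix x y :: "nat \<Rightarrow> real"
  assume fin: "finite {i. x i \<noteq> 0}" "finite {i. y i \<noteq> 0}"
  show "finite {i. x i + y i \<noteq> 0}"
    by (rule finite_subset[of _ "{i. x i \<noteq> 0} \<union> {i. y i \<noteq> 0}"]) (auto simp: fin)
qed

lift_definition minus_rseq :: "rseq \<Rightarrow> rseq \<Rightarrow> rseq" is "\<lambda>x y i. x i - y i"
proof -
  fix x y :: "nat \<Rightarrow> real"
  assume fin: "finite {i. x i \<noteq> 0}" "finite {i. y i \<noteq> 0}"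
  show "finite {i. x i - y i \<noteq> 0}"
    by (rule finite_subset[of _ "{i. x i \<noteq> 0} \<union> {i. y i \<noteq> 0}"]) (auto simp: fin)
qed

lift_definition uminus_rseq :: "rseq \<Rightarrow> rseq" is "\<lambda>x i. - x i" by simp

lift_definition scaleR_rseq :: "real \<Rightarrow> rseq \<Rightarrow> rseq" is "\<lambda>c x i. c * x i"
  by (erule finite_subset[rotated]) auto

instance
  by standard
    (auto intro!: rseq_eqI simp: zero_rseq.rep_eq plus_rseq.rep_eq minus_rseq.rep_eq
      uminus_rseq.rep_eq scaleR_rseq.rep_eq distrib_left distrib_right)

end

lemma finite_supp_coord: "finite {i. coord x i \<noteq> 0}"
  using coord[of x] by simp

instantiation rseq :: real_inner
begin

definition inner_rseq :: "rseq \<Rightarrow> rseq \<Rightarrow> real" where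
  "inner_rseq x y = (\<Sum>i | coord x i \<noteq> 0. coord x i * coord y i)"

definition norm_rseq :: "rseq \<Rightarrow> real" where
  "norm_rseq x = sqrt (inner x x)"

definition dist_rseq :: "rseq \<Rightarrow> rseq \<Rightarrow> real" where
  "dist_rseq x y = norm (x - y)"

definition sgn_rseq :: "rseq \<Rightarrow> rseq" where
  "sgn_rseq x = x /\<^sub>R norm x"

definition uniformity_rseq :: "(rseq \<times> rseq) filter" where
  "uniformity_rseq = (INF e\<in>{0 <..}. principal {(x, y). dist x y < e})"

definition open_rseq :: "rseq set \<Rightarrow> bool" where
  "open_rseq U \<longleftrightarrow> (\<forall>x\<in>U. \<forall>\<^sub>F (x', y) in uniformity. x' = x \<longrightarrow> y \<in> U)"

lemma inner_rseq_superset: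
  assumes "finite A" "{i. coord x i \<noteq> 0} \<subseteq> A"
  shows "inner x y = (\<Sum>i\<in>A. coord x i * coord y i)"
  unfolding inner_rseq_def using assms by (intro sum.mono_neutral_left) auto

instance
proof
  fix x y z :: rseq and r :: real
  let ?A = "{i. coord x i \<noteq> 0} \<union> {i. coord y i \<noteq> 0}"
  have fin: "finite ?A" by (simp add: finite_supp_coord)
  show "inner x y = inner y x"
    by (subst (1 2) inner_rseq_superset[OF fin]) (auto simp: mult.commute)
  show "inner (x + y) z = inner x z + inner y z"
    by (subst (1 2 3) inner_rseq_superset[OF fin])
      (auto simp: plus_rseq.rep_eq distrib_right sum.distrib)
  show "inner (r *\<^sub>R x) y = r * inner x y"
    by (subst (1 2) inner_rseq_superset[OF fin])
      (auto simp: scaleR_rseq.rep_eq sum_distrib_left mult.assoc)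
  show "0 \<le> inner x x" by (simp add: inner_rseq_def sum_nonneg)
  show "inner x x = 0 \<longleftrightarrow> x = 0"
  proof
    assume "inner x x = 0"
    then have "\<forall>i\<in>{i. coord x i \<noteq> 0}. coord x i * coord x i = 0"
      unfolding inner_rseq_def by (subst (asm) sum_nonneg_eq_0_iff) (auto simp: finite_supp_coord)
    then show "x = 0" by (auto intro!: rseq_eqI simp: zero_rseq.rep_eq)
  qed (simp add: inner_rseq_def zero_rseq.rep_eq)
qed (simp_all add: norm_rseq_def dist_rseq_def sgn_rseq_def uniformity_rseq_def open_rseq_def)

end

definition euclid :: "nat \<Rightarrow> rseq set" where
  "euclid n = {x. \<forall>i\<ge>n. coord x i = 0}"

lemma inner_euclid:
  assumes "x \<in> euclid n"
  shows "inner x y = (\<Sum>i<n. coord x i * coord y i)"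
  using assms by (intro inner_rseq_superset) (auto simp: euclid_def, meson leI)

lemma subspace_euclid: "subspace (euclid n)"
  by (auto simp: subspace_def euclid_def zero_rseq.rep_eq plus_rseq.rep_eq scaleR_rseq.rep_eq)

definition cross_polytope :: "nat \<Rightarrow> rseq set" where
  "cross_polytope n = {x \<in> euclid n. (\<Sum>i<n. \<bar>coord x i\<bar>) \<le> 1}"


section \<open>Subspaces as Euclidean spaces\<close>

definition orth_proj :: "rseq set \<Rightarrow> rseq \<Rightarrow> rseq" where
  "orth_proj E x = (THE y. y \<in> E \<and> (\<forall>z\<in>E. orthogonal (x - y) z))"

definition orthonormal_basis :: "rseq set \<Rightarrow> nat \<Rightarrow> (nat \<Rightarrow> rseq) \<Rightarrow> bool" where
  "orthonormal_basis E d b \<longleftrightarrow>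
     span (b ` {..<d}) = E \<and> (\<forall>i<d. \<forall>j<d. b i \<bullet> b j = (if i = j then 1 else 0))"

text \<open>
  Lebesgue measure of a finite-dimensional subspace, transported from coordinates with respect to
  an orthonormal basis; it does not depend on the basis, since Lebesgue measure on coordinate
  space is invariant under orthogonal matrices.
\<close>
definition subspace_lborel :: "rseq set \<Rightarrow> rseq measure" where
  "subspace_lborel E =
     (let d = dim E; b = (SOME b. orthonormal_basis E d b)
      in distr (\<Pi>\<^sub>M i\<in>{..<d}. lborel) (restrict_space borel E) (\<lambda>t. \<Sum>i<d. t i *\<^sub>R b i))"

definition convex_body :: "rseq set \<Rightarrow> rseq set \<Rightarrow> bool" where
  "convex_body E K \<longleftrightarrow>
     K \<subseteq> E \<and> compact K \<and> convex K \<and> (top_of_set E) interior_of K \<noteq> {}"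

text \<open>
  The vector integral of the identity over K is taken weakly, by testing against the elements of
  E: the ambient space is not complete, so the Bochner integral is not available.
\<close>
definition has_barycenter :: "rseq set \<Rightarrow> rseq set \<Rightarrow> rseq \<Rightarrow> bool" where
  "has_barycenter E K g \<longleftrightarrow> g \<in> E \<and>
     (\<forall>\<theta>\<in>E. g \<bullet> \<theta> =
        (LINT x:K|subspace_lborel E. x \<bullet> \<theta>) / measure (subspace_lborel E) K)"

definition isotropic_body :: "rseq set \<Rightarrow> rseq set \<Rightarrow> real \<Rightarrow> bool" where
  "isotropic_body E K L \<longleftrightarrow>
     convex_body E K \<and> measure (subspace_lborel E) K = 1 \<and> has_barycenter E K 0 \<and> L > 0 \<and>
     (\<forall>\<theta>\<in>E. norm \<theta> = 1 \<longrightarrow> (LINT x:K|subspace_lborel E. (x \<bullet> \<theta>)\<^sup>2) = L\<^sup>2)"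

text \<open>
  A linear bijection of E is given by a linear map of the ambient space that restricts to it;
  every linear endomorphism of E has such an extension.
\<close>
definition isotropy_constant :: "rseq set \<Rightarrow> rseq set \<Rightarrow> real" where
  "isotropy_constant E K =
     (THE L. \<exists>T a. linear T \<and> bij_betw T E E \<and> a \<in> E \<and>
        isotropic_body E ((\<lambda>x. a + T x) ` K) L)"

definition regular_simplex :: "nat \<Rightarrow> rseq set \<Rightarrow> bool" where
  "regular_simplex n S \<longleftrightarrow>
     (\<exists>V r. V \<subseteq> euclid n \<and> card V = n + 1 \<and> \<not> affine_dependent V \<and>
        (\<forall>v\<in>V. \<forall>w\<in>V. v \<noteq> w \<longrightarrow> dist v w = r) \<and> S = convex hull V)"


section \<open>The Grassmann manifold\<close>

definition grassmannian :: "nat \<Rightarrow> nat \<Rightarrow> rseq set set" where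
  "grassmannian n d = {E. subspace E \<and> E \<subseteq> euclid n \<and> dim E = d}"

text \<open>
  Operator norm of the difference of the projections.  The absolute value only affects arguments
  that are not finite-dimensional subspaces; the library's metric spaces ask for a distance that
  is nonnegative also outside the carrier.
\<close>
definition gap_dist :: "rseq set \<Rightarrow> rseq set \<Rightarrow> real" where
  "gap_dist E F = \<bar>onorm (\<lambda>x. orth_proj E x - orth_proj F x)\<bar>"

definition grassmann_topology :: "nat \<Rightarrow> nat \<Rightarrow> rseq set topology" where
  "grassmann_topology n d = Metric_space.mtopology (grassmannian n d) gap_dist"

text \<open>
  Being the Haar probability measure: a Borel probability measure on the Grassmannian that is
  invariant under the orthogonal group of n-space.  Such a measure exists and is unique.
\<close>
definition is_grassmann_haar :: "nat \<Rightarrow> nat \<Rightarrow> rseq set measure \<Rightarrow> bool" where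
  "is_grassmann_haar n d \<mu> \<longleftrightarrow>
     prob_space \<mu> \<and> space \<mu> = grassmannian n d \<and>
     sets \<mu> = sigma_sets (grassmannian n d) {U. openin (grassmann_topology n d) U} \<and>
     (\<forall>U. orthogonal_transformation U \<and> U ` euclid n = euclid n \<longrightarrow>
        (\<forall>A\<in>sets \<mu>. emeasure \<mu> ((\<lambda>E. U ` E) ` A) = emeasure \<mu> A))"


section \<open>The distance of subspaces is a metric\<close>

lemma euclid_subset_span_finite:
  "\<exists>B. finite B \<and> euclid n \<subseteq> span B"
proof (intro exI conjI)
  define e where "e i = Abs_rseq (\<lambda>j. if j = i then 1 else 0)" for i :: nat
  have e: "coord (e i) j = (if j = i then 1 else 0)" for i j
    by (simp add: e_def Abs_rseq_inverse)
  have cs: "coord (sum f A) j = (\<Sum>i\<in>A. coord (f i) j)" for f :: "nat \<Rightarrow> rseq" and A j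
    by (induction A rule: infinite_finite_induct) (auto simp: zero_rseq.rep_eq plus_rseq.rep_eq)
  show "finite (e ` {..<n})" by simp
  show "euclid n \<subseteq> span (e ` {..<n})"
  proof
    fix x assume x: "x \<in> euclid n"
    have "x = (\<Sum>i<n. coord x i *\<^sub>R e i)"
      using x by (intro rseq_eqI)
        (simp add: cs scaleR_rseq.rep_eq e euclid_def if_distrib cong: if_cong)
    also have "\<dots> \<in> span (e ` {..<n})"
      by (intro span_sum span_scale span_base) auto
    finally show "x \<in> span (e ` {..<n})" .
  qed
qed

lemma subspace_finite_orthogonal_basis:
  assumes "subspace E" "E \<subseteq> euclid n"
  obtains C where "finite C" "pairwise orthogonal C" "span C = E"
proof -
  obtain B0 where B0: "finite B0" "euclid n \<subseteq> span B0"
    using euclid_subset_span_finite by blast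
  obtain B where B: "B \<subseteq> E" "independent B" "E \<subseteq> span B"
    using maximal_independent_subset[of E] by blast
  have "finite B"
    using independent_span_bound[OF B0(1) B(2)] B(1) B0(2) assms by auto
  from basis_orthogonal[OF this] obtain C
    where C: "finite C" "span C = span B" "pairwise orthogonal C" by blast
  moreover have "span B = E"
    using B assms by (metis span_minimal subset_antisym)
  ultimately show thesis using that by metis
qed

lemma orth_proj_unique:
  assumes "subspace E" "y \<in> E" "\<forall>z\<in>E. orthogonal (x - y) z"
  shows "orth_proj E x = y"
  unfolding orth_proj_def
proof (rule the_equality)
  fix y' assume y': "y' \<in> E \<and> (\<forall>z\<in>E. orthogonal (x - y') z)"
  then have "y - y' \<in> E" using assms by (simp add: subspace_diff)
  then have "orthogonal (x - y') (y - y')" "orthogonal (x - y) (y - y')"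
    using y' assms by auto
  then have "inner (y - y') (y - y') = 0"
    by (simp add: orthogonal_def inner_diff_left)
  then show "y' = y" by simp
qed (use assms in auto)

lemma orth_proj:
  assumes "subspace E" "E \<subseteq> euclid n"
  shows "orth_proj E x \<in> E" "\<And>z. z \<in> E \<Longrightarrow> orthogonal (x - orth_proj E x) z"
proof -
  obtain C where C: "finite C" "pairwise orthogonal C" "span C = E"
    using subspace_finite_orthogonal_basis[OF assms] .
  define y where "y = (\<Sum>b\<in>C. (b \<bullet> x / (b \<bullet> b)) *\<^sub>R b)"
  have y: "y \<in> E" unfolding y_def C(3)[symmetric]
    by (intro span_sum span_scale span_base)
  have "\<forall>z\<in>E. orthogonal (x - y) z"
  proof
    fix z assume "z \<in> E"
    then have "z \<in> span C" using C by simp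
    then show "orthogonal (x - y) z"
    proof (rule span_induct)
      show "subspace {z. orthogonal (x - y) z}" by (rule subspace_orthogonal_to_vector)
    next
      fix c assume c: "c \<in> C"
      have "y \<bullet> c = (\<Sum>b\<in>C. if b = c then x \<bullet> c else 0)"
        unfolding y_def inner_sum_left
      proof (rule sum.cong)
        fix b assume "b \<in> C"
        then show "(b \<bullet> x / (b \<bullet> b)) *\<^sub>R b \<bullet> c = (if b = c then x \<bullet> c else 0)"
          using c C(2) by (auto simp: pairwise_def orthogonal_def inner_commute)
      qed simp
      then show "orthogonal (x - y) c"
        using c C(1) by (simp add: orthogonal_def inner_diff_left)
    qed
  qed
  from orth_proj_unique[OF assms(1) y this] y this
  show "orth_proj E x \<in> E" "\<And>z. z \<in> E \<Longrightarrow> orthogonal (x - orth_proj E x) z" by auto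
qed

lemma bounded_linear_orth_proj:
  assumes "subspace E" "E \<subseteq> euclid n"
  shows "bounded_linear (orth_proj E)"
proof (rule bounded_linear_intro[where K = 1])
  have mem: "orth_proj E u \<in> E" for u
    by (rule orth_proj(1)[OF assms])
  have inner: "u \<bullet> z = orth_proj E u \<bullet> z" if "z \<in> E" for u z
    using orth_proj(2)[OF assms that, of u] by (simp add: orthogonal_def inner_diff_left)
  fix x y r
  show "orth_proj E (x + y) = orth_proj E x + orth_proj E y"
  proof (rule orth_proj_unique[OF assms(1)])
    show "orth_proj E x + orth_proj E y \<in> E"
      by (rule subspace_add[OF assms(1) mem mem])
    show "\<forall>z\<in>E. orthogonal (x + y - (orth_proj E x + orth_proj E y)) z"
    proof
      fix z assume "z \<in> E"
      from inner[OF this, of x] inner[OF this, of y]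
      show "orthogonal (x + y - (orth_proj E x + orth_proj E y)) z"
        unfolding orthogonal_def inner_diff_left inner_add_left by linarith
    qed
  qed
  show "orth_proj E (r *\<^sub>R x) = r *\<^sub>R orth_proj E x"
  proof (rule orth_proj_unique[OF assms(1)])
    show "r *\<^sub>R orth_proj E x \<in> E"
      by (rule subspace_scale[OF assms(1) mem])
    show "\<forall>z\<in>E. orthogonal (r *\<^sub>R x - r *\<^sub>R orth_proj E x) z"
    proof
      fix z assume "z \<in> E"
      from inner[OF this, of x]
      show "orthogonal (r *\<^sub>R x - r *\<^sub>R orth_proj E x) z"
        unfolding orthogonal_def inner_diff_left inner_scaleR_left by simp
    qed
  qed
  have "norm (orth_proj E x) * norm (orth_proj E x) = orth_proj E x \<bullet> orth_proj E x"
    using power2_norm_eq_inner[of "orth_proj E x"] unfolding power2_eq_square .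
  also have "\<dots> = x \<bullet> orth_proj E x"
    by (rule inner[OF mem, symmetric])
  also have "\<dots> \<le> norm x * norm (orth_proj E x)" by (rule norm_cauchy_schwarz)
  finally have "norm (orth_proj E x) * norm (orth_proj E x) \<le> norm x * norm (orth_proj E x)" .
  then show "norm (orth_proj E x) \<le> norm x * 1"
    using mult_right_le_imp_le[of "norm (orth_proj E x)" "norm (orth_proj E x)" "norm x"]
      norm_ge_zero[of x] norm_ge_zero[of "orth_proj E x"] by linarith
qed

lemma Metric_space_grassmannian: "Metric_space (grassmannian n d) gap_dist"
proof
  have bl: "bounded_linear (\<lambda>x. orth_proj E x - orth_proj F x)"
    if "E \<in> grassmannian n d" "F \<in> grassmannian n d" for E F
  proof (rule bounded_linear_sub)
    show "bounded_linear (orth_proj E)" "bounded_linear (orth_proj F)"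
      using that bounded_linear_orth_proj unfolding grassmannian_def by blast+
  qed
  have sub: "E \<subseteq> F"
    if EF: "E \<in> grassmannian n d" "F \<in> grassmannian n d"
      and eq: "\<And>x. orth_proj E x = orth_proj F x" for E F
  proof
    fix x assume x: "x \<in> E"
    have E: "subspace E" and F: "subspace F" "F \<subseteq> euclid n"
      using EF unfolding grassmannian_def by blast+
    have "orth_proj E x = x"
      by (rule orth_proj_unique[OF E x]) (simp add: orthogonal_def)
    with eq[of x] have "orth_proj F x = x" by (rule trans[OF sym])
    then show "x \<in> F"
      using orth_proj(1)[OF F, of x] by (rule subst)
  qed
  fix E F G :: "rseq set"
  show "0 \<le> gap_dist E F"
    by (simp add: gap_dist_def)
  show "gap_dist E F = gap_dist F E"
  proof -
    have "norm (orth_proj E x - orth_proj F x) = norm (orth_proj F x - orth_proj E x)" for x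
      by (rule norm_minus_commute)
    then show ?thesis
      unfolding gap_dist_def onorm_def by presburger
  qed
  show "gap_dist E F = 0 \<longleftrightarrow> E = F" if EF: "E \<in> grassmannian n d" "F \<in> grassmannian n d"
  proof
    assume "gap_dist E F = 0"
    then have "onorm (\<lambda>x. orth_proj E x - orth_proj F x) = 0"
      unfolding gap_dist_def by (rule abs_eq_0_iff[THEN iffD1])
    then have "\<forall>x. orth_proj E x - orth_proj F x = 0"
      using onorm_eq_0[OF bl[OF EF]] by blast
    then have eq: "orth_proj E x = orth_proj F x" for x
      by (metis right_minus_eq)
    show "E = F"
      by (rule subset_antisym[OF sub[OF EF eq] sub[OF EF(2,1) eq[symmetric]]])
  next
    assume "E = F"
    then show "gap_dist E F = 0"
      by (simp add: gap_dist_def onorm_zero)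
  qed
  show "gap_dist E G \<le> gap_dist E F + gap_dist F G"
    if "E \<in> grassmannian n d" "F \<in> grassmannian n d" "G \<in> grassmannian n d"
  proof -
    have nn: "\<bar>onorm (\<lambda>x. orth_proj E x - orth_proj F x)\<bar> = onorm (\<lambda>x. orth_proj E x - orth_proj F x)"
      if "E \<in> grassmannian n d" "F \<in> grassmannian n d" for E F
      by (rule abs_of_nonneg[OF onorm_pos_le[OF bl[OF that]]])
    have "(\<lambda>x. orth_proj E x - orth_proj G x) =
        (\<lambda>x. (orth_proj E x - orth_proj F x) + (orth_proj F x - orth_proj G x))"
      by simp
    then show ?thesis
      using onorm_triangle[OF bl[OF that(1,2)] bl[OF that(2,3)]]
      unfolding gap_dist_def nn[OF that(1,2)] nn[OF that(2,3)] nn[OF that(1,3)] by (simp only:)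
  qed
qed

end

theory Submission
  imports Defs "HOL-Probability.Probability" "HOL-Computational_Algebra.Polynomial"
    "HOL-Real_Asymp.Real_Asymp"
begin

text \<open>
  Let \<open>K = P_E (conv V)\<close>, where \<open>V\<close> consists of an orthonormal basis \<open>e\<close> of n-space and at most \<open>n\<close>
  further points, and \<open>\<bar>\<Sum>I\<bar>\<^sup>2 \<le> 4 \<bar>I\<bar>\<close> for all \<open>I \<subseteq> V\<close>; both polytopes are of this form up to
  homothety.  The isotropy constant is the minimum of the normalized second moment over affine
  images, so it is enough to bound \<open>Vol K\<close> from below and the second moment of \<open>K\<close> from above.
  Triangulating \<open>K\<close> shows that the mean of \<open>\<bar>x\<bar>\<^sup>2\<close> over \<open>K\<close> is at most a multiple of
  \<open>(\<bar>P_E (\<Sum>I)\<bar>\<^sup>2 + (\<Sum>a\<in>I. \<bar>P_E a\<bar>\<^sup>2)) / d\<^sup>2\<close> for some \<open>d\<close>-element \<open>I \<subseteq> V\<close>.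

  If \<open>n / d\<close> is bounded, then \<open>\<bar>P_E x\<bar> \<le> \<bar>x\<bar>\<close> and a volume bound \<open>(c / d) ^ d\<close> suffice, for every \<open>E\<close>.
  Otherwise a union bound over \<open>I\<close> shows that with high probability
  \<open>\<bar>P_E (\<Sum>I)\<bar>\<^sup>2\<close> is at most a multiple of \<open>\<bar>I\<bar> (d / n) ln (n / d)\<close> for all \<open>I\<close> with at most \<open>d\<close>
  elements, and with high probability \<open>K\<close> contains the ball of \<open>E\<close> with radius a multiple \<open>t\<close> of
  \<open>sqrt (ln (n / d) / n)\<close>.  For the latter, if \<open>t\<close> exceeds all coordinates of some unit vector
  of \<open>E\<close>, then a cone of Gaussian measure \<open>\<delta> ^ d\<close> in \<open>E\<close> consists of vectors with few large coordinates;
  since the projection of a Gaussian vector to a random \<open>E\<close> has a uniform direction, the measure of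
  such \<open>E\<close> is at most \<open>\<delta> ^ (- d)\<close> times the probability that a Gaussian vector has few large coordinates.
\<close>

text \<open>Put \<open>q = n / d\<close>. The mean of \<open>|x|^2\<close> over \<open>K\<close> is
  of order \<open>ln q / n\<close>, and a ball of radius \<open>t = sqrt (ln q / n)\<close> has a
  \<open>d\<close>-th root of volume of order \<open>t / sqrt d\<close>. The squared isotropy
  constant is at most the mean divided by \<open>d\<close> times the squared root of volume, so the
  logarithms cancel. The union bound over \<open>exp (d ln q)\<close> sets is what forces
  \<open>ln q\<close> into the bound for the sums, and the inradius has to match it.

  The inradius must be controlled in all directions of \<open>E\<close> at once. Having no large
  coordinate is destroyed by small perturbations, having few of them is not, and the cone of such
  vectors takes the place of a net. Its loss \<delta>\<open>^(-d)\<close>, where \<delta> is of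
  order \<open>q^(-1/8)\<close> up to logarithms, is beaten by
  \<open>exp (- d q^(3/4) / 36)\<close>. The failure exponents dominate both \<open>d\<close> and
  \<open>ln n = ln d + ln q <= d + ln q\<close>.

  Volumes are push-forwards from coordinates. Where a determinant would appear stands a factor
  \<kappa>, supplied by the uniqueness of translation-invariant measures.\<close>

section \<open>Coordinates and topology of the ambient space\<close>

lemma norm_euclid: "x \<in> euclid n \<Longrightarrow> norm x = L2_set (coord x) {..<n}"
  by (simp add: norm_eq_sqrt_inner inner_euclid L2_set_def power2_eq_square)

lemma ex_euclid: "\<exists>n. x \<in> euclid n"
proof -
  obtain n where "\<forall>i\<in>{i. coord x i \<noteq> 0}. i < n"
    using finite_supp_coord[of x] finite_nat_set_iff_bounded by blast
  then show ?thesis by (intro exI[of _ n]) (force simp: euclid_def)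
qed

lemma coord_minus [simp]: "coord (x - y) i = coord x i - coord y i"
  by (simp add: minus_rseq.rep_eq)

lemma coord_add [simp]: "coord (x + y) i = coord x i + coord y i"
  by (simp add: plus_rseq.rep_eq)

lemma coord_uminus [simp]: "coord (- y) i = - coord y i"
  by (simp add: uminus_rseq.rep_eq)

lemma coord_scaleR [simp]: "coord (c *\<^sub>R x) i = c * coord x i"
  by (simp add: scaleR_rseq.rep_eq)

lemma coord_zero [simp]: "coord 0 i = 0"
  by (simp add: zero_rseq.rep_eq)

lemma coord_sum [simp]: "coord (sum f A) i = (\<Sum>j\<in>A. coord (f j) i)"
  by (induction A rule: infinite_finite_induct) auto

definition list_rseq :: "real list \<Rightarrow> rseq" where
  "list_rseq xs = Abs_rseq (\<lambda>i. if i < length xs then xs ! i else 0)"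

lemma coord_list_rseq: "coord (list_rseq xs) i = (if i < length xs then xs ! i else 0)"
proof -
  have "finite {i. (if i < length xs then xs ! i else 0) \<noteq> 0}"
    by (rule finite_subset[of _ "{..<length xs}"]) (auto split: if_splits)
  then show ?thesis by (simp add: list_rseq_def Abs_rseq_inverse)
qed

text \<open>Measurability of sums, norms and inner products of Borel functions rests on second
  countability. The finitely supported rational sequences, encoded as lists, are countable and
  dense.\<close>

instance rseq :: second_countable_topology
proof
  define D where "D = list_rseq ` lists \<rat>"
  have cD: "countable D"
    unfolding D_def by (intro countable_image countable_lists countable_rat)
  have dense: "\<exists>q\<in>D. dist x q < e" if "e > 0" for x e
  proof -
    obtain n where n: "x \<in> euclid n" using ex_euclid by blast
    \<comment> \<open>Errors below \<open>e / (n + 1)\<close> in \<open>n\<close> coordinates add up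
      to strictly less than \<open>e\<close>, also for \<open>n = 0\<close>.\<close>
    have "\<exists>q\<in>\<rat>. \<bar>coord x i - q\<bar> < e / (real n + 1)" for i
    proof -
      have "e / (real n + 1) > 0" using that by simp
      then obtain q where "q \<in> \<rat>" "coord x i < q" "q < coord x i + e / (real n + 1)"
        using Rats_dense_in_real[of "coord x i" "coord x i + e / (real n + 1)"] by auto
      then show ?thesis by (intro bexI[of _ q]) auto
    qed
    then obtain q where q: "\<And>i. q i \<in> \<rat>" "\<And>i. \<bar>coord x i - q i\<bar> < e / (real n + 1)" by metis
    define y where "y = list_rseq (map q [0..<n])"
    have y: "y \<in> D" unfolding D_def y_def using q by (intro imageI) auto
    have cy: "coord y i = (if i < n then q i else 0)" for i
      by (simp add: y_def coord_list_rseq)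
    have xy: "x - y \<in> euclid n" using n by (auto simp: euclid_def cy)
    have "norm (x - y) \<le> (\<Sum>i<n. \<bar>coord (x - y) i\<bar>)"
      unfolding norm_euclid[OF xy] by (rule L2_set_le_sum_abs)
    also have "\<dots> \<le> (\<Sum>i<n. e / (real n + 1))"
      using q(2) by (intro sum_mono) (auto simp: cy intro: less_imp_le)
    also have "\<dots> < e" using that by (simp add: field_simps)
    finally show ?thesis using y by (auto simp: dist_norm)
  qed
  define B where "B = (\<lambda>(q, k). ball q (1 / real (Suc k))) ` (D \<times> UNIV)"
  have "countable B" unfolding B_def using cD by (intro countable_image countable_SIGMA) auto
  moreover have "topological_basis B"
  proof (rule topological_basisI)
    fix U :: "rseq set" and x assume U: "open U" "x \<in> U"
    then obtain e where e: "e > 0" "ball x e \<subseteq> U" by (meson openE)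
    obtain k where k: "1 / real (Suc k) < e / 2"
      using e(1) by (metis half_gt_zero nat_approx_posE)
    obtain q where q: "q \<in> D" "dist x q < 1 / real (Suc k)"
      using dense[of "1 / real (Suc k)" x] by auto
    have "ball q (1 / real (Suc k)) \<subseteq> ball x e"
    proof
      fix y assume "y \<in> ball q (1 / real (Suc k))"
      then have "dist x y < 1 / real (Suc k) + 1 / real (Suc k)"
        using q dist_triangle[of x y q] unfolding mem_ball by linarith
      also have "\<dots> < e" using k by linarith
      finally show "y \<in> ball x e" by simp
    qed
    then show "\<exists>B'\<in>B. x \<in> B' \<and> B' \<subseteq> U"
      using q e unfolding B_def
      by (intro bexI[of _ "ball q (1 / real (Suc k))"]) (auto simp: dist_commute)
  qed (auto simp: B_def)
  ultimately show "\<exists>B::rseq set set. countable B \<and> open = generate_topology B"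
    using topological_basis_imp_subbasis by blast
qed


section \<open>Frames of finite-dimensional subspaces\<close>

definition lin_comb :: "(nat \<Rightarrow> 'a::real_vector) \<Rightarrow> nat \<Rightarrow> (nat \<Rightarrow> real) \<Rightarrow> 'a" where
  "lin_comb w d t = (\<Sum>i<d. t i *\<^sub>R w i)"

text \<open>A basis \<open>w\<close> of \<open>E\<close> with its dual basis \<open>v\<close>, also
  taken in \<open>E\<close>. Coordinates thus are inner products, hence continuous and measurable on
  the whole space. Orthonormal bases are the self-dual frames.\<close>

definition dual_frame :: "rseq set \<Rightarrow> nat \<Rightarrow> (nat \<Rightarrow> rseq) \<Rightarrow> (nat \<Rightarrow> rseq) \<Rightarrow> bool" where
  "dual_frame E d w v \<longleftrightarrow> subspace E \<and> (\<forall>i<d. w i \<in> E) \<and> (\<forall>i<d. v i \<in> E) \<and>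
     (\<forall>i<d. \<forall>j<d. w i \<bullet> v j = (if i = j then 1 else 0)) \<and>
     (\<forall>x\<in>E. lin_comb w d (\<lambda>i. x \<bullet> v i) = x)"

lemma lin_comb_add: "lin_comb w d (\<lambda>i. s i + t i) = lin_comb w d s + lin_comb w d t"
  by (simp add: lin_comb_def scaleR_add_left sum.distrib)

lemma lin_comb_scale: "lin_comb w d (\<lambda>i. c * t i) = c *\<^sub>R lin_comb w d t"
  by (simp add: lin_comb_def scaleR_sum_right)

lemma lin_comb_cong: "(\<And>i. i < d \<Longrightarrow> s i = t i) \<Longrightarrow> lin_comb w d s = lin_comb w d t"
  by (simp add: lin_comb_def)

lemma lin_comb_mem: "subspace E \<Longrightarrow> (\<And>i. i < d \<Longrightarrow> w i \<in> E) \<Longrightarrow> lin_comb w d t \<in> E"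
  unfolding lin_comb_def by (intro subspace_sum subspace_scale) auto

lemma linear_lin_comb: "linear T \<Longrightarrow> T (lin_comb w d t) = lin_comb (\<lambda>i. T (w i)) d t"
  by (simp add: lin_comb_def linear_sum linear_scale)

lemma dual_frame_mem: "dual_frame E d w v \<Longrightarrow> lin_comb w d t \<in> E"
  by (simp add: dual_frame_def lin_comb_mem)

lemma dual_frame_subspace: "dual_frame E d w v \<Longrightarrow> subspace E"
  by (simp add: dual_frame_def)

lemma dual_frame_expand: "dual_frame E d w v \<Longrightarrow> x \<in> E \<Longrightarrow> lin_comb w d (\<lambda>i. x \<bullet> v i) = x"
  by (simp add: dual_frame_def)

lemma dual_frame_coeff:
  assumes "dual_frame E d w v" "j < d"
  shows "lin_comb w d t \<bullet> v j = t j"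
proof -
  have "lin_comb w d t \<bullet> v j = (\<Sum>i<d. t i * (if i = j then 1 else 0))"
    unfolding lin_comb_def inner_sum_left using assms
    by (intro sum.cong) (auto simp: dual_frame_def)
  then show ?thesis using assms(2) by (simp add: if_distrib cong: if_cong)
qed

lemma dual_frame_span:
  assumes "dual_frame E d w v"
  shows "span (w ` {..<d}) = E"
proof
  show "span (w ` {..<d}) \<subseteq> E"
    using assms by (intro span_minimal) (auto simp: dual_frame_def)
  show "E \<subseteq> span (w ` {..<d})"
  proof
    fix x assume "x \<in> E"
    then have "x = lin_comb w d (\<lambda>i. x \<bullet> v i)" using dual_frame_expand[OF assms] by simp
    also have "\<dots> \<in> span (w ` {..<d})"
      unfolding lin_comb_def by (intro span_sum span_scale span_base) auto
    finally show "x \<in> span (w ` {..<d})" .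
  qed
qed

lemma dual_frame_inj:
  assumes "dual_frame E d w v"
  shows "inj_on w {..<d}"
proof (rule inj_onI)
  fix i j assume ij: "i \<in> {..<d}" "j \<in> {..<d}" "w i = w j"
  have *: "w i \<bullet> v j = (if i = j then 1 else 0)" if "i < d" "j < d" for i j
    using assms that unfolding dual_frame_def by blast
  show "i = j" using *[of i j] *[of j j] ij by (simp split: if_splits)
qed

lemma dual_frame_indep:
  assumes "dual_frame E d w v"
  shows "independent (w ` {..<d})"
proof (rule independent_if_scalars_zero)
  fix f x assume f: "(\<Sum>x\<in>w ` {..<d}. f x *\<^sub>R x) = 0" and x: "x \<in> w ` {..<d}"
  then obtain j where j: "j < d" "x = w j" by auto
  have "lin_comb w d (f \<circ> w) = 0"
    using f by (simp add: lin_comb_def sum.reindex[OF dual_frame_inj[OF assms]])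
  then show "f x = 0" using dual_frame_coeff[OF assms j(1), of "f \<circ> w"] j by simp
qed simp

lemma dual_frame_dim:
  assumes "dual_frame E d w v"
  shows "dim E = d"
  using dim_span_eq_card_independent[OF dual_frame_indep[OF assms]]
    card_image[OF dual_frame_inj[OF assms]] dual_frame_span[OF assms] by simp

section \<open>Orthonormal bases and orthogonal projections\<close>

lemma onb_dual_frame:
  assumes "orthonormal_basis E d b"
  shows "dual_frame E d b b"
proof -
  have b: "b i \<bullet> b j = (if i = j then 1 else 0)" if "i < d" "j < d" for i j
    using assms that by (auto simp: orthonormal_basis_def)
  have E: "E = span (b ` {..<d})" using assms by (simp add: orthonormal_basis_def)
  have "lin_comb b d (\<lambda>i. x \<bullet> b i) = x" if "x \<in> span (b ` {..<d})" for x
    using that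
  proof (rule span_induct)
    show "subspace {x. lin_comb b d (\<lambda>i. x \<bullet> b i) = x}"
    proof (rule subspaceI)
      show "0 \<in> {x. lin_comb b d (\<lambda>i. x \<bullet> b i) = x}" by (simp add: lin_comb_def)
      fix x y assume "x \<in> {x. lin_comb b d (\<lambda>i. x \<bullet> b i) = x}" "y \<in> {x. lin_comb b d (\<lambda>i. x \<bullet> b i) = x}"
      then show "x + y \<in> {x. lin_comb b d (\<lambda>i. x \<bullet> b i) = x}"
        by (simp add: inner_add_left lin_comb_add)
    next
      fix c x assume "x \<in> {x. lin_comb b d (\<lambda>i. x \<bullet> b i) = x}"
      then show "c *\<^sub>R x \<in> {x. lin_comb b d (\<lambda>i. x \<bullet> b i) = x}"
        by (simp add: lin_comb_scale)
    qed
    fix y assume "y \<in> b ` {..<d}"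
    then obtain j where j: "j < d" "y = b j" by auto
    have "lin_comb b d (\<lambda>i. y \<bullet> b i) = (\<Sum>i<d. if i = j then b j else 0)"
      unfolding lin_comb_def using j by (intro sum.cong) (auto simp: b)
    then show "lin_comb b d (\<lambda>i. y \<bullet> b i) = y" using j by simp
  qed
  then show ?thesis
    unfolding dual_frame_def E using b by (auto intro: span_base)
qed

lemma onb_iff_self_dual: "orthonormal_basis E d b \<longleftrightarrow> dual_frame E d b b"
  using onb_dual_frame dual_frame_span by (auto simp: orthonormal_basis_def dual_frame_def)

lemma onb_inner:
  assumes "orthonormal_basis E d b"
  shows "lin_comb b d s \<bullet> lin_comb b d t = (\<Sum>i<d. s i * t i)"
proof -
  have "lin_comb b d s \<bullet> lin_comb b d t = (\<Sum>i<d. t i * (lin_comb b d s \<bullet> b i))"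
    by (subst (2) lin_comb_def) (simp add: inner_sum_right)
  then show ?thesis using dual_frame_coeff[OF onb_dual_frame[OF assms]] by (simp add: mult.commute)
qed

lemma onb_norm:
  assumes "orthonormal_basis E d b"
  shows "(norm (lin_comb b d t))\<^sup>2 = (\<Sum>i<d. (t i)\<^sup>2)"
  unfolding power2_norm_eq_inner onb_inner[OF assms] by (simp add: power2_eq_square)

lemma onb_norm_inner:
  assumes "orthonormal_basis E d b" "x \<in> E"
  shows "(norm x)\<^sup>2 = (\<Sum>i<d. (x \<bullet> b i)\<^sup>2)"
  using onb_norm[OF assms(1), of "\<lambda>i. x \<bullet> b i"] dual_frame_expand[OF onb_dual_frame[OF assms(1)] assms(2)]
  by simp

lemma orth_proj_onb:
  assumes "orthonormal_basis E d b"
  shows "orth_proj E x = lin_comb b d (\<lambda>i. x \<bullet> b i)"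
proof (rule orth_proj_unique)
  note df = onb_dual_frame[OF assms]
  show "subspace E" "lin_comb b d (\<lambda>i. x \<bullet> b i) \<in> E"
    using df dual_frame_subspace dual_frame_mem by auto
  show "\<forall>z\<in>E. orthogonal (x - lin_comb b d (\<lambda>i. x \<bullet> b i)) z"
  proof
    fix z assume z: "z \<in> E"
    let ?y = "lin_comb b d (\<lambda>i. x \<bullet> b i)"
    have "(x - ?y) \<bullet> z = (x - ?y) \<bullet> lin_comb b d (\<lambda>i. z \<bullet> b i)"
      using dual_frame_expand[OF df z] by simp
    also have "\<dots> = (\<Sum>i<d. (z \<bullet> b i) * ((x - ?y) \<bullet> b i))"
      by (simp add: lin_comb_def[of _ _ "\<lambda>i. z \<bullet> b i"] inner_sum_right)
    also have "\<dots> = 0"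
      using dual_frame_coeff[OF df] by (intro sum.neutral) (auto simp: inner_diff_left)
    finally show "orthogonal (x - ?y) z" by (simp add: orthogonal_def)
  qed
qed

lemma onb_exists:
  assumes "subspace E" "E \<subseteq> euclid n" "dim E = d"
  shows "\<exists>b. orthonormal_basis E d b"
proof -
  obtain C where C: "finite C" "pairwise orthogonal C" "span C = E"
    using subspace_finite_orthogonal_basis[OF assms(1,2)] .
  define D where "D = (\<lambda>x. x /\<^sub>R norm x) ` (C - {0})"
  have orth: "x \<bullet> y = 0" if "x \<in> C" "y \<in> C" "x \<noteq> y" for x y
    using C(2) that by (auto simp: pairwise_def orthogonal_def)
  have inj: "inj_on (\<lambda>x. x /\<^sub>R norm x) (C - {0})"
  proof (rule inj_onI, rule ccontr)
    fix x y assume xy: "x \<in> C - {0}" "y \<in> C - {0}" "x /\<^sub>R norm x = y /\<^sub>R norm y" "x \<noteq> y"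
    then have "x \<bullet> (x /\<^sub>R norm x) = x \<bullet> (y /\<^sub>R norm y)" by simp
    then have "x \<bullet> x / norm x = 0" using orth[of x y] xy(1,2,4) by (simp add: divide_inverse mult.commute)
    then show False using xy(1) by simp
  qed
  have oD: "x \<bullet> y = (if x = y then 1 else 0)" if xD: "x \<in> D" and yD: "y \<in> D" for x y
  proof -
    obtain x' where x': "x' \<in> C - {0}" "x = x' /\<^sub>R norm x'" using xD unfolding D_def by blast
    obtain y' where y': "y' \<in> C - {0}" "y = y' /\<^sub>R norm y'" using yD unfolding D_def by blast
    note xy = x'(1) y'(1) x'(2) y'(2)
    show ?thesis
    proof (cases "x' = y'")
      case True
      then show ?thesis using xy by (simp add: dot_square_norm power2_eq_square)
    next
      case False
      then have "x \<noteq> y" using inj xy by (auto dest: inj_onD)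
      then show ?thesis using orth[of x' y'] False xy by simp
    qed
  qed
  have sD: "span D = E"
  proof -
    have "span D = span (C - {0})" unfolding D_def by (rule span_image_scale) (auto simp: C(1))
    then show ?thesis using C(3) by (simp add: span_delete_0)
  qed
  have fD: "finite D" unfolding D_def using C(1) by simp
  obtain f where f: "bij_betw f {..<card D} D"
    using ex_bij_betw_nat_finite[OF fD] by (auto simp: atLeast0LessThan)
  have im: "f ` {..<card D} = D" using f by (rule bij_betw_imp_surj_on)
  have "f i \<bullet> f j = (if i = j then 1 else 0)" if "i < card D" "j < card D" for i j
  proof -
    have "f i \<in> D" "f j \<in> D" using that im by blast+
    moreover have "f i = f j \<longleftrightarrow> i = j" using that bij_betw_imp_inj_on[OF f] by (auto simp: inj_on_eq_iff)
    ultimately show ?thesis using oD by simp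
  qed
  then have "orthonormal_basis E (card D) f"
    by (simp add: orthonormal_basis_def im sD)
  moreover from dual_frame_dim[OF onb_dual_frame[OF this]] have "card D = d" using assms by simp
  ultimately show ?thesis by auto
qed

definition unit_vec :: "nat \<Rightarrow> rseq" where
  "unit_vec i = list_rseq (replicate i 0 @ [1])"

lemma coord_unit_vec [simp]: "coord (unit_vec i) j = (if j = i then 1 else 0)"
  by (auto simp: unit_vec_def coord_list_rseq nth_append)

lemma unit_vec_mem: "i < n \<Longrightarrow> unit_vec i \<in> euclid n"
  by (auto simp: euclid_def)

lemma inner_unit_vec [simp]: "unit_vec i \<bullet> x = coord x i" "x \<bullet> unit_vec i = coord x i"
proof -
  show "unit_vec i \<bullet> x = coord x i"
    using inner_euclid[OF unit_vec_mem[of i "Suc i"], of x] by simp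
  then show "x \<bullet> unit_vec i = coord x i" by (simp add: inner_commute)
qed

lemma onb_euclid: "orthonormal_basis (euclid n) n unit_vec"
proof -
  have "lin_comb unit_vec n (\<lambda>i. x \<bullet> unit_vec i) = x" if "x \<in> euclid n" for x
    using that by (intro rseq_eqI) (auto simp: lin_comb_def euclid_def if_distrib cong: if_cong)
  then have "dual_frame (euclid n) n unit_vec unit_vec"
    unfolding dual_frame_def by (auto simp: subspace_euclid unit_vec_mem)
  then show ?thesis by (simp add: onb_iff_self_dual)
qed

lemma dim_euclid: "dim (euclid n) = n"
  using dual_frame_dim[OF onb_dual_frame[OF onb_euclid]] .

text \<open>A basis of the orthogonal complement \<open>G\<close> of \<open>E\<close> in n-space is
  appended. In the completed basis \<open>orth_proj E\<close> just drops coordinates, which is how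
  Gaussian vectors are projected later.\<close>

lemma onb_extend:
  assumes b: "orthonormal_basis E d b" and E: "E \<subseteq> euclid n"
  shows "\<exists>b'. orthonormal_basis (euclid n) n b' \<and> (\<forall>i<d. b' i = b i)"
proof -
  note df = onb_dual_frame[OF b]
  define G where "G = {x \<in> euclid n. \<forall>z\<in>E. x \<bullet> z = 0}"
  have "subspace G" using subspace_euclid[of n]
    by (auto simp: G_def subspace_def inner_add_left)
  moreover have "G \<subseteq> euclid n" by (auto simp: G_def)
  ultimately obtain c where c: "orthonormal_basis G (dim G) c" using onb_exists by blast
  note dc = onb_dual_frame[OF c]
  define m where "m = dim G"
  define b' where "b' = (\<lambda>i. if i < d then b i else c (i - d))"
  have bE: "b i \<in> E" if "i < d" for i using df that by (auto simp: dual_frame_def)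
  have cG: "c i \<in> G" if "i < m" for i using dc that by (auto simp: dual_frame_def m_def)
  have "b' i \<bullet> b' j = (if i = j then 1 else 0)" if "i < d + m" "j < d + m" for i j
  proof -
    have *: "c i' \<bullet> b j' = 0" "b j' \<bullet> c i' = 0" if "i' < m" "j' < d" for i' j'
      using cG[OF that(1)] bE[OF that(2)] by (auto simp: G_def inner_commute)
    have bb: "b i \<bullet> b j = (if i = j then 1 else 0)" if "i < d" "j < d" for i j
      using df that by (auto simp: dual_frame_def)
    have cc: "c i \<bullet> c j = (if i = j then 1 else 0)" if "i < m" "j < m" for i j
      using dc that by (auto simp: dual_frame_def m_def)
    show ?thesis using that by (auto simp: b'_def * bb cc)
  qed
  moreover have "lin_comb b' (d + m) (\<lambda>i. x \<bullet> b' i) = x" if x: "x \<in> euclid n" for x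
  proof -
    let ?y = "orth_proj E x"
    have y: "?y = lin_comb b d (\<lambda>i. x \<bullet> b i)" by (rule orth_proj_onb[OF b])
    have yE: "?y \<in> E" unfolding y by (rule dual_frame_mem[OF df])
    have sE: "subspace E" by (rule dual_frame_subspace[OF df])
    have xy: "x - ?y \<in> G"
      using orth_proj(2)[OF sE E, of _ x] yE E x subspace_diff[OF subspace_euclid, of x n ?y]
      by (auto simp: G_def orthogonal_def)
    have "lin_comb b' (d + m) (\<lambda>i. x \<bullet> b' i) = (\<Sum>i<d. (x \<bullet> b' i) *\<^sub>R b' i) + (\<Sum>i<m. (x \<bullet> b' (d + i)) *\<^sub>R b' (d + i))"
      unfolding lin_comb_def using sum.nat_group[of "\<lambda>i. (x \<bullet> b' i) *\<^sub>R b' i"]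
      by (induction m) (simp_all add: algebra_simps)
    also have "(\<Sum>i<d. (x \<bullet> b' i) *\<^sub>R b' i) = ?y" by (simp add: y lin_comb_def b'_def)
    also have "(\<Sum>i<m. (x \<bullet> b' (d + i)) *\<^sub>R b' (d + i)) = lin_comb c m (\<lambda>i. (x - ?y) \<bullet> c i)"
      unfolding lin_comb_def
    proof (rule sum.cong)
      fix i assume "i \<in> {..<m}"
      then have "?y \<bullet> c i = 0" using cG[of i] yE by (auto simp: G_def inner_commute)
      then show "(x \<bullet> b' (d + i)) *\<^sub>R b' (d + i) = ((x - ?y) \<bullet> c i) *\<^sub>R c i"
        by (simp add: b'_def inner_diff_left)
    qed simp
    also have "\<dots> = x - ?y" using dual_frame_expand[OF dc xy] by (simp add: m_def)
    finally show ?thesis by simp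
  qed
  moreover have "b' i \<in> euclid n" if "i < d + m" for i
    using that bE E cG[of "i - d"] by (auto simp: b'_def G_def)
  ultimately have df': "dual_frame (euclid n) (d + m) b' b'"
    by (auto simp: dual_frame_def subspace_euclid)
  then have "d + m = n" using dual_frame_dim dim_euclid by metis
  then show ?thesis using df' by (intro exI[of _ b']) (auto simp: onb_iff_self_dual b'_def)
qed

section \<open>Lebesgue measure in a frame\<close>

abbreviation coord_lborel :: "nat \<Rightarrow> (nat \<Rightarrow> real) measure" where
  "coord_lborel d \<equiv> Pi\<^sub>M {..<d} (\<lambda>_. lborel)"

lemma product_sigma_finite_lborel: "product_sigma_finite (\<lambda>_::nat. lborel :: real measure)"
  by (simp add: product_sigma_finite_def lborel.sigma_finite_measure_axioms)

lemma measurable_lin_comb [measurable]: "lin_comb w d \<in> borel_measurable (coord_lborel d)"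
  for w :: "nat \<Rightarrow> rseq"
  unfolding lin_comb_def by measurable

text \<open>Lebesgue measure of the span, divided by the determinant of the frame; for an
  orthonormal frame it is Lebesgue measure itself. It lives on the Borel sets of the whole space and
  is concentrated on the span, so that different subspaces share one \<sigma>-algebra.\<close>

definition frame_measure :: "(nat \<Rightarrow> rseq) \<Rightarrow> nat \<Rightarrow> rseq measure" where
  "frame_measure w d = distr (coord_lborel d) borel (lin_comb w d)"

lemma sets_frame_measure [simp, measurable_cong]: "sets (frame_measure w d) = sets borel"
  and space_frame_measure [simp]: "space (frame_measure w d) = UNIV"
  by (simp_all add: frame_measure_def)

lemma nn_integral_frame:
  "f \<in> borel_measurable borel \<Longrightarrow>
    (\<integral>\<^sup>+x. f x \<partial>frame_measure w d) = (\<integral>\<^sup>+t. f (lin_comb w d t) \<partial>coord_lborel d)"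
  unfolding frame_measure_def by (rule nn_integral_distr) auto

lemma coord_translate:
  "distr (coord_lborel d) (coord_lborel d) (\<lambda>t. \<lambda>i\<in>{..<d}. t i + u i) = coord_lborel d"
proof (rule product_sigma_finite.PiM_eqI[OF product_sigma_finite_lborel])
  fix A :: "nat \<Rightarrow> real set" assume A: "\<And>i. i \<in> {..<d} \<Longrightarrow> A i \<in> sets lborel"
  have "(\<lambda>t. \<lambda>i\<in>{..<d}. t i + u i) -` Pi\<^sub>E {..<d} A \<inter> space (coord_lborel d)
      = Pi\<^sub>E {..<d} (\<lambda>i. (\<lambda>x. u i + x) -` A i)"
    by (auto simp: space_PiM PiE_iff add.commute)
  moreover have "(\<lambda>x. u i + x) -` A i \<in> sets borel" if "i < d" for i
  proof -
    have "(\<lambda>x. u i + x) \<in> borel_measurable borel" by measurable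
    from measurable_sets[OF this, of "A i"] show ?thesis using A[of i] that by simp
  qed
  moreover have "emeasure lborel ((\<lambda>x. u i + x) -` A i) = emeasure lborel (A i)" if "i < d" for i
  proof -
    have "emeasure lborel (A i) = emeasure (distr lborel borel ((+) (u i))) (A i)"
      by (simp add: lborel_distr_plus)
    also have "\<dots> = emeasure lborel ((\<lambda>x. u i + x) -` A i)"
      using A[of i] that by (subst emeasure_distr) auto
    finally show ?thesis by simp
  qed
  moreover from calculation(2,3)
  have "emeasure (coord_lborel d) (Pi\<^sub>E {..<d} (\<lambda>i. (\<lambda>x. u i + x) -` A i)) = (\<Prod>i\<in>{..<d}. emeasure lborel (A i))"
    by (subst product_sigma_finite.emeasure_PiM[OF product_sigma_finite_lborel]) auto
  ultimately show "emeasure (distr (coord_lborel d) (coord_lborel d) (\<lambda>t. \<lambda>i\<in>{..<d}. t i + u i)) (Pi\<^sub>E {..<d} A)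
      = (\<Prod>i\<in>{..<d}. emeasure lborel (A i))"
    using A by (subst emeasure_distr) (auto intro!: sets_PiM_I_finite)
qed auto

lemma frame_translate:
  assumes "dual_frame E d w v" "u \<in> E"
  shows "distr (frame_measure w d) borel (\<lambda>x. x + u) = frame_measure w d"
proof -
  define s where "s = (\<lambda>i. u \<bullet> v i)"
  have u: "u = lin_comb w d s" unfolding s_def using dual_frame_expand[OF assms] by simp
  have "frame_measure w d
      = distr (distr (coord_lborel d) (coord_lborel d) (\<lambda>t. \<lambda>i\<in>{..<d}. t i + s i)) borel (lin_comb w d)"
    by (simp add: coord_translate frame_measure_def)
  also have "\<dots> = distr (coord_lborel d) borel (lin_comb w d \<circ> (\<lambda>t. \<lambda>i\<in>{..<d}. t i + s i))"
    by (rule distr_distr) auto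
  also have "lin_comb w d \<circ> (\<lambda>t. \<lambda>i\<in>{..<d}. t i + s i) = (\<lambda>x. x + u) \<circ> lin_comb w d"
  proof
    fix t
    have "lin_comb w d (\<lambda>i\<in>{..<d}. t i + s i) = lin_comb w d (\<lambda>i. t i + s i)"
      by (rule lin_comb_cong) simp
    then show "(lin_comb w d \<circ> (\<lambda>t. \<lambda>i\<in>{..<d}. t i + s i)) t = ((\<lambda>x. x + u) \<circ> lin_comb w d) t"
      by (simp add: lin_comb_add u[symmetric])
  qed
  also have "distr (coord_lborel d) borel ((\<lambda>x. x + u) \<circ> lin_comb w d)
      = distr (frame_measure w d) borel (\<lambda>x. x + u)"
    unfolding frame_measure_def by (rule distr_distr[OF _ measurable_lin_comb, symmetric]) measurable
  finally show ?thesis by (rule sym)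
qed

lemma closed_dual_frame:
  assumes "dual_frame E d w v"
  shows "closed E"
proof -
  have "E = {x. lin_comb w d (\<lambda>i. x \<bullet> v i) = x}"
    using dual_frame_expand[OF assms] dual_frame_mem[OF assms] by auto metis
  also have "closed \<dots>"
    unfolding lin_comb_def by (intro closed_Collect_eq continuous_intros)
  finally show ?thesis .
qed

lemma borel_dual_frame: "dual_frame E d w v \<Longrightarrow> E \<in> sets borel"
  by (simp add: closed_dual_frame)

lemma AE_frame:
  assumes "dual_frame E d w v"
  shows "AE x in frame_measure w d. x \<in> E"
  unfolding frame_measure_def using dual_frame_mem[OF assms]
  by (subst AE_distr_iff) (auto simp: borel_dual_frame[OF assms])

lemma frame_box:
  assumes "dual_frame E d w v" "a \<le> b"
  shows "emeasure (frame_measure w d) {x. \<forall>i<d. x \<bullet> v i \<in> {a..b}} = ennreal (b - a) ^ d"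
proof -
  have "closed {x. \<forall>i<d. x \<bullet> v i \<in> {a..b}}"
    unfolding atLeastAtMost_iff
    by (intro closed_Collect_all closed_Collect_imp open_Collect_const closed_Collect_conj closed_Collect_le continuous_intros)
  then have B: "{x. \<forall>i<d. x \<bullet> v i \<in> {a..b}} \<in> sets borel" by simp
  have "lin_comb w d -` {x. \<forall>i<d. x \<bullet> v i \<in> {a..b}} \<inter> space (coord_lborel d) = Pi\<^sub>E {..<d} (\<lambda>_. {a..b})"
    using dual_frame_coeff[OF assms(1)] by (auto simp: space_PiM PiE_iff)
  then show ?thesis
    using B assms(2) unfolding frame_measure_def
    by (subst emeasure_distr) (auto simp: product_sigma_finite.emeasure_PiM[OF product_sigma_finite_lborel])
qed

lemma frame_bounded_finite:
  assumes "dual_frame E d w v" "bounded A"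
  shows "emeasure (frame_measure w d) A < \<infinity>"
proof -
  obtain r where r: "r \<ge> 0" "\<And>x. x \<in> A \<Longrightarrow> norm x \<le> r"
    using assms(2) unfolding bounded_iff by (metis norm_ge_zero order_trans linear)
  define C where "C = r * (\<Sum>i<d. norm (v i))"
  have C: "C \<ge> 0" using r by (auto simp: C_def sum_nonneg)
  have "closed {x. \<forall>i<d. x \<bullet> v i \<in> {-C..C}}"
    unfolding atLeastAtMost_iff
    by (intro closed_Collect_all closed_Collect_imp open_Collect_const closed_Collect_conj closed_Collect_le continuous_intros)
  moreover have "A \<subseteq> {x. \<forall>i<d. x \<bullet> v i \<in> {-C..C}}"
  proof clarify
    fix x i assume x: "x \<in> A" "i < d"
    have "\<bar>x \<bullet> v i\<bar> \<le> norm x * norm (v i)" by (rule Cauchy_Schwarz_ineq2)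
    also have "\<dots> \<le> r * (\<Sum>i<d. norm (v i))"
      using x r by (intro mult_mono member_le_sum) auto
    finally show "x \<bullet> v i \<in> {-C..C}" by (auto simp: C_def)
  qed
  ultimately have "emeasure (frame_measure w d) A \<le> emeasure (frame_measure w d) {x. \<forall>i<d. x \<bullet> v i \<in> {-C..C}}"
    by (intro emeasure_mono) auto
  also have "\<dots> < \<infinity>" using frame_box[OF assms(1), of "-C" C] C
    by (simp add: ennreal_power[symmetric] power_less_top_ennreal)
  finally show ?thesis .
qed

lemma frame_ball_pos:
  assumes "dual_frame E d w v" "z \<in> E" "r > 0"
  shows "emeasure (frame_measure w d) (ball z r) > 0"
proof -
  \<comment> \<open>Coefficients in \<open>[0, \<epsilon>]\<close> give vectors of norm at most
    \<open>r / 2\<close>; the summand 1 keeps the denominator positive for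
    \<open>d = 0\<close>.\<close>
  define \<epsilon> where "\<epsilon> = r / (2 * (1 + (\<Sum>i<d. norm (w i))))"
  have s: "(\<Sum>i<d. norm (w i)) \<ge> 0" by (simp add: sum_nonneg)
  then have eps: "\<epsilon> > 0" using assms(3) by (simp add: \<epsilon>_def add_nonneg_pos)
  have "norm (lin_comb w d t) < r" if "t \<in> Pi\<^sub>E {..<d} (\<lambda>_. {0..\<epsilon>})" for t
  proof -
    have "norm (lin_comb w d t) \<le> (\<Sum>i<d. norm (t i *\<^sub>R w i))" unfolding lin_comb_def by (rule norm_sum)
    also have "\<dots> \<le> (\<Sum>i<d. \<epsilon> * norm (w i))"
      using that by (intro sum_mono) (auto simp: PiE_iff intro!: mult_right_mono)
    also have "\<dots> = \<epsilon> * (\<Sum>i<d. norm (w i))" by (simp add: sum_distrib_left)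
    also have "\<dots> \<le> \<epsilon> * (1 + (\<Sum>i<d. norm (w i)))" using eps by (intro mult_left_mono) auto
    also have "\<dots> = r / 2" using s by (simp add: \<epsilon>_def field_simps add_nonneg_eq_0_iff)
    also have "\<dots> < r" using assms(3) by simp
    finally show ?thesis .
  qed
  then have sub: "Pi\<^sub>E {..<d} (\<lambda>_. {0..\<epsilon>}) \<subseteq> lin_comb w d -` ball 0 r \<inter> space (coord_lborel d)"
    by (auto simp: space_PiM)
  have "0 < ennreal \<epsilon> ^ d" using eps by (simp add: ennreal_power)
  also have "\<dots> = emeasure (coord_lborel d) (Pi\<^sub>E {..<d} (\<lambda>_. {0..\<epsilon>}))"
    using eps by (subst product_sigma_finite.emeasure_PiM[OF product_sigma_finite_lborel]) auto
  also have "\<dots> \<le> emeasure (frame_measure w d) (ball 0 r)"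
    unfolding frame_measure_def by (subst emeasure_distr) (auto intro!: emeasure_mono sub)
  also have "\<dots> = emeasure (distr (frame_measure w d) borel (\<lambda>x. x + z)) (ball z r)"
    by (subst emeasure_distr) (auto intro!: arg_cong[where f = "emeasure _"] simp: dist_norm)
  also have "\<dots> = emeasure (frame_measure w d) (ball z r)"
    by (simp add: frame_translate[OF assms(1,2)])
  finally show ?thesis .
qed

lemma sigma_finite_frame:
  assumes "dual_frame E d w v"
  shows "sigma_finite_measure (frame_measure w d)"
proof
  show "\<exists>A. countable A \<and> A \<subseteq> sets (frame_measure w d) \<and> \<Union> A = space (frame_measure w d) \<and>
      (\<forall>a\<in>A. emeasure (frame_measure w d) a \<noteq> \<infinity>)"
  proof (intro exI[of _ "range (\<lambda>k::nat. cball 0 (real k))"] conjI ballI)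
    show "\<Union> (range (\<lambda>k::nat. cball 0 (real k))) = space (frame_measure w d)"
      by (auto simp: real_arch_simple)
    fix a assume "a \<in> range (\<lambda>k::nat. cball (0::rseq) (real k))"
    then show "emeasure (frame_measure w d) a \<noteq> \<infinity>"
      using frame_bounded_finite[OF assms, of a] by auto
  qed auto
qed

section \<open>Uniqueness of translation-invariant measures\<close>

text \<open>The double integral of \<open>indicator A (x + y) * indicator B y\<close> is evaluated
  by translating \<mu>, and after Fubini by translating \<nu>. The product form avoids dividing
  values that may be infinite; with a ball for \<open>B\<close> it yields proportionality.\<close>

lemma translation_invariant_unique:
  fixes \<mu> \<nu> :: "rseq measure"
  assumes \<mu>: "sigma_finite_measure \<mu>" "sets \<mu> = sets borel"
    and \<nu>: "sigma_finite_measure \<nu>" "sets \<nu> = sets borel"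
    and E: "subspace E" "AE x in \<mu>. x \<in> E" "AE x in \<nu>. x \<in> E"
    and inv: "\<And>u. u \<in> E \<Longrightarrow> distr \<mu> borel (\<lambda>x. x + u) = \<mu>" "\<And>u. u \<in> E \<Longrightarrow> distr \<nu> borel (\<lambda>x. x + u) = \<nu>"
    and A: "A \<in> sets borel" and B: "B \<in> sets borel" "\<And>x. - x \<in> B \<longleftrightarrow> x \<in> B"
  shows "emeasure \<mu> A * emeasure \<nu> B = emeasure \<nu> A * emeasure \<mu> B"
proof -
  note [measurable_cong] = \<mu>(2) \<nu>(2)
  note [measurable] = A B(1)
  interpret \<mu>: sigma_finite_measure \<mu> by fact
  interpret \<nu>: sigma_finite_measure \<nu> by fact
  interpret P: pair_sigma_finite \<mu> \<nu> ..
  have "emeasure \<mu> A * emeasure \<nu> B = (\<integral>\<^sup>+y. emeasure \<mu> A * indicator B y \<partial>\<nu>)"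
    by (simp add: nn_integral_cmult_indicator)
  \<comment> \<open>For fixed \<open>y\<close> in \<open>E\<close> the set \<open>A\<close> is
    translated by \<open>y\<close> without changing its mass under \<mu>.\<close>
  also have "\<dots> = (\<integral>\<^sup>+y. (\<integral>\<^sup>+x. indicator A (x + y) * indicator B y \<partial>\<mu>) \<partial>\<nu>)"
  proof (rule nn_integral_cong_AE)
    show "AE y in \<nu>. emeasure \<mu> A * indicator B y = (\<integral>\<^sup>+x. indicator A (x + y) * indicator B y \<partial>\<mu>)"
      using E(3)
    proof eventually_elim
      case (elim y)
      have "emeasure \<mu> A = (\<integral>\<^sup>+x. indicator A x \<partial>distr \<mu> borel (\<lambda>x. x + y))"
        using inv(1)[OF elim] by simp
      also have "\<dots> = (\<integral>\<^sup>+x. indicator A (x + y) \<partial>\<mu>)" by (subst nn_integral_distr) auto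
      finally show ?case by (simp add: nn_integral_multc)
    qed
  qed
  also have "\<dots> = (\<integral>\<^sup>+x. (\<integral>\<^sup>+y. indicator A (x + y) * indicator B y \<partial>\<nu>) \<partial>\<mu>)"
    by (rule P.Fubini') measurable
  \<comment> \<open>Substituting \<open>y - x\<close> for \<open>y\<close> under \<nu> frees
    \<open>A\<close> from \<open>x\<close>.\<close>
  also have "\<dots> = (\<integral>\<^sup>+x. (\<integral>\<^sup>+y. indicator A y * indicator B (y - x) \<partial>\<nu>) \<partial>\<mu>)"
  proof (rule nn_integral_cong_AE)
    show "AE x in \<mu>. (\<integral>\<^sup>+y. indicator A (x + y) * indicator B y \<partial>\<nu>)
        = (\<integral>\<^sup>+y. indicator A y * indicator B (y - x) \<partial>\<nu>)"
      using E(2)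
    proof eventually_elim
      case (elim x)
      have "(\<integral>\<^sup>+y. indicator A y * indicator B (y - x) \<partial>\<nu>)
          = (\<integral>\<^sup>+y. indicator A y * indicator B (y - x) \<partial>distr \<nu> borel (\<lambda>y. y + x))"
        using inv(2)[OF elim] by simp
      also have "\<dots> = (\<integral>\<^sup>+y. indicator A (x + y) * indicator B y \<partial>\<nu>)"
        by (subst nn_integral_distr) (auto simp: add.commute)
      finally show ?case by simp
    qed
  qed
  also have "\<dots> = (\<integral>\<^sup>+y. (\<integral>\<^sup>+x. indicator A y * indicator B (y - x) \<partial>\<mu>) \<partial>\<nu>)"
    by (rule P.Fubini'[symmetric]) measurable
  also have "\<dots> = (\<integral>\<^sup>+y. indicator A y * emeasure \<mu> B \<partial>\<nu>)"
  proof (rule nn_integral_cong_AE)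
    show "AE y in \<nu>. (\<integral>\<^sup>+x. indicator A y * indicator B (y - x) \<partial>\<mu>) = indicator A y * emeasure \<mu> B"
      using E(3)
    proof eventually_elim
      case (elim y)
      have "emeasure \<mu> B = (\<integral>\<^sup>+x. indicator B x \<partial>distr \<mu> borel (\<lambda>x. x + (- y)))"
        using inv(1)[of "- y"] elim E(1) by (simp add: subspace_neg)
      also have "\<dots> = (\<integral>\<^sup>+x. indicator B (x + (- y)) \<partial>\<mu>)" by (subst nn_integral_distr) auto
      \<comment> \<open>Symmetry of \<open>B\<close> exchanges \<open>x - y\<close> and
        \<open>y - x\<close>.\<close>
      also have "\<dots> = (\<integral>\<^sup>+x. indicator B (y - x) \<partial>\<mu>)"
        using B(2)[of "y - x" for x] by (intro nn_integral_cong) (auto simp: indicator_def)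
      finally show ?case by (simp add: nn_integral_cmult)
    qed
  qed
  also have "\<dots> = emeasure \<nu> A * emeasure \<mu> B"
    by (simp add: nn_integral_multc)
  finally show ?thesis .
qed

lemma emeasure_pos_finite_measure:
  assumes "emeasure M A > 0" "emeasure M A < \<infinity>"
  shows "emeasure M A = ennreal (measure M A)" "measure M A > 0"
proof -
  show "emeasure M A = ennreal (measure M A)"
    by (rule emeasure_eq_ennreal_measure) (use assms in auto)
  with assms show "measure M A > 0"
    by (metis ennreal_0 less_irrefl measure_nonneg order_le_less)
qed

text \<open>\<kappa> is the quotient of the masses of the unit ball and plays the role of a Jacobian
  determinant throughout.\<close>

lemma frame_measure_scale:
  assumes w: "dual_frame E d w v" and w': "dual_frame E d w' v'"
  shows "\<exists>\<kappa>>0. frame_measure w d = scale_measure (ennreal \<kappa>) (frame_measure w' d)"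
proof -
  let ?\<mu> = "frame_measure w d" and ?\<nu> = "frame_measure w' d" and ?B = "ball (0::rseq) 1"
  have z: "0 \<in> E" using dual_frame_subspace[OF w] by (simp add: subspace_0)
  have fin: "emeasure ?\<mu> ?B < \<infinity>" "emeasure ?\<nu> ?B < \<infinity>"
    using frame_bounded_finite[OF w] frame_bounded_finite[OF w'] by auto
  have pos: "emeasure ?\<mu> ?B > 0" "emeasure ?\<nu> ?B > 0"
    using frame_ball_pos[OF w z] frame_ball_pos[OF w' z] by auto
  define m where "m = measure ?\<mu> ?B"
  define k where "k = measure ?\<nu> ?B"
  have m: "emeasure ?\<mu> ?B = ennreal m" "m > 0" and k: "emeasure ?\<nu> ?B = ennreal k" "k > 0"
    unfolding m_def k_def using emeasure_pos_finite_measure[OF pos(1) fin(1)] emeasure_pos_finite_measure[OF pos(2) fin(2)] by auto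
  have eq: "emeasure ?\<mu> A * ennreal k = emeasure ?\<nu> A * ennreal m" if "A \<in> sets borel" for A
    using translation_invariant_unique[OF sigma_finite_frame[OF w] _ sigma_finite_frame[OF w'] _
        dual_frame_subspace[OF w] AE_frame[OF w] AE_frame[OF w'] frame_translate[OF w] frame_translate[OF w'] that, of ?B]
    by (simp add: m k)
  have "?\<mu> = scale_measure (ennreal (m / k)) ?\<nu>"
  proof (rule measure_eqI)
    fix A assume "A \<in> sets ?\<mu>"
    then have "emeasure ?\<mu> A * ennreal k = emeasure ?\<nu> A * ennreal m" using eq by simp
    then have "emeasure ?\<mu> A * ennreal k * ennreal (1 / k) = emeasure ?\<nu> A * ennreal m * ennreal (1 / k)"
      by simp
    then show "emeasure ?\<mu> A = emeasure (scale_measure (ennreal (m / k)) ?\<nu>) A"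
      using k m by (simp add: mult.assoc ennreal_mult[symmetric]) (simp add: mult.commute)
  qed simp
  then show ?thesis using m k by (intro exI[of _ "m / k"]) auto
qed

text \<open>The unit ball has the same coordinate description in every orthonormal basis, so the
  factor is 1. Hence the basis picked by \<open>SOME\<close> in \<open>subspace_lborel\<close> does
  not matter.\<close>

lemma frame_measure_onb:
  assumes b: "orthonormal_basis E d b" and b': "orthonormal_basis E d b'"
  shows "frame_measure b d = frame_measure b' d"
proof -
  note df = onb_dual_frame[OF b] onb_dual_frame[OF b']
  obtain \<kappa> where k: "\<kappa> > 0" "frame_measure b d = scale_measure (ennreal \<kappa>) (frame_measure b' d)"
    using frame_measure_scale[OF df] by blast
  have "lin_comb b d t \<in> ball 0 1 \<longleftrightarrow> lin_comb b' d t \<in> ball 0 1" for t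
  proof -
    have "(norm (lin_comb b d t))\<^sup>2 = (norm (lin_comb b' d t))\<^sup>2"
      using onb_norm[OF b] onb_norm[OF b'] by simp
    then have "norm (lin_comb b d t) = norm (lin_comb b' d t)" by simp
    then show ?thesis by simp
  qed
  then have "lin_comb b d -` ball 0 1 \<inter> space (coord_lborel d) = lin_comb b' d -` ball 0 1 \<inter> space (coord_lborel d)"
    by auto
  then have eq: "emeasure (frame_measure b d) (ball 0 1) = emeasure (frame_measure b' d) (ball 0 1)"
    unfolding frame_measure_def by (subst (1 2) emeasure_distr) auto
  have z: "0 \<in> E" using dual_frame_subspace[OF df(1)] by (simp add: subspace_0)
  define m where "m = measure (frame_measure b' d) (ball 0 1)"
  have m: "emeasure (frame_measure b' d) (ball 0 1) = ennreal m" "m > 0"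
    unfolding m_def
    using emeasure_pos_finite_measure[OF frame_ball_pos[OF df(2) z, of 1] frame_bounded_finite[OF df(2), of "ball 0 1"]]
    by simp_all
  have "ennreal m = ennreal \<kappa> * ennreal m"
    using eq unfolding k(2) by (simp add: m)
  then have "\<kappa> = 1" using m(2) k(1) by (simp add: ennreal_mult[symmetric])
  then show ?thesis using k(2) by simp
qed

lemma frame_measure_scaleR:
  assumes w: "dual_frame E d w v" and s: "s > 0"
  shows "frame_measure (\<lambda>i. s *\<^sub>R w i) d = scale_measure (ennreal (1 / s ^ d)) (frame_measure w d)"
proof -
  have df: "dual_frame E d (\<lambda>i. s *\<^sub>R w i) (\<lambda>i. v i /\<^sub>R s)"
  proof -
    have "lin_comb (\<lambda>i. s *\<^sub>R w i) d (\<lambda>i. x \<bullet> v i /\<^sub>R s) = lin_comb w d (\<lambda>i. x \<bullet> v i)" for x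
      using s by (auto simp: lin_comb_def field_simps intro!: sum.cong)
    then show ?thesis using w s unfolding dual_frame_def by (auto simp: subspace_scale)
  qed
  obtain \<kappa> where k: "\<kappa> > 0" "frame_measure (\<lambda>i. s *\<^sub>R w i) d = scale_measure (ennreal \<kappa>) (frame_measure w d)"
    using frame_measure_scale[OF df w] by blast
  \<comment> \<open>The unit box of the frame \<open>w\<close> is a box of side \<open>1 / s\<close>
    for the stretched frame; comparing its two masses determines \<kappa>.\<close>
  have set_eq: "{x. \<forall>i<d. x \<bullet> v i \<in> {0..1}} = {x. \<forall>i<d. x \<bullet> (v i /\<^sub>R s) \<in> {0..1 / s}}"
    using s by (simp add: field_simps)
  have "ennreal (1 / s) ^ d = emeasure (frame_measure (\<lambda>i. s *\<^sub>R w i) d) {x. \<forall>i<d. x \<bullet> v i \<in> {0..1}}"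
    unfolding set_eq using frame_box[OF df, of 0 "1 / s"] s by simp
  also have "\<dots> = ennreal \<kappa> * emeasure (frame_measure w d) {x. \<forall>i<d. x \<bullet> v i \<in> {0..1}}"
    unfolding k(2) by simp
  also have "\<dots> = ennreal \<kappa>"
    using frame_box[OF w, of 0 1] by simp
  finally have "\<kappa> = (1 / s) ^ d" using s k(1) by (simp add: ennreal_power)
  then show ?thesis using k(2) by (simp add: power_one_over)
qed

section \<open>Lebesgue measure of a subspace in an arbitrary orthonormal basis\<close>

text \<open>Bridge from the definition to \<open>frame_measure\<close>: \<open>b0\<close> is the
  basis selected by \<open>SOME\<close>, and its frame measure agrees with that of the given
  \<open>b\<close>. Only the restricted \<sigma>-algebra of \<open>subspace_lborel\<close> remains
  to be dealt with.\<close>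

lemma subspace_lborel_eq:
  assumes b: "orthonormal_basis E d b"
  shows "\<exists>b0. frame_measure b0 d = frame_measure b d \<and> (\<forall>t. lin_comb b0 d t \<in> E) \<and>
     subspace_lborel E = distr (coord_lborel d) (restrict_space borel E) (lin_comb b0 d)"
proof -
  have d: "dim E = d" using dual_frame_dim[OF onb_dual_frame[OF b]] .
  define b0 where "b0 = (SOME b. orthonormal_basis E d b)"
  have b0: "orthonormal_basis E d b0" unfolding b0_def by (rule someI[of "orthonormal_basis E d", OF b])
  have "frame_measure b0 d = frame_measure b d" by (rule frame_measure_onb[OF b0 b])
  moreover have "subspace_lborel E = distr (coord_lborel d) (restrict_space borel E) (lin_comb b0 d)"
    by (simp add: subspace_lborel_def d b0_def[symmetric] lin_comb_def[abs_def])
  ultimately show ?thesis using dual_frame_mem[OF onb_dual_frame[OF b0]] by auto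
qed

lemma measurable_restrict_lin_comb:
  "(\<And>t. lin_comb b d t \<in> E) \<Longrightarrow> lin_comb b d \<in> measurable (coord_lborel d) (restrict_space borel E)"
  for b :: "nat \<Rightarrow> rseq"
  by (intro measurable_restrict_space2) auto

lemma emeasure_subspace_lborel:
  assumes b: "orthonormal_basis E d b" and K: "K \<in> sets borel" "K \<subseteq> E"
  shows "emeasure (subspace_lborel E) K = emeasure (frame_measure b d) K"
proof -
  obtain b0 where b0: "frame_measure b0 d = frame_measure b d" "\<And>t. lin_comb b0 d t \<in> E"
     "subspace_lborel E = distr (coord_lborel d) (restrict_space borel E) (lin_comb b0 d)"
    using subspace_lborel_eq[OF b] by blast
  have "K \<in> sets (restrict_space borel E)"
    using K borel_dual_frame[OF onb_dual_frame[OF b]] by (simp add: sets_restrict_space_iff)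
  then have "emeasure (subspace_lborel E) K = emeasure (coord_lborel d) (lin_comb b0 d -` K \<inter> space (coord_lborel d))"
    unfolding b0(3) by (intro emeasure_distr measurable_restrict_lin_comb b0(2))
  also have "\<dots> = emeasure (frame_measure b0 d) K"
    unfolding frame_measure_def using K by (subst emeasure_distr) auto
  finally show ?thesis using b0(1) by simp
qed

lemma measure_subspace_lborel:
  assumes b: "orthonormal_basis E d b" and K: "K \<in> sets borel" "K \<subseteq> E"
  shows "measure (subspace_lborel E) K = measure (frame_measure b d) K"
  using emeasure_subspace_lborel[OF assms] by (simp add: measure_def)

lemma integral_subspace_lborel:
  fixes f :: "rseq \<Rightarrow> real"
  assumes b: "orthonormal_basis E d b" and K: "K \<in> sets borel" and f: "f \<in> borel_measurable borel"
  shows "(LINT x:K|subspace_lborel E. f x) = (LINT x:K|frame_measure b d. f x)"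
proof -
  obtain b0 where b0: "frame_measure b0 d = frame_measure b d" "\<And>t. lin_comb b0 d t \<in> E"
     "subspace_lborel E = distr (coord_lborel d) (restrict_space borel E) (lin_comb b0 d)"
    using subspace_lborel_eq[OF b] by blast
  have m: "(\<lambda>x. indicator K x *\<^sub>R f x) \<in> borel_measurable borel" using K f by measurable
  have "(LINT x:K|subspace_lborel E. f x) = (LINT t|coord_lborel d. indicator K (lin_comb b0 d t) *\<^sub>R f (lin_comb b0 d t))"
    unfolding b0(3) set_lebesgue_integral_def
    by (rule integral_distr[OF measurable_restrict_lin_comb[OF b0(2)] measurable_restrict_space1[OF m]])
  also have "\<dots> = (LINT x:K|frame_measure b0 d. f x)"
    unfolding frame_measure_def set_lebesgue_integral_def by (subst integral_distr) (use m in auto)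
  finally show ?thesis using b0(1) by simp
qed

section \<open>Product probability measures and Gaussians\<close>

lemma PiM_density_lborel:
  fixes f :: "real \<Rightarrow> ennreal" and d :: nat
  assumes f [measurable]: "f \<in> borel_measurable borel" and p: "prob_space (density lborel f)"
  shows "Pi\<^sub>M {..<d} (\<lambda>_. density lborel f) = density (coord_lborel d) (\<lambda>t. \<Prod>i<d. f (t i))"
proof (rule sym, rule product_sigma_finite.PiM_eqI)
  show "product_sigma_finite (\<lambda>_::nat. density lborel f)"
    using p by (simp add: product_sigma_finite_def prob_space_imp_sigma_finite)
  show "sets (density (coord_lborel d) (\<lambda>t. \<Prod>i<d. f (t i))) = sets (Pi\<^sub>M {..<d} (\<lambda>_. density lborel f))"
    by (simp, rule sets_PiM_cong) auto
  fix A :: "nat \<Rightarrow> real set" assume A: "\<And>i. i \<in> {..<d} \<Longrightarrow> A i \<in> sets (density lborel f)"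
  then have A' [measurable]: "A i \<in> sets borel" if "i < d" for i using that by auto
  have "emeasure (density (coord_lborel d) (\<lambda>t. \<Prod>i<d. f (t i))) (Pi\<^sub>E {..<d} A)
      = (\<integral>\<^sup>+t. (\<Prod>i<d. f (t i)) * indicator (Pi\<^sub>E {..<d} A) t \<partial>coord_lborel d)"
    using A by (intro emeasure_density) (auto intro!: sets_PiM_I_finite)
  also have "\<dots> = (\<integral>\<^sup>+t. (\<Prod>i<d. f (t i) * indicator (A i) (t i)) \<partial>coord_lborel d)"
  proof (rule nn_integral_cong)
    fix t assume t: "t \<in> space (coord_lborel d)"
    have "indicator (Pi\<^sub>E {..<d} A) t = (\<Prod>i<d. indicator (A i) (t i) :: ennreal)"
    proof (cases "t \<in> Pi\<^sub>E {..<d} A")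
      case True
      then have "(\<Prod>i<d. indicator (A i) (t i) :: ennreal) = 1" by (intro prod.neutral) (auto simp: PiE_iff)
      then show ?thesis using True by simp
    next
      case False
      then obtain i where "i < d" "t i \<notin> A i" using t by (auto simp: PiE_iff space_PiM)
      then have "(\<Prod>i<d. indicator (A i) (t i) :: ennreal) = 0" by (intro prod_zero bexI[of _ i]) auto
      then show ?thesis using False by simp
    qed
    then show "(\<Prod>i<d. f (t i)) * indicator (Pi\<^sub>E {..<d} A) t = (\<Prod>i<d. f (t i) * indicator (A i) (t i))"
      by (simp add: prod.distrib)
  qed
  also have "\<dots> = (\<Prod>i<d. \<integral>\<^sup>+x. f x * indicator (A i) x \<partial>lborel)"
    by (rule product_sigma_finite.product_nn_integral_prod[OF product_sigma_finite_lborel]) auto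
  also have "\<dots> = (\<Prod>i<d. emeasure (density lborel f) (A i))"
    by (intro prod.cong refl) (auto simp: emeasure_density)
  finally show "emeasure (density (coord_lborel d) (\<lambda>t. \<Prod>i<d. f (t i))) (Pi\<^sub>E {..<d} A)
      = (\<Prod>i<d. emeasure (density lborel f) (A i))" .
qed auto

lemma product_second_moment:
  fixes N :: "real measure" and d :: nat
  assumes p: "prob_space N" and s: "sets N = sets borel"
    and i1: "integrable N (\<lambda>x. x)" and i2: "integrable N (\<lambda>x. x\<^sup>2)" and ij: "i < d" "j < d"
  shows "integrable (Pi\<^sub>M {..<d} (\<lambda>_. N)) (\<lambda>t. t i * t j)"
    and "(LINT t|Pi\<^sub>M {..<d} (\<lambda>_. N). t i * t j) = (if i = j then LINT x|N. x\<^sup>2 else (LINT x|N. x)\<^sup>2)"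
proof -
  interpret N: prob_space N by fact
  have ps: "product_sigma_finite (\<lambda>_::nat. N)"
    by (simp add: product_sigma_finite_def N.sigma_finite_measure_axioms)
  \<comment> \<open>Writes \<open>t i * t j\<close> as a product over all coordinates, with factor 1
    at the others, so that the product formula for integrals applies; for \<open>i = j\<close> the
    factor is a square.\<close>
  define f where "f = (\<lambda>k x::real. (if k = i then x else 1) * (if k = j then x else 1))"
  have fi: "integrable N (f k)" for k
    using i1 i2 by (cases "k = i"; cases "k = j") (auto simp: f_def power2_eq_square)
  have tt: "(\<Prod>k<d. f k (t k)) = t i * t j" for t
    using ij by (simp add: f_def prod.distrib)
  show "integrable (Pi\<^sub>M {..<d} (\<lambda>_. N)) (\<lambda>t. t i * t j)"
    using product_sigma_finite.product_integrable_prod[OF ps, of "{..<d}" f] fi tt by simp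
  have "(LINT t|Pi\<^sub>M {..<d} (\<lambda>_. N). t i * t j) = (\<Prod>k<d. LINT x|N. f k x)"
    using product_sigma_finite.product_integral_prod[OF ps, of "{..<d}" f] fi tt by simp
  also have "\<dots> = (if i = j then LINT x|N. x\<^sup>2 else (LINT x|N. x)\<^sup>2)"
  proof (cases "i = j")
    case True
    have "(\<Prod>k<d. LINT x|N. f k x) = (\<Prod>k<d. if k = i then LINT x|N. x\<^sup>2 else 1)"
      using True by (intro prod.cong) (auto simp: f_def power2_eq_square N.prob_space)
    then show ?thesis using True ij by simp
  next
    case False
    have "(\<Prod>k<d. LINT x|N. f k x) = (\<Prod>k<d. (if k = i then LINT x|N. x else 1) * (if k = j then LINT x|N. x else 1))"
      using False by (intro prod.cong) (auto simp: f_def N.prob_space)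
    then show ?thesis using False ij by (simp add: prod.distrib power2_eq_square)
  qed
  finally show "(LINT t|Pi\<^sub>M {..<d} (\<lambda>_. N). t i * t j) = (if i = j then LINT x|N. x\<^sup>2 else (LINT x|N. x)\<^sup>2)" .
qed

lemma norm_lin_comb_sq: "(norm (lin_comb r d t))\<^sup>2 = (\<Sum>i<d. \<Sum>j<d. (r i \<bullet> r j) * (t i * t j))"
  for r :: "nat \<Rightarrow> rseq"
  unfolding power2_norm_eq_inner lin_comb_def inner_sum_left inner_sum_right
  by (subst sum.swap, intro sum.cong refl) (simp add: algebra_simps inner_commute)

text \<open>Expanding the square, the squared mean appears in all pairs and the variance only on the
  diagonal. The lemma serves Gaussian coefficients, with mean 0 and variance 1, and exponential
  ones, with mean and variance 1.\<close>

lemma product_norm_lin_comb: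
  fixes N :: "real measure" and r :: "nat \<Rightarrow> rseq"
  assumes p: "prob_space N" and s: "sets N = sets borel"
    and i1: "integrable N (\<lambda>x. x)" and i2: "integrable N (\<lambda>x. x\<^sup>2)"
  shows "integrable (Pi\<^sub>M {..<d} (\<lambda>_. N)) (\<lambda>t. (norm (lin_comb r d t))\<^sup>2)"
    and "(LINT t|Pi\<^sub>M {..<d} (\<lambda>_. N). (norm (lin_comb r d t))\<^sup>2) =
       (LINT x|N. x)\<^sup>2 * (norm (\<Sum>i<d. r i))\<^sup>2 + ((LINT x|N. x\<^sup>2) - (LINT x|N. x)\<^sup>2) * (\<Sum>i<d. (norm (r i))\<^sup>2)"
proof -
  note m = product_second_moment[OF p s i1 i2, where d = d]
  show "integrable (Pi\<^sub>M {..<d} (\<lambda>_. N)) (\<lambda>t. (norm (lin_comb r d t))\<^sup>2)"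
    unfolding norm_lin_comb_sq using m(1) by (intro Bochner_Integration.integrable_sum integrable_mult_right) auto
  define a where "a = (LINT x|N. x)\<^sup>2"
  define b where "b = (LINT x|N. x\<^sup>2)"
  have "(LINT t|Pi\<^sub>M {..<d} (\<lambda>_. N). (norm (lin_comb r d t))\<^sup>2) =
     (\<Sum>i<d. \<Sum>j<d. (r i \<bullet> r j) * (LINT t|Pi\<^sub>M {..<d} (\<lambda>_. N). t i * t j))"
    unfolding norm_lin_comb_sq using m(1)
    by (subst Bochner_Integration.integral_sum)
      (auto intro!: sum.cong Bochner_Integration.integrable_sum integrable_mult_right)
  also have "\<dots> = (\<Sum>i<d. \<Sum>j<d. a * (r i \<bullet> r j) + (if i = j then (b - a) * (r i \<bullet> r j) else 0))"
    by (intro sum.cong refl) (auto simp: m(2) a_def b_def algebra_simps)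
  also have "\<dots> = a * (\<Sum>i<d. \<Sum>j<d. r i \<bullet> r j) + (b - a) * (\<Sum>i<d. r i \<bullet> r i)"
    by (simp add: sum.distrib sum_distrib_left)
  also have "(\<Sum>i<d. \<Sum>j<d. r i \<bullet> r j) = (norm (\<Sum>i<d. r i))\<^sup>2"
    by (simp add: power2_norm_eq_inner inner_sum_left inner_sum_right) (rule sum.swap)
  finally show "(LINT t|Pi\<^sub>M {..<d} (\<lambda>_. N). (norm (lin_comb r d t))\<^sup>2) =
       (LINT x|N. x)\<^sup>2 * (norm (\<Sum>i<d. r i))\<^sup>2 + ((LINT x|N. x\<^sup>2) - (LINT x|N. x)\<^sup>2) * (\<Sum>i<d. (norm (r i))\<^sup>2)"
    by (simp add: a_def b_def power2_norm_eq_inner)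
qed

section \<open>Standard Gaussian measures on subspaces\<close>

abbreviation std_normal :: "real measure" where
  "std_normal \<equiv> density lborel (\<lambda>x. ennreal (std_normal_density x))"

abbreviation gauss_coord :: "nat \<Rightarrow> (nat \<Rightarrow> real) measure" where
  "gauss_coord d \<equiv> Pi\<^sub>M {..<d} (\<lambda>_. std_normal)"

lemma prob_space_std_normal: "prob_space std_normal"
  by (rule prob_space_normal_density) simp

lemma product_prob_space_std_normal: "product_prob_space (\<lambda>_::nat. std_normal)"
  using prob_space_std_normal
  by (simp add: product_prob_space_def product_prob_space_axioms_def product_sigma_finite_def prob_space_imp_sigma_finite)

lemma prob_space_gauss_coord: "prob_space (gauss_coord d)"
  by (rule prob_space_PiM) (rule prob_space_std_normal)

lemma std_normal_integrable: "integrable std_normal (\<lambda>x. x)" "integrable std_normal (\<lambda>x. x\<^sup>2)"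
  using integrable_std_normal_moment[of 1] integrable_std_normal_moment[of 2]
  by (auto simp: integrable_density)

lemma std_normal_moments: "(LINT x|std_normal. x) = 0" "(LINT x|std_normal. x\<^sup>2) = 1"
  using integral_std_normal_moment_odd[of 0] integral_std_normal_moment_even[of 1]
  by (auto simp: integral_density fact_numeral)

definition gauss_dens :: "nat \<Rightarrow> rseq \<Rightarrow> real" where
  "gauss_dens d x = exp (- (norm x)\<^sup>2 / 2) / sqrt (2 * pi) ^ d"

definition gaussian :: "(nat \<Rightarrow> rseq) \<Rightarrow> nat \<Rightarrow> rseq measure" where
  "gaussian w d = distr (gauss_coord d) borel (lin_comb w d)"

lemma gauss_dens_pos [simp]: "gauss_dens d x > 0"
  by (simp add: gauss_dens_def)

lemma measurable_gauss_dens [measurable]: "gauss_dens d \<in> borel_measurable borel"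
  unfolding gauss_dens_def by measurable

lemma sets_gaussian [simp, measurable_cong]: "sets (gaussian w d) = sets borel"
  and space_gaussian [simp]: "space (gaussian w d) = UNIV"
  by (simp_all add: gaussian_def)

lemma sets_gauss_coord: "sets (gauss_coord d) = sets (coord_lborel d)"
  by (rule sets_PiM_cong) auto

lemma measurable_lin_comb_gauss [measurable]: "lin_comb w d \<in> borel_measurable (gauss_coord d)"
  for w :: "nat \<Rightarrow> rseq"
  using measurable_lin_comb measurable_cong_sets[OF sets_gauss_coord refl] by blast

lemma prob_space_gaussian: "prob_space (gaussian w d)"
  unfolding gaussian_def by (rule prob_space.prob_space_distr[OF prob_space_gauss_coord]) simp

lemma gauss_dens_onb:
  assumes "orthonormal_basis E d b"
  shows "gauss_dens d (lin_comb b d t) = (\<Prod>i<d. std_normal_density (t i))"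
proof -
  have "(\<Prod>i<d. std_normal_density (t i)) = (\<Prod>i<d. 1 / sqrt (2 * pi)) * (\<Prod>i<d. exp (- (t i)\<^sup>2 / 2))"
    unfolding std_normal_density_def by (rule prod.distrib)
  also have "(\<Prod>i<d. exp (- (t i)\<^sup>2 / 2)) = exp (\<Sum>i<d. - (t i)\<^sup>2 / 2)"
    by (simp add: exp_sum)
  also have "(\<Sum>i<d. - (t i)\<^sup>2 / 2) = - (norm (lin_comb b d t))\<^sup>2 / 2"
    unfolding onb_norm[OF assms] by (simp add: sum_negf sum_divide_distrib[symmetric])
  finally show ?thesis by (simp add: gauss_dens_def power_one_over)
qed

lemma gaussian_density:
  assumes "orthonormal_basis E d b"
  shows "gaussian b d = density (frame_measure b d) (\<lambda>x. ennreal (gauss_dens d x))"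
proof -
  have "gauss_coord d = density (coord_lborel d) (\<lambda>t. \<Prod>i<d. ennreal (std_normal_density (t i)))"
    by (rule PiM_density_lborel[OF _ prob_space_std_normal]) measurable
  also have "(\<lambda>t. \<Prod>i<d. ennreal (std_normal_density (t i))) = (\<lambda>t. ennreal (gauss_dens d (lin_comb b d t)))"
    by (simp add: gauss_dens_onb[OF assms] prod_ennreal)
  finally have "gauss_coord d = density (coord_lborel d) (\<lambda>t. ennreal (gauss_dens d (lin_comb b d t)))" .
  then have "gaussian b d = distr (density (coord_lborel d) (\<lambda>t. ennreal (gauss_dens d (lin_comb b d t)))) borel (lin_comb b d)"
    by (simp add: gaussian_def)
  also have "\<dots> = density (distr (coord_lborel d) borel (lin_comb b d)) (\<lambda>x. ennreal (gauss_dens d x))"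
    by (rule density_distr[symmetric]) measurable
  finally show ?thesis by (simp add: frame_measure_def)
qed

text \<open>Rotation invariance: \<open>gauss_dens\<close> depends on the norm alone, and Lebesgue
  measure is the same for both bases.\<close>

lemma gaussian_onb:
  assumes "orthonormal_basis E d b" "orthonormal_basis E d b'"
  shows "gaussian b d = gaussian b' d"
  by (simp add: gaussian_density[OF assms(1)] gaussian_density[OF assms(2)] frame_measure_onb[OF assms])

lemma nn_integral_gaussian:
  "f \<in> borel_measurable borel \<Longrightarrow>
    (\<integral>\<^sup>+x. f x \<partial>gaussian w d) = (\<integral>\<^sup>+t. f (lin_comb w d t) \<partial>gauss_coord d)"
  unfolding gaussian_def by (rule nn_integral_distr) auto

lemma measurable_orth_proj:
  assumes "orthonormal_basis E d b"
  shows "orth_proj E \<in> borel_measurable borel"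
proof -
  have "orth_proj E = (\<lambda>x. lin_comb b d (\<lambda>i. x \<bullet> b i))"
    using orth_proj_onb[OF assms] by auto
  also have "\<dots> \<in> borel_measurable borel" unfolding lin_comb_def by measurable
  finally show ?thesis .
qed

text \<open>In a basis of n-space that begins with \<open>b\<close>, projecting onto
  \<open>E\<close> keeps the first \<open>d\<close> coordinates, and these are again independent
  standard normals.\<close>

lemma orth_proj_gaussian:
  assumes b: "orthonormal_basis E d b" and E: "E \<subseteq> euclid n" and e: "orthonormal_basis (euclid n) n e"
  shows "distr (gaussian e n) borel (orth_proj E) = gaussian b d"
proof -
  obtain b' where b': "orthonormal_basis (euclid n) n b'" "\<And>i. i < d \<Longrightarrow> b' i = b i"
    using onb_extend[OF b E] by blast
  have "card (b ` {..<d}) \<le> n"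
  proof -
    have "d = dim E" using dual_frame_dim[OF onb_dual_frame[OF b]] by simp
    also have "\<dots> \<le> card (unit_vec ` {..<n})"
      using E dual_frame_span[OF onb_dual_frame[OF onb_euclid[of n]]] by (intro dim_le_card) auto
    also have "\<dots> \<le> n" using card_image_le[of "{..<n}" unit_vec] by simp
    finally show ?thesis using card_image_le[of "{..<d}" b] by simp
  qed
  then have dn: "d \<le> n" using card_image[OF dual_frame_inj[OF onb_dual_frame[OF b]]] by simp
  interpret PP: product_prob_space "\<lambda>_::nat. std_normal" by (rule product_prob_space_std_normal)
  have "distr (gaussian e n) borel (orth_proj E) = distr (gaussian b' n) borel (orth_proj E)"
    by (simp add: gaussian_onb[OF e b'(1)])
  also have "\<dots> = distr (gauss_coord n) borel (orth_proj E \<circ> lin_comb b' n)"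
    unfolding gaussian_def by (rule distr_distr) (auto intro: measurable_orth_proj[OF b])
  also have "orth_proj E \<circ> lin_comb b' n = lin_comb b d \<circ> (\<lambda>t. restrict t {..<d})"
  proof
    fix t
    have "lin_comb b d (\<lambda>i. lin_comb b' n t \<bullet> b i) = lin_comb b d (restrict t {..<d})"
      using dual_frame_coeff[OF onb_dual_frame[OF b'(1)], of _ t] b'(2) dn
      by (intro lin_comb_cong) (metis order_less_le_trans restrict_apply' lessThan_iff)
    then show "(orth_proj E \<circ> lin_comb b' n) t = (lin_comb b d \<circ> (\<lambda>t. restrict t {..<d})) t"
      by (simp add: orth_proj_onb[OF b])
  qed
  also have "distr (gauss_coord n) borel (lin_comb b d \<circ> (\<lambda>t. restrict t {..<d}))
      = distr (distr (gauss_coord n) (gauss_coord d) (\<lambda>t. restrict t {..<d})) borel (lin_comb b d)"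
    using dn by (intro distr_distr[symmetric] measurable_lin_comb_gauss measurable_restrict_subset) auto
  also have "distr (gauss_coord n) (gauss_coord d) (\<lambda>t. restrict t {..<d}) = gauss_coord d"
    using PP.distr_restrict[of "{..<d}" "{..<n}"] dn by simp
  finally show ?thesis by (simp add: gaussian_def)
qed

text \<open>Multiplying the normal density by \<open>exp (a x^2)\<close> gives \<sigma> times a
  normal density of deviation \<sigma>. Both Chernoff bounds for the norm use this, one with
  \<open>a > 0\<close> and one with \<open>a < 0\<close>.\<close>

lemma gaussian_mgf:
  assumes b: "orthonormal_basis E d b" and a: "a < 1 / 2"
  shows "(\<integral>\<^sup>+x. ennreal (exp (a * (norm x)\<^sup>2)) \<partial>gaussian b d) = ennreal ((1 / sqrt (1 - 2 * a)) ^ d)"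
proof -
  define \<sigma> where "\<sigma> = 1 / sqrt (1 - 2 * a)"
  have s: "\<sigma> > 0" "\<sigma>\<^sup>2 = 1 / (1 - 2 * a)" using a by (auto simp: \<sigma>_def power_divide)
  have one: "(\<integral>\<^sup>+x. ennreal (exp (a * x\<^sup>2)) \<partial>std_normal) = ennreal \<sigma>"
  proof -
    have "ennreal (std_normal_density x) * ennreal (exp (a * x\<^sup>2)) = ennreal \<sigma> * ennreal (normal_density 0 \<sigma> x)" for x
    proof -
      have "- x\<^sup>2 / 2 + a * x\<^sup>2 = - x\<^sup>2 / (2 * \<sigma>\<^sup>2)" using a by (simp add: s(2) field_simps)
      then have "exp (- x\<^sup>2 / 2) * exp (a * x\<^sup>2) = exp (- x\<^sup>2 / (2 * \<sigma>\<^sup>2))" by (simp add: exp_add[symmetric])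
      then have "std_normal_density x * exp (a * x\<^sup>2) = \<sigma> * normal_density 0 \<sigma> x"
        unfolding normal_density_def using s(1) by (simp add: real_sqrt_mult)
      then show ?thesis using s(1) by (simp add: ennreal_mult[symmetric])
    qed
    then have "(\<integral>\<^sup>+x. ennreal (exp (a * x\<^sup>2)) \<partial>std_normal) = ennreal \<sigma> * (\<integral>\<^sup>+x. ennreal (normal_density 0 \<sigma> x) \<partial>lborel)"
      by (simp add: nn_integral_density nn_integral_cmult)
    also have "(\<integral>\<^sup>+x. ennreal (normal_density 0 \<sigma> x) \<partial>lborel) = 1"
    proof -
      interpret D: prob_space "density lborel (\<lambda>x. ennreal (normal_density 0 \<sigma> x))"
        using s(1) by (rule prob_space_normal_density)
      show ?thesis using D.emeasure_space_1 by (simp add: emeasure_density)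
    qed
    finally show ?thesis by simp
  qed
  have "(\<integral>\<^sup>+x. ennreal (exp (a * (norm x)\<^sup>2)) \<partial>gaussian b d) = (\<integral>\<^sup>+t. (\<Prod>i<d. ennreal (exp (a * (t i)\<^sup>2))) \<partial>gauss_coord d)"
    by (subst nn_integral_gaussian) (auto simp: onb_norm[OF b] sum_distrib_left exp_sum prod_ennreal)
  also have "\<dots> = (\<Prod>i<d. \<integral>\<^sup>+x. ennreal (exp (a * x\<^sup>2)) \<partial>std_normal)"
    using product_prob_space_std_normal
    by (intro product_sigma_finite.product_nn_integral_prod) (auto simp: product_prob_space_def)
  also have "\<dots> = ennreal (\<sigma> ^ d)" using s(1) by (simp add: one ennreal_power)
  finally show ?thesis by (simp add: \<sigma>_def)
qed

text \<open>Arithmetic-geometric mean and Hadamard inequality in one, with the factor \<open>\<kappa>\<close> of the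
  volume change in place of a determinant; the substitute for convexity is \<open>exp u \<ge> 1 + u\<close>
  under the Gaussian integral.\<close>

lemma frame_am_gm_normalized:
  assumes c: "orthonormal_basis E d c" and r: "frame_measure r d = frame_measure c d"
  shows "real d \<le> (\<Sum>i<d. (norm (r i))\<^sup>2)"
proof -
  interpret G: prob_space "gauss_coord d" by (rule prob_space_gauss_coord)
  \<comment> \<open>The logarithm of the quotient of the Gaussian densities in the frames
    \<open>r\<close> and \<open>c\<close>. Hence \<open>exp u\<close> integrates to the total mass
    of a Gaussian under \<open>frame_measure r d\<close>, which is 1 because the two frame measures
    agree.\<close>
  define u where "u = (\<lambda>t. ((norm (lin_comb c d t))\<^sup>2 - (norm (lin_comb r d t))\<^sup>2) / 2)"
  note pl = product_norm_lin_comb[OF prob_space_std_normal _ std_normal_integrable, where d = d, simplified std_normal_moments]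
  have nc: "norm (c i) = 1" if "i < d" for i
    using c that by (auto simp: orthonormal_basis_def norm_eq_1)
  have iu: "integrable (gauss_coord d) u" unfolding u_def
    by (intro Bochner_Integration.integrable_diff integrable_divide_zero impI pl(1)) auto
  have "(LINT t|gauss_coord d. u t) = (real d - (\<Sum>i<d. (norm (r i))\<^sup>2)) / 2"
    unfolding u_def by (simp add: pl nc)
  moreover have um [measurable]: "u \<in> borel_measurable (gauss_coord d)" using iu by auto
  have "(\<integral>\<^sup>+t. ennreal (exp (u t)) \<partial>gauss_coord d) = 1"
  proof -
    have "gauss_coord d = density (coord_lborel d) (\<lambda>t. \<Prod>i<d. ennreal (std_normal_density (t i)))"
      by (rule PiM_density_lborel[OF _ prob_space_std_normal]) measurable
    also have "(\<lambda>t. \<Prod>i<d. ennreal (std_normal_density (t i))) = (\<lambda>t. ennreal (gauss_dens d (lin_comb c d t)))"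
      by (simp add: gauss_dens_onb[OF c] prod_ennreal)
    finally have G: "gauss_coord d = density (coord_lborel d) (\<lambda>t. ennreal (gauss_dens d (lin_comb c d t)))" .
    have "(\<integral>\<^sup>+t. ennreal (exp (u t)) \<partial>gauss_coord d) = (\<integral>\<^sup>+t. ennreal (gauss_dens d (lin_comb c d t)) * ennreal (exp (u t)) \<partial>coord_lborel d)"
      unfolding G by (rule nn_integral_density) (auto simp: u_def)
    also have "\<dots> = (\<integral>\<^sup>+t. ennreal (gauss_dens d (lin_comb r d t)) \<partial>coord_lborel d)"
    proof (rule nn_integral_cong)
      fix t
      have "gauss_dens d (lin_comb c d t) * exp (u t) = gauss_dens d (lin_comb r d t)"
        unfolding gauss_dens_def u_def by (simp add: exp_add[symmetric] field_simps)
      then show "ennreal (gauss_dens d (lin_comb c d t)) * ennreal (exp (u t)) = ennreal (gauss_dens d (lin_comb r d t))"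
        by (simp add: ennreal_mult[symmetric] less_imp_le)
    qed
    also have "\<dots> = (\<integral>\<^sup>+x. ennreal (gauss_dens d x) \<partial>frame_measure r d)"
      by (rule nn_integral_frame[symmetric]) measurable
    also have "\<dots> = emeasure (gaussian c d) UNIV"
      unfolding r gaussian_density[OF c] by (simp add: emeasure_density)
    also have "\<dots> = 1" using prob_space.emeasure_space_1[OF prob_space_gaussian, of c d] by simp
    finally show ?thesis .
  qed
  then have "integrable (gauss_coord d) (\<lambda>t. exp (u t))" "(LINT t|gauss_coord d. exp (u t)) = 1"
    by (auto intro!: integrableI_nonneg integral_eq_nn_integral[THEN trans])
  \<comment> \<open>Since \<open>exp u\<close> has integral 1, the mean of \<open>u\<close>, half of
    \<open>d\<close> minus the sum of squares, is at most 0.\<close>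
  moreover have "(LINT t|gauss_coord d. 1 + u t) \<le> (LINT t|gauss_coord d. exp (u t))"
    using iu calculation(2) by (intro integral_mono) auto
  ultimately show ?thesis using iu by (simp add: G.prob_space)
qed

text \<open>\<kappa> is the inverse determinant of \<open>r\<close>, so the mean of
  \<open>(norm (r i))^2\<close> is at least the determinant to the power \<open>2 / d\<close>.
  Stretching by \<kappa>\<open>^(1/d)\<close> reduces this to determinant 1.\<close>

lemma frame_am_gm:
  assumes c: "orthonormal_basis E d c" and d: "d > 0" and k: "\<kappa> > 0"
    and df: "dual_frame E d r v"
    and r: "frame_measure r d = scale_measure (ennreal \<kappa>) (frame_measure c d)"
  shows "real d \<le> \<kappa> powr (2 / d) * (\<Sum>i<d. (norm (r i))\<^sup>2)"
proof -
  define s where "s = \<kappa> powr (1 / d)"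
  have s: "s > 0" "s ^ d = \<kappa>" using k d
    by (auto simp: s_def powr_realpow[symmetric] powr_powr)
  have "frame_measure (\<lambda>i. s *\<^sub>R r i) d = frame_measure c d"
    unfolding frame_measure_scaleR[OF df s(1)] r using s k by (simp add: ennreal_mult[symmetric])
  from frame_am_gm_normalized[OF c this] have "real d \<le> s\<^sup>2 * (\<Sum>i<d. (norm (r i))\<^sup>2)"
    by (simp add: power_mult_distrib sum_distrib_left)
  also have "s\<^sup>2 = \<kappa> powr (2 / d)"
    by (simp add: s_def power2_eq_square powr_add[symmetric])
  finally show ?thesis .
qed

text \<open>By counting, \<open>d\<close> independent vectors span \<open>E\<close>. With
  \<open>g\<close> the linear map taking \<open>r i\<close> to \<open>c i\<close>, the dual vector
  \<open>v i\<close> represents the functional \<open>x \<mapsto> g x \<bullet> c i\<close> on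
  \<open>E\<close>.\<close>

lemma dual_frame_exists:
  assumes c: "orthonormal_basis E d c" and r: "\<And>i. i < d \<Longrightarrow> r i \<in> E"
    and indep: "\<And>t i. lin_comb r d t = 0 \<Longrightarrow> i < d \<Longrightarrow> t i = 0"
  shows "\<exists>v. dual_frame E d r v"
proof -
  note dc = onb_dual_frame[OF c]
  have sE: "subspace E" by (rule dual_frame_subspace[OF dc])
  have inj: "inj_on r {..<d}"
  proof (rule inj_onI, rule ccontr)
    fix i j assume ij: "i \<in> {..<d}" "j \<in> {..<d}" "r i = r j" "i \<noteq> j"
    define t where "t = (\<lambda>k. if k = i then 1 else if k = j then - 1 else 0 :: real)"
    have "lin_comb r d t = (\<Sum>k<d. (if k = i then r i else 0) - (if k = j then r j else 0))"
      unfolding lin_comb_def using ij by (intro sum.cong) (auto simp: t_def)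
    also have "\<dots> = 0" using ij by (simp add: sum_subtractf)
    finally have "t i = 0" using indep[of t i] ij by simp
    then show False by (simp add: t_def)
  qed
  have ind: "independent (r ` {..<d})"
  proof (rule independent_if_scalars_zero)
    fix f x assume f: "(\<Sum>x\<in>r ` {..<d}. f x *\<^sub>R x) = 0" and "x \<in> r ` {..<d}"
    then obtain i where i: "i < d" "x = r i" by auto
    have "lin_comb r d (f \<circ> r) = 0" using f by (simp add: lin_comb_def sum.reindex[OF inj])
    then show "f x = 0" using indep[of "f \<circ> r" i] i by simp
  qed simp
  have span: "E \<subseteq> span (r ` {..<d})"
  proof (rule ccontr)
    assume "\<not> E \<subseteq> span (r ` {..<d})"
    then obtain x where x: "x \<in> E" "x \<notin> span (r ` {..<d})" by auto
    have "independent (insert x (r ` {..<d}))" using ind x by (simp add: independent_insertI)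
    moreover have "insert x (r ` {..<d}) \<subseteq> span (c ` {..<d})"
      using dual_frame_span[OF dc] x r by auto
    ultimately have "card (insert x (r ` {..<d})) \<le> card (c ` {..<d})"
      using independent_span_bound[of "c ` {..<d}" "insert x (r ` {..<d})"] by simp
    moreover have "card (insert x (r ` {..<d})) = Suc d"
      using x card_image[OF inj] span_base[of x "r ` {..<d}"] by (subst card_insert_disjoint) auto
    moreover have "card (c ` {..<d}) \<le> d" using card_image_le[of "{..<d}" c] by simp
    ultimately show False by simp
  qed
  obtain g where g: "linear g" "\<And>x. x \<in> r ` {..<d} \<Longrightarrow> g x = c (inv_into {..<d} r x)"
    using linear_independent_extend[OF ind, of "\<lambda>x. c (inv_into {..<d} r x)"] by blast
  have gr: "g (r i) = c i" if "i < d" for i using g(2)[of "r i"] that inv_into_f_f[OF inj, of i] by simp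
  define v where "v = (\<lambda>i. lin_comb c d (\<lambda>j. g (c j) \<bullet> c i))"
  have v: "x \<bullet> v i = g x \<bullet> c i" if "x \<in> E" for x i
  proof -
    have "x \<bullet> v i = (\<Sum>j<d. (x \<bullet> c j) * (g (c j) \<bullet> c i))"
      by (simp add: v_def lin_comb_def inner_sum_right mult.commute)
    also have "\<dots> = g (lin_comb c d (\<lambda>j. x \<bullet> c j)) \<bullet> c i"
      by (simp add: linear_lin_comb[OF g(1)]) (simp add: lin_comb_def inner_sum_left)
    finally show ?thesis using dual_frame_expand[OF dc that] by simp
  qed
  have cc: "c i \<bullet> c j = (if i = j then 1 else 0)" if "i < d" "j < d" for i j
    using dc that by (auto simp: dual_frame_def)
  have coef: "lin_comb r d t \<bullet> v j = t j" if "j < d" for t j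
    using that v[OF lin_comb_mem[OF sE r]] dual_frame_coeff[OF dc that, of t]
    by (simp add: linear_lin_comb[OF g(1)]) (simp add: lin_comb_def gr)
  have "lin_comb r d (\<lambda>i. x \<bullet> v i) = x" if "x \<in> E" for x
  proof -
    have "\<exists>t. x = lin_comb r d t"
    proof -
      have "x \<in> span (r ` {..<d})" using that span by auto
      then obtain u where "x = (\<Sum>y\<in>r ` {..<d}. u y *\<^sub>R y)"
        by (auto simp: span_finite)
      then have "x = lin_comb r d (u \<circ> r)" by (simp add: lin_comb_def sum.reindex[OF inj])
      then show ?thesis by blast
    qed
    then obtain t where t: "x = lin_comb r d t" by blast
    show ?thesis unfolding t by (rule lin_comb_cong) (rule coef)
  qed
  moreover have "r i \<bullet> v j = (if i = j then 1 else 0)" if "i < d" "j < d" for i j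
    using that v[OF r] gr cc by simp
  moreover have "v i \<in> E" for i unfolding v_def by (rule dual_frame_mem[OF dc])
  ultimately have "dual_frame E d r v" using r sE by (auto simp: dual_frame_def)
  then show ?thesis by blast
qed

section \<open>Affine images of convex bodies\<close>

text \<open>For an orthonormal \<open>b\<close>, the linear map with
  \<open>b i \<mapsto> r i\<close> that vanishes on the orthogonal complement; being defined on the
  whole space it is continuous and measurable there.\<close>

definition frame_map :: "(nat \<Rightarrow> rseq) \<Rightarrow> nat \<Rightarrow> (nat \<Rightarrow> rseq) \<Rightarrow> rseq \<Rightarrow> rseq" where
  "frame_map b d r x = lin_comb r d (\<lambda>i. x \<bullet> b i)"

lemma continuous_frame_map [continuous_intros]:
  "continuous_on A f \<Longrightarrow> continuous_on A (\<lambda>x. frame_map b d r (f x))"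
  unfolding frame_map_def lin_comb_def by (intro continuous_intros)

lemma measurable_frame_map [measurable]: "frame_map b d r \<in> borel_measurable borel"
  unfolding frame_map_def lin_comb_def by measurable

lemma linear_frame_map: "linear (frame_map b d r)"
  by (rule linearI) (simp_all add: frame_map_def inner_add_left lin_comb_add[symmetric] lin_comb_scale[symmetric])

lemma frame_map_inj:
  assumes b: "orthonormal_basis E d b" and r: "dual_frame F d r v"
    and "x \<in> E" "y \<in> E" "frame_map b d r x = frame_map b d r y"
  shows "x = y"
proof -
  have "x \<bullet> b i = y \<bullet> b i" if "i < d" for i
    using dual_frame_coeff[OF r that] assms(5) unfolding frame_map_def by metis
  then have "lin_comb b d (\<lambda>i. x \<bullet> b i) = lin_comb b d (\<lambda>i. y \<bullet> b i)" by (rule lin_comb_cong)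
  then show ?thesis using dual_frame_expand[OF onb_dual_frame[OF b]] assms(3,4) by simp
qed

lemma scale_measure_density: "scale_measure k M = density M (\<lambda>_. k)"
  by (rule measure_eqI) (auto simp: emeasure_density_const)

lemma integral_scale_measure:
  fixes f :: "'a \<Rightarrow> real"
  assumes "f \<in> borel_measurable M" "k \<ge> 0"
  shows "(LINT x|scale_measure (ennreal k) M. f x) = k * (LINT x|M. f x)"
  unfolding scale_measure_density using assms by (subst integral_density) auto

text \<open>Change of variables without a Jacobian: the determinant of the map is already contained
  in the measure of the frame \<open>r\<close>.\<close>

lemma frame_distr_affine:
  assumes b: "orthonormal_basis E d b" and r: "dual_frame F d r v" and "\<eta> \<in> F"
  shows "distr (frame_measure b d) borel (\<lambda>x. \<eta> + frame_map b d r x) = frame_measure r d"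
proof -
  have "distr (frame_measure b d) borel (\<lambda>x. \<eta> + frame_map b d r x)
      = distr (coord_lborel d) borel ((\<lambda>x. \<eta> + frame_map b d r x) \<circ> lin_comb b d)"
    unfolding frame_measure_def by (rule distr_distr) auto
  also have "(\<lambda>x. \<eta> + frame_map b d r x) \<circ> lin_comb b d = (\<lambda>x. x + \<eta>) \<circ> lin_comb r d"
  proof
    fix t
    have "frame_map b d r (lin_comb b d t) = lin_comb r d t"
      unfolding frame_map_def using dual_frame_coeff[OF onb_dual_frame[OF b]] by (intro lin_comb_cong)
    then show "((\<lambda>x. \<eta> + frame_map b d r x) \<circ> lin_comb b d) t = ((\<lambda>x. x + \<eta>) \<circ> lin_comb r d) t"
      by simp
  qed
  also have "distr (coord_lborel d) borel ((\<lambda>x. x + \<eta>) \<circ> lin_comb r d) = distr (frame_measure r d) borel (\<lambda>x. x + \<eta>)"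
    unfolding frame_measure_def by (rule distr_distr[symmetric]) auto
  also have "\<dots> = frame_measure r d" by (rule frame_translate[OF r assms(3)])
  finally show ?thesis .
qed

lemma indicator_affine_image:
  assumes b: "orthonormal_basis E d b" and r: "dual_frame F d r v" and "K \<subseteq> E" "x \<in> E"
  shows "indicator ((\<lambda>x. \<eta> + frame_map b d r x) ` K) (\<eta> + frame_map b d r x) = indicator K x"
  using frame_map_inj[OF b r] assms(3,4) by (auto simp: indicator_def image_iff)

lemma integral_affine_image:
  fixes f :: "rseq \<Rightarrow> real"
  assumes b: "orthonormal_basis E d b" and r: "dual_frame F d r v" and \<eta>: "\<eta> \<in> F"
    and K: "K \<subseteq> E" "compact K" and f [measurable]: "f \<in> borel_measurable borel"
  shows "(LINT y|frame_measure r d. indicator ((\<lambda>x. \<eta> + frame_map b d r x) ` K) y * f y)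
     = (LINT x|frame_measure b d. indicator K x * f (\<eta> + frame_map b d r x))"
proof -
  let ?A = "\<lambda>x. \<eta> + frame_map b d r x"
  have "compact (?A ` K)" by (intro compact_continuous_image continuous_intros K)
  then have [measurable]: "?A ` K \<in> sets borel" "K \<in> sets borel" using K by (simp_all add: borel_compact)
  have "(LINT y|frame_measure r d. indicator (?A ` K) y * f y)
      = (LINT y|distr (frame_measure b d) borel ?A. indicator (?A ` K) y * f y)"
    by (simp add: frame_distr_affine[OF b r \<eta>])
  also have "\<dots> = (LINT x|frame_measure b d. indicator (?A ` K) (?A x) * f (?A x))"
    by (subst integral_distr) auto
  also have "\<dots> = (LINT x|frame_measure b d. indicator K x * f (?A x))"
    using AE_frame[OF onb_dual_frame[OF b]]
    by (intro integral_cong_AE, measurable, eventually_elim) (simp add: indicator_affine_image[OF b r K(1)])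
  finally show ?thesis .
qed

lemma integrable_compact:
  fixes f :: "rseq \<Rightarrow> real"
  assumes b: "dual_frame E d b v" and K: "compact K" and f: "continuous_on UNIV f"
  shows "integrable (frame_measure b d) (\<lambda>x. indicator K x * f x)"
proof -
  have "bounded (f ` K)"
    by (intro compact_imp_bounded compact_continuous_image continuous_on_subset[OF f] K) auto
  then obtain B where "\<And>x. x \<in> K \<Longrightarrow> norm (f x) \<le> B" by (auto simp: bounded_iff)
  then show ?thesis
    using integrableI_bounded_set_indicator[of K "frame_measure b d" f B] K
      frame_bounded_finite[OF b compact_imp_bounded[OF K]] borel_measurable_continuous_onI[OF f]
    by (simp add: borel_compact)
qed

lemma convex_body_ball:
  assumes "convex_body E K"
  shows "\<exists>z r. r > 0 \<and> z \<in> E \<and> ball z r \<inter> E \<subseteq> K"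
proof -
  obtain z T where T: "openin (top_of_set E) T" "z \<in> T" "T \<subseteq> K"
    using assms by (auto simp: convex_body_def interior_of_def)
  then obtain U where U: "open U" "T = E \<inter> U" by (auto simp: openin_open)
  then obtain r where "r > 0" "ball z r \<subseteq> U" using T by (meson IntD2 openE)
  then show ?thesis using T U by blast
qed

lemma convex_bodyI_ball:
  assumes "K \<subseteq> E" "compact K" "convex K" "r > 0" "z \<in> E" "ball z r \<inter> E \<subseteq> K"
  shows "convex_body E K"
proof -
  have "openin (top_of_set E) (E \<inter> ball z r)" by (auto simp: openin_open)
  then have "z \<in> (top_of_set E) interior_of K"
    unfolding interior_of_def using assms by (auto intro!: exI[of _ "E \<inter> ball z r"])
  then show ?thesis using assms by (auto simp: convex_body_def)
qed

lemma convex_body_vol: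
  assumes b: "dual_frame E d b v" and K: "convex_body E K"
  shows "emeasure (frame_measure b d) K = ennreal (measure (frame_measure b d) K)"
    and "measure (frame_measure b d) K > 0"
proof -
  obtain z r where zr: "r > 0" "z \<in> E" "ball z r \<inter> E \<subseteq> K" using convex_body_ball[OF K] by blast
  have cK: "compact K" using K by (simp add: convex_body_def)
  have "0 < emeasure (frame_measure b d) (ball z r)" by (rule frame_ball_pos[OF b zr(2,1)])
  also have "\<dots> \<le> emeasure (frame_measure b d) K"
    using AE_frame[OF b] zr(3) cK
    by (intro emeasure_mono_AE) (auto elim!: eventually_mono simp: borel_compact)
  finally show "emeasure (frame_measure b d) K = ennreal (measure (frame_measure b d) K)"
    and "measure (frame_measure b d) K > 0"
    using emeasure_pos_finite_measure[of "frame_measure b d" K]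
      frame_bounded_finite[OF b compact_imp_bounded[OF cK]] by auto
qed

lemma convex_body_affine_image:
  assumes b: "orthonormal_basis E d b" and r: "dual_frame F d r v" and \<eta>: "\<eta> \<in> F"
    and K: "convex_body E K"
  shows "convex_body F ((\<lambda>x. \<eta> + frame_map b d r x) ` K)"
proof -
  let ?A = "\<lambda>x. \<eta> + frame_map b d r x"
  note db = onb_dual_frame[OF b]
  have sF: "subspace F" by (rule dual_frame_subspace[OF r])
  have mF: "?A x \<in> F" for x
    unfolding frame_map_def by (intro subspace_add[OF sF] \<eta> dual_frame_mem[OF r])
  obtain z \<rho> where z: "\<rho> > 0" "z \<in> E" "ball z \<rho> \<inter> E \<subseteq> K" using convex_body_ball[OF K] by blast
  \<comment> \<open>The inverse map sends \<open>u\<close> to the combination of the unit vectors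
    \<open>b i\<close> with coefficients \<open>u \<bullet> v i\<close>, so \<open>C\<close> bounds
    its norm and \<open>\<rho> / C\<close> is a safe radius for the image.\<close>
  define C where "C = 1 + (\<Sum>i<d. norm (v i))"
  have C: "C > 0" by (auto simp: C_def intro!: add_pos_nonneg sum_nonneg)
  have "ball (?A z) (\<rho> / C) \<inter> F \<subseteq> ?A ` K"
  proof
    fix y assume y: "y \<in> ball (?A z) (\<rho> / C) \<inter> F"
    define u where "u = y - ?A z"
    have u: "u \<in> F" "norm u < \<rho> / C"
      using y mF[of z] sF by (auto simp: u_def subspace_diff dist_norm norm_minus_commute)
    define x where "x = z + lin_comb b d (\<lambda>i. u \<bullet> v i)"
    have "frame_map b d r (lin_comb b d (\<lambda>i. u \<bullet> v i)) = lin_comb r d (\<lambda>i. u \<bullet> v i)"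
      unfolding frame_map_def using dual_frame_coeff[OF db] by (intro lin_comb_cong)
    then have "frame_map b d r x = frame_map b d r z + u"
      by (simp add: x_def linear_add[OF linear_frame_map] dual_frame_expand[OF r u(1)])
    then have "?A x = y" by (simp add: u_def)
    moreover have "x \<in> E" using z(2) dual_frame_subspace[OF db] dual_frame_mem[OF db]
      by (simp add: x_def subspace_add)
    moreover have "norm (x - z) < \<rho>"
    proof -
      have "norm (x - z) \<le> (\<Sum>i<d. norm ((u \<bullet> v i) *\<^sub>R b i))"
        unfolding x_def lin_comb_def add_diff_cancel_left' by (rule norm_sum)
      also have "\<dots> \<le> (\<Sum>i<d. norm u * norm (v i))"
      proof (rule sum_mono)
        fix i assume "i \<in> {..<d}"
        then have "norm (b i) = 1" using b by (auto simp: orthonormal_basis_def norm_eq_1)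
        then show "norm ((u \<bullet> v i) *\<^sub>R b i) \<le> norm u * norm (v i)" by (simp add: Cauchy_Schwarz_ineq2)
      qed
      also have "\<dots> \<le> norm u * C"
        by (auto simp: C_def sum_distrib_left[symmetric] intro!: mult_left_mono)
      also have "\<dots> < \<rho>" using u(2) C by (simp add: pos_less_divide_eq)
      finally show ?thesis .
    qed
    moreover from calculation have "x \<in> K" using z(3) by (auto simp: dist_norm norm_minus_commute)
    ultimately show "y \<in> ?A ` K" by blast
  qed
  moreover have "compact (?A ` K)" using K
    by (intro compact_continuous_image continuous_intros) (auto simp: convex_body_def)
  moreover have "convex (?A ` K)"
    using K convex_translation[OF convex_linear_image[OF linear_frame_map], of K \<eta>]
    by (auto simp: convex_body_def image_image)
  ultimately show ?thesis
    using z(1) C mF by (intro convex_bodyI_ball[of _ _ "\<rho> / C" "?A z"]) auto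
qed

section \<open>The isotropy constant\<close>

lemma isotropic_moments:
  assumes b: "orthonormal_basis E d b" and iso: "isotropic_body E K L" and i: "i < d"
  shows "(LINT x|frame_measure b d. indicator K x * (x \<bullet> b i)) = 0"
    and "j < d \<Longrightarrow> (LINT x|frame_measure b d. indicator K x * ((x \<bullet> b i) * (x \<bullet> b j))) = (if i = j then L\<^sup>2 else 0)"
proof -
  note db = onb_dual_frame[OF b]
  have cb: "convex_body E K" and bary: "has_barycenter E K 0"
    and mom: "\<And>\<theta>. \<theta> \<in> E \<Longrightarrow> norm \<theta> = 1 \<Longrightarrow> (LINT x:K|subspace_lborel E. (x \<bullet> \<theta>)\<^sup>2) = L\<^sup>2"
    and m1: "measure (subspace_lborel E) K = 1"
    using iso by (auto simp: isotropic_body_def)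
  have cK: "compact K" and KE: "K \<subseteq> E" using cb by (auto simp: convex_body_def)
  have bK [measurable]: "K \<in> sets borel" using cK by (rule borel_compact)
  have bE: "b i \<in> E" if "i < d" for i using db that by (auto simp: dual_frame_def)
  have bb: "b i \<bullet> b j = (if i = j then 1 else 0)" if "i < d" "j < d" for i j
    using db that by (auto simp: dual_frame_def)
  have "(LINT x:K|subspace_lborel E. x \<bullet> b i) = 0"
    using bary bE[OF i] m1 by (auto simp: has_barycenter_def)
  then show "(LINT x|frame_measure b d. indicator K x * (x \<bullet> b i)) = 0"
    by (subst (asm) integral_subspace_lborel[OF b bK]) (auto simp: set_lebesgue_integral_def)
  have sq: "(LINT x|frame_measure b d. indicator K x * (x \<bullet> \<theta>)\<^sup>2) = L\<^sup>2" if "\<theta> \<in> E" "norm \<theta> = 1" for \<theta>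
    using mom[OF that] by (subst (asm) integral_subspace_lborel[OF b bK]) (auto simp: set_lebesgue_integral_def)
  have int: "integrable (frame_measure b d) (\<lambda>x. indicator K x * ((x \<bullet> b i) * (x \<bullet> b j)))" for i j
    by (intro integrable_compact[OF db cK] continuous_intros)
  show "(LINT x|frame_measure b d. indicator K x * ((x \<bullet> b i) * (x \<bullet> b j))) = (if i = j then L\<^sup>2 else 0)" if j: "j < d"
  proof (cases "i = j")
    case True
    then show ?thesis using sq[OF bE[OF i]] bb[OF i i] by (simp add: norm_eq_1 power2_eq_square)
  next
    case False
    \<comment> \<open>Polarization: testing isotropy in the direction between \<open>b i\<close> and
      \<open>b j\<close> forces the mixed moment to vanish.\<close>
    define \<theta> where "\<theta> = (1 / sqrt 2) *\<^sub>R (b i + b j)"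
    have "\<theta> \<in> E" unfolding \<theta>_def
      by (intro subspace_scale subspace_add dual_frame_subspace[OF db] bE i j)
    moreover have "norm \<theta> = 1"
      using bb i j False unfolding norm_eq_1 \<theta>_def by (simp add: inner_add_left inner_add_right)
    ultimately have "L\<^sup>2 = (LINT x|frame_measure b d. indicator K x * (x \<bullet> \<theta>)\<^sup>2)" using sq by simp
    also have "\<dots> = (LINT x|frame_measure b d. (1/2) * (indicator K x * ((x \<bullet> b i) * (x \<bullet> b i)))
        + ((1/2) * (indicator K x * ((x \<bullet> b j) * (x \<bullet> b j))) + indicator K x * ((x \<bullet> b i) * (x \<bullet> b j))))"
      by (intro Bochner_Integration.integral_cong refl)
        (simp add: \<theta>_def inner_add_right power2_eq_square algebra_simps add_divide_distrib)
    also have "\<dots> = (1/2) * L\<^sup>2 + ((1/2) * L\<^sup>2 + (LINT x|frame_measure b d. indicator K x * ((x \<bullet> b i) * (x \<bullet> b j))))"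
      using sq[OF bE[OF i]] sq[OF bE[OF j]] bb[OF i i] bb[OF j j] int
      by (simp add: norm_eq_1 power2_eq_square)
    finally show ?thesis using False by simp
  qed
qed

text \<open>Over an isotropic body the mean of \<open>(norm (\<eta> + frame_map b d r x))^2\<close>
  is \<open>(norm \<eta>)^2 + L^2 * \<Sum> (norm (r i))^2\<close>, and \<open>frame_am_gm\<close>
  bounds the sum by the volume of the image. The exponent \<open>1 + 2 / d\<close> makes both sides
  scale alike.\<close>

lemma isotropic_key:
  assumes b: "orthonormal_basis E d b" and c: "orthonormal_basis F d c" and d: "d > 0"
    and r: "dual_frame F d r v" and \<eta>: "\<eta> \<in> F" and iso: "isotropic_body E K L"
    and Q: "Q = (\<lambda>x. \<eta> + frame_map b d r x) ` K"
  shows "real d * L\<^sup>2 * measure (frame_measure c d) Q powr (1 + 2 / d)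
      \<le> (LINT y|frame_measure c d. indicator Q y * (norm y)\<^sup>2)"
proof -
  note db = onb_dual_frame[OF b] and dc = onb_dual_frame[OF c]
  have cb: "convex_body E K" and m1: "measure (subspace_lborel E) K = 1" and L: "L > 0"
    using iso by (auto simp: isotropic_body_def)
  have cK: "compact K" and KE: "K \<subseteq> E" using cb by (auto simp: convex_body_def)
  have bK [measurable]: "K \<in> sets borel" using cK by (rule borel_compact)
  have volK: "measure (frame_measure b d) K = 1"
    using measure_subspace_lborel[OF b bK KE] m1 by simp
  obtain \<kappa> where k: "\<kappa> > 0" "frame_measure r d = scale_measure (ennreal \<kappa>) (frame_measure c d)"
    using frame_measure_scale[OF r dc] by blast
  have bQ [measurable]: "Q \<in> sets borel" unfolding Q
    by (intro borel_compact compact_continuous_image continuous_intros cK)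
  \<comment> \<open>\<open>K\<close> has volume 1, hence the factor \<kappa> is the inverse volume
    of \<open>Q\<close>.\<close>
  have volQ: "\<kappa> * measure (frame_measure c d) Q = 1"
  proof -
    have "\<kappa> * measure (frame_measure c d) Q = (LINT y|frame_measure r d. indicator Q y * 1)"
      unfolding k(2) using k(1) by (subst integral_scale_measure) auto
    also have "\<dots> = 1" unfolding Q
      by (subst integral_affine_image[OF b r \<eta> KE cK]) (auto simp: volK)
    finally show ?thesis .
  qed
  have "\<kappa> * (LINT y|frame_measure c d. indicator Q y * (norm y)\<^sup>2)
      = (LINT y|frame_measure r d. indicator Q y * (norm y)\<^sup>2)"
    unfolding k(2) using k(1) by (subst integral_scale_measure) auto
  also have "\<dots> = (LINT x|frame_measure b d. indicator K x * (norm (\<eta> + frame_map b d r x))\<^sup>2)"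
    unfolding Q by (subst integral_affine_image[OF b r \<eta> KE cK]) auto
  also have "\<dots> = (LINT x|frame_measure b d. indicator K x * (norm \<eta>)\<^sup>2
      + ((\<Sum>i<d. (2 * (\<eta> \<bullet> r i)) * (indicator K x * (x \<bullet> b i)))
      + (\<Sum>i<d. \<Sum>j<d. (r i \<bullet> r j) * (indicator K x * ((x \<bullet> b i) * (x \<bullet> b j))))))"
  proof (intro Bochner_Integration.integral_cong refl)
    fix x
    have "(norm (\<eta> + frame_map b d r x))\<^sup>2 = (norm \<eta>)\<^sup>2 + 2 * (\<eta> \<bullet> frame_map b d r x) + (norm (frame_map b d r x))\<^sup>2"
      by (simp add: power2_norm_eq_inner inner_add_left inner_add_right inner_commute)
    also have "2 * (\<eta> \<bullet> frame_map b d r x) = (\<Sum>i<d. (2 * (\<eta> \<bullet> r i)) * (x \<bullet> b i))"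
      by (simp add: frame_map_def lin_comb_def inner_sum_right sum_distrib_left mult_ac)
    also have "(norm (frame_map b d r x))\<^sup>2 = (\<Sum>i<d. \<Sum>j<d. (r i \<bullet> r j) * ((x \<bullet> b i) * (x \<bullet> b j)))"
      unfolding frame_map_def by (rule norm_lin_comb_sq)
    finally show "indicator K x * (norm (\<eta> + frame_map b d r x))\<^sup>2 = indicator K x * (norm \<eta>)\<^sup>2
      + ((\<Sum>i<d. (2 * (\<eta> \<bullet> r i)) * (indicator K x * (x \<bullet> b i)))
      + (\<Sum>i<d. \<Sum>j<d. (r i \<bullet> r j) * (indicator K x * ((x \<bullet> b i) * (x \<bullet> b j)))))"
      by (cases "x \<in> K") auto
  qed
  also have "\<dots> = (norm \<eta>)\<^sup>2 + L\<^sup>2 * (\<Sum>i<d. (norm (r i))\<^sup>2)"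
  proof -
    have i0: "integrable (frame_measure b d) (\<lambda>x. indicator K x * (norm \<eta>)\<^sup>2)"
      and i1: "\<And>i. integrable (frame_measure b d) (\<lambda>x. indicator K x * (x \<bullet> b i))"
      and i2: "\<And>i j. integrable (frame_measure b d) (\<lambda>x. indicator K x * ((x \<bullet> b i) * (x \<bullet> b j)))"
      by (intro integrable_compact[OF db cK] continuous_intros)+
    have I0: "(LINT x|frame_measure b d. indicator K x * (norm \<eta>)\<^sup>2) = (norm \<eta>)\<^sup>2"
      by (simp add: volK)
    have I1: "(LINT x|frame_measure b d. (\<Sum>i<d. (2 * (\<eta> \<bullet> r i)) * (indicator K x * (x \<bullet> b i)))) = 0"
      using i1 isotropic_moments(1)[OF b iso]
      by (subst Bochner_Integration.integral_sum) (auto intro!: sum.neutral)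
    have "(LINT x|frame_measure b d. (\<Sum>i<d. \<Sum>j<d. (r i \<bullet> r j) * (indicator K x * ((x \<bullet> b i) * (x \<bullet> b j)))))
      = (\<Sum>i<d. \<Sum>j<d. (r i \<bullet> r j) * (if i = j then L\<^sup>2 else 0))"
      using i2 isotropic_moments(2)[OF b iso]
      by (subst Bochner_Integration.integral_sum)
        (auto intro!: sum.cong Bochner_Integration.integrable_sum simp del: mult_if_delta)
    also have "\<dots> = L\<^sup>2 * (\<Sum>i<d. (norm (r i))\<^sup>2)"
      by (simp add: power2_norm_eq_inner sum_distrib_left mult_ac if_distrib cong: if_cong)
    finally have I2: "(LINT x|frame_measure b d. (\<Sum>i<d. \<Sum>j<d. (r i \<bullet> r j) * (indicator K x * ((x \<bullet> b i) * (x \<bullet> b j)))))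
      = L\<^sup>2 * (\<Sum>i<d. (norm (r i))\<^sup>2)" .
    have s1: "integrable (frame_measure b d) (\<lambda>x. \<Sum>i<d. (2 * (\<eta> \<bullet> r i)) * (indicator K x * (x \<bullet> b i)))"
      by (intro Bochner_Integration.integrable_sum integrable_mult_right i1)
    have s2: "integrable (frame_measure b d) (\<lambda>x. \<Sum>i<d. \<Sum>j<d. (r i \<bullet> r j) * (indicator K x * ((x \<bullet> b i) * (x \<bullet> b j))))"
      by (intro Bochner_Integration.integrable_sum integrable_mult_right i2)
    show ?thesis
      by (subst Bochner_Integration.integral_add[OF i0 Bochner_Integration.integrable_add[OF s1 s2]],
          subst Bochner_Integration.integral_add[OF s1 s2], unfold I0 I1 I2) simp
  qed
  finally have "L\<^sup>2 * (\<Sum>i<d. (norm (r i))\<^sup>2) \<le> \<kappa> * (LINT y|frame_measure c d. indicator Q y * (norm y)\<^sup>2)"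
    by simp
  \<comment> \<open>The shift \<eta> only adds to the integral and is dropped; the power of \<kappa>
    is the one that \<open>frame_am_gm\<close> asks for.\<close>
  then have "\<kappa> powr (2 / d) * (L\<^sup>2 * (\<Sum>i<d. (norm (r i))\<^sup>2))
      \<le> \<kappa> powr (2 / d) * (\<kappa> * (LINT y|frame_measure c d. indicator Q y * (norm y)\<^sup>2))"
    by (rule mult_left_mono) simp
  moreover have "L\<^sup>2 * real d \<le> L\<^sup>2 * (\<kappa> powr (2 / d) * (\<Sum>i<d. (norm (r i))\<^sup>2))"
    by (intro mult_left_mono frame_am_gm[OF c d k(1) r k(2)]) auto
  ultimately have "L\<^sup>2 * real d \<le> \<kappa> powr (2 / d) * (\<kappa> * (LINT y|frame_measure c d. indicator Q y * (norm y)\<^sup>2))"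
    by (simp add: mult_ac)
  also have "\<dots> = \<kappa> powr (1 + 2 / d) * (LINT y|frame_measure c d. indicator Q y * (norm y)\<^sup>2)"
    using k(1) by (simp add: powr_add)
  finally have *: "L\<^sup>2 * real d \<le> \<kappa> powr (1 + 2 / d) * (LINT y|frame_measure c d. indicator Q y * (norm y)\<^sup>2)" .
  have V: "measure (frame_measure c d) Q = 1 / \<kappa>" using volQ k(1) by (simp add: field_simps)
  have "real d * L\<^sup>2 * (1 / \<kappa>) powr (1 + 2 / d)
      \<le> (\<kappa> powr (1 + 2 / d) * (LINT y|frame_measure c d. indicator Q y * (norm y)\<^sup>2)) * (1 / \<kappa>) powr (1 + 2 / d)"
    using * by (intro mult_right_mono) (simp_all add: mult.commute)
  also have "\<dots> = (LINT y|frame_measure c d. indicator Q y * (norm y)\<^sup>2)"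
    using k(1) by (simp add: powr_mult[symmetric] mult.commute mult.assoc[symmetric])
  finally show ?thesis unfolding V .
qed

section \<open>Existence and uniqueness of the isotropic position\<close>

text \<open>Two affine images of the same body differ by the linear part
  \<open>S \<circ> T^(-1)\<close> and a shift. Writing this map in frame form, with
  \<open>r i = S (T^(-1) (b i))\<close>, makes \<open>isotropic_key\<close> applicable.\<close>

lemma affine_image_frame_map:
  assumes b: "orthonormal_basis E d b" and c: "orthonormal_basis F d c"
    and T: "linear T" "bij_betw T E E" and a: "a \<in> E"
    and S: "linear S" "bij_betw S E F" and \<beta>: "\<beta> \<in> F" and K: "K \<subseteq> E"
  shows "\<exists>r v \<eta>. dual_frame F d r v \<and> \<eta> \<in> F \<and>
    (\<lambda>x. \<beta> + S x) ` K = (\<lambda>x. \<eta> + frame_map b d r x) ` (\<lambda>x. a + T x) ` K"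
proof -
  note db = onb_dual_frame[OF b] and dc = onb_dual_frame[OF c]
  have sE: "subspace E" and sF: "subspace F" using db dc dual_frame_subspace by auto
  have bE: "b i \<in> E" if "i < d" for i using db that by (auto simp: dual_frame_def)
  have SF: "S x \<in> F" if "x \<in> E" for x using S(2) that by (auto simp: bij_betw_def)
  have TE: "T x \<in> E" if "x \<in> E" for x using T(2) that by (auto simp: bij_betw_def)
  \<comment> \<open>\<open>T\<close> is invertible only on \<open>E\<close>, so \<open>U\<close>
    carries no linearity of its own; it is recovered below by applying \<open>T\<close> and using
    injectivity on \<open>E\<close>.\<close>
  define U where "U = inv_into E T"
  have U: "U x \<in> E" "T (U x) = x" if "x \<in> E" for x
    using that T(2) by (auto simp: U_def bij_betw_def intro: inv_into_into f_inv_into_f)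
  define r where "r = (\<lambda>i. S (U (b i)))"
  have zero: "x = 0" if "x \<in> E" "S x = 0" for x
    using that S inj_onD[of S E x 0] subspace_0[OF sE] by (auto simp: bij_betw_def linear_0)
  have lr: "lin_comb r d t = S (lin_comb (\<lambda>i. U (b i)) d t)" for t
    by (simp add: r_def linear_lin_comb[OF S(1)])
  have lT: "T (lin_comb (\<lambda>i. U (b i)) d t) = lin_comb b d t" for t
    using U(2)[OF bE] by (simp add: linear_lin_comb[OF T(1)]) (simp add: lin_comb_def)
  have lE: "lin_comb (\<lambda>i. U (b i)) d t \<in> E" for t
    by (intro lin_comb_mem sE U bE)
  have "\<exists>v. dual_frame F d r v"
  proof (rule dual_frame_exists[OF c])
    fix i assume "i < d" then show "r i \<in> F" by (simp add: r_def SF U bE)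
  next
    fix t i assume t: "lin_comb r d t = 0" and i: "i < d"
    have "lin_comb (\<lambda>i. U (b i)) d t = 0" using zero[OF lE] t lr by simp
    then have "lin_comb b d t = 0" using lT[of t] by (simp add: linear_0[OF T(1)])
    then show "t i = 0" using dual_frame_coeff[OF db i, of t] by simp
  qed
  then obtain v where v: "dual_frame F d r v" by blast
  define \<eta> where "\<eta> = \<beta> - S (U a)"
  have "\<eta> \<in> F" unfolding \<eta>_def by (intro subspace_diff[OF sF] \<beta> SF U a)
  moreover have "\<eta> + frame_map b d r (a + T k) = \<beta> + S k" if "k \<in> K" for k
  proof -
    have k: "k \<in> E" using that K by auto
    define z where "z = lin_comb (\<lambda>i. U (b i)) d (\<lambda>i. (a + T k) \<bullet> b i)"
    have "T z = a + T k" unfolding z_def lT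
      by (rule dual_frame_expand[OF db]) (intro subspace_add[OF sE] a TE k)
    also have "\<dots> = T (U a + k)" using U(2)[OF a] by (simp add: linear_add[OF T(1)])
    finally have "z = U a + k"
      using T(2) lE subspace_add[OF sE U(1)[OF a] k] by (auto simp: z_def bij_betw_def dest: inj_onD)
    then have "frame_map b d r (a + T k) = S (U a) + S k"
      unfolding frame_map_def lr z_def[symmetric] by (simp add: linear_add[OF S(1)])
    then show ?thesis by (simp add: \<eta>_def)
  qed
  then have "(\<lambda>x. \<beta> + S x) ` K = (\<lambda>x. \<eta> + frame_map b d r x) ` (\<lambda>x. a + T x) ` K"
    unfolding image_image by (intro image_cong) auto
  ultimately show ?thesis using v by blast
qed

lemma isotropic_norm_integral:
  assumes b: "orthonormal_basis E d b" and iso: "isotropic_body E K L"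
  shows "(LINT y|frame_measure b d. indicator K y * (norm y)\<^sup>2) = real d * L\<^sup>2"
proof -
  note db = onb_dual_frame[OF b]
  have cK: "compact K" and KE: "K \<subseteq> E" using iso by (auto simp: isotropic_body_def convex_body_def)
  have [measurable]: "K \<in> sets borel" using cK by (rule borel_compact)
  have "(LINT y|frame_measure b d. indicator K y * (norm y)\<^sup>2)
    = (LINT y|frame_measure b d. (\<Sum>i<d. indicator K y * ((y \<bullet> b i) * (y \<bullet> b i))))"
    using onb_norm_inner[OF b] KE
    by (intro Bochner_Integration.integral_cong refl) (auto simp: indicator_def power2_eq_square)
  also have "\<dots> = (\<Sum>i<d. LINT y|frame_measure b d. indicator K y * ((y \<bullet> b i) * (y \<bullet> b i)))"
    by (intro Bochner_Integration.integral_sum integrable_compact[OF db cK] continuous_intros)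
  also have "\<dots> = real d * L\<^sup>2" using isotropic_moments(2)[OF b iso] by simp
  finally show ?thesis .
qed

text \<open>Both positions have volume 1 and each is an affine image of the other, so
  \<open>isotropic_key\<close> compares their second moments. Used in both directions it shows that
  the \<open>THE\<close> in \<open>isotropy_constant\<close> is justified.\<close>

lemma isotropic_unique_le:
  assumes b: "orthonormal_basis E d b" and d: "d > 0" and K: "K \<subseteq> E"
    and T: "linear T" "bij_betw T E E" "a \<in> E" "isotropic_body E ((\<lambda>x. a + T x) ` K) L"
    and T': "linear T'" "bij_betw T' E E" "a' \<in> E" "isotropic_body E ((\<lambda>x. a' + T' x) ` K) L'"
  shows "L \<le> L'"
proof -
  obtain r v \<eta> where r: "dual_frame E d r v" "\<eta> \<in> E"
    "(\<lambda>x. a' + T' x) ` K = (\<lambda>x. \<eta> + frame_map b d r x) ` (\<lambda>x. a + T x) ` K"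
    using affine_image_frame_map[OF b b T(1-3) T'(1-3) K] by blast
  let ?Q = "(\<lambda>x. a' + T' x) ` K"
  have "convex_body E ?Q" "measure (subspace_lborel E) ?Q = 1" and L': "L' > 0"
    using T'(4) by (auto simp: isotropic_body_def)
  then have V: "measure (frame_measure b d) ?Q = 1"
    using measure_subspace_lborel[OF b, of ?Q] by (metis borel_compact convex_body_def)
  have "real d * L\<^sup>2 * measure (frame_measure b d) ?Q powr (1 + 2 / d) \<le> (LINT y|frame_measure b d. indicator ?Q y * (norm y)\<^sup>2)"
    by (rule isotropic_key[OF b b d r(1,2) T(4) r(3)])
  then have "real d * L\<^sup>2 \<le> (LINT y|frame_measure b d. indicator ?Q y * (norm y)\<^sup>2)"
    unfolding V powr_one_eq_one mult_1_right .
  also have "\<dots> = real d * L'\<^sup>2" by (rule isotropic_norm_integral[OF b T'(4)])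
  finally have "real d * L\<^sup>2 \<le> real d * L'\<^sup>2" .
  then have "L\<^sup>2 \<le> L'\<^sup>2" using d by simp
  then show ?thesis using L' power2_le_imp_le by (metis less_imp_le)
qed

text \<open>Gram-Schmidt with \<open>B\<close> in place of the inner product, by induction on the
  number \<open>k\<close> of vectors. It will be applied to the covariance form of a body.\<close>

lemma orthonormal_for_form:
  fixes B :: "rseq \<Rightarrow> rseq \<Rightarrow> real"
  assumes b: "orthonormal_basis E d b"
    and lin: "\<And>y. linear (\<lambda>x. B x y)" and sym: "\<And>x y. B x y = B y x"
    and pos: "\<And>x. x \<in> E \<Longrightarrow> x \<noteq> 0 \<Longrightarrow> B x x > 0"
  shows "\<exists>f. (\<forall>i<d. f i \<in> E) \<and> (\<forall>i<d. \<forall>j<d. B (f i) (f j) = (if i = j then 1 else 0))"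
proof -
  note db = onb_dual_frame[OF b]
  have sE: "subspace E" by (rule dual_frame_subspace[OF db])
  have "k \<le> d \<Longrightarrow> \<exists>f. (\<forall>i<k. f i \<in> E) \<and> (\<forall>i<k. \<forall>j<k. B (f i) (f j) = (if i = j then 1 else 0))" for k
  proof (induction k)
    case (Suc k)
    then obtain f where f: "\<And>i. i < k \<Longrightarrow> f i \<in> E" "\<And>i j. i < k \<Longrightarrow> j < k \<Longrightarrow> B (f i) (f j) = (if i = j then 1 else 0)"
      by auto
    have "\<not> E \<subseteq> span (f ` {..<k})"
    proof
      assume "E \<subseteq> span (f ` {..<k})"
      then have "dim E \<le> card (f ` {..<k})" by (rule dim_le_card) simp
      also have "\<dots> \<le> k" using card_image_le[of "{..<k}" f] by simp
      finally show False using Suc.prems dual_frame_dim[OF db] by simp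
    qed
    then obtain x where x: "x \<in> E" "x \<notin> span (f ` {..<k})" by auto
    define y where "y = x - lin_comb f k (\<lambda>i. B x (f i))"
    have lc: "lin_comb f k t \<in> span (f ` {..<k})" for t
      unfolding lin_comb_def by (intro span_sum span_scale span_base) auto
    have y: "y \<in> E" "y \<noteq> 0"
      using x lc[of "\<lambda>i. B x (f i)"] lin_comb_mem[OF sE f(1)] by (auto simp: y_def subspace_diff[OF sE])
    have yf: "B y (f j) = 0" if "j < k" for j
    proof -
      have "B (lin_comb f k (\<lambda>i. B x (f i))) (f j) = (\<Sum>i<k. B x (f i) * B (f i) (f j))"
        unfolding lin_comb_def by (simp add: linear_sum[OF lin] linear_scale[OF lin])
      also have "\<dots> = B x (f j)" using that by (simp add: f(2) if_distrib cong: if_cong)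
      finally show ?thesis by (simp add: y_def linear_diff[OF lin])
    qed
    define z where "z = (1 / sqrt (B y y)) *\<^sub>R y"
    have zf: "B z (f j) = 0" "B (f j) z = 0" if "j < k" for j
    proof -
      show "B z (f j) = 0" using yf[OF that] by (simp add: z_def linear_scale[OF lin])
      then show "B (f j) z = 0" using sym by metis
    qed
    have zz: "B z z = 1"
    proof -
      have "B z z = (1 / sqrt (B y y)) * B y z"
        unfolding z_def by (simp add: linear_scale[OF lin])
      also have "B y z = B z y" by (rule sym)
      also have "B z y = (1 / sqrt (B y y)) * B y y"
        unfolding z_def by (simp add: linear_scale[OF lin])
      finally show ?thesis using pos[OF y] by (simp add: power2_eq_square[symmetric] real_div_sqrt)
    qed
    have zE: "z \<in> E" by (simp add: z_def y subspace_scale[OF sE])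
    show ?case
    proof (intro exI[of _ "f(k := z)"] conjI allI impI)
      fix i assume "i < Suc k"
      then show "(f(k := z)) i \<in> E" using f(1) zE by auto
      fix j assume "j < Suc k"
      then show "B ((f(k := z)) i) ((f(k := z)) j) = (if i = j then 1 else 0)"
        using \<open>i < Suc k\<close> f(2) zf zz by (auto simp: less_Suc_eq)
    qed
  qed simp
  then show ?thesis by blast
qed

text \<open>An affine function of slope \<theta> cannot be small both at the centre \<open>z\<close>
  of a ball in \<open>K\<close> and at the point \<open>z2\<close> half a radius further along
  \<theta>, so it is bounded away from 0 on a smaller ball inside \<open>K\<close>.\<close>

lemma ball_frame_pos_form:
  assumes b: "orthonormal_basis E d b" and K: "convex_body E K" and g: "g \<in> E"
    and \<theta>: "\<theta> \<in> E" "\<theta> \<noteq> 0"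
  shows "(LINT x|frame_measure b d. indicator K x * ((x - g) \<bullet> \<theta>)\<^sup>2) > 0"
proof -
  note db = onb_dual_frame[OF b]
  have cK: "compact K" using K by (simp add: convex_body_def)
  have [measurable]: "K \<in> sets borel" using cK by (rule borel_compact)
  obtain z r where zr: "r > 0" "z \<in> E" "ball z r \<inter> E \<subseteq> K" using convex_body_ball[OF K] by blast
  \<comment> \<open>The values at \<open>z\<close> and \<open>z2\<close> differ by
    \<open>4 c\<close>, so one of them is at least \<open>2 c\<close> in modulus, and over distance
    \<open>r / 8\<close> the function changes by at most \<open>c\<close>.\<close>
  define c where "c = r * norm \<theta> / 8"
  have c: "c > 0" using zr \<theta> by (simp add: c_def)
  define z2 where "z2 = z + (r / (2 * norm \<theta>)) *\<^sub>R \<theta>"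
  have "(z2 - z) \<bullet> \<theta> = 4 * c" using \<theta>
    by (simp add: z2_def c_def power2_norm_eq_inner[symmetric] power2_eq_square)
  then have "\<bar>(z - g) \<bullet> \<theta>\<bar> \<ge> 2 * c \<or> \<bar>(z2 - g) \<bullet> \<theta>\<bar> \<ge> 2 * c"
    by (simp add: inner_diff_left) linarith
  moreover have "z2 \<in> E" unfolding z2_def
    by (intro subspace_add subspace_scale dual_frame_subspace[OF db] zr \<theta>)
  moreover have "norm (z2 - z) \<le> r / 2" using \<theta> zr(1) by (simp add: z2_def)
  ultimately obtain y where y: "y \<in> E" "norm (y - z) \<le> r / 2" "\<bar>(y - g) \<bullet> \<theta>\<bar> \<ge> 2 * c"
    using zr(1,2) by (metis diff_self half_gt_zero less_imp_le norm_zero)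
  define B where "B = ball y (r / 8)"
  have Bpos: "emeasure (frame_measure b d) B > 0"
    unfolding B_def using zr(1) by (intro frame_ball_pos[OF db y(1)]) simp
  have Bfin: "emeasure (frame_measure b d) B < \<infinity>"
    unfolding B_def by (rule frame_bounded_finite[OF db]) simp
  have sub: "x \<in> K \<and> c\<^sup>2 \<le> ((x - g) \<bullet> \<theta>)\<^sup>2" if x: "x \<in> E" "x \<in> B" for x
  proof
    have xy: "norm (x - y) < r / 8" using x by (simp add: B_def dist_norm norm_minus_commute)
    then have "norm (x - z) < r" using y(2) zr(1) norm_triangle_ineq[of "x - y" "y - z"] by simp
    then show "x \<in> K" using zr(3) x by (auto simp: dist_norm norm_minus_commute)
    have "\<bar>(x - y) \<bullet> \<theta>\<bar> \<le> norm (x - y) * norm \<theta>" by (rule Cauchy_Schwarz_ineq2)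
    also have "\<dots> \<le> c" using mult_right_mono[of "norm (x - y)" "r / 8" "norm \<theta>"] xy unfolding c_def by simp
    finally have "\<bar>(x - g) \<bullet> \<theta>\<bar> \<ge> c" using y(3) by (simp add: inner_diff_left)
    then show "c\<^sup>2 \<le> ((x - g) \<bullet> \<theta>)\<^sup>2" using c by (metis abs_le_square_iff abs_of_pos)
  qed
  have "0 < c\<^sup>2 * measure (frame_measure b d) B"
    using c emeasure_pos_finite_measure(2)[OF Bpos Bfin] by simp
  also have "\<dots> = (LINT x|frame_measure b d. indicator B x * c\<^sup>2)" by (simp add: B_def)
  also have "\<dots> \<le> (LINT x|frame_measure b d. indicator K x * ((x - g) \<bullet> \<theta>)\<^sup>2)"
  proof (rule integral_mono_AE)
    show "integrable (frame_measure b d) (\<lambda>x. indicator B x * c\<^sup>2)"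
      using Bfin by (simp add: B_def)
    show "integrable (frame_measure b d) (\<lambda>x. indicator K x * ((x - g) \<bullet> \<theta>)\<^sup>2)"
      by (intro integrable_compact[OF db cK] continuous_intros)
    show "AE x in frame_measure b d. indicator B x * c\<^sup>2 \<le> indicator K x * ((x - g) \<bullet> \<theta>)\<^sup>2"
      using AE_frame[OF db] by eventually_elim (use sub in \<open>auto simp: indicator_def\<close>)
  qed
  finally show ?thesis .
qed

text \<open>The body is centred at its barycenter \<open>g\<close> and mapped by
  \<open>x \<mapsto> \<Sum> (x \<bullet> f i) b i\<close>, where \<open>f\<close> is orthonormal for
  the covariance form \<open>B\<close>; this makes the covariance a multiple of the identity. A
  dilation then gives volume 1.\<close>

lemma isotropic_position_exists:
  assumes b: "orthonormal_basis E d b" and d: "d > 0" and K: "convex_body E K"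
  shows "\<exists>L T a. linear T \<and> bij_betw T E E \<and> a \<in> E \<and> isotropic_body E ((\<lambda>x. a + T x) ` K) L"
proof -
  note db = onb_dual_frame[OF b]
  have sE: "subspace E" by (rule dual_frame_subspace[OF db])
  have cK: "compact K" and KE: "K \<subseteq> E" using K by (auto simp: convex_body_def)
  have [measurable]: "K \<in> sets borel" using cK by (rule borel_compact)
  define V where "V = measure (frame_measure b d) K"
  have V: "V > 0" unfolding V_def by (rule convex_body_vol[OF db K])
  define g where "g = lin_comb b d (\<lambda>i. (LINT x|frame_measure b d. indicator K x * (x \<bullet> b i)) / V)"
  have gE: "g \<in> E" unfolding g_def by (rule dual_frame_mem[OF db])
  have int1: "integrable (frame_measure b d) (\<lambda>x. indicator K x * f x)" if "continuous_on UNIV f" for f :: "rseq \<Rightarrow> real"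
    by (rule integrable_compact[OF db cK that])
  have bary: "(LINT x|frame_measure b d. indicator K x * ((x - g) \<bullet> h)) = 0" if h: "h \<in> E" for h
  proof -
    have i: "integrable (frame_measure b d) (\<lambda>x. indicator K x * ((x - g) \<bullet> b i))" for i
      by (intro int1 continuous_intros)
    have "(LINT x|frame_measure b d. indicator K x * ((x - g) \<bullet> b i)) = 0" if "i < d" for i
    proof -
      have "(LINT x|frame_measure b d. indicator K x * ((x - g) \<bullet> b i))
        = (LINT x|frame_measure b d. indicator K x * (x \<bullet> b i) - indicator K x * (g \<bullet> b i))"
        by (intro Bochner_Integration.integral_cong refl) (simp add: inner_diff_left right_diff_distrib)
      also have "\<dots> = (LINT x|frame_measure b d. indicator K x * (x \<bullet> b i)) - V * (g \<bullet> b i)"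
        by (subst Bochner_Integration.integral_diff[OF int1 int1]) (auto intro!: continuous_intros simp: V_def)
      also have "\<dots> = 0" unfolding g_def dual_frame_coeff[OF db that] using V by simp
      finally show ?thesis .
    qed
    moreover have "(LINT x|frame_measure b d. indicator K x * ((x - g) \<bullet> lin_comb b d (\<lambda>i. h \<bullet> b i)))
       = (LINT x|frame_measure b d. (\<Sum>i<d. (h \<bullet> b i) * (indicator K x * ((x - g) \<bullet> b i))))"
      by (intro Bochner_Integration.integral_cong refl)
        (simp add: lin_comb_def inner_sum_right sum_distrib_left mult_ac)
    ultimately have "(LINT x|frame_measure b d. indicator K x * ((x - g) \<bullet> lin_comb b d (\<lambda>i. h \<bullet> b i))) = 0"
      using i by (simp add: Bochner_Integration.integral_sum)
    then show ?thesis by (simp add: dual_frame_expand[OF db h])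
  qed
  define B where "B = (\<lambda>\<theta> \<phi>. LINT x|frame_measure b d. indicator K x * (((x - g) \<bullet> \<theta>) * ((x - g) \<bullet> \<phi>)))"
  have iB: "integrable (frame_measure b d) (\<lambda>x. indicator K x * (((x - g) \<bullet> \<theta>) * ((x - g) \<bullet> \<phi>)))" for \<theta> \<phi>
    by (intro int1 continuous_intros)
  have linB: "linear (\<lambda>\<theta>. B \<theta> \<phi>)" for \<phi>
  proof (rule linearI)
    fix \<theta> \<theta>'
    have "B (\<theta> + \<theta>') \<phi> = (LINT x|frame_measure b d. indicator K x * (((x - g) \<bullet> \<theta>) * ((x - g) \<bullet> \<phi>))
        + indicator K x * (((x - g) \<bullet> \<theta>') * ((x - g) \<bullet> \<phi>)))"
      unfolding B_def by (intro Bochner_Integration.integral_cong refl) (simp add: inner_add_right algebra_simps)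
    also have "\<dots> = B \<theta> \<phi> + B \<theta>' \<phi>" unfolding B_def by (rule Bochner_Integration.integral_add[OF iB iB])
    finally show "B (\<theta> + \<theta>') \<phi> = B \<theta> \<phi> + B \<theta>' \<phi>" .
  next
    fix s \<theta>
    have "B (s *\<^sub>R \<theta>) \<phi> = (LINT x|frame_measure b d. s * (indicator K x * (((x - g) \<bullet> \<theta>) * ((x - g) \<bullet> \<phi>))))"
      unfolding B_def by (intro Bochner_Integration.integral_cong refl) (simp add: algebra_simps)
    then show "B (s *\<^sub>R \<theta>) \<phi> = s *\<^sub>R B \<theta> \<phi>" by (simp add: B_def)
  qed
  have symB: "B \<theta> \<phi> = B \<phi> \<theta>" for \<theta> \<phi> by (simp add: B_def mult_ac)
  have posB: "B \<theta> \<theta> > 0" if "\<theta> \<in> E" "\<theta> \<noteq> 0" for \<theta>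
    using ball_frame_pos_form[OF b K gE that] by (simp add: B_def power2_eq_square)
  obtain f where f: "\<And>i. i < d \<Longrightarrow> f i \<in> E" "\<And>i j. i < d \<Longrightarrow> j < d \<Longrightarrow> B (f i) (f j) = (if i = j then 1 else 0)"
    using orthonormal_for_form[OF b linB symB posB] by blast
  have Bf: "B (lin_comb f d s) (lin_comb f d t) = (\<Sum>i<d. s i * t i)" for s t
  proof -
    have 1: "B (lin_comb f d s) y = (\<Sum>i<d. s i * B (f i) y)" for s y
      unfolding lin_comb_def by (simp add: linear_sum[OF linB] linear_scale[OF linB])
    have "B (lin_comb f d s) (lin_comb f d t) = (\<Sum>i<d. s i * (\<Sum>j<d. t j * B (f j) (f i)))"
      unfolding 1 by (simp add: symB[of "f _" "lin_comb f d t"] 1)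
    also have "\<dots> = (\<Sum>i<d. s i * t i)"
      by (intro sum.cong refl) (simp add: f(2) if_distrib cong: if_cong)
    finally show ?thesis .
  qed
  have f_coeff: "t = (\<lambda>_. 0)" if "\<And>i. i \<ge> d \<Longrightarrow> t i = 0" "lin_comb f d t = 0" for t
  proof -
    have "(\<Sum>i<d. t i * t i) = 0" using Bf[of t t] that(2) by (simp add: linear_0[OF linB])
    then have "\<forall>i\<in>{..<d}. t i * t i = 0" by (subst (asm) sum_nonneg_eq_0_iff) auto
    then show ?thesis using that(1) by (auto simp: fun_eq_iff) (metis lessThan_iff linorder_not_le mult_eq_0_iff)
  qed
  have "\<exists>v. dual_frame E d f v"
    using f_coeff[of "\<lambda>i. if i < d then t i else 0" for t]
  proof (intro dual_frame_exists[OF b f(1)])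
    fix t i assume *: "lin_comb f d t = 0" "i < d"
    have "lin_comb f d (\<lambda>i. if i < d then t i else 0) = 0" using *(1) by (simp add: lin_comb_def)
    then have "(\<lambda>i. if i < d then t i else 0) = (\<lambda>_. 0)" by (intro f_coeff) auto
    then show "t i = 0" using *(2) by (metis (mono_tags))
  qed auto
  then obtain vf where vf: "dual_frame E d f vf" by blast
  \<comment> \<open>The matrix of the map \<open>x \<mapsto> \<Sum> (x \<bullet> f i) b i\<close> in
    the basis \<open>b\<close>; \<open>m1\<close> identifies its adjoint.\<close>
  define r1 where "r1 = (\<lambda>j. lin_comb b d (\<lambda>i. b j \<bullet> f i))"
  have m1: "frame_map b d r1 x \<bullet> y = x \<bullet> lin_comb f d (\<lambda>i. y \<bullet> b i)" if "x \<in> E" for x y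
  proof -
    have "frame_map b d r1 x \<bullet> y = (\<Sum>j<d. \<Sum>i<d. (x \<bullet> b j) * ((b j \<bullet> f i) * (b i \<bullet> y)))"
      by (simp add: frame_map_def r1_def lin_comb_def inner_sum_left sum_distrib_left)
    also have "\<dots> = (\<Sum>i<d. (lin_comb b d (\<lambda>j. x \<bullet> b j) \<bullet> f i) * (b i \<bullet> y))"
      by (subst sum.swap) (simp add: lin_comb_def inner_sum_left sum_distrib_right mult.assoc)
    also have "\<dots> = (\<Sum>i<d. (x \<bullet> f i) * (b i \<bullet> y))"
      using dual_frame_expand[OF db that] by simp
    also have "\<dots> = x \<bullet> lin_comb f d (\<lambda>i. y \<bullet> b i)"
      by (simp add: lin_comb_def inner_sum_right inner_commute mult_ac)
    finally show ?thesis .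
  qed
  have bE: "b i \<in> E" if "i < d" for i using db that by (auto simp: dual_frame_def)
  have "\<exists>v. dual_frame E d r1 v"
  proof (rule dual_frame_exists[OF b])
    fix i assume "i < d" show "r1 i \<in> E" unfolding r1_def by (rule dual_frame_mem[OF db])
  next
    fix t i assume t: "lin_comb r1 d t = 0" and i: "i < d"
    define x where "x = lin_comb b d t"
    have xE: "x \<in> E" unfolding x_def by (rule dual_frame_mem[OF db])
    have "frame_map b d r1 x = lin_comb r1 d t"
      unfolding frame_map_def x_def using dual_frame_coeff[OF db] by (intro lin_comb_cong)
    then have z: "x \<bullet> lin_comb f d (\<lambda>i. y \<bullet> b i) = 0" for y using m1[OF xE, of y] t by simp
    have "x \<bullet> f j = 0" if "j < d" for j
    proof -
      have "lin_comb f d (\<lambda>i. b j \<bullet> b i) = (\<Sum>i<d. if i = j then f j else 0)"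
        unfolding lin_comb_def using db that by (intro sum.cong) (auto simp: dual_frame_def)
      then show ?thesis using z[of "b j"] that by simp
    qed
    then have "x \<bullet> lin_comb f d t' = 0" for t' by (simp add: lin_comb_def inner_sum_right)
    then have "x \<bullet> x = 0" using dual_frame_expand[OF vf xE] by metis
    then have "lin_comb b d t = 0" by (simp add: x_def)
    then show "t i = 0" using dual_frame_coeff[OF db i, of t] by simp
  qed
  then obtain v1 where v1: "dual_frame E d r1 v1" by blast
  obtain \<kappa> where k: "\<kappa> > 0" "frame_measure r1 d = scale_measure (ennreal \<kappa>) (frame_measure b d)"
    using frame_measure_scale[OF v1 db] by blast
  \<comment> \<open>The image of \<open>K\<close> under the map of \<open>r1\<close> has volume
    \<open>V / \<kappa>\<close>, so it has to be stretched by the \<open>d\<close>-th root of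
    \<open>\<kappa> / V\<close>.\<close>
  define s where "s = (\<kappa> / V) powr (1 / d)"
  have s: "s > 0" "s ^ d = \<kappa> / V" using k V d by (auto simp: s_def powr_realpow[symmetric] powr_powr)
  define r where "r = (\<lambda>i. s *\<^sub>R r1 i)"
  have r_scale: "frame_measure r d = scale_measure (ennreal V) (frame_measure b d)"
    unfolding r_def frame_measure_scaleR[OF v1 s(1)] k(2) using s k V by (simp add: ennreal_mult[symmetric])
  have fmr: "frame_map b d r x = s *\<^sub>R frame_map b d r1 x" for x
    by (simp add: frame_map_def r_def lin_comb_def scaleR_sum_right mult.commute)
  have "dual_frame E d r (\<lambda>i. v1 i /\<^sub>R s)"
  proof -
    have "lin_comb r d (\<lambda>i. x \<bullet> v1 i /\<^sub>R s) = lin_comb r1 d (\<lambda>i. x \<bullet> v1 i)" for x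
      using s(1) by (auto simp: lin_comb_def r_def field_simps intro!: sum.cong)
    then show ?thesis using v1 s(1) unfolding dual_frame_def r_def by (auto simp: subspace_scale)
  qed
  then obtain v where v: "dual_frame E d r v" by blast
  define T where "T = frame_map b d r"
  have linT: "linear T" unfolding T_def by (rule linear_frame_map)
  have TE: "T x \<in> E" for x unfolding T_def frame_map_def by (rule dual_frame_mem[OF v])
  have bijT: "bij_betw T E E"
    unfolding bij_betw_def
  proof
    show "inj_on T E" unfolding T_def by (rule inj_onI) (rule frame_map_inj[OF b v])
    show "T ` E = E"
    proof
      show "E \<subseteq> T ` E"
      proof
        fix y assume y: "y \<in> E"
        have "T (lin_comb b d (\<lambda>i. y \<bullet> v i)) = lin_comb r d (\<lambda>i. y \<bullet> v i)"
          unfolding T_def frame_map_def using dual_frame_coeff[OF db] by (intro lin_comb_cong)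
        then have "y = T (lin_comb b d (\<lambda>i. y \<bullet> v i))" using dual_frame_expand[OF v y] by simp
        then show "y \<in> T ` E" using dual_frame_mem[OF db] by blast
      qed
    qed (use TE in auto)
  qed
  define a where "a = - T g"
  have aE: "a \<in> E" using TE[of g] sE by (simp add: a_def subspace_neg)
  have aff: "(a + T x) \<bullet> y = (x - g) \<bullet> lin_comb f d (\<lambda>i. s * (y \<bullet> b i))" if "x \<in> E" for x y
  proof -
    have "a + T x = s *\<^sub>R frame_map b d r1 (x - g)"
      by (simp add: a_def T_def linear_diff[OF linear_frame_map] fmr scaleR_diff_right)
    then show ?thesis using m1[of "x - g" y] that gE sE by (simp add: subspace_diff lin_comb_scale)
  qed
  define K1 where "K1 = (\<lambda>x. a + T x) ` K"
  have K1: "convex_body E K1" unfolding K1_def T_def by (rule convex_body_affine_image[OF b v aE K])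
  have bK1: "K1 \<in> sets borel" "K1 \<subseteq> E" using K1 by (auto simp: convex_body_def borel_compact)
  have int: "V * (LINT y|frame_measure b d. indicator K1 y * h y) = (LINT x|frame_measure b d. indicator K x * h (a + T x))"
    if "h \<in> borel_measurable borel" for h :: "rseq \<Rightarrow> real"
    using integral_affine_image[OF b v aE KE cK that] V bK1 that
    by (subst integral_scale_measure[symmetric]) (auto simp: r_scale[symmetric] K1_def T_def)
  have "V * measure (frame_measure b d) K1 = V"
    using int[of "\<lambda>_. 1"] by (simp add: V_def bK1)
  then have vol1: "measure (subspace_lborel E) K1 = 1"
    using V measure_subspace_lborel[OF b bK1] by simp
  have lf: "lin_comb f d t \<in> E" for t by (rule lin_comb_mem[OF sE f(1)])
  have bary1: "has_barycenter E K1 0"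
    unfolding has_barycenter_def
  proof (intro conjI ballI)
    fix \<theta> assume "\<theta> \<in> E"
    have "V * (LINT y|frame_measure b d. indicator K1 y * (y \<bullet> \<theta>)) = (LINT x|frame_measure b d. indicator K x * ((x - g) \<bullet> lin_comb f d (\<lambda>i. s * (\<theta> \<bullet> b i))))"
      using KE aff by (subst int) (auto intro!: Bochner_Integration.integral_cong simp: indicator_def)
    also have "\<dots> = 0" by (rule bary[OF lf])
    finally have "(LINT y:K1|subspace_lborel E. y \<bullet> \<theta>) = 0"
      using V by (subst integral_subspace_lborel[OF b bK1(1)]) (auto simp: set_lebesgue_integral_def)
    then show "0 \<bullet> \<theta> = (LINT x:K1|subspace_lborel E. x \<bullet> \<theta>) / measure (subspace_lborel E) K1"
      by simp
  qed (rule subspace_0[OF sE])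
  have iso: "isotropic_body E K1 (s / sqrt V)"
    unfolding isotropic_body_def
  proof (intro conjI ballI impI K1 vol1 bary1)
    show "s / sqrt V > 0" using s V by simp
    fix \<theta> assume \<theta>: "\<theta> \<in> E" "norm \<theta> = 1"
    have "V * (LINT y|frame_measure b d. indicator K1 y * (y \<bullet> \<theta>)\<^sup>2)
       = B (lin_comb f d (\<lambda>i. s * (\<theta> \<bullet> b i))) (lin_comb f d (\<lambda>i. s * (\<theta> \<bullet> b i)))"
      unfolding B_def using KE aff
      by (subst int) (auto intro!: Bochner_Integration.integral_cong simp: indicator_def power2_eq_square)
    also have "\<dots> = s\<^sup>2 * (\<Sum>i<d. (\<theta> \<bullet> b i)\<^sup>2)"
      unfolding Bf by (simp add: power2_eq_square sum_distrib_left mult_ac)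
    also have "\<dots> = s\<^sup>2" using onb_norm_inner[OF b \<theta>(1)] \<theta>(2) by simp
    finally have "(LINT y|frame_measure b d. indicator K1 y * (y \<bullet> \<theta>)\<^sup>2) = (s / sqrt V)\<^sup>2"
      using V by (simp add: power_divide field_simps)
    then show "(LINT x:K1|subspace_lborel E. (x \<bullet> \<theta>)\<^sup>2) = (s / sqrt V)\<^sup>2"
      by (subst integral_subspace_lborel[OF b bK1(1)]) (auto simp: set_lebesgue_integral_def)
  qed
  then show ?thesis using linT bijT aE unfolding K1_def by blast
qed

lemma isotropy_constant_position:
  assumes b: "orthonormal_basis E d b" and d: "d > 0" and K: "convex_body E K"
  shows "\<exists>T a. linear T \<and> bij_betw T E E \<and> a \<in> E \<and>
    isotropic_body E ((\<lambda>x. a + T x) ` K) (isotropy_constant E K)"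
proof -
  have KE: "K \<subseteq> E" using K by (simp add: convex_body_def)
  let ?P = "\<lambda>L. \<exists>T a. linear T \<and> bij_betw T E E \<and> a \<in> E \<and> isotropic_body E ((\<lambda>x. a + T x) ` K) L"
  have "\<exists>L. ?P L" using isotropic_position_exists[OF b d K] .
  moreover have "L = L'" if "?P L" "?P L'" for L L'
    using that isotropic_unique_le[OF b d KE] by (metis antisym)
  ultimately have "\<exists>!L. ?P L" by blast
  then show ?thesis unfolding isotropy_constant_def by (rule theI')
qed

text \<open>The variational bound through which all estimates of isotropy constants go.\<close>

lemma isotropy_constant_le:
  assumes b: "orthonormal_basis E d b" and c: "orthonormal_basis F d c" and d: "d > 0"
    and K: "convex_body E K" and S: "linear S" "bij_betw S E F" and \<beta>: "\<beta> \<in> F"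
    and Q: "Q = (\<lambda>x. \<beta> + S x) ` K"
  shows "real d * (isotropy_constant E K)\<^sup>2 * measure (frame_measure c d) Q powr (1 + 2 / d)
      \<le> (LINT y|frame_measure c d. indicator Q y * (norm y)\<^sup>2)"
    and "isotropy_constant E K > 0" and "convex_body F Q"
proof -
  obtain T a where T: "linear T" "bij_betw T E E" "a \<in> E"
      "isotropic_body E ((\<lambda>x. a + T x) ` K) (isotropy_constant E K)"
    using isotropy_constant_position[OF b d K] by blast
  have KE: "K \<subseteq> E" using K by (simp add: convex_body_def)
  obtain r v \<eta> where r: "dual_frame F d r v" "\<eta> \<in> F"
    "Q = (\<lambda>x. \<eta> + frame_map b d r x) ` (\<lambda>x. a + T x) ` K"
    using affine_image_frame_map[OF b c T(1-3) S \<beta> KE] unfolding Q by blast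
  show "real d * (isotropy_constant E K)\<^sup>2 * measure (frame_measure c d) Q powr (1 + 2 / d)
      \<le> (LINT y|frame_measure c d. indicator Q y * (norm y)\<^sup>2)"
    by (rule isotropic_key[OF b c d r(1,2) T(4) r(3)])
  show "isotropy_constant E K > 0" using T(4) by (simp add: isotropic_body_def)
  show "convex_body F Q" unfolding r(3)
    using T(4) by (intro convex_body_affine_image[OF b r(1,2)]) (simp add: isotropic_body_def)
qed

section \<open>Second moments of polytopes\<close>

text \<open>Infinitely many disjoint translates of a bounded piece of the hyperplane fit into one
  ball of finite measure; having equal mass they are null.\<close>

lemma hyperplane_null:
  assumes w: "dual_frame F d w v" and n: "n \<in> F" "n \<noteq> 0"
  shows "AE x in frame_measure w d. x \<bullet> n \<noteq> 0"
proof -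
  let ?M = "frame_measure w d"
  define H where "H = (\<lambda>R::nat. {x \<in> ball 0 (real R). x \<bullet> n = 0})"
  have bH: "H R \<in> sets borel" for R unfolding H_def by measurable
  have "emeasure ?M (H R) = 0" for R
  proof (rule ccontr)
    assume ne: "emeasure ?M (H R) \<noteq> 0"
    \<comment> \<open>The shifts \<open>n / (k + 1)\<close> are pairwise different, and bounded by
      \<open>n\<close>, which keeps all translates inside a ball.\<close>
    define A where "A = (\<lambda>k::nat. (\<lambda>x. x - (1 / real (Suc k)) *\<^sub>R n) -` H R)"
    have bA: "A k \<in> sets borel" for k
    proof -
      have "(\<lambda>x. x - (1 / real (Suc k)) *\<^sub>R n) \<in> borel_measurable borel" by measurable
      from measurable_sets[OF this bH[of R]] show ?thesis by (simp add: A_def)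
    qed
    have mA: "emeasure ?M (A k) = emeasure ?M (H R)" for k
    proof -
      let ?u = "- ((1 / real (Suc k)) *\<^sub>R n)"
      have "?u \<in> F" using n dual_frame_subspace[OF w] by (intro subspace_neg subspace_scale)
      then have "emeasure ?M (H R) = emeasure (distr ?M borel (\<lambda>x. x + ?u)) (H R)"
        using frame_translate[OF w, of ?u] by simp
      also have "\<dots> = emeasure ?M (A k)"
        using bH by (subst emeasure_distr) (simp_all add: A_def)
      finally show ?thesis by simp
    qed
    have "disjoint_family A"
      unfolding disjoint_family_on_def
    proof (intro ballI impI)
      fix j k :: nat assume jk: "j \<noteq> k"
      show "A j \<inter> A k = {}"
      proof (rule ccontr)
        assume "A j \<inter> A k \<noteq> {}"
        then obtain x where "x \<in> A j" "x \<in> A k" by auto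
        then have "x \<bullet> n = (1 / real (Suc j)) * (n \<bullet> n)" "x \<bullet> n = (1 / real (Suc k)) * (n \<bullet> n)"
          by (auto simp: A_def H_def inner_diff_left)
        then show False using n jk by (simp add: field_simps)
      qed
    qed
    then have "(\<Sum>k. emeasure ?M (A k)) = emeasure ?M (\<Union>k. A k)"
      using bA by (intro suminf_emeasure) auto
    also have "\<dots> \<le> emeasure ?M (ball 0 (real R + norm n))"
    proof (rule emeasure_mono)
      show "(\<Union>k. A k) \<subseteq> ball 0 (real R + norm n)"
      proof clarify
        fix x k assume "x \<in> A k"
        then have "norm (x - (1 / real (Suc k)) *\<^sub>R n) < real R" by (auto simp: A_def H_def)
        moreover have "norm ((1 / real (Suc k)) *\<^sub>R n) \<le> 1 * norm n"
          unfolding norm_scaleR by (intro mult_right_mono) auto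
        ultimately show "x \<in> ball 0 (real R + norm n)"
          using norm_triangle_ineq[of "x - (1 / real (Suc k)) *\<^sub>R n" "(1 / real (Suc k)) *\<^sub>R n"] by simp
      qed
    qed simp
    also have "\<dots> < \<infinity>" by (rule frame_bounded_finite[OF w]) simp
    finally have "(\<Sum>k::nat. emeasure ?M (H R)) < \<infinity>" by (simp add: mA)
    moreover have fH: "emeasure ?M (H R) = ennreal (measure ?M (H R))"
    proof -
      have "bounded (H R)" by (rule bounded_subset[of "ball 0 (real R)"]) (auto simp: H_def)
      from frame_bounded_finite[OF w this] show ?thesis
        by (intro emeasure_eq_ennreal_measure) auto
    qed
    ultimately have "(\<Sum>k::nat. ennreal (measure ?M (H R))) \<noteq> top" by simp
    then have "summable (\<lambda>k::nat. measure ?M (H R))" by (intro summable_suminf_not_top) auto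
    then show False using ne fH by (auto simp: summable_const_iff)
  qed
  then have "AE x in ?M. \<forall>R. x \<notin> H R"
    unfolding AE_all_countable by (intro allI AE_not_in) (auto simp: null_sets_def bH)
  then show ?thesis
  proof eventually_elim
    case (elim x)
    obtain R :: nat where "norm x < real R" using reals_Archimedean2 by blast
    then show ?case using elim by (auto simp: H_def)
  qed
qed

text \<open>Fewer than \<open>d\<close> vectors leave some \<open>x\<close> of \<open>F\<close>
  outside their span; the part of \<open>x\<close> orthogonal to the span is the normal of a
  hyperplane containing it.\<close>

lemma proper_subspace_null:
  assumes c: "orthonormal_basis F d c" and D: "finite D" "D \<subseteq> F" "card D < d"
  shows "AE x in frame_measure c d. x \<notin> span D"
proof -
  note dc = onb_dual_frame[OF c]
  have sF: "subspace F" by (rule dual_frame_subspace[OF dc])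
  have DF: "span D \<subseteq> F" using D(2) by (rule span_minimal) (rule sF)
  have "\<not> F \<subseteq> span D"
    using dim_le_card[of F D] D dual_frame_dim[OF dc] by auto
  then obtain x where x: "x \<in> F" "x \<notin> span D" by auto
  obtain C where C: "finite C" "span C = span D" "pairwise orthogonal C"
    using basis_orthogonal[OF D(1)] by blast
  define y where "y = (\<Sum>b\<in>C. (b \<bullet> x / (b \<bullet> b)) *\<^sub>R b)"
  have y: "y \<in> span D" unfolding y_def C(2)[symmetric] by (intro span_sum span_scale span_base)
  have orth: "(x - y) \<bullet> b = 0" if "b \<in> C" for b
  proof -
    have "y \<bullet> b = (\<Sum>b'\<in>C. if b' = b then x \<bullet> b else 0)"
      unfolding y_def inner_sum_left using that C(3)
      by (intro sum.cong) (auto simp: pairwise_def orthogonal_def inner_commute)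
    then show ?thesis using that C(1) by (simp add: inner_diff_left)
  qed
  have orthD: "(x - y) \<bullet> z = 0" if "z \<in> span D" for z
  proof -
    have "z \<in> span C" using that C(2) by simp
    then have "orthogonal (x - y) z"
      by (rule orthogonal_to_span) (use orth in \<open>auto simp: orthogonal_def\<close>)
    then show ?thesis by (simp add: orthogonal_def)
  qed
  have "x - y \<in> F" "x - y \<noteq> 0" using x y DF subspace_diff[OF sF] by auto
  from hyperplane_null[OF dc this] show ?thesis
    by eventually_elim (metis inner_commute orthD)
qed

lemma nn_integral_frame_scale:
  assumes c: "dual_frame F d c v" and s: "s > 0" and f [measurable]: "f \<in> borel_measurable borel"
  shows "(\<integral>\<^sup>+x. f (s *\<^sub>R x) \<partial>frame_measure c d) = ennreal (1 / s ^ d) * (\<integral>\<^sup>+x. f x \<partial>frame_measure c d)"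
proof -
  have *: "lin_comb (\<lambda>i. s *\<^sub>R c i) d t = s *\<^sub>R lin_comb c d t" for t
    by (simp add: lin_comb_def scaleR_sum_right mult.commute)
  have "(\<integral>\<^sup>+x. f (s *\<^sub>R x) \<partial>frame_measure c d) = (\<integral>\<^sup>+x. f x \<partial>frame_measure (\<lambda>i. s *\<^sub>R c i) d)"
    by (simp add: nn_integral_frame *)
  then show ?thesis by (simp add: frame_measure_scaleR[OF c s] nn_integral_scale_measure)
qed

section \<open>Moments of independent exponential variables\<close>

definition exp_coord :: "nat \<Rightarrow> (nat \<Rightarrow> real) measure" where
  "exp_coord d = Pi\<^sub>M {..<d} (\<lambda>_. density lborel (\<lambda>x. ennreal (exponential_density 1 x)))"

lemma exp_coord_density:
  "exp_coord d = density (coord_lborel d) (\<lambda>t. indicator {t. \<forall>i<d. t i \<ge> 0} t * ennreal (exp (- (\<Sum>i<d. t i))))"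
proof -
  have "exp_coord d = density (coord_lborel d) (\<lambda>t. \<Prod>i<d. ennreal (exponential_density 1 (t i)))"
    unfolding exp_coord_def
    by (rule PiM_density_lborel[OF _ prob_space_exponential_density]) auto
  also have "(\<lambda>t. \<Prod>i<d. ennreal (exponential_density 1 (t i)))
      = (\<lambda>t. indicator {t. \<forall>i<d. t i \<ge> 0} t * ennreal (exp (- (\<Sum>i<d. t i))))"
  proof
    fix t :: "nat \<Rightarrow> real"
    show "(\<Prod>i<d. ennreal (exponential_density 1 (t i))) = indicator {t. \<forall>i<d. t i \<ge> 0} t * ennreal (exp (- (\<Sum>i<d. t i)))"
    proof (cases "\<forall>i<d. t i \<ge> 0")
      case True
      then have "(\<Prod>i<d. ennreal (exponential_density 1 (t i))) = (\<Prod>i<d. ennreal (exp (- t i)))"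
        by (intro prod.cong) (auto simp: exponential_density_def)
      also have "\<dots> = ennreal (exp (- (\<Sum>i<d. t i)))"
        by (simp add: prod_ennreal exp_sum[symmetric] sum_negf)
      finally show ?thesis using True by simp
    next
      case False
      then obtain i where "i < d" "t i < 0" by (auto simp: not_le)
      then have "(\<Prod>i<d. ennreal (exponential_density 1 (t i))) = 0"
        by (intro prod_zero bexI[of _ i]) (auto simp: exponential_density_def)
      then show ?thesis using False by auto
    qed
  qed
  finally show ?thesis .
qed

text \<open>An exponential variable has mean 1 and second moment 2, hence variance 1. The two terms
  of the second moment bound, the squared norm of the sum and the sum of squared norms, come from
  here.\<close>

lemma exp_coord_integrals:
  fixes w :: "nat \<Rightarrow> rseq"
  shows "(\<integral>\<^sup>+t. indicator {t. \<forall>i<d. t i \<ge> 0} t * ennreal (exp (- (\<Sum>i<d. t i))) \<partial>coord_lborel d) = 1"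
    and "(\<integral>\<^sup>+t. indicator {t. \<forall>i<d. t i \<ge> 0} t * ennreal (exp (- (\<Sum>i<d. t i))) * ennreal ((norm (lin_comb w d t))\<^sup>2) \<partial>coord_lborel d)
      = ennreal ((norm (\<Sum>i<d. w i))\<^sup>2 + (\<Sum>i<d. (norm (w i))\<^sup>2))"
proof -
  let ?N = "density lborel (\<lambda>x. ennreal (exponential_density 1 x))"
  have meas [measurable]: "(\<lambda>t. indicator {t. \<forall>i<d. t i \<ge> 0} t * ennreal (exp (- (\<Sum>i<d. t i)))) \<in> borel_measurable (coord_lborel d)"
    by measurable
  have p: "prob_space ?N" by (rule prob_space_exponential_density) simp
  have pe: "prob_space (exp_coord d)" unfolding exp_coord_def by (rule prob_space_PiM) (rule p)
  interpret P: prob_space ?N by (rule p)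
  have dd: "distributed ?N lborel (\<lambda>x. x) (\<lambda>x. ennreal (exponential_density 1 x))"
    by (auto simp: distributed_def intro: distr_id2)
  have e1: "(LINT x|?N. x) = 1"
    using P.erlang_ith_moment[OF _ dd, of 1] by simp
  have e2: "(LINT x|?N. x\<^sup>2) = 2"
    using P.erlang_ith_moment[OF _ dd, of 2] by (simp add: fact_numeral)
  have i1: "integrable ?N (\<lambda>x. x)" using P.erlang_ith_moment_integrable[OF _ dd, of 1] by simp
  have i2: "integrable ?N (\<lambda>x. x\<^sup>2)" using P.erlang_ith_moment_integrable[OF _ dd, of 2] by simp
  have "(\<integral>\<^sup>+t. indicator {t. \<forall>i<d. t i \<ge> 0} t * ennreal (exp (- (\<Sum>i<d. t i))) \<partial>coord_lborel d)
      = emeasure (exp_coord d) (space (exp_coord d))"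
    unfolding exp_coord_density using meas by (subst emeasure_density) (auto intro!: nn_integral_cong)
  then show "(\<integral>\<^sup>+t. indicator {t. \<forall>i<d. t i \<ge> 0} t * ennreal (exp (- (\<Sum>i<d. t i))) \<partial>coord_lborel d) = 1"
    using prob_space.emeasure_space_1[OF pe] by simp
  note pl = product_norm_lin_comb[OF p _ i1 i2, of d w, folded exp_coord_def]
  have "(\<integral>\<^sup>+t. indicator {t. \<forall>i<d. t i \<ge> 0} t * ennreal (exp (- (\<Sum>i<d. t i))) * ennreal ((norm (lin_comb w d t))\<^sup>2) \<partial>coord_lborel d)
      = (\<integral>\<^sup>+t. ennreal ((norm (lin_comb w d t))\<^sup>2) \<partial>exp_coord d)"
    unfolding exp_coord_density using meas by (subst nn_integral_density) auto
  also have "\<dots> = ennreal (LINT t|exp_coord d. (norm (lin_comb w d t))\<^sup>2)"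
    by (rule nn_integral_eq_integral[OF pl(1)]) auto
  also have "(LINT t|exp_coord d. (norm (lin_comb w d t))\<^sup>2) = (norm (\<Sum>i<d. w i))\<^sup>2 + (\<Sum>i<d. (norm (w i))\<^sup>2)"
    using pl(2) by (simp add: e1 e2)
  finally show "(\<integral>\<^sup>+t. indicator {t. \<forall>i<d. t i \<ge> 0} t * ennreal (exp (- (\<Sum>i<d. t i))) * ennreal ((norm (lin_comb w d t))\<^sup>2) \<partial>coord_lborel d)
      = ennreal ((norm (\<Sum>i<d. w i))\<^sup>2 + (\<Sum>i<d. (norm (w i))\<^sup>2))" .
qed

subsection \<open>Optimal representations\<close>

text \<open>
  The cone over the polytope with vertex set \<open>W\<close> is triangulated by linear programming: a point is
  represented as a nonnegative combination of \<open>W\<close> of minimal cost, where the cost \<open>h\<close> is generic.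
\<close>

definition represents :: "rseq set \<Rightarrow> rseq \<Rightarrow> (rseq \<Rightarrow> real) \<Rightarrow> bool" where
  "represents W x l \<longleftrightarrow> (\<forall>w. l w \<ge> 0) \<and> (\<forall>w. w \<notin> W \<longrightarrow> l w = 0) \<and> (\<Sum>w\<in>W. l w *\<^sub>R w) = x"

definition rep_cost :: "rseq set \<Rightarrow> (rseq \<Rightarrow> real) \<Rightarrow> (rseq \<Rightarrow> real) \<Rightarrow> real" where
  "rep_cost W h l = (\<Sum>w\<in>W. l w * h w)"

definition optimal :: "rseq set \<Rightarrow> (rseq \<Rightarrow> real) \<Rightarrow> rseq \<Rightarrow> (rseq \<Rightarrow> real) \<Rightarrow> bool" where
  "optimal W h x l \<longleftrightarrow> represents W x l \<and> (\<forall>l'. represents W x l' \<longrightarrow> rep_cost W h l \<le> rep_cost W h l')"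

text \<open>The pivot step of the simplex method: as long as the support is dependent, moving along
  a dependency in the direction of non-increasing cost makes a coefficient vanish.\<close>

lemma basic_representation:
  assumes W: "finite W" and h: "\<And>w. w \<in> W \<Longrightarrow> h w > 0" and l: "represents W x l"
  shows "\<exists>l'. represents W x l' \<and> rep_cost W h l' \<le> rep_cost W h l \<and> independent {w. l' w \<noteq> 0}"
  using l
proof (induction "card {w. l w \<noteq> 0}" arbitrary: l rule: less_induct)
  case less
  define D where "D = {w. l w \<noteq> 0}"
  have DW: "D \<subseteq> W" using less.prems by (auto simp: D_def represents_def)
  have fD: "finite D" using DW W finite_subset by blast
  have lpos: "l w > 0" if "w \<in> D" for w using that less.prems by (auto simp: D_def represents_def order_less_le)
  show ?case
  proof (cases "independent D")
    case True
    then show ?thesis using less.prems by (auto simp: D_def)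
  next
    case False
    then obtain u where u: "(\<Sum>w\<in>D. u w *\<^sub>R w) = 0" "\<exists>w\<in>D. u w \<noteq> 0"
      using dependent_finite[OF fD] by auto
    \<comment> \<open>The sign of the dependency is chosen such that following it does not raise the
      cost.\<close>
    define u' where "u' = (if (\<Sum>w\<in>D. u w * h w) \<le> 0 then u else (\<lambda>w. - u w))"
    have u': "(\<Sum>w\<in>D. u' w *\<^sub>R w) = 0" "\<exists>w\<in>D. u' w \<noteq> 0" "(\<Sum>w\<in>D. u' w * h w) \<le> 0"
      using u by (auto simp: u'_def sum_negf)
    define N where "N = {w \<in> D. u' w < 0}"
    \<comment> \<open>Without a negative entry the cost would strictly increase, since all costs are
      positive; so the movement is bounded.\<close>
    have "N \<noteq> {}"
    proof
      assume "N = {}"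
      then have nn: "u' w \<ge> 0" if "w \<in> D" for w using that by (auto simp: N_def not_less)
      obtain w0 where w0: "w0 \<in> D" "u' w0 \<noteq> 0" using u'(2) by auto
      have "(\<Sum>w\<in>D. u' w * h w) > 0"
        using nn h DW w0 fD by (intro sum_pos2[of _ w0]) (auto intro!: mult_nonneg_nonneg mult_pos_pos simp: order_less_le)
      then show False using u'(3) by simp
    qed
    have fN: "finite N" using fD by (simp add: N_def)
    \<comment> \<open>The longest step that keeps all coefficients nonnegative; at
      \<open>w1\<close>, where the minimum is attained, the coefficient becomes 0.\<close>
    define \<tau> where "\<tau> = Min ((\<lambda>w. l w / (- u' w)) ` N)"
    have "\<tau> \<in> (\<lambda>w. l w / (- u' w)) ` N" unfolding \<tau>_def using fN \<open>N \<noteq> {}\<close> by (intro Min_in) auto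
    then obtain w1 where w1: "w1 \<in> N" "\<tau> = l w1 / (- u' w1)" by auto
    have \<tau>le: "\<tau> \<le> l w / (- u' w)" if "w \<in> N" for w unfolding \<tau>_def using fN that by (intro Min_le) auto
    have \<tau>pos: "\<tau> > 0" using w1 lpos[of w1] by (auto simp: N_def divide_pos_neg)
    define l' where "l' = (\<lambda>w. if w \<in> D then l w + \<tau> * u' w else 0)"
    have l'nn: "l' w \<ge> 0" for w
    proof (cases "w \<in> D")
      case True
      show ?thesis
      proof (cases "u' w < 0")
        case True
        then show ?thesis using \<tau>le[of w] \<open>w \<in> D\<close> by (auto simp: N_def l'_def field_simps)
      next
        case False
        then show ?thesis using \<tau>pos lpos[OF True] by (auto simp: l'_def intro!: add_nonneg_nonneg)
      qed
    qed (simp add: l'_def)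
    have sumD: "(\<Sum>w\<in>W. f w) = (\<Sum>w\<in>D. f w)" if "\<And>w. w \<notin> D \<Longrightarrow> f w = 0" for f :: "rseq \<Rightarrow> 'b::comm_monoid_add"
      using that DW W by (intro sum.mono_neutral_right) auto
    have lD: "l w = 0" if "w \<notin> D" for w using that by (simp add: D_def)
    have "(\<Sum>w\<in>W. l' w *\<^sub>R w) = (\<Sum>w\<in>D. l' w *\<^sub>R w)" by (rule sumD) (simp add: l'_def)
    also have "\<dots> = (\<Sum>w\<in>D. l w *\<^sub>R w) + \<tau> *\<^sub>R (\<Sum>w\<in>D. u' w *\<^sub>R w)"
      by (simp add: l'_def scaleR_add_left sum.distrib scaleR_sum_right)
    also have "(\<Sum>w\<in>D. l w *\<^sub>R w) = (\<Sum>w\<in>W. l w *\<^sub>R w)" by (rule sumD[symmetric]) (simp add: lD)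
    finally have rep: "represents W x l'"
      using less.prems u'(1) l'nn DW by (auto simp: represents_def l'_def)
    have "rep_cost W h l' = (\<Sum>w\<in>D. l' w * h w)" unfolding rep_cost_def by (rule sumD) (simp add: l'_def)
    also have "\<dots> = (\<Sum>w\<in>D. l w * h w) + \<tau> * (\<Sum>w\<in>D. u' w * h w)"
      by (simp add: l'_def distrib_right sum.distrib sum_distrib_left mult.assoc)
    also have "(\<Sum>w\<in>D. l w * h w) = rep_cost W h l" unfolding rep_cost_def by (rule sumD[symmetric]) (simp add: lD)
    finally have cost: "rep_cost W h l' \<le> rep_cost W h l"
      using \<tau>pos u'(3) by (simp add: mult_le_0_iff)
    have "l' w1 = 0" using w1 by (auto simp: l'_def N_def)
    moreover have "w1 \<in> D" using w1 by (simp add: N_def)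
    moreover have "{w. l' w \<noteq> 0} \<subseteq> D" by (auto simp: l'_def split: if_splits)
    ultimately have "{w. l' w \<noteq> 0} \<subset> D" by blast
    then have "card {w. l' w \<noteq> 0} < card {w. l w \<noteq> 0}"
      using fD psubset_card_mono unfolding D_def by blast
    from less.hyps[OF this rep] cost show ?thesis by (meson order_trans)
  qed
qed

text \<open>A representation with independent support is determined by its support, so there are
  finitely many; the cheapest of them is optimal among all representations by
  \<open>basic_representation\<close>.\<close>

lemma optimal_exists:
  assumes W: "finite W" and h: "\<And>w. w \<in> W \<Longrightarrow> h w > 0" and l: "represents W x l"
  shows "\<exists>l'. optimal W h x l' \<and> independent {w. l' w \<noteq> 0}"
proof -
  define B where "B = {l. represents W x l \<and> independent {w. l w \<noteq> 0}}"
  have "inj_on (\<lambda>l. {w. l w \<noteq> 0}) B"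
  proof (rule inj_onI)
    fix l l' assume ll: "l \<in> B" "l' \<in> B" "{w. l w \<noteq> 0} = {w. l' w \<noteq> 0}"
    define D where "D = {w. l w \<noteq> 0}"
    have D: "D \<subseteq> W" "finite D" "independent D"
      using ll(1) W finite_subset[of D W] by (auto simp: B_def D_def represents_def)
    have lx: "(\<Sum>w\<in>D. l w *\<^sub>R w) = x"
      using ll(1) D W sum.mono_neutral_left[of W D "\<lambda>w. l w *\<^sub>R w"] by (auto simp: B_def represents_def D_def)
    have lx': "(\<Sum>w\<in>D. l' w *\<^sub>R w) = x"
      using ll D W sum.mono_neutral_left[of W D "\<lambda>w. l' w *\<^sub>R w"] by (auto simp: B_def represents_def D_def)
    have "(\<Sum>w\<in>D. (l w - l' w) *\<^sub>R w) = 0" using lx lx' by (simp add: scaleR_diff_left sum_subtractf)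
    then have "\<forall>w\<in>D. l w - l' w = 0"
      using D(2,3) dependent_finite[OF D(2)] by (auto dest: spec[of _ "\<lambda>w. l w - l' w"])
    then show "l = l'" using ll(3) by (auto simp: fun_eq_iff D_def)
  qed
  moreover have "(\<lambda>l. {w. l w \<noteq> 0}) ` B \<subseteq> Pow W" by (auto simp: B_def represents_def)
  ultimately have fB: "finite B" using W by (meson finite_Pow_iff finite_imageD finite_subset)
  have "B \<noteq> {}" using basic_representation[where h = h, OF W h l] by (auto simp: B_def)
  then obtain l' where l': "l' \<in> B" "\<And>l. l \<in> B \<Longrightarrow> rep_cost W h l' \<le> rep_cost W h l"
    using arg_min_if_finite(1)[OF fB, of "rep_cost W h"] arg_min_least[OF fB, of _ "rep_cost W h"] by metis
  have "rep_cost W h l' \<le> rep_cost W h l2" if l2: "represents W x l2" for l2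
  proof -
    obtain l3 where "l3 \<in> B" "rep_cost W h l3 \<le> rep_cost W h l2"
      using basic_representation[where h = h, OF W h l2] by (auto simp: B_def)
    then show ?thesis using l'(2) by (meson order_trans)
  qed
  then show ?thesis using l'(1) by (auto simp: optimal_def B_def)
qed

text \<open>Optimality depends only on the support: if \<open>m\<close> were cheaper than
  \<open>l'\<close>, adding a small multiple of \<open>m - l'\<close> to \<open>l\<close> would
  improve \<open>l\<close>. Thus one optimal point with support \<open>J\<close> makes the whole
  cone over \<open>J\<close> optimal.\<close>

lemma optimal_support:
  assumes W: "finite W" and l: "optimal W h x0 l" and l': "represents W x l'"
    and sub: "\<And>w. l' w \<noteq> 0 \<Longrightarrow> l w \<noteq> 0"
  shows "optimal W h x l'"
  unfolding optimal_def
proof (intro conjI l' allI impI)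
  fix m assume m: "represents W x m"
  have rl: "represents W x0 l" using l by (simp add: optimal_def)
  have "\<exists>\<epsilon>>0. \<forall>w\<in>W. l w - \<epsilon> * l' w \<ge> 0"
  proof -
    \<comment> \<open>The quotients bound the admissible \<epsilon>; the element 1 keeps the set
      nonempty when \<open>l'\<close> vanishes.\<close>
    define R where "R = insert 1 ((\<lambda>w. l w / l' w) ` {w \<in> W. l' w \<noteq> 0})"
    have fR: "finite R" using W by (simp add: R_def)
    have pos: "\<forall>r\<in>R. r > 0" using sub rl l' by (auto simp: R_def represents_def order_less_le intro!: divide_pos_pos)
    have "Min R > 0" using fR pos by (subst Min_gr_iff) (auto simp: R_def)
    moreover have "l w - Min R * l' w \<ge> 0" if "w \<in> W" for w
    proof (cases "l' w = 0")
      case False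
      then have "Min R \<le> l w / l' w" using fR that by (intro Min_le) (auto simp: R_def)
      moreover have "l' w > 0" using False l' by (auto simp: represents_def order_less_le)
      ultimately show ?thesis by (simp add: field_simps)
    qed (use rl in \<open>auto simp: represents_def\<close>)
    ultimately show ?thesis by blast
  qed
  then obtain \<epsilon> where e: "\<epsilon> > 0" "\<And>w. w \<in> W \<Longrightarrow> l w - \<epsilon> * l' w \<ge> 0" by blast
  define k where "k = (\<lambda>w. l w + \<epsilon> * (m w - l' w))"
  have "represents W x0 k"
    unfolding represents_def
  proof (intro conjI allI impI)
    fix w show "k w \<ge> 0"
    proof (cases "w \<in> W")
      case True
      have "\<epsilon> * m w \<ge> 0" using e(1) m by (auto simp: represents_def)
      then show ?thesis using e(2)[OF True] by (simp add: k_def algebra_simps)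
    qed (use rl m l' in \<open>auto simp: k_def represents_def\<close>)
    show "w \<notin> W \<Longrightarrow> k w = 0" using rl m l' by (auto simp: k_def represents_def)
  next
    have "(\<Sum>w\<in>W. k w *\<^sub>R w) = (\<Sum>w\<in>W. l w *\<^sub>R w) + \<epsilon> *\<^sub>R ((\<Sum>w\<in>W. m w *\<^sub>R w) - (\<Sum>w\<in>W. l' w *\<^sub>R w))"
      by (simp add: k_def scaleR_add_left sum.distrib scaleR_sum_right sum_subtractf[symmetric] scaleR_diff_right scaleR_diff_left)
        (simp add: right_diff_distrib scaleR_diff_left)
    then show "(\<Sum>w\<in>W. k w *\<^sub>R w) = x0" using rl m l' by (simp add: represents_def)
  qed
  then have "rep_cost W h l \<le> rep_cost W h k" using l by (simp add: optimal_def)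
  also have "rep_cost W h k = rep_cost W h l + \<epsilon> * (rep_cost W h m - rep_cost W h l')"
    by (simp add: rep_cost_def k_def algebra_simps sum.distrib sum_distrib_left sum_subtractf)
  finally show "rep_cost W h l' \<le> rep_cost W h m" using e(1) by (simp add: zero_le_mult_iff)
qed

section \<open>Triangulation of the cone over a polytope\<close>

definition simplices :: "rseq set \<Rightarrow> nat \<Rightarrow> rseq set set" where
  "simplices W d = {J. J \<subseteq> W \<and> card J = d \<and> independent J}"

lemma convex_hull_represents:
  assumes "finite W"
  shows "x \<in> convex hull W \<longleftrightarrow> (\<exists>l. represents W x l \<and> sum l W = 1)"
proof
  assume "x \<in> convex hull W"
  then obtain u where u: "\<forall>w\<in>W. 0 \<le> u w" "sum u W = 1" "(\<Sum>w\<in>W. u w *\<^sub>R w) = x"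
    using assms by (auto simp: convex_hull_finite)
  have "represents W x (\<lambda>w. if w \<in> W then u w else 0)"
    using u by (auto simp: represents_def intro!: sum.cong)
  moreover have "sum (\<lambda>w. if w \<in> W then u w else 0) W = 1" using u(2) by (simp cong: sum.cong)
  ultimately show "\<exists>l. represents W x l \<and> sum l W = 1" by blast
next
  assume "\<exists>l. represents W x l \<and> sum l W = 1"
  then show "x \<in> convex hull W" using assms by (auto simp: convex_hull_finite represents_def)
qed

lemma represents_scale: "represents W x l \<Longrightarrow> s \<ge> 0 \<Longrightarrow> represents W (s *\<^sub>R x) (\<lambda>w. s * l w)"
  unfolding represents_def by (auto simp: scaleR_sum_right intro!: sum.cong)

lemma represents_add: "represents W x l \<Longrightarrow> represents W y m \<Longrightarrow> represents W (x + y) (\<lambda>w. l w + m w)"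
  unfolding represents_def by (auto simp: scaleR_add_left sum.distrib)

lemma nn_integral_exp_Ici:
  assumes "a \<ge> 0"
  shows "(\<integral>\<^sup>+s. indicator {a..} s * ennreal (exp (- s)) \<partial>lborel) = ennreal (exp (- a))"
proof -
  have "(\<integral>\<^sup>+s. indicator {a..} s * ennreal (exp (- s)) \<partial>lborel)
      = (\<integral>\<^sup>+s. indicator {a..} (a + 1 * s) * ennreal (exp (- (a + 1 * s))) \<partial>lborel)"
    by (subst nn_integral_real_affine[where c = 1 and t = a]) auto
  also have "\<dots> = (\<integral>\<^sup>+s. ennreal (exp (- a)) * (ennreal (s ^ 0 * exp (- s)) * indicator {0..} s) \<partial>lborel)"
    by (intro nn_integral_cong) (auto simp: indicator_def exp_add[symmetric] ennreal_mult[symmetric] split: if_splits)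
  also have "\<dots> = ennreal (exp (- a))"
    by (subst nn_integral_cmult) (auto simp: nn_intergal_power_times_exp_Ici simp del: power_0)
  finally show ?thesis .
qed

text \<open>For a convex body \<open>K\<close> around 0 this is \<open>exp\<close> of minus the
  Minkowski gauge, because \<open>x / s\<close> lies in \<open>K\<close> exactly for
  \<open>s\<close> from the gauge on. As an integral over \<open>s\<close> it is visibly measurable
  and open to Fubini.\<close>

definition gauge_exp :: "rseq set \<Rightarrow> rseq \<Rightarrow> ennreal" where
  "gauge_exp K x = (\<integral>\<^sup>+s. indicator {0<..} s * ennreal (exp (- s)) * indicator K ((1 / s) *\<^sub>R x) \<partial>lborel)"

lemma measurable_gauge_exp [measurable]:
  assumes [measurable]: "K \<in> sets borel"
  shows "gauge_exp K \<in> borel_measurable borel"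
  unfolding gauge_exp_def[abs_def] by measurable

text \<open>Integrating \<open>exp\<close> of minus the gauge of \<open>K\<close> turns \<open>K\<close> into a cone, on which coordinates are independent.\<close>

lemma nn_integral_gauge_exp:
  assumes c: "dual_frame F d c v" and [measurable]: "K \<in> sets borel"
  shows "(\<integral>\<^sup>+x. gauge_exp K x * ennreal ((norm x) ^ k) \<partial>frame_measure c d)
      = ennreal (fact (d + k)) * (\<integral>\<^sup>+x. indicator K x * ennreal ((norm x) ^ k) \<partial>frame_measure c d)"
proof -
  interpret M: sigma_finite_measure "frame_measure c d" by (rule sigma_finite_frame[OF c])
  interpret P: pair_sigma_finite lborel "frame_measure c d" ..
  let ?I = "\<integral>\<^sup>+x. indicator K x * ennreal ((norm x) ^ k) \<partial>frame_measure c d"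
  have "(\<integral>\<^sup>+x. gauge_exp K x * ennreal ((norm x) ^ k) \<partial>frame_measure c d)
      = (\<integral>\<^sup>+x. (\<integral>\<^sup>+s. indicator {0<..} s * ennreal (exp (- s)) * indicator K ((1 / s) *\<^sub>R x) * ennreal ((norm x) ^ k) \<partial>lborel) \<partial>frame_measure c d)"
    unfolding gauge_exp_def by (intro nn_integral_cong nn_integral_multc[symmetric]) measurable
  also have "\<dots> = (\<integral>\<^sup>+s. (\<integral>\<^sup>+x. indicator {0<..} s * ennreal (exp (- s)) * indicator K ((1 / s) *\<^sub>R x) * ennreal ((norm x) ^ k) \<partial>frame_measure c d) \<partial>lborel)"
    by (rule P.Fubini') measurable
  \<comment> \<open>For fixed \<open>s\<close> the substitution \<open>x = s y\<close> produces
    \<open>s^d\<close> from the measure and \<open>s^k\<close> from the norm; the remaining integral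
    over \<open>s\<close> is a Gamma integral.\<close>
  also have "\<dots> = (\<integral>\<^sup>+s. ennreal (s ^ (d + k) * exp (- s)) * indicator {0..} s * ?I \<partial>lborel)"
  proof (rule nn_integral_cong_AE)
    have "AE s in lborel. s \<noteq> (0::real)" by (rule AE_lborel_singleton)
    then show "AE s in lborel. (\<integral>\<^sup>+x. indicator {0<..} s * ennreal (exp (- s)) * indicator K ((1 / s) *\<^sub>R x) * ennreal ((norm x) ^ k) \<partial>frame_measure c d)
        = ennreal (s ^ (d + k) * exp (- s)) * indicator {0..} s * ?I"
    proof eventually_elim
      case (elim s)
      show ?case
      proof (cases "s > 0")
        case True
        have "(\<integral>\<^sup>+x. indicator {0<..} s * ennreal (exp (- s)) * indicator K ((1 / s) *\<^sub>R x) * ennreal ((norm x) ^ k) \<partial>frame_measure c d)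
          = (\<integral>\<^sup>+x. (\<lambda>y. ennreal (exp (- s) * s ^ k) * (indicator K y * ennreal ((norm y) ^ k))) ((1 / s) *\<^sub>R x) \<partial>frame_measure c d)"
        proof (rule nn_integral_cong)
          fix x :: rseq
          have "norm ((1 / s) *\<^sub>R x) = norm x / s" using True by simp
          then have "exp (- s) * norm x ^ k = exp (- s) * s ^ k * norm ((1 / s) *\<^sub>R x) ^ k"
            using True by (simp only: power_divide) simp
          then have "ennreal (exp (- s)) * ennreal (norm x ^ k) = ennreal (exp (- s) * s ^ k) * ennreal (norm ((1 / s) *\<^sub>R x) ^ k)"
            using True by (simp only: ennreal_mult[symmetric] exp_ge_zero zero_le_power norm_ge_zero mult_nonneg_nonneg less_imp_le)
          moreover define y where "y = (1 / s) *\<^sub>R x"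
          ultimately have "ennreal (exp (- s)) * ennreal (norm x ^ k) = ennreal (exp (- s) * s ^ k) * ennreal (norm y ^ k)"
            by (simp only: y_def)
          then show "indicator {0<..} s * ennreal (exp (- s)) * indicator K ((1 / s) *\<^sub>R x) * ennreal ((norm x) ^ k)
            = (\<lambda>y. ennreal (exp (- s) * s ^ k) * (indicator K y * ennreal ((norm y) ^ k))) ((1 / s) *\<^sub>R x)"
            using True unfolding y_def[symmetric] by (cases "y \<in> K") simp_all
        qed
        also have "\<dots> = ennreal (1 / (1 / s) ^ d) * (\<integral>\<^sup>+y. ennreal (exp (- s) * s ^ k) * (indicator K y * ennreal ((norm y) ^ k)) \<partial>frame_measure c d)"
          using True by (intro nn_integral_frame_scale[OF c]) auto
        also have "\<dots> = ennreal (s ^ d) * (ennreal (exp (- s) * s ^ k) * ?I)"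
          using True by (simp add: nn_integral_cmult power_one_over)
        also have "\<dots> = ennreal (s ^ (d + k) * exp (- s)) * ?I"
          using True by (simp add: power_add ennreal_mult mult_ac)
        finally show ?thesis using True by simp
      next
        case False
        then show ?thesis using elim by simp
      qed
    qed
  qed
  also have "\<dots> = (\<integral>\<^sup>+s. ennreal (s ^ (d + k) * exp (- s)) * indicator {0..} s \<partial>lborel) * ?I"
    by (rule nn_integral_multc) measurable
  also have "\<dots> = ennreal (fact (d + k)) * ?I"
    by (simp add: nn_intergal_power_times_exp_Ici)
  finally show ?thesis .
qed

text \<open>With constant cost 1 the minimal cost of representing \<open>x\<close> is the gauge of
  the polytope, but optimal bases may overlap when the polytope has faces that are not simplices.
  The cost \<open>h\<close> is a perturbation in \<open>[\<zeta>, 1]\<close>; \<open>generic\<close>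
  says that the reduced cost of a vertex outside a basis never vanishes, so that different bases
  have different cost functionals.\<close>

locale weighted_vertices =
  fixes F :: "rseq set" and d :: nat and c :: "nat \<Rightarrow> rseq" and W :: "rseq set" and h :: "rseq \<Rightarrow> real"
    and wf vf :: "rseq set \<Rightarrow> nat \<Rightarrow> rseq" and \<zeta> :: real
  assumes c: "orthonormal_basis F d c" and finW: "finite W" and WF: "W \<subseteq> F"
    and zeta: "\<zeta> > 0" "\<zeta> \<le> 1" and h: "w \<in> W \<Longrightarrow> \<zeta> \<le> h w" "w \<in> W \<Longrightarrow> h w \<le> 1"
    and feasible: "x \<in> F \<Longrightarrow> \<exists>l. represents W x l" and zero: "0 \<in> convex hull W"
    and bij: "J \<in> simplices W d \<Longrightarrow> bij_betw (wf J) {..<d} J"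
    and dual: "J \<in> simplices W d \<Longrightarrow> dual_frame F d (wf J) (vf J)"
    and generic: "J \<in> simplices W d \<Longrightarrow> w \<in> W - J \<Longrightarrow> (\<Sum>i<d. h (wf J i) * (w \<bullet> vf J i)) \<noteq> h w"
begin

abbreviation "M \<equiv> frame_measure c d"

lemma dc: "dual_frame F d c c" by (rule onb_dual_frame[OF c])

lemma hpos: "w \<in> W \<Longrightarrow> h w > 0" using h(1) zeta(1) by force

text \<open>The dual solution of the linear program at the basis \<open>J\<close>: the functional on
  \<open>F\<close> with value \<open>h w\<close> at every \<open>w\<close> in
  \<open>J\<close>.\<close>

definition cost_vec :: "rseq set \<Rightarrow> rseq" where
  "cost_vec J = (\<Sum>i<d. h (wf J i) *\<^sub>R vf J i)"

definition vcone :: "rseq set \<Rightarrow> rseq set" where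
  "vcone J = {x. \<forall>i<d. x \<bullet> vf J i \<ge> 0}"

text \<open>\<open>J\<close> is an optimal basis at some point; by \<open>optimal_support\<close> it
  then is optimal on the whole cone \<open>vcone J\<close> in \<open>F\<close>.\<close>

definition good :: "rseq set \<Rightarrow> bool" where
  "good J \<longleftrightarrow> J \<in> simplices W d \<and> (\<exists>x l. optimal W h x l \<and> {w. l w \<noteq> 0} = J)"

definition coef :: "rseq set \<Rightarrow> rseq \<Rightarrow> rseq \<Rightarrow> real" where
  "coef J x w = (if w \<in> J then x \<bullet> vf J (inv_into {..<d} (wf J) w) else 0)"

lemma finite_simplices: "finite (simplices W d)"
  by (rule finite_subset[of _ "Pow W"]) (auto simp: simplices_def finW)

lemma sets_vcone [measurable]: "vcone J \<in> sets borel"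
  unfolding vcone_def by measurable

lemma sum_coef:
  assumes J: "J \<in> simplices W d"
  shows "(\<Sum>w\<in>W. coef J x w *\<^sub>R g w) = (\<Sum>i<d. (x \<bullet> vf J i) *\<^sub>R (g (wf J i) :: 'b::real_vector))"
proof -
  have JW: "J \<subseteq> W" using J by (simp add: simplices_def)
  have "(\<Sum>w\<in>W. coef J x w *\<^sub>R g w) = (\<Sum>w\<in>J. coef J x w *\<^sub>R g w)"
    using JW finW by (intro sum.mono_neutral_right) (auto simp: coef_def)
  also have "\<dots> = (\<Sum>i<d. coef J x (wf J i) *\<^sub>R g (wf J i))"
    by (rule sum.reindex_bij_betw[OF bij[OF J], symmetric])
  also have "\<dots> = (\<Sum>i<d. (x \<bullet> vf J i) *\<^sub>R g (wf J i))"
    using bij[OF J] by (intro sum.cong) (auto simp: coef_def bij_betw_def inv_into_f_f)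
  finally show ?thesis .
qed

lemma represents_coef:
  assumes J: "J \<in> simplices W d" and x: "x \<in> F" "x \<in> vcone J"
  shows "represents W x (coef J x)"
proof -
  have "(\<Sum>w\<in>W. coef J x w *\<^sub>R w) = x"
    using sum_coef[OF J, of x "\<lambda>w. w"] dual_frame_expand[OF dual[OF J] x(1)] by (simp add: lin_comb_def)
  moreover have "coef J x w \<ge> 0" for w
    using x(2) bij[OF J] inv_into_into[of w "wf J" "{..<d}"] by (auto simp: coef_def vcone_def bij_betw_def)
  ultimately show ?thesis using J by (auto simp: represents_def coef_def simplices_def)
qed

lemma cost_coef:
  assumes J: "J \<in> simplices W d"
  shows "rep_cost W h (coef J x) = x \<bullet> cost_vec J"
  using sum_coef[OF J, of x h] by (simp add: rep_cost_def cost_vec_def inner_sum_right mult.commute)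

lemma good_optimal:
  assumes J: "good J" and x: "x \<in> F" "x \<in> vcone J"
  shows "optimal W h x (coef J x)"
proof -
  obtain x0 l where l: "optimal W h x0 l" "{w. l w \<noteq> 0} = J" and Js: "J \<in> simplices W d"
    using J by (auto simp: good_def)
  show ?thesis
  proof (rule optimal_support[OF finW l(1) represents_coef[OF Js x]])
    fix w assume "coef J x w \<noteq> 0"
    then have "w \<in> J" by (auto simp: coef_def split: if_splits)
    then show "l w \<noteq> 0" using l(2) by auto
  qed
qed

text \<open>Off the finitely many spans of fewer than \<open>d\<close> vertices, an optimal
  representation with independent support must use exactly \<open>d\<close> vertices, and these form
  a good basis.\<close>

lemma AE_cover: "AE x in M. \<exists>J. good J \<and> x \<in> vcone J"
proof -
  define \<D> where "\<D> = {D. D \<subseteq> W \<and> card D < d}"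
  have "finite \<D>" by (rule finite_subset[of _ "Pow W"]) (auto simp: \<D>_def finW)
  then have "AE x in M. \<forall>D\<in>\<D>. x \<notin> span D"
    using proper_subspace_null[OF c] WF finW
    by (intro AE_finite_allI) (auto simp: \<D>_def finite_subset)
  then show ?thesis using AE_frame[OF dc]
  proof eventually_elim
    case (elim x)
    obtain l0 where "represents W x l0" using feasible elim by blast
    then obtain l where l: "optimal W h x l" "independent {w. l w \<noteq> 0}"
      using optimal_exists[where h = h, OF finW hpos] by blast
    define D where "D = {w. l w \<noteq> 0}"
    have rep: "represents W x l" using l(1) by (simp add: optimal_def)
    have DW: "D \<subseteq> W" using rep by (auto simp: D_def represents_def)
    have fD: "finite D" using DW finW finite_subset by blast
    have xD: "x = (\<Sum>w\<in>D. l w *\<^sub>R w)"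
      using rep DW finW sum.mono_neutral_left[of W D "\<lambda>w. l w *\<^sub>R w"] by (auto simp: represents_def D_def)
    have "x \<in> span D" by (subst xD) (intro span_sum span_scale span_base)
    then have "card D \<ge> d" using elim DW by (auto simp: \<D>_def not_less)
    moreover have "card D \<le> d"
    proof -
      have "card D \<le> card (c ` {..<d})"
        using independent_span_bound[of "c ` {..<d}" D] l(2) DW WF dual_frame_span[OF dc] by (auto simp: D_def)
      also have "\<dots> \<le> d" using card_image_le[of "{..<d}" c] by simp
      finally show ?thesis .
    qed
    ultimately have Ds: "D \<in> simplices W d" using DW l(2) by (simp add: simplices_def D_def)
    have "x = lin_comb (wf D) d (\<lambda>i. l (wf D i))"
      unfolding lin_comb_def by (subst sum.reindex_bij_betw[OF bij[OF Ds]]) (rule xD)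
    then have "x \<bullet> vf D i = l (wf D i)" if "i < d" for i
      using dual_frame_coeff[OF dual[OF Ds] that] by metis
    then have "x \<in> vcone D" using rep by (simp add: vcone_def represents_def)
    moreover have "good D" unfolding good_def using Ds l(1) by (auto simp: D_def)
    ultimately show ?case by blast
  qed
qed

lemma cost_vec_mem: "J \<in> simplices W d \<Longrightarrow> cost_vec J \<in> F"
  using dual[of J] unfolding cost_vec_def
  by (intro subspace_sum subspace_scale) (auto simp: dual_frame_def)

text \<open>If the functionals agreed, a vertex of \<open>J'\<close> outside \<open>J\<close> would
  have the value \<open>h w\<close> under \<open>cost_vec J\<close>, which \<open>generic\<close>
  excludes.\<close>

lemma cost_vec_ne:
  assumes J: "J \<in> simplices W d" and J': "J' \<in> simplices W d" and "J \<noteq> J'"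
  shows "cost_vec J \<noteq> cost_vec J'"
proof
  assume eq: "cost_vec J = cost_vec J'"
  have "\<not> J' \<subseteq> J"
    using assms finW card_seteq[of J J'] finite_subset[of J W] by (auto simp: simplices_def)
  then obtain w where w: "w \<in> J'" "w \<notin> J" by auto
  then obtain k where k: "k < d" "w = wf J' k" using bij[OF J'] by (auto simp: bij_betw_def)
  have "w \<bullet> cost_vec J' = (\<Sum>i<d. h (wf J' i) * (if i = k then 1 else 0))"
    unfolding cost_vec_def inner_sum_right using dual[OF J'] k by (intro sum.cong) (auto simp: dual_frame_def)
  also have "\<dots> = h w" using k by (simp add: if_distrib cong: if_cong)
  finally have "(\<Sum>i<d. h (wf J i) * (w \<bullet> vf J i)) = h w"
    unfolding eq[symmetric] by (simp add: cost_vec_def inner_sum_right)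
  moreover have "w \<in> W - J" using w J' by (auto simp: simplices_def)
  ultimately show False using generic[OF J] by blast
qed

text \<open>On a common part of two good cones both bases are optimal, so their costs coincide;
  distinct cost functionals agree only on a hyperplane.\<close>

lemma AE_unique: "AE x in M. \<forall>J\<in>simplices W d. \<forall>J'\<in>simplices W d. J \<noteq> J' \<longrightarrow> good J \<longrightarrow> good J' \<longrightarrow> x \<notin> vcone J \<or> x \<notin> vcone J'"
proof (intro AE_finite_allI finite_simplices)
  fix J J' assume JJ: "J \<in> simplices W d" "J' \<in> simplices W d"
  show "AE x in M. J \<noteq> J' \<longrightarrow> good J \<longrightarrow> good J' \<longrightarrow> x \<notin> vcone J \<or> x \<notin> vcone J'"
  proof (cases "J = J' \<or> \<not> good J \<or> \<not> good J'")
    case False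
    then have g: "J \<noteq> J'" "good J" "good J'" by auto
    have "AE x in M. x \<bullet> (cost_vec J - cost_vec J') \<noteq> 0"
      using cost_vec_ne[OF JJ g(1)] cost_vec_mem JJ subspace_diff[OF dual_frame_subspace[OF dc]]
      by (intro hyperplane_null[OF dc]) auto
    then show ?thesis using AE_frame[OF dc]
    proof eventually_elim
      case (elim x)
      show ?case
      proof (rule ccontr)
        assume "\<not> ?thesis"
        then have x: "x \<in> vcone J" "x \<in> vcone J'" by auto
        have "optimal W h x (coef J x)" "optimal W h x (coef J' x)"
          using good_optimal g x elim by auto
        then have "rep_cost W h (coef J x) = rep_cost W h (coef J' x)"
          by (auto simp: optimal_def intro!: antisym)
        then show False using elim by (simp add: cost_coef JJ inner_diff_right)
      qed
    qed
  qed auto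
qed

definition piece :: "rseq set \<Rightarrow> rseq \<Rightarrow> ennreal" where
  "piece J x = indicator (vcone J) x * ennreal (exp (- (x \<bullet> cost_vec J)))"

lemma measurable_piece [measurable]: "piece J \<in> borel_measurable borel"
  unfolding piece_def[abs_def] by measurable

text \<open>Costs are at most 1, hence the optimal cost \<open>l\<close> is at most every
  \<open>s\<close> with \<open>x / s\<close> in the polytope.\<close>

lemma gauge_exp_le:
  assumes J: "good J" and x: "x \<in> F" "x \<in> vcone J"
  shows "gauge_exp (convex hull W) x \<le> ennreal (exp (- (x \<bullet> cost_vec J)))"
proof -
  define l where "l = x \<bullet> cost_vec J"
  have opt: "optimal W h x (coef J x)" by (rule good_optimal[OF assms])
  have cost: "rep_cost W h (coef J x) = l"
    unfolding l_def using J by (intro cost_coef) (simp add: good_def)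
  have l0: "l \<ge> 0" unfolding cost[symmetric] rep_cost_def
    using opt hpos by (intro sum_nonneg mult_nonneg_nonneg) (auto simp: optimal_def represents_def less_imp_le)
  have "s \<ge> l" if s: "s > 0" "(1 / s) *\<^sub>R x \<in> convex hull W" for s
  proof -
    obtain m where m: "represents W ((1 / s) *\<^sub>R x) m" "sum m W = 1"
      using s(2) convex_hull_represents[OF finW] by blast
    have "represents W x (\<lambda>w. s * m w)" using represents_scale[OF m(1), of s] s(1) by simp
    then have "l \<le> rep_cost W h (\<lambda>w. s * m w)" using opt cost by (auto simp: optimal_def)
    also have "\<dots> \<le> (\<Sum>w\<in>W. s * m w * 1)"
      unfolding rep_cost_def using h(2) m(1) s(1) by (intro sum_mono mult_left_mono) (auto simp: represents_def)
    also have "\<dots> = s" using m(2) by (simp add: sum_distrib_left[symmetric])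
    finally show ?thesis .
  qed
  then have "gauge_exp (convex hull W) x \<le> (\<integral>\<^sup>+s. indicator {l..} s * ennreal (exp (- s)) \<partial>lborel)"
    unfolding gauge_exp_def by (intro nn_integral_mono) (auto simp: indicator_def)
  also have "\<dots> = ennreal (exp (- l))" by (rule nn_integral_exp_Ici[OF l0])
  finally show ?thesis by (simp add: l_def)
qed

text \<open>Costs are at least \<zeta>, hence the total weight of \<zeta> times the representation
  is at most the optimal cost \<open>l\<close>, and \<open>\<zeta> x / s\<close> lies in the
  polytope for all \<open>s >= l\<close>.\<close>

lemma gauge_exp_ge:
  assumes J: "good J" and x: "x \<in> F" "x \<in> vcone J"
  shows "ennreal (exp (- (x \<bullet> cost_vec J))) \<le> gauge_exp (convex hull W) (\<zeta> *\<^sub>R x)"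
proof -
  define l where "l = x \<bullet> cost_vec J"
  have Js: "J \<in> simplices W d" using J by (simp add: good_def)
  have rep: "represents W x (coef J x)" by (rule represents_coef[OF Js x])
  have cost: "rep_cost W h (coef J x) = l" unfolding l_def by (rule cost_coef[OF Js])
  have l0: "l \<ge> 0" unfolding cost[symmetric] rep_cost_def
    using rep hpos by (intro sum_nonneg mult_nonneg_nonneg) (auto simp: represents_def less_imp_le)
  have "\<zeta> * sum (coef J x) W \<le> l"
    unfolding cost[symmetric] rep_cost_def sum_distrib_left
  proof (rule sum_mono)
    fix w assume "w \<in> W"
    then show "\<zeta> * coef J x w \<le> coef J x w * h w"
      using h(1) rep mult_left_mono[of \<zeta> "h w" "coef J x w"] by (simp add: represents_def mult.commute)
  qed
  moreover have rep\<zeta>: "represents W (\<zeta> *\<^sub>R x) (\<lambda>w. \<zeta> * coef J x w)"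
    using represents_scale[OF rep] zeta by simp
  ultimately have mem: "(1 / s) *\<^sub>R (\<zeta> *\<^sub>R x) \<in> convex hull W" if s: "s > 0" "s \<ge> l" for s
  proof -
    obtain m where m: "represents W 0 m" "sum m W = 1"
      using zero convex_hull_represents[OF finW] by blast
    \<comment> \<open>The weight used by the point itself; the missing \<open>1 - t\<close> is spent
      on a representation of 0.\<close>
    define t where "t = \<zeta> * sum (coef J x) W / s"
    have t: "t \<le> 1" using s \<open>\<zeta> * sum (coef J x) W \<le> l\<close> by (simp add: t_def)
    have "represents W ((1 / s) *\<^sub>R (\<zeta> *\<^sub>R x) + (1 - t) *\<^sub>R 0) (\<lambda>w. (1 / s) * (\<zeta> * coef J x w) + (1 - t) * m w)"
      using s t by (intro represents_add represents_scale rep\<zeta> m) auto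
    moreover have "sum (\<lambda>w. (1 / s) * (\<zeta> * coef J x w) + (1 - t) * m w) W = 1"
      using s m(2) by (simp add: sum.distrib sum_distrib_left[symmetric] t_def sum_divide_distrib[symmetric])
    ultimately show ?thesis using convex_hull_represents[OF finW] by auto
  qed
  have "ennreal (exp (- l)) = (\<integral>\<^sup>+s. indicator {l..} s * ennreal (exp (- s)) \<partial>lborel)"
    by (rule nn_integral_exp_Ici[OF l0, symmetric])
  also have "\<dots> \<le> gauge_exp (convex hull W) (\<zeta> *\<^sub>R x)"
    unfolding gauge_exp_def
  proof (rule nn_integral_mono_AE)
    have "AE s in lborel. s \<noteq> (0::real)" by (rule AE_lborel_singleton)
    then show "AE s in lborel. indicator {l..} s * ennreal (exp (- s))
        \<le> indicator {0<..} s * ennreal (exp (- s)) * indicator (convex hull W) ((1 / s) *\<^sub>R (\<zeta> *\<^sub>R x))"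
    proof eventually_elim
      case (elim s)
      then show ?case using mem[of s] l0 by (cases "s \<ge> l") auto
    qed
  qed
  finally show ?thesis by (simp add: l_def)
qed

text \<open>In the coordinates of the cone the piece is \<open>exp (- \<Sum> h i * t i)\<close> on
  the positive orthant. Comparison with cost 1 leads to independent exponential variables and costs
  only a power of \<zeta>; the unknown factor \<kappa> of the frame drops out of the
  quotient.\<close>

lemma piece_bound:
  assumes J: "J \<in> simplices W d" and B: "(norm (\<Sum>J))\<^sup>2 + (\<Sum>w\<in>J. (norm w)\<^sup>2) \<le> B"
  shows "(\<integral>\<^sup>+x. piece J x * ennreal ((norm x)\<^sup>2) \<partial>M) \<le> ennreal (B / \<zeta> ^ (d + 2)) * (\<integral>\<^sup>+x. piece J x \<partial>M)"
proof -
  note dw = dual[OF J]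
  obtain \<kappa> where k: "\<kappa> > 0" "M = scale_measure (ennreal \<kappa>) (frame_measure (wf J) d)"
    using frame_measure_scale[OF dc dw] by blast
  have hb: "\<zeta> \<le> h (wf J i)" "h (wf J i) \<le> 1" if "i < d" for i
  proof -
    have "wf J i \<in> W" using that bij[OF J] J by (auto simp: bij_betw_def simplices_def)
    then show "\<zeta> \<le> h (wf J i)" "h (wf J i) \<le> 1" using h by auto
  qed
  have B0: "B \<ge> 0" using B by (smt (verit) sum_nonneg zero_le_power2)
  define e where "e = (\<lambda>t::nat \<Rightarrow> real. indicator {t. \<forall>i<d. t i \<ge> 0} t * ennreal (exp (- (\<Sum>i<d. t i))))"
  have [measurable]: "e \<in> borel_measurable (coord_lborel d)" unfolding e_def by measurable
  have cone: "indicator (vcone J) (lin_comb (wf J) d t) = (indicator {t. \<forall>i<d. t i \<ge> 0} t :: ennreal)" for t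
    using dual_frame_coeff[OF dw, of _ t] by (auto simp: vcone_def indicator_def)
  have cost: "lin_comb (wf J) d t \<bullet> cost_vec J = (\<Sum>i<d. h (wf J i) * t i)" for t
    using dual_frame_coeff[OF dw, of _ t] by (simp add: cost_vec_def inner_sum_right)
  have "1 = (\<integral>\<^sup>+t. e t \<partial>coord_lborel d)" unfolding e_def by (simp add: exp_coord_integrals(1))
  also have "\<dots> \<le> (\<integral>\<^sup>+t. piece J (lin_comb (wf J) d t) \<partial>coord_lborel d)"
  proof (rule nn_integral_mono)
    fix t :: "nat \<Rightarrow> real"
    show "e t \<le> piece J (lin_comb (wf J) d t)"
    proof (cases "\<forall>i<d. t i \<ge> 0")
      case True
      have "(\<Sum>i<d. h (wf J i) * t i) \<le> (\<Sum>i<d. 1 * t i)"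
        using True hb by (intro sum_mono mult_right_mono) auto
      then show ?thesis using True by (simp add: piece_def e_def cone cost)
    qed (simp add: e_def)
  qed
  also have "\<dots> = (\<integral>\<^sup>+x. piece J x \<partial>frame_measure (wf J) d)" by (simp add: nn_integral_frame)
  finally have lower: "1 \<le> (\<integral>\<^sup>+x. piece J x \<partial>frame_measure (wf J) d)" .
  \<comment> \<open>Dilating by \<open>1 / \<zeta>\<close> raises all costs to at least 1; the
    measure contributes \<open>\<zeta>^(-d)\<close> and the squared norm
    \<open>\<zeta>^(-2)\<close>.\<close>
  have "(\<integral>\<^sup>+x. piece J x * ennreal ((norm x)\<^sup>2) \<partial>frame_measure (wf J) d)
      = ennreal (1 / \<zeta> ^ d) * (\<integral>\<^sup>+x. piece J ((1 / \<zeta>) *\<^sub>R x) * ennreal ((norm ((1 / \<zeta>) *\<^sub>R x))\<^sup>2) \<partial>frame_measure (wf J) d)"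
    using zeta nn_integral_frame_scale[OF dw, of "1 / \<zeta>" "\<lambda>x. piece J x * ennreal ((norm x)\<^sup>2)"]
    by (simp add: power_one_over mult.assoc[symmetric] ennreal_mult[symmetric])
  also have "(\<integral>\<^sup>+x. piece J ((1 / \<zeta>) *\<^sub>R x) * ennreal ((norm ((1 / \<zeta>) *\<^sub>R x))\<^sup>2) \<partial>frame_measure (wf J) d)
      = (\<integral>\<^sup>+t. piece J ((1 / \<zeta>) *\<^sub>R lin_comb (wf J) d t) * ennreal ((norm ((1 / \<zeta>) *\<^sub>R lin_comb (wf J) d t))\<^sup>2) \<partial>coord_lborel d)"
    by (rule nn_integral_frame) measurable
  also have "\<dots> \<le> (\<integral>\<^sup>+t. ennreal (1 / \<zeta>\<^sup>2) * (e t * ennreal ((norm (lin_comb (wf J) d t))\<^sup>2)) \<partial>coord_lborel d)"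
  proof (rule nn_integral_mono)
    fix t :: "nat \<Rightarrow> real"
    have "piece J ((1 / \<zeta>) *\<^sub>R lin_comb (wf J) d t) \<le> e t"
    proof (cases "\<forall>i<d. t i \<ge> 0")
      case True
      have "(\<Sum>i<d. \<zeta> * t i) \<le> (\<Sum>i<d. h (wf J i) * t i)"
        using True hb by (intro sum_mono mult_right_mono) auto
      then have "(\<Sum>i<d. t i) \<le> (1 / \<zeta>) * (\<Sum>i<d. h (wf J i) * t i)"
        using zeta by (simp add: sum_distrib_left[symmetric] field_simps)
      then show ?thesis using True by (simp add: piece_def e_def cost) (auto simp: indicator_def)
    next
      case False
      then have "(1 / \<zeta>) *\<^sub>R lin_comb (wf J) d t \<notin> vcone J"
        using zeta dual_frame_coeff[OF dw, of _ t] by (auto simp: vcone_def zero_le_divide_iff)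
      then show ?thesis by (simp add: piece_def)
    qed
    moreover have "ennreal ((norm ((1 / \<zeta>) *\<^sub>R lin_comb (wf J) d t))\<^sup>2) = ennreal (1 / \<zeta>\<^sup>2) * ennreal ((norm (lin_comb (wf J) d t))\<^sup>2)"
      using zeta by (simp add: ennreal_mult[symmetric] power_divide)
    ultimately show "piece J ((1 / \<zeta>) *\<^sub>R lin_comb (wf J) d t) * ennreal ((norm ((1 / \<zeta>) *\<^sub>R lin_comb (wf J) d t))\<^sup>2)
        \<le> ennreal (1 / \<zeta>\<^sup>2) * (e t * ennreal ((norm (lin_comb (wf J) d t))\<^sup>2))"
      by (metis mult.left_commute mult_right_mono zero_le)
  qed
  also have "\<dots> = ennreal (1 / \<zeta>\<^sup>2) * ennreal ((norm (\<Sum>i<d. wf J i))\<^sup>2 + (\<Sum>i<d. (norm (wf J i))\<^sup>2))"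
    using exp_coord_integrals(2)[of d "wf J"] by (simp add: nn_integral_cmult e_def)
  also have "(\<Sum>i<d. wf J i) = \<Sum>J" by (rule sum.reindex_bij_betw[OF bij[OF J]])
  also have "(\<Sum>i<d. (norm (wf J i))\<^sup>2) = (\<Sum>w\<in>J. (norm w)\<^sup>2)" by (rule sum.reindex_bij_betw[OF bij[OF J]])
  also have "ennreal (1 / \<zeta>\<^sup>2) * ennreal ((norm (\<Sum>J))\<^sup>2 + (\<Sum>w\<in>J. (norm w)\<^sup>2)) \<le> ennreal (1 / \<zeta>\<^sup>2) * ennreal B"
    using B by (intro mult_left_mono ennreal_leI) auto
  finally have "(\<integral>\<^sup>+x. piece J x * ennreal ((norm x)\<^sup>2) \<partial>frame_measure (wf J) d) \<le> ennreal (1 / \<zeta> ^ d) * (ennreal (1 / \<zeta>\<^sup>2) * ennreal B)"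
    by (simp add: mult_left_mono)
  also have "\<dots> = ennreal (B / \<zeta> ^ (d + 2)) * 1"
    using zeta B0 by (simp add: ennreal_mult[symmetric] power_add power2_eq_square)
  also have "\<dots> \<le> ennreal (B / \<zeta> ^ (d + 2)) * (\<integral>\<^sup>+x. piece J x \<partial>frame_measure (wf J) d)"
    using lower by (rule mult_left_mono) simp
  finally show ?thesis
    unfolding k(2) by (simp add: nn_integral_scale_measure mult_left_mono mult.left_commute)
qed

text \<open>The pieces dominate \<open>exp\<close> of minus the gauge from above, and their sum is
  dominated by the same function dilated by \<zeta>. So the bound for single pieces passes to the
  polytope, and the factorials come from \<open>nn_integral_gauge_exp\<close> with exponents 2 and
  0.\<close>

lemma second_moment_bound:
  assumes B: "\<And>J. J \<in> simplices W d \<Longrightarrow> (norm (\<Sum>J))\<^sup>2 + (\<Sum>w\<in>J. (norm w)\<^sup>2) \<le> B" and B0: "B \<ge> 0"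
  shows "ennreal (fact (d + 2)) * (\<integral>\<^sup>+x. indicator (convex hull W) x * ennreal ((norm x)\<^sup>2) \<partial>M)
     \<le> ennreal (B / \<zeta> ^ (d + 2)) * (ennreal (1 / \<zeta> ^ d) * (ennreal (fact d) * emeasure M (convex hull W)))"
proof -
  have [measurable]: "convex hull W \<in> sets borel"
    by (intro borel_compact finite_imp_compact_convex_hull finW)
  define G where "G = {J \<in> simplices W d. good J}"
  have fG: "finite G" using finite_simplices by (simp add: G_def)
  have "ennreal (fact (d + 2)) * (\<integral>\<^sup>+x. indicator (convex hull W) x * ennreal ((norm x)\<^sup>2) \<partial>M)
      = (\<integral>\<^sup>+x. gauge_exp (convex hull W) x * ennreal ((norm x)\<^sup>2) \<partial>M)"
    by (simp add: nn_integral_gauge_exp[OF dc])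
  also have "\<dots> \<le> (\<integral>\<^sup>+x. (\<Sum>J\<in>G. piece J x * ennreal ((norm x)\<^sup>2)) \<partial>M)"
  proof (rule nn_integral_mono_AE)
    show "AE x in M. gauge_exp (convex hull W) x * ennreal ((norm x)\<^sup>2) \<le> (\<Sum>J\<in>G. piece J x * ennreal ((norm x)\<^sup>2))"
      using AE_cover AE_frame[OF dc]
    proof eventually_elim
      case (elim x)
      then obtain J where J: "good J" "x \<in> vcone J" by blast
      have "gauge_exp (convex hull W) x \<le> piece J x"
        using gauge_exp_le[OF J(1) _ J(2)] elim J by (simp add: piece_def)
      then have "gauge_exp (convex hull W) x * ennreal ((norm x)\<^sup>2) \<le> piece J x * ennreal ((norm x)\<^sup>2)"
        by (rule mult_right_mono) simp
      also have "\<dots> \<le> (\<Sum>J\<in>G. piece J x * ennreal ((norm x)\<^sup>2))"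
        using J fG by (intro member_le_sum) (auto simp: G_def good_def)
      finally show ?case .
    qed
  qed
  also have "\<dots> = (\<Sum>J\<in>G. \<integral>\<^sup>+x. piece J x * ennreal ((norm x)\<^sup>2) \<partial>M)"
    by (rule nn_integral_sum) measurable
  also have "\<dots> \<le> (\<Sum>J\<in>G. ennreal (B / \<zeta> ^ (d + 2)) * (\<integral>\<^sup>+x. piece J x \<partial>M))"
    using B by (intro sum_mono piece_bound) (auto simp: G_def)
  also have "\<dots> = ennreal (B / \<zeta> ^ (d + 2)) * (\<integral>\<^sup>+x. (\<Sum>J\<in>G. piece J x) \<partial>M)"
    by (subst nn_integral_sum) (auto simp: sum_distrib_left)
  \<comment> \<open>Almost every point lies in at most one good cone, so at most one summand
    survives.\<close>
  also have "(\<integral>\<^sup>+x. (\<Sum>J\<in>G. piece J x) \<partial>M) \<le> (\<integral>\<^sup>+x. gauge_exp (convex hull W) (\<zeta> *\<^sub>R x) \<partial>M)"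
  proof (rule nn_integral_mono_AE)
    show "AE x in M. (\<Sum>J\<in>G. piece J x) \<le> gauge_exp (convex hull W) (\<zeta> *\<^sub>R x)"
      using AE_unique AE_frame[OF dc]
    proof eventually_elim
      case (elim x)
      show ?case
      proof (cases "\<exists>J\<in>G. x \<in> vcone J")
        case True
        then obtain J where J: "J \<in> G" "x \<in> vcone J" by blast
        have "piece J' x = 0" if "J' \<in> G - {J}" for J'
        proof -
          have "x \<notin> vcone J'" using elim(1) J that unfolding G_def by blast
          then show ?thesis by (simp add: piece_def)
        qed
        then have "(\<Sum>J\<in>G. piece J x) = piece J x"
          using fG J(1) by (simp add: sum.remove[of G J])
        also have "\<dots> \<le> gauge_exp (convex hull W) (\<zeta> *\<^sub>R x)"
          using gauge_exp_ge[of J x] J elim(2) by (simp add: piece_def G_def)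
        finally show ?thesis .
      next
        case False
        then have "(\<Sum>J\<in>G. piece J x) = 0" by (intro sum.neutral) (auto simp: piece_def)
        then show ?thesis by simp
      qed
    qed
  qed
  also have "(\<integral>\<^sup>+x. gauge_exp (convex hull W) (\<zeta> *\<^sub>R x) \<partial>M) = ennreal (1 / \<zeta> ^ d) * (\<integral>\<^sup>+x. gauge_exp (convex hull W) x \<partial>M)"
    by (rule nn_integral_frame_scale[OF dc zeta(1)]) measurable
  also have "(\<integral>\<^sup>+x. gauge_exp (convex hull W) x \<partial>M) = ennreal (fact d) * emeasure M (convex hull W)"
    using nn_integral_gauge_exp[OF dc, of "convex hull W" 0] by simp
  finally show ?thesis by (simp add: mult_left_mono)
qed

end

section \<open>Generic costs and the second moment of a polytope\<close>

lemma independent_dual_frame: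
  assumes c: "orthonormal_basis F d c" and J: "J \<subseteq> F" "card J = d" "independent J" "finite J"
  shows "\<exists>w v. bij_betw w {..<d} J \<and> dual_frame F d w v"
proof -
  obtain w where w: "bij_betw w {..<d} J"
    using ex_bij_betw_nat_finite[OF J(4)] J(2) by (auto simp: atLeast0LessThan)
  have "\<exists>v. dual_frame F d w v"
  proof (rule dual_frame_exists[OF c])
    show "w i \<in> F" if "i < d" for i using w that J(1) by (auto simp: bij_betw_def)
  next
    fix t i assume t: "lin_comb w d t = 0" and i: "i < d"
    define u where "u = (\<lambda>x. t (inv_into {..<d} w x))"
    have uw: "u (w j) = t j" if "j < d" for j
      using w that by (simp add: u_def bij_betw_def inv_into_f_f)
    have "(\<Sum>x\<in>J. u x *\<^sub>R x) = (\<Sum>j<d. u (w j) *\<^sub>R w j)"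
      by (rule sum.reindex_bij_betw[OF w, symmetric])
    also have "\<dots> = 0" using t uw by (simp add: lin_comb_def)
    finally have "\<forall>x\<in>J. u x = 0" using J(3) dependent_finite[OF J(4)] by blast
    moreover have "w i \<in> J" using w i by (auto simp: bij_betw_def)
    ultimately show "t i = 0" using uw[OF i] by auto
  qed
  then show ?thesis using w by blast
qed

text \<open>With distinct powers of \<tau> as perturbations, every forbidden equation is a
  polynomial in \<tau> whose coefficient at the power of \<open>g p\<close> is 1. Finitely many
  nonzero polynomials leave room in \<open>(0, e)\<close>. The \<open>Suc\<close> keeps the constant
  term apart.\<close>

lemma generic_weights:
  fixes idx :: "'a \<Rightarrow> nat" and a :: "'b \<Rightarrow> nat \<Rightarrow> real" and f :: "'b \<Rightarrow> nat \<Rightarrow> 'a" and g :: "'b \<Rightarrow> 'a"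
  assumes P: "finite P" and ne: "\<And>p i. p \<in> P \<Longrightarrow> i < d \<Longrightarrow> idx (f p i) \<noteq> idx (g p)" and e: "e > 0"
  shows "\<exists>\<tau>. 0 < \<tau> \<and> \<tau> < e \<and>
     (\<forall>p\<in>P. (\<Sum>i<d. (1 - \<tau> ^ Suc (idx (f p i))) * a p i) \<noteq> 1 - \<tau> ^ Suc (idx (g p)))"
proof -
  define q where "q = (\<lambda>p. (\<Sum>i<d. smult (a p i) (1 - monom 1 (Suc (idx (f p i))))) - (1 - monom 1 (Suc (idx (g p)))))"
  have poly_q: "poly (q p) \<tau> = (\<Sum>i<d. (1 - \<tau> ^ Suc (idx (f p i))) * a p i) - (1 - \<tau> ^ Suc (idx (g p)))" for p \<tau>
    by (simp add: q_def poly_sum poly_monom mult.commute)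
  have "q p \<noteq> 0" if "p \<in> P" for p
  proof -
    have "coeff (q p) (Suc (idx (g p))) = 1"
      using ne[OF that] by (simp add: q_def coeff_sum)
    then show ?thesis by auto
  qed
  then have "finite (\<Union>p\<in>P. {\<tau>. poly (q p) \<tau> = 0})"
    using P poly_roots_finite by blast
  moreover have "infinite {0<..<e}" using e by simp
  ultimately obtain \<tau> where "\<tau> \<in> {0<..<e}" "\<tau> \<notin> (\<Union>p\<in>P. {\<tau>. poly (q p) \<tau> = 0})"
    by (meson finite_subset subsetI)
  then show ?thesis using poly_q by (intro exI[of _ \<tau>]) force
qed

text \<open>The quotient of the factorials yields \<open>(d + 1) (d + 2)\<close>, and the factor 2
  pays for the perturbation of the costs. The ball makes every point of \<open>F\<close>
  representable.\<close>

lemma polytope_second_moment: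
  assumes c: "orthonormal_basis F d c" and W: "finite W" "W \<subseteq> F"
    and r: "r > 0" "ball 0 r \<inter> F \<subseteq> convex hull W"
    and B: "\<And>J. J \<subseteq> W \<Longrightarrow> card J = d \<Longrightarrow> (norm (\<Sum>J))\<^sup>2 + (\<Sum>w\<in>J. (norm w)\<^sup>2) \<le> B" and B0: "B \<ge> 0"
  shows "(LINT x|frame_measure c d. indicator (convex hull W) x * (norm x)\<^sup>2)
    \<le> 2 * B / (real (d + 1) * real (d + 2)) * measure (frame_measure c d) (convex hull W)"
proof -
  note dc = onb_dual_frame[OF c]
  let ?M = "frame_measure c d"
  have sF: "subspace F" by (rule dual_frame_subspace[OF dc])
  have cK: "compact (convex hull W)" by (rule finite_imp_compact_convex_hull[OF W(1)])
  have zero: "0 \<in> convex hull W" using r subspace_0[OF sF] by auto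
  have feasible: "\<exists>l. represents W x l" if x: "x \<in> F" for x
  proof -
    define s where "s = (r / 2) / (norm x + 1)"
    have s: "s > 0" using r(1) by (simp add: s_def add_nonneg_pos)
    have "s * norm x \<le> s * (norm x + 1)" using s by simp
    also have "\<dots> = r / 2"
    proof -
      have "norm x + 1 \<noteq> 0" using norm_ge_zero[of x] by linarith
      then show ?thesis using nonzero_eq_divide_eq[of "norm x + 1" s "r / 2"] s_def by blast
    qed
    also have "\<dots> < r" using r(1) by simp
    finally have "norm (s *\<^sub>R x) < r" using s by simp
    then have "s *\<^sub>R x \<in> convex hull W" using r(2) x subspace_scale[OF sF] by auto
    then obtain l where "represents W (s *\<^sub>R x) l" using convex_hull_represents[OF W(1)] by blast
    from represents_scale[OF this, of "1 / s"] s show ?thesis by auto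
  qed
  obtain idx :: "rseq \<Rightarrow> nat" where idx: "inj_on idx W"
    using finite_imp_inj_to_nat_seg[OF W(1)] by blast
  have "\<exists>w v. bij_betw w {..<d} J \<and> dual_frame F d w v" if "J \<in> simplices W d" for J
    using that W finite_subset by (intro independent_dual_frame[OF c]) (auto simp: simplices_def)
  then obtain wf vf where wv: "\<And>J. J \<in> simplices W d \<Longrightarrow> bij_betw (wf J) {..<d} J \<and> dual_frame F d (wf J) (vf J)"
    by metis
  \<comment> \<open>The total loss is \<open>(1 - \<epsilon>)^(-(2 d + 2))\<close>, and with this
    \<epsilon> Bernoulli's inequality bounds it by 2.\<close>
  define \<epsilon> where "\<epsilon> = 1 / (2 * (2 * real d + 2))"
  have eps: "\<epsilon> > 0" "\<epsilon> < 1" by (auto simp: \<epsilon>_def)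
  define P where "P = {(J, w). J \<in> simplices W d \<and> w \<in> W - J}"
  have "finite P"
  proof (rule finite_subset)
    show "P \<subseteq> Pow W \<times> W" by (auto simp: P_def simplices_def)
  qed (use W in auto)
  moreover have "idx (wf (fst p) i) \<noteq> idx (snd p)" if p: "p \<in> P" and i: "i < d" for p i
  proof -
    have "fst p \<in> simplices W d" using p by (auto simp: P_def)
    then have "wf (fst p) i \<in> fst p" using bij_betwE[of "wf (fst p)" "{..<d}" "fst p"] wv i by blast
    then have "wf (fst p) i \<in> W" "snd p \<in> W" "wf (fst p) i \<noteq> snd p"
      using p by (auto simp: P_def simplices_def)
    then show ?thesis using idx by (auto dest: inj_onD)
  qed
  ultimately obtain \<tau> where t: "0 < \<tau>" "\<tau> < \<epsilon>"
    "\<And>p. p \<in> P \<Longrightarrow> (\<Sum>i<d. (1 - \<tau> ^ Suc (idx (wf (fst p) i))) * (snd p \<bullet> vf (fst p) i)) \<noteq> 1 - \<tau> ^ Suc (idx (snd p))"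
    using generic_weights[of P d idx "\<lambda>p. wf (fst p)" snd \<epsilon> "\<lambda>p i. snd p \<bullet> vf (fst p) i"] eps(1) by blast
  define h where "h = (\<lambda>w. 1 - \<tau> ^ Suc (idx w))"
  define \<zeta> where "\<zeta> = 1 - \<epsilon>"
  have tp: "\<tau> ^ Suc k \<le> \<epsilon>" for k
  proof -
    have "\<tau> ^ k \<le> 1" using t eps by (intro power_le_one) auto
    then have "\<tau> * \<tau> ^ k \<le> \<tau> * 1" using t by (intro mult_left_mono) auto
    then show ?thesis unfolding power_Suc using t(2) by linarith
  qed
  interpret weighted_vertices F d c W h wf vf \<zeta>
  proof
    show "0 < \<zeta>" "\<zeta> \<le> 1" using eps by (auto simp: \<zeta>_def)
    show "\<zeta> \<le> h w" "h w \<le> 1" if "w \<in> W" for w using tp[of "idx w"] t(1) by (auto simp: h_def \<zeta>_def)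
    show "(\<Sum>i<d. h (wf J i) * (w \<bullet> vf J i)) \<noteq> h w" if "J \<in> simplices W d" "w \<in> W - J" for J w
      using t(3)[of "(J, w)"] that by (simp add: P_def h_def)
  qed (use c W feasible zero wv in auto)
  have "convex_body F (convex hull W)"
    using W(2) sF r cK subspace_0[OF sF]
    by (intro convex_bodyI_ball[of _ _ r 0]) (auto simp: convex_convex_hull hull_minimal subspace_imp_convex)
  note vol = convex_body_vol[OF dc this]
  define V where "V = measure ?M (convex hull W)"
  have int: "integrable ?M (\<lambda>x. indicator (convex hull W) x * (norm x)\<^sup>2)"
    by (intro integrable_compact[OF dc cK] continuous_intros)
  define I where "I = (LINT x|?M. indicator (convex hull W) x * (norm x)\<^sup>2)"
  have I0: "I \<ge> 0" unfolding I_def by (intro integral_nonneg_AE) auto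
  have "(\<integral>\<^sup>+x. indicator (convex hull W) x * ennreal ((norm x)\<^sup>2) \<partial>?M) = ennreal I"
    unfolding I_def by (subst nn_integral_eq_integral[OF int, symmetric]) (auto intro!: nn_integral_cong simp: indicator_def)
  with second_moment_bound[OF _ B0] B
  have "ennreal (fact (d + 2)) * ennreal I \<le> ennreal (B / \<zeta> ^ (d + 2)) * (ennreal (1 / \<zeta> ^ d) * (ennreal (fact d) * ennreal V))"
    by (simp add: simplices_def V_def vol(1))
  then have "fact (d + 2) * I \<le> B / \<zeta> ^ (d + 2) * (1 / \<zeta> ^ d * (fact d * V))"
    using I0 B0 zeta(1) vol(2) by (simp add: ennreal_mult[symmetric] V_def)
  also have "\<dots> = fact d * (B * V) * (1 / \<zeta> ^ (2 * d + 2))"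
    by (simp add: power_add power_mult power2_eq_square power_mult_distrib mult_ac)
  also have "\<dots> \<le> fact d * (B * V) * 2"
  proof (intro mult_left_mono)
    have "1 + real (2 * d + 2) * (- \<epsilon>) \<le> (1 + (- \<epsilon>)) ^ (2 * d + 2)"
      using eps by (intro Bernoulli_inequality) auto
    moreover have "real (2 * d + 2) * \<epsilon> = 1 / 2" by (simp add: \<epsilon>_def field_simps)
    ultimately have "\<zeta> ^ (2 * d + 2) \<ge> 1 / 2" by (simp add: \<zeta>_def)
    then show "1 / \<zeta> ^ (2 * d + 2) \<le> 2" using zeta(1) by (simp add: field_simps)
  qed (use B0 vol in \<open>auto simp: V_def\<close>)
  finally have "fact d * (real (d + 1) * real (d + 2) * I) \<le> fact d * (2 * B * V)"
    by (simp add: algebra_simps)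
  then have "real (d + 1) * real (d + 2) * I \<le> 2 * B * V" by simp
  moreover have "real (d + 1) * real (d + 2) > 0" by simp
  ultimately have "I \<le> 2 * B * V / (real (d + 1) * real (d + 2))"
    by (simp only: pos_le_divide_eq mult.commute)
  then show ?thesis by (simp add: I_def V_def)
qed

section \<open>Volume of hulls\<close>

text \<open>Separation by the nearest point \<open>y\<close> of the hull: if \<open>z\<close> is
  outside, all of the hull lies behind the hyperplane through \<open>y\<close> with normal
  \<open>z - y\<close>, so in this direction no vertex reaches \<open>norm z < t\<close>.\<close>

lemma ball_subset_hull:
  assumes E: "subspace E" and W: "finite W" "W \<subseteq> E" "W \<noteq> {}"
    and t: "\<And>\<theta>. \<theta> \<in> E \<Longrightarrow> norm \<theta> = 1 \<Longrightarrow> \<exists>a\<in>W. \<theta> \<bullet> a \<ge> t"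
  shows "ball 0 t \<inter> E \<subseteq> convex hull W"
proof
  fix z assume z: "z \<in> ball 0 t \<inter> E"
  show "z \<in> convex hull W"
  proof (rule ccontr)
    assume nz: "z \<notin> convex hull W"
    have cK: "compact (convex hull W)" by (rule finite_imp_compact_convex_hull[OF W(1)])
    obtain y where y: "y \<in> convex hull W" "\<And>x. x \<in> convex hull W \<Longrightarrow> norm (z - y) \<le> norm (z - x)"
    proof -
      have "continuous_on (convex hull W) (\<lambda>x. norm (z - x))" by (intro continuous_intros)
      then have "\<exists>y\<in>convex hull W. \<forall>x\<in>convex hull W. norm (z - y) \<le> norm (z - x)"
        using W(3) by (intro continuous_attains_inf[OF cK]) auto
      then show ?thesis using that by blast
    qed
    have "convex hull W \<subseteq> E" using W(2) subspace_imp_convex[OF E] by (rule hull_minimal)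
    then have yE: "y \<in> E" using y(1) by blast
    have le: "(z - y) \<bullet> (x - y) \<le> 0" if x: "x \<in> convex hull W" for x
    proof (rule ccontr)
      assume "\<not> ?thesis"
      then have pos: "(z - y) \<bullet> (x - y) > 0" by simp
      define p where "p = (z - y) \<bullet> (x - y)"
      define q where "q = (norm (x - y))\<^sup>2"
      have q: "q > 0" using pos by (auto simp: q_def)
      \<comment> \<open>A step from \<open>y\<close> towards \<open>x\<close> that would bring the
        point closer to \<open>z\<close>: \<open>p / q\<close> minimizes the distance on the line,
        and 1 keeps the point on the segment.\<close>
      define s where "s = min 1 (p / q)"
      have "p / q > 0" using pos q by (simp add: p_def)
      then have s: "s > 0" "s \<le> 1" by (simp_all add: s_def)
      have "s \<le> p / q" by (simp add: s_def)
      then have sq: "s * q \<le> p" using q by (simp add: pos_le_divide_eq)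
      have "(1 - s) *\<^sub>R y + s *\<^sub>R x \<in> convex hull W"
        using convexD[OF convex_convex_hull y(1) x, of "1 - s" s] s by simp
      from y(2)[OF this] have "(norm (z - y))\<^sup>2 \<le> (norm (z - ((1 - s) *\<^sub>R y + s *\<^sub>R x)))\<^sup>2" by simp
      also have "z - ((1 - s) *\<^sub>R y + s *\<^sub>R x) = (z - y) - s *\<^sub>R (x - y)" by (simp add: algebra_simps)
      also have "(norm ((z - y) - s *\<^sub>R (x - y)))\<^sup>2 = (norm (z - y))\<^sup>2 - 2 * s * p + s\<^sup>2 * q"
        unfolding p_def q_def power2_norm_eq_inner
        by (simp add: inner_diff_left inner_diff_right inner_commute power2_eq_square algebra_simps)
      finally have "2 * s * p \<le> s * (s * q)" by (simp add: power2_eq_square)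
      also have "\<dots> \<le> s * p" using s sq by (intro mult_left_mono) auto
      finally show False using s pos by (simp add: p_def)
    qed
    define \<theta> where "\<theta> = (1 / norm (z - y)) *\<^sub>R (z - y)"
    have zy: "z - y \<noteq> 0" using nz y(1) by auto
    have "\<theta> \<in> E" "norm \<theta> = 1" using z yE E zy by (auto simp: \<theta>_def subspace_diff subspace_scale)
    then obtain a where a: "a \<in> W" "\<theta> \<bullet> a \<ge> t" using t by blast
    have "a \<in> convex hull W" using a(1) by (simp add: hull_inc)
    then have "(z - y) \<bullet> a \<le> (z - y) \<bullet> y" using le by (simp add: inner_diff_right)
    also have "\<dots> < (z - y) \<bullet> z"
    proof -
      have "(z - y) \<bullet> (z - y) > 0" using zy by (simp only: inner_gt_zero_iff not_False_eq_True)
      then show ?thesis by (simp only: inner_diff_right diff_gt_0_iff_gt)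
    qed
    also have "\<dots> \<le> norm (z - y) * norm z" by (rule norm_cauchy_schwarz)
    finally have "\<theta> \<bullet> a < norm z" using zy unfolding \<theta>_def inner_scaleR_left
      by (simp add: pos_divide_less_eq mult.commute)
    then show False using a(2) z by simp
  qed
qed

text \<open>An inscribed cube gives the right order for the \<open>d\<close>-th root of the volume
  and avoids the exact volume of the ball.\<close>

lemma ball_volume_ge:
  assumes c: "orthonormal_basis E d c" and d: "d > 0" and t: "t > 0"
    and K: "ball 0 t \<inter> E \<subseteq> K" "K \<in> sets borel"
  shows "emeasure (frame_measure c d) K \<ge> ennreal ((t / sqrt d) ^ d)"
proof -
  note dc = onb_dual_frame[OF c]
  \<comment> \<open>Half the side of the cube; its vertices have norm \<open>t / 2\<close>, so the
    cube lies inside the open ball.\<close>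
  define a where "a = t / (2 * sqrt d)"
  have a: "a > 0" using t d by (simp add: a_def)
  have "ennreal ((t / sqrt d) ^ d) = ennreal (a - (- a)) ^ d" using a by (simp add: a_def ennreal_power)
  also have "\<dots> = emeasure (frame_measure c d) {x. \<forall>i<d. x \<bullet> c i \<in> {- a..a}}"
    using frame_box[OF dc, of "- a" a] a by simp
  also have "\<dots> \<le> emeasure (frame_measure c d) K"
  proof (rule emeasure_mono_AE)
    show "AE x in frame_measure c d. x \<in> {x. \<forall>i<d. x \<bullet> c i \<in> {- a..a}} \<longrightarrow> x \<in> K"
      using AE_frame[OF dc]
    proof eventually_elim
      case (elim x)
      show ?case
      proof
        assume x: "x \<in> {x. \<forall>i<d. x \<bullet> c i \<in> {- a..a}}"
        have "(norm x)\<^sup>2 = (\<Sum>i<d. (x \<bullet> c i)\<^sup>2)" by (rule onb_norm_inner[OF c elim])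
        also have "\<dots> \<le> (\<Sum>i<d. a\<^sup>2)"
        proof (rule sum_mono)
          fix i assume "i \<in> {..<d}"
          then have "\<bar>x \<bullet> c i\<bar> \<le> \<bar>a\<bar>" using x a by auto
          then show "(x \<bullet> c i)\<^sup>2 \<le> a\<^sup>2" by (simp add: abs_le_square_iff)
        qed
        also have "\<dots> = t\<^sup>2 / 4" using d by (simp add: a_def power_divide power_mult_distrib)
        also have "\<dots> < t\<^sup>2" using t by simp
        finally have "norm x < t" using t by (simp add: power_less_imp_less_base)
        then show "x \<in> K" using K(1) elim by auto
      qed
    qed
  qed (use K in auto)
  finally show ?thesis .
qed

lemma std_normal_unit_interval: "emeasure std_normal {0..1} \<ge> ennreal (1 / 6)"
proof -
  have "ennreal (1 / 6) = (\<integral>\<^sup>+x. ennreal (1 / 6) * indicator {0..1::real} x \<partial>lborel)"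
    by (simp add: nn_integral_cmult_indicator)
  also have "\<dots> \<le> (\<integral>\<^sup>+x. ennreal (std_normal_density x) * indicator {0..1} x \<partial>lborel)"
  proof (rule nn_integral_mono)
    fix x :: real
    show "ennreal (1 / 6) * indicator {0..1} x \<le> ennreal (std_normal_density x) * indicator {0..1} x"
    proof (cases "x \<in> {0..1}")
      case True
      then have "x\<^sup>2 \<le> 1" by (simp add: power_le_one)
      then have "1 / 2 \<le> 1 + - x\<^sup>2 / 2" by simp
      also have "\<dots> \<le> exp (- x\<^sup>2 / 2)" by (rule exp_ge_add_one_self)
      finally have e: "1 / 2 \<le> exp (- x\<^sup>2 / 2)" .
      have "sqrt (2 * pi) \<le> 3"
        using pi_less_4 by (intro real_le_lsqrt) auto
      then have "(1 / 2) / 3 \<le> exp (- x\<^sup>2 / 2) / sqrt (2 * pi)"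
        using e by (intro frac_le) auto
      then have "1 / 6 \<le> std_normal_density x" by (simp add: std_normal_density_def)
      then show ?thesis using True by (simp add: ennreal_leI)
    qed simp
  qed
  also have "\<dots> = emeasure std_normal {0..1}" by (subst emeasure_density) auto
  finally show ?thesis .
qed

section \<open>Projections of polytopes\<close>

text \<open>What both polytopes share: the orthonormal basis controls volume and inradius, the bound
  on subset sums controls second moments, and the cardinality controls the union bound. The ball, of
  arbitrary radius, gives the projections interior points.\<close>

definition good_vertices :: "nat \<Rightarrow> rseq set \<Rightarrow> bool" where
  "good_vertices n V \<longleftrightarrow> finite V \<and> V \<subseteq> euclid n \<and> card V \<le> 2 * n \<and>
     (\<exists>e. orthonormal_basis (euclid n) n e \<and> (\<forall>i<n. e i \<in> V)) \<and>
     (\<exists>r>0. ball 0 r \<inter> euclid n \<subseteq> convex hull V) \<and>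
     (\<forall>I\<subseteq>V. (norm (\<Sum>I))\<^sup>2 \<le> 4 * real (card I))"

lemma grassmannian_onb:
  assumes "E \<in> grassmannian n d"
  obtains b where "orthonormal_basis E d b"
  using assms onb_exists unfolding grassmannian_def by blast

lemma orth_proj_linear:
  assumes "E \<in> grassmannian n d"
  shows "linear (orth_proj E)"
  using assms bounded_linear_orth_proj bounded_linear.linear unfolding grassmannian_def by blast

lemma orth_proj_fixed: "subspace E \<Longrightarrow> x \<in> E \<Longrightarrow> orth_proj E x = x"
  by (rule orth_proj_unique) (auto simp: orthogonal_def)

lemma orth_proj_norm_le:
  assumes "E \<in> grassmannian n d"
  shows "norm (orth_proj E x) \<le> norm x"
proof -
  have E: "subspace E" "E \<subseteq> euclid n" using assms by (auto simp: grassmannian_def)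
  let ?y = "orth_proj E x"
  have "(norm ?y)\<^sup>2 = x \<bullet> ?y"
    using orth_proj(2)[OF E orth_proj(1)[OF E], of x x]
    by (simp add: orthogonal_def inner_diff_left power2_norm_eq_inner)
  also have "\<dots> \<le> norm x * norm ?y" by (rule norm_cauchy_schwarz)
  finally show ?thesis by (cases "?y = 0") (auto simp: power2_eq_square)
qed

lemma orth_proj_hull:
  assumes "E \<in> grassmannian n d"
  shows "orth_proj E ` (convex hull V) = convex hull (orth_proj E ` V)"
  by (rule convex_hull_linear_image[OF orth_proj_linear[OF assms]])

lemma proj_ball:
  assumes E: "E \<in> grassmannian n d" and r: "ball 0 r \<inter> euclid n \<subseteq> convex hull V"
  shows "ball 0 r \<inter> E \<subseteq> convex hull (orth_proj E ` V)"
proof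
  fix x assume x: "x \<in> ball 0 r \<inter> E"
  then have "x \<in> convex hull V" using E r by (auto simp: grassmannian_def)
  moreover have "orth_proj E x = x" using x E by (auto simp: grassmannian_def orth_proj_fixed)
  ultimately show "x \<in> convex hull (orth_proj E ` V)"
    unfolding orth_proj_hull[OF E, symmetric] by (metis imageI)
qed

lemma proj_convex_body:
  assumes E: "E \<in> grassmannian n d" and V: "good_vertices n V"
  shows "convex_body E (convex hull (orth_proj E ` V))"
proof -
  have sE: "subspace E" "E \<subseteq> euclid n" using E by (auto simp: grassmannian_def)
  obtain r where r: "r > 0" "ball 0 r \<inter> euclid n \<subseteq> convex hull V" using V by (auto simp: good_vertices_def)
  have "orth_proj E ` V \<subseteq> E" using orth_proj(1)[OF sE] by auto
  then have "convex hull (orth_proj E ` V) \<subseteq> E" using sE(1) by (simp add: hull_minimal subspace_imp_convex)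
  moreover have "compact (convex hull (orth_proj E ` V))"
    using V by (intro finite_imp_compact_convex_hull) (auto simp: good_vertices_def)
  ultimately show ?thesis
    using proj_ball[OF E r(2)] r(1) subspace_0[OF sE(1)]
    by (intro convex_bodyI_ball[of _ _ r 0]) (auto simp: convex_convex_hull)
qed

lemma isotropy_constant_affine:
  assumes E: "subspace E" and \<beta>: "\<beta> \<in> E" and s: "s \<noteq> 0"
  shows "isotropy_constant E ((\<lambda>x. \<beta> + s *\<^sub>R x) ` K) = isotropy_constant E K"
proof -
  have bs: "bij_betw (\<lambda>x. s *\<^sub>R x) E E" if "s \<noteq> 0" for s
    using that E
    by (intro bij_betw_byWitness[where f' = "\<lambda>x. (1 / s) *\<^sub>R x"]) (auto simp: subspace_scale)
  have "(\<exists>T a. linear T \<and> bij_betw T E E \<and> a \<in> E \<and> isotropic_body E ((\<lambda>x. a + T x) ` (\<lambda>x. \<beta> + s *\<^sub>R x) ` K) L) \<longleftrightarrow>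
        (\<exists>T a. linear T \<and> bij_betw T E E \<and> a \<in> E \<and> isotropic_body E ((\<lambda>x. a + T x) ` K) L)" (is "?A \<longleftrightarrow> ?B") for L
  proof
    assume ?A
    then obtain T a where T: "linear T" "bij_betw T E E" "a \<in> E"
      "isotropic_body E ((\<lambda>x. a + T x) ` (\<lambda>x. \<beta> + s *\<^sub>R x) ` K) L" by blast
    have "T \<beta> \<in> E" using T(2) \<beta> by (auto simp: bij_betw_def)
    moreover have "linear (\<lambda>x. T (s *\<^sub>R x))"
      by (rule linear_compose[unfolded o_def, OF linear_scale_self T(1)])
    moreover have "bij_betw (\<lambda>x. T (s *\<^sub>R x)) E E" using bij_betw_trans[OF bs[OF s] T(2)] by (simp add: o_def)
    moreover have "(\<lambda>x. a + T x) ` (\<lambda>x. \<beta> + s *\<^sub>R x) ` K = (\<lambda>x. (a + T \<beta>) + T (s *\<^sub>R x)) ` K"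
      by (simp add: image_image linear_add[OF T(1)] add.assoc)
    ultimately show ?B using T(3,4) subspace_add[OF E]
      by (intro exI[of _ "\<lambda>x. T (s *\<^sub>R x)"] exI[of _ "a + T \<beta>"]) auto
  next
    assume ?B
    then obtain T a where T: "linear T" "bij_betw T E E" "a \<in> E" "isotropic_body E ((\<lambda>x. a + T x) ` K) L" by blast
    have si: "1 / s \<noteq> 0" using s by simp
    have lin: "linear (\<lambda>x. T ((1 / s) *\<^sub>R x))"
      by (rule linear_compose[unfolded o_def, OF linear_scale_self T(1)])
    have bij: "bij_betw (\<lambda>x. T ((1 / s) *\<^sub>R x)) E E" using bij_betw_trans[OF bs[OF si] T(2)] by (simp add: o_def)
    then have "T ((1 / s) *\<^sub>R \<beta>) \<in> E" using \<beta> by (auto simp: bij_betw_def)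
    moreover have "(\<lambda>x. (a - T ((1 / s) *\<^sub>R \<beta>)) + T ((1 / s) *\<^sub>R x)) ` (\<lambda>x. \<beta> + s *\<^sub>R x) ` K = (\<lambda>x. a + T x) ` K"
      using s by (simp add: image_image linear_add[OF T(1)] scaleR_add_right)
    ultimately show ?A using lin bij T(3,4) subspace_diff[OF E]
      by (intro exI[of _ "\<lambda>x. T ((1 / s) *\<^sub>R x)"] exI[of _ "a - T ((1 / s) *\<^sub>R \<beta>)"]) auto
  qed
  then show ?thesis unfolding isotropy_constant_def by presburger
qed

text \<open>The variational bound for the identity map, combined with the second moment of the
  projected polytope; \<open>v\<close> is a lower bound for the \<open>d\<close>-th root of the
  volume.\<close>

lemma isotropy_constant_bound:
  assumes E: "E \<in> grassmannian n d" and d: "d > 0" and b: "orthonormal_basis E d b" and V: "good_vertices n V"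
    and vol: "measure (frame_measure b d) (convex hull (orth_proj E ` V)) \<ge> v ^ d" and v: "v > 0"
    and B: "\<And>I. I \<subseteq> V \<Longrightarrow> card I = d \<Longrightarrow> (norm (orth_proj E (\<Sum>I)))\<^sup>2 + (\<Sum>a\<in>I. (norm (orth_proj E a))\<^sup>2) \<le> B" and B0: "B \<ge> 0"
  shows "real d ^ 3 * v\<^sup>2 * (isotropy_constant E (convex hull (orth_proj E ` V)))\<^sup>2 \<le> 2 * B"
proof -
  let ?M = "frame_measure b d" and ?K = "convex hull (orth_proj E ` V)"
  have sE: "subspace E" "E \<subseteq> euclid n" using E by (auto simp: grassmannian_def)
  have cb: "convex_body E ?K" by (rule proj_convex_body[OF E V])
  obtain r where r: "r > 0" "ball 0 r \<inter> euclid n \<subseteq> convex hull V" using V by (auto simp: good_vertices_def)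
  define L where "L = isotropy_constant E ?K"
  define m where "m = measure ?M ?K"
  have m: "m > 0" unfolding m_def by (rule convex_body_vol[OF onb_dual_frame[OF b] cb])
  have bid: "bij_betw (\<lambda>x. x) E E" by (simp add: bij_betw_def)
  have id: "?K = (\<lambda>x. 0 + id x) ` ?K" by simp
  have "real d * L\<^sup>2 * m powr (1 + 2 / d) \<le> (LINT y|?M. indicator ?K y * (norm y)\<^sup>2)"
    unfolding L_def m_def
    using isotropy_constant_le(1)[OF b b d cb linear_id[unfolded id_def[symmetric]] _ subspace_0[OF sE(1)] id] bid by simp
  also have "\<dots> \<le> 2 * B / (real (d + 1) * real (d + 2)) * m"
    unfolding m_def
  proof (rule polytope_second_moment[OF b _ _ r(1) proj_ball[OF E r(2)] _ B0])
    show "finite (orth_proj E ` V)" using V by (simp add: good_vertices_def)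
    show "orth_proj E ` V \<subseteq> E" using orth_proj(1)[OF sE] by auto
    fix J assume J: "J \<subseteq> orth_proj E ` V" "card J = d"
    then obtain I where I: "I \<subseteq> V" "inj_on (orth_proj E) I" "J = orth_proj E ` I"
      by (auto simp: subset_image_inj)
    have "card I = d" using card_image[OF I(2)] I(3) J(2) by simp
    moreover have "\<Sum>J = orth_proj E (\<Sum>I)"
      using I by (simp add: sum.reindex linear_sum[OF orth_proj_linear[OF E]])
    moreover have "(\<Sum>w\<in>J. (norm w)\<^sup>2) = (\<Sum>a\<in>I. (norm (orth_proj E a))\<^sup>2)"
      using I by (simp add: sum.reindex)
    ultimately show "(norm (\<Sum>J))\<^sup>2 + (\<Sum>w\<in>J. (norm w)\<^sup>2) \<le> B" using B[OF I(1)] by simp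
  qed
  finally have "(real d * L\<^sup>2 * m powr (2 / d)) * m \<le> 2 * B / (real (d + 1) * real (d + 2)) * m"
    using m by (simp add: powr_add mult_ac)
  then have *: "real d * L\<^sup>2 * m powr (2 / d) \<le> 2 * B / (real (d + 1) * real (d + 2))"
    by (rule mult_right_le_imp_le[OF _ m])
  have "v\<^sup>2 = v powr (real d * (2 / real d))" using v d by simp
  also have "\<dots> = (v ^ d) powr (2 / d)" unfolding powr_realpow[OF v, symmetric] powr_powr ..
  also have "\<dots> \<le> m powr (2 / d)" using vol v unfolding m_def by (intro powr_mono2) auto
  finally have "real d * L\<^sup>2 * v\<^sup>2 \<le> real d * L\<^sup>2 * m powr (2 / d)" by (intro mult_left_mono) auto
  with * have "real d * L\<^sup>2 * v\<^sup>2 \<le> 2 * B / (real (d + 1) * real (d + 2))" by linarith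
  also have "\<dots> \<le> 2 * B / (real d * real d)" using B0 d by (intro divide_left_mono mult_mono) auto
  finally have "(real d * L\<^sup>2 * v\<^sup>2) * (real d * real d) \<le> 2 * B" using d by (simp add: pos_le_divide_eq)
  then show ?thesis by (simp add: L_def power3_eq_cube mult_ac)
qed

lemma hull_scaled_sum:
  fixes V :: "rseq set"
  assumes z: "0 \<in> convex hull V" and e: "\<And>i. i < n \<Longrightarrow> e i \<in> convex hull V"
    and t: "\<And>i. i < n \<Longrightarrow> t i \<in> {0..1}" and n: "n > 0"
  shows "(1 / real n) *\<^sub>R (\<Sum>i<n. t i *\<^sub>R e i) \<in> convex hull V"
proof -
  have "t i *\<^sub>R e i \<in> convex hull V" if "i < n" for i
    using convexD[OF convex_convex_hull e[OF that] z, of "t i" "1 - t i"] t[OF that] by simp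
  then have "(\<Sum>i<n. (1 / real n) *\<^sub>R (t i *\<^sub>R e i)) \<in> convex hull V"
    using n by (intro convex_sum convex_convex_hull) auto
  then show ?thesis by (simp add: scaleR_sum_right)
qed

text \<open>A Gaussian vector has all its coordinates in the unit interval with probability at least
  \<open>6 ^ (- n)\<close>, and then its projection lies in the \<open>n\<close>-fold dilate of the projected polytope.\<close>

lemma proj_volume_ge:
  assumes E: "E \<in> grassmannian n d" and d: "d > 0" and b: "orthonormal_basis E d b" and V: "good_vertices n V"
  shows "measure (frame_measure b d) (convex hull (orth_proj E ` V)) \<ge> (1 / 6) ^ n / real n ^ d"
proof -
  let ?M = "frame_measure b d" and ?K = "convex hull (orth_proj E ` V)"
  note db = onb_dual_frame[OF b]
  have sE: "subspace E" "E \<subseteq> euclid n" "dim E = d" using E by (auto simp: grassmannian_def)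
  have n: "n > 0"
  proof (rule ccontr)
    assume "\<not> n > 0"
    then have "E \<subseteq> {0}" using sE(2) by (auto simp: euclid_def intro!: rseq_eqI)
    then have "dim E \<le> card ({} :: rseq set)" by (intro dim_le_card) auto
    then show False using sE(3) d by simp
  qed
  have cb: "convex_body E ?K" by (rule proj_convex_body[OF E V])
  have cK: "compact ?K" using cb by (simp add: convex_body_def)
  have [measurable]: "?K \<in> sets borel" using cK by (rule borel_compact)
  obtain e where e: "orthonormal_basis (euclid n) n e" "\<And>i. i < n \<Longrightarrow> e i \<in> V"
    using V by (auto simp: good_vertices_def)
  obtain r where r: "r > 0" "ball 0 r \<inter> euclid n \<subseteq> convex hull V" using V by (auto simp: good_vertices_def)
  have z: "0 \<in> ?K" using proj_ball[OF E r(2)] r(1) subspace_0[OF sE(1)] by auto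
  define A where "A = {x. (1 / real n) *\<^sub>R x \<in> ?K}"
  have A [measurable]: "A \<in> sets borel"
  proof -
    have "(\<lambda>x::rseq. (1 / real n) *\<^sub>R x) \<in> borel_measurable borel"
      by (intro borel_measurable_continuous_onI continuous_intros)
    from measurable_sets[OF this, of ?K] show ?thesis by (simp add: A_def vimage_def)
  qed
  interpret PS: product_sigma_finite "\<lambda>_::nat. std_normal"
    using product_prob_space_std_normal by (simp add: product_prob_space_def)
  have "ennreal ((1 / 6) ^ n) = (\<Prod>i<n. ennreal (1 / 6))" by (simp add: ennreal_power)
  also have "\<dots> \<le> (\<Prod>i<n. emeasure std_normal {0..1})"
    unfolding prod_constant using std_normal_unit_interval by (rule power_mono_ennreal)
  also have "\<dots> = emeasure (gauss_coord n) (Pi\<^sub>E {..<n} (\<lambda>_. {0..1}))"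
    by (subst PS.emeasure_PiM) auto
  also have "\<dots> \<le> emeasure (gauss_coord n) ((\<lambda>t. orth_proj E (lin_comb e n t)) -` A \<inter> space (gauss_coord n))"
  proof (rule emeasure_mono)
    show "Pi\<^sub>E {..<n} (\<lambda>_. {0..1}) \<subseteq> (\<lambda>t. orth_proj E (lin_comb e n t)) -` A \<inter> space (gauss_coord n)"
    proof
      fix t :: "nat \<Rightarrow> real" assume t: "t \<in> Pi\<^sub>E {..<n} (\<lambda>_. {0..1})"
      have "(1 / real n) *\<^sub>R (\<Sum>i<n. t i *\<^sub>R orth_proj E (e i)) \<in> ?K"
        using t e(2) by (intro hull_scaled_sum z n) (auto simp: PiE_iff intro: hull_inc)
      then have "orth_proj E (lin_comb e n t) \<in> A"
        unfolding A_def linear_lin_comb[OF orth_proj_linear[OF E]] by (simp add: lin_comb_def)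
      then show "t \<in> (\<lambda>t. orth_proj E (lin_comb e n t)) -` A \<inter> space (gauss_coord n)"
        using t by (auto simp: space_PiM PiE_iff)
    qed
    show "(\<lambda>t. orth_proj E (lin_comb e n t)) -` A \<inter> space (gauss_coord n) \<in> sets (gauss_coord n)"
      by (rule measurable_sets[OF measurable_compose[OF measurable_lin_comb_gauss measurable_orth_proj[OF b]] A])
  qed
  also have "\<dots> = emeasure (distr (gaussian e n) borel (orth_proj E)) A"
    unfolding gaussian_def
    by (subst distr_distr[OF measurable_orth_proj[OF b]], simp, subst emeasure_distr)
      (auto simp: o_def intro: measurable_compose[OF measurable_lin_comb_gauss measurable_orth_proj[OF b]])
  also have "\<dots> = emeasure (gaussian b d) A" by (simp add: orth_proj_gaussian[OF b sE(2) e(1)])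
  also have "\<dots> = (\<integral>\<^sup>+x. ennreal (gauss_dens d x) * indicator A x \<partial>?M)"
    unfolding gaussian_density[OF b] by (rule emeasure_density) auto
  also have "\<dots> \<le> (\<integral>\<^sup>+x. 1 * indicator A x \<partial>?M)"
  \<comment> \<open>The Gaussian density is at most 1, so the Gaussian measure bounds Lebesgue
    measure from below.\<close>
  proof (intro nn_integral_mono mult_right_mono)
    fix x
    have "(1::real) \<le> sqrt (2 * pi) ^ d" using pi_gt3 by (intro one_le_power) auto
    then have "gauss_dens d x \<le> 1 / 1" unfolding gauss_dens_def by (intro frac_le) auto
    then show "ennreal (gauss_dens d x) \<le> 1" by (simp add: ennreal_le_1)
  qed simp
  also have "\<dots> = (\<integral>\<^sup>+x. indicator ?K ((1 / real n) *\<^sub>R x) \<partial>?M)"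
    by (intro nn_integral_cong) (auto simp: A_def indicator_def)
  also have "\<dots> = ennreal (real n ^ d) * emeasure ?M ?K"
    using nn_integral_frame_scale[OF db, of "1 / real n" "indicator ?K"] n by (simp add: power_one_over)
  also have "\<dots> = ennreal (real n ^ d * measure ?M ?K)"
    using convex_body_vol(1)[OF db cb] by (simp add: ennreal_mult)
  finally have "(1 / 6) ^ n \<le> real n ^ d * measure ?M ?K" by simp
  then show ?thesis using n by (simp add: field_simps)
qed

text \<open>Subset sums have squared norm at most \<open>4 d\<close> also after projection, so the
  second moment is of order \<open>1 / d\<close>; the root of the volume is at least
  \<open>6^(-n/d) / n\<close>, which is comparable to \<open>1 / d\<close> when \<open>n / d\<close>
  is bounded.\<close>

lemma isotropy_constant_small_codim:
  assumes E: "E \<in> grassmannian n d" and d: "d > 0" and V: "good_vertices n V" and nd: "real n \<le> C * real d"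
  shows "(isotropy_constant E (convex hull (orth_proj E ` V)))\<^sup>2 \<le> 16 * C\<^sup>2 * 36 powr C"
proof -
  obtain b where b: "orthonormal_basis E d b" using grassmannian_onb[OF E] .
  define L where "L = isotropy_constant E (convex hull (orth_proj E ` V))"
  have n: "n > 0"
  proof (rule ccontr)
    assume "\<not> n > 0"
    then have "E \<subseteq> {0}" using E by (auto simp: euclid_def grassmannian_def intro!: rseq_eqI)
    then have "dim E \<le> card ({} :: rseq set)" by (intro dim_le_card) auto
    then show False using E d by (simp add: grassmannian_def)
  qed
  \<comment> \<open>The \<open>d\<close>-th root of the volume bound in
    \<open>proj_volume_ge\<close>.\<close>
  define v where "v = (1 / 6) powr (real n / real d) / real n"
  have v: "v > 0" using n by (simp add: v_def)
  have "v ^ d = (1 / 6) ^ n / real n ^ d"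
  proof -
    have "((1 / 6) powr (real n / real d)) ^ d = ((1 / 6) powr (real n / real d)) powr real d"
      by (rule powr_realpow[symmetric]) simp
    also have "\<dots> = (1 / 6) powr real n" unfolding powr_powr using d by simp
    also have "\<dots> = (1 / 6) ^ n" by (rule powr_realpow) simp
    finally show ?thesis by (simp only: v_def power_divide)
  qed
  then have vol: "measure (frame_measure b d) (convex hull (orth_proj E ` V)) \<ge> v ^ d"
    using proj_volume_ge[OF E d b V] by simp
  have "real d ^ 3 * v\<^sup>2 * L\<^sup>2 \<le> 2 * (8 * real d)"
    unfolding L_def
  proof (rule isotropy_constant_bound[OF E d b V vol v])
    fix I assume I: "I \<subseteq> V" "card I = d"
    have V': "(norm (\<Sum>I))\<^sup>2 \<le> 4 * real (card I)" if "I \<subseteq> V" for I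
      using V that by (simp add: good_vertices_def)
    have le: "(norm (orth_proj E x))\<^sup>2 \<le> (norm x)\<^sup>2" for x
      using orth_proj_norm_le[OF E] by (simp add: power_mono)
    have "(norm (orth_proj E (\<Sum>I)))\<^sup>2 \<le> 4 * real d" by (rule order_trans[OF le V'[OF I(1), unfolded I(2)]])
    moreover have "(\<Sum>a\<in>I. (norm (orth_proj E a))\<^sup>2) \<le> (\<Sum>a\<in>I. 4)"
    proof (rule sum_mono)
      fix a assume "a \<in> I"
      then have "(norm a)\<^sup>2 \<le> 4" using V'[of "{a}"] I(1) by auto
      then show "(norm (orth_proj E a))\<^sup>2 \<le> 4" using le[of a] by linarith
    qed
    ultimately show "(norm (orth_proj E (\<Sum>I)))\<^sup>2 + (\<Sum>a\<in>I. (norm (orth_proj E a))\<^sup>2) \<le> 8 * real d"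
      using I(2) by simp
  qed simp
  then have "(real d)\<^sup>2 * v\<^sup>2 * L\<^sup>2 \<le> 16" using d by (simp add: power3_eq_cube power2_eq_square mult_ac)
  then have "L\<^sup>2 \<le> 16 / ((real d)\<^sup>2 * v\<^sup>2)" using d v by (simp add: field_simps)
  also have "\<dots> = 16 * (real n / real d)\<^sup>2 * 36 powr (real n / real d)"
  proof -
    have "((1 / 6) powr (real n / real d))\<^sup>2 = (1 / 36) powr (real n / real d)"
      by (simp add: power2_eq_square powr_mult[symmetric])
    also have "\<dots> = 1 / 36 powr (real n / real d)" by (simp add: powr_divide)
    finally show ?thesis by (simp add: v_def power_divide)
  qed
  also have "\<dots> \<le> 16 * C\<^sup>2 * 36 powr C"
    using d nd by (intro mult_mono power_mono powr_mono) (auto simp: field_simps)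
  finally show ?thesis by (simp add: L_def)
qed

section \<open>Measurability on the Grassmannian\<close>

lemma gap_dist_bound:
  assumes "E \<in> grassmannian n d" "F \<in> grassmannian n d"
  shows "norm (orth_proj E x - orth_proj F x) \<le> gap_dist E F * norm x"
proof -
  have "bounded_linear (\<lambda>x. orth_proj E x - orth_proj F x)"
    using assms bounded_linear_orth_proj unfolding grassmannian_def by (intro bounded_linear_sub) blast+
  from onorm[OF this, of x] show ?thesis
    unfolding gap_dist_def by (meson abs_ge_self mult_right_mono norm_ge_zero order_trans)
qed

lemma openin_grassmann:
  "openin (grassmann_topology n d) U \<longleftrightarrow>
     U \<subseteq> grassmannian n d \<and> (\<forall>E\<in>U. \<exists>\<eta>>0. \<forall>F\<in>grassmannian n d. gap_dist E F < \<eta> \<longrightarrow> F \<in> U)"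
proof -
  interpret Metric_space "grassmannian n d" gap_dist by (rule Metric_space_grassmannian)
  have *: "mball E r \<subseteq> U \<longleftrightarrow> (\<forall>F\<in>grassmannian n d. gap_dist E F < r \<longrightarrow> F \<in> U)" if "E \<in> grassmannian n d" for E r
    using that by (auto simp: subset_eq)
  have "(\<forall>E. E \<in> U \<longrightarrow> (\<exists>r>0. mball E r \<subseteq> U)) \<longleftrightarrow>
      (\<forall>E\<in>U. \<exists>\<eta>>0. \<forall>F\<in>grassmannian n d. gap_dist E F < \<eta> \<longrightarrow> F \<in> U)" if "U \<subseteq> grassmannian n d"
    unfolding Ball_def[of U] using *[OF subsetD[OF that]] by simp
  then show ?thesis
    unfolding grassmann_topology_def openin_mtopology by (rule conj_cong[OF refl])
qed

lemma haar_space: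
  assumes "is_grassmann_haar n d \<mu>"
  shows "prob_space \<mu>" "space \<mu> = grassmannian n d"
  using assms by (auto simp: is_grassmann_haar_def)

lemma haar_open:
  assumes "is_grassmann_haar n d \<mu>" "openin (grassmann_topology n d) U"
  shows "U \<in> sets \<mu>"
  using assms by (auto simp: is_grassmann_haar_def intro: sigma_sets.Basic)

lemma measurable_proj_inner:
  assumes \<mu>: "is_grassmann_haar n d \<mu>"
  shows "(\<lambda>E. orth_proj E x \<bullet> y) \<in> borel_measurable \<mu>"
  unfolding borel_measurable_iff_less
proof
  fix a
  have "openin (grassmann_topology n d) {E \<in> grassmannian n d. orth_proj E x \<bullet> y < a}"
    unfolding openin_grassmann
  proof (intro conjI ballI)
    fix E assume E: "E \<in> {E \<in> grassmannian n d. orth_proj E x \<bullet> y < a}"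
    define \<eta> where "\<eta> = (a - orth_proj E x \<bullet> y) / (norm x * norm y + 1)"
    have N: "norm x * norm y + 1 > 0" by (simp add: add_nonneg_pos)
    have "\<eta> > 0" using E N by (simp add: \<eta>_def)
    moreover have "orth_proj F x \<bullet> y < a" if F: "F \<in> grassmannian n d" "gap_dist E F < \<eta>" for F
    proof -
      have "orth_proj F x \<bullet> y - orth_proj E x \<bullet> y = (orth_proj F x - orth_proj E x) \<bullet> y"
        by (simp add: inner_diff_left)
      also have "\<dots> \<le> norm (orth_proj F x - orth_proj E x) * norm y" by (rule norm_cauchy_schwarz)
      also have "\<dots> \<le> (gap_dist E F * norm x) * norm y"
        using gap_dist_bound[of E n d F x] E F by (intro mult_right_mono) (auto simp: norm_minus_commute)
      also have "\<dots> \<le> \<eta> * (norm x * norm y)"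
        using F(2) by (simp add: mult.assoc mult_right_mono)
      also have "\<dots> < \<eta> * (norm x * norm y + 1)" using \<open>\<eta> > 0\<close> by simp
      also have "\<dots> = a - orth_proj E x \<bullet> y" using N by (simp add: \<eta>_def)
      finally show ?thesis by simp
    qed
    ultimately show "\<exists>\<eta>>0. \<forall>F\<in>grassmannian n d. gap_dist E F < \<eta> \<longrightarrow> F \<in> {E \<in> grassmannian n d. orth_proj E x \<bullet> y < a}"
      by blast
  qed auto
  then show "{E \<in> space \<mu>. orth_proj E x \<bullet> y < a} \<in> sets \<mu>"
    using haar_open[OF \<mu>] haar_space[OF \<mu>] by simp
qed

lemma orth_proj_expand:
  assumes E: "E \<in> grassmannian n d"
  shows "orth_proj E g = (\<Sum>j<n. (\<Sum>i<n. coord g i * (orth_proj E (unit_vec i) \<bullet> unit_vec j)) *\<^sub>R unit_vec j)"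
proof -
  have sE: "subspace E" "E \<subseteq> euclid n" using E by (auto simp: grassmannian_def)
  note de = onb_dual_frame[OF onb_euclid[of n]]
  \<comment> \<open>\<open>g\<close> may have coordinates beyond \<open>n\<close>. They are
    orthogonal to \<open>E\<close> and are cut off first, so that the finite expansion
    applies.\<close>
  define g' where "g' = lin_comb unit_vec n (\<lambda>i. g \<bullet> unit_vec i)"
  have g': "g' = orth_proj (euclid n) g" unfolding g'_def by (rule orth_proj_onb[OF onb_euclid, symmetric])
  have "orth_proj E g = orth_proj E g'"
  proof (rule orth_proj_unique[OF sE(1) orth_proj(1)[OF sE]], intro ballI)
    fix z assume z: "z \<in> E"
    have "orthogonal (g - g') z"
      unfolding g' using z sE(2) by (intro orth_proj(2)[OF subspace_euclid order_refl]) auto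
    moreover have "orthogonal (g' - orth_proj E g') z" by (rule orth_proj(2)[OF sE z])
    ultimately show "orthogonal (g - orth_proj E g') z" by (simp add: orthogonal_def inner_diff_left)
  qed
  also have "\<dots> = lin_comb (\<lambda>i. orth_proj E (unit_vec i)) n (coord g)"
    unfolding g'_def by (simp add: linear_lin_comb[OF orth_proj_linear[OF E]])
  finally have *: "orth_proj E g = lin_comb (\<lambda>i. orth_proj E (unit_vec i)) n (coord g)" .
  have "orth_proj E g = lin_comb unit_vec n (\<lambda>j. orth_proj E g \<bullet> unit_vec j)"
    using dual_frame_expand[OF de] orth_proj(1)[OF sE] sE(2) by (metis subsetD)
  also have "\<dots> = (\<Sum>j<n. (\<Sum>i<n. coord g i * (orth_proj E (unit_vec i) \<bullet> unit_vec j)) *\<^sub>R unit_vec j)"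
    unfolding lin_comb_def[of unit_vec] by (subst *) (simp add: lin_comb_def inner_sum_left del: inner_unit_vec)
  finally show ?thesis .
qed

text \<open>The projection is a finite sum of products of matrix entries, measurable in
  \<open>E\<close>, and coordinates of \<open>g\<close>. Joint measurability is what the exchanges
  of integrals over \<open>E\<close> and over Gaussian vectors require.\<close>

lemma measurable_proj_pair:
  assumes \<mu>: "is_grassmann_haar n d \<mu>" and N: "sets N = sets borel"
  shows "(\<lambda>(E, g). orth_proj E g) \<in> borel_measurable (\<mu> \<Otimes>\<^sub>M N)"
proof -
  note [measurable] = measurable_proj_inner[OF \<mu>]
  have [measurable]: "(\<lambda>g. coord g i) \<in> borel_measurable N" for i
  proof -
    have "(\<lambda>g. unit_vec i \<bullet> g) \<in> borel_measurable borel" by (simp del: inner_unit_vec)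
    then show ?thesis using N measurable_cong_sets by fastforce
  qed
  have "(\<lambda>p. (\<Sum>j<n. (\<Sum>i<n. coord (snd p) i * (orth_proj (fst p) (unit_vec i) \<bullet> unit_vec j)) *\<^sub>R unit_vec j))
      \<in> borel_measurable (\<mu> \<Otimes>\<^sub>M N)"
    by (intro borel_measurable_sum borel_measurable_scaleR borel_measurable_const borel_measurable_times
      measurable_compose[OF measurable_fst measurable_proj_inner[OF \<mu>]] measurable_compose[OF measurable_snd]) measurable
  moreover have "(\<lambda>(E, g). orth_proj E g) p
     = (\<Sum>j<n. (\<Sum>i<n. coord (snd p) i * (orth_proj (fst p) (unit_vec i) \<bullet> unit_vec j)) *\<^sub>R unit_vec j)"
    if "p \<in> space (\<mu> \<Otimes>\<^sub>M N)" for p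
    using that haar_space(2)[OF \<mu>] orth_proj_expand by (auto simp: space_pair_measure split: prod.split)
  ultimately show ?thesis by (simp cong: measurable_cong)
qed

lemma measurable_proj:
  assumes \<mu>: "is_grassmann_haar n d \<mu>"
  shows "(\<lambda>E. orth_proj E x) \<in> borel_measurable \<mu>"
  using measurable_compose[OF _ measurable_proj_pair[OF \<mu>, of borel], of "\<lambda>E. (E, x)" \<mu>] by simp

section \<open>Reflections\<close>

text \<open>The Householder reflection for a unit vector \<open>w\<close>. Reflections are enough
  symmetry for all that follows: they move any vector to any other one of the same norm, and as
  involutions they make images and preimages interchangeable.\<close>

definition refl_map :: "rseq \<Rightarrow> rseq \<Rightarrow> rseq" where
  "refl_map w x = x - (2 * (x \<bullet> w)) *\<^sub>R w"

lemma linear_refl_map: "linear (refl_map w)"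
  by (rule linearI) (simp_all add: refl_map_def inner_add_left algebra_simps)

lemma refl_map_inner:
  assumes "norm w = 1"
  shows "refl_map w x \<bullet> refl_map w y = x \<bullet> y"
  using assms by (simp add: refl_map_def inner_diff_left inner_diff_right norm_eq_1 inner_commute)

lemma refl_map_involution:
  assumes "norm w = 1"
  shows "refl_map w (refl_map w x) = x"
  using assms by (simp add: refl_map_def inner_diff_left norm_eq_1 algebra_simps)

lemma refl_map_norm: "norm w = 1 \<Longrightarrow> norm (refl_map w x) = norm x"
  by (simp add: norm_eq_sqrt_inner refl_map_inner)

lemma refl_map_orthogonal: "norm w = 1 \<Longrightarrow> orthogonal_transformation (refl_map w)"
  by (simp add: orthogonal_transformation_def linear_refl_map refl_map_inner)

lemma refl_map_euclid: "w \<in> euclid n \<Longrightarrow> x \<in> euclid n \<Longrightarrow> refl_map w x \<in> euclid n"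
  unfolding refl_map_def by (intro subspace_diff[OF subspace_euclid] subspace_scale[OF subspace_euclid])

lemma refl_map_image_euclid:
  assumes "w \<in> euclid n" "norm w = 1"
  shows "refl_map w ` euclid n = euclid n"
  using refl_map_euclid[OF assms(1)] refl_map_involution[OF assms(2)]
  by (auto simp: image_iff) metis

lemma measurable_refl_map [measurable]: "refl_map w \<in> borel_measurable borel"
  unfolding refl_map_def by measurable

lemma refl_map_exists:
  assumes "x \<in> euclid n" "y \<in> euclid n" "norm x = norm y" "x \<noteq> y"
  shows "\<exists>w\<in>euclid n. norm w = 1 \<and> refl_map w x = y"
proof
  define w where "w = (1 / norm (x - y)) *\<^sub>R (x - y)"
  show "w \<in> euclid n" unfolding w_def
    by (intro subspace_scale[OF subspace_euclid] subspace_diff[OF subspace_euclid] assms)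
  have xx: "x \<bullet> x = y \<bullet> y" using assms(3) by (simp add: norm_eq)
  have "(norm (x - y))\<^sup>2 = 2 * (x \<bullet> (x - y))"
    using xx by (simp add: power2_norm_eq_inner inner_diff_left inner_diff_right inner_commute)
  moreover have "(2 * (x \<bullet> w)) * (1 / norm (x - y)) = (2 * (x \<bullet> (x - y))) / (norm (x - y))\<^sup>2"
    unfolding w_def inner_scaleR_right by (simp add: power2_eq_square)
  ultimately have "(2 * (x \<bullet> w)) * (1 / norm (x - y)) = 1"
    using assms(4) by (metis divide_self_if eq_iff_diff_eq_0 norm_eq_zero power_eq_0_iff)
  moreover have "(2 * (x \<bullet> w)) *\<^sub>R w = ((2 * (x \<bullet> w)) * (1 / norm (x - y))) *\<^sub>R (x - y)"
    by (subst (2) w_def) (simp only: scaleR_scaleR)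
  ultimately have "(2 * (x \<bullet> w)) *\<^sub>R w = x - y" by (simp only: scaleR_one)
  then show "norm w = 1 \<and> refl_map w x = y" using assms(4) by (simp add: w_def refl_map_def)
qed

lemma refl_onb:
  assumes b: "orthonormal_basis E d b" and w: "norm w = 1"
  shows "orthonormal_basis (refl_map w ` E) d (\<lambda>i. refl_map w (b i))"
proof -
  have "span ((\<lambda>i. refl_map w (b i)) ` {..<d}) = refl_map w ` span (b ` {..<d})"
    by (simp add: linear_span_image[OF linear_refl_map] image_image[symmetric])
  then show ?thesis using b w by (simp add: orthonormal_basis_def refl_map_inner)
qed

lemma refl_grassmannian:
  assumes E: "E \<in> grassmannian n d" and w: "w \<in> euclid n" "norm w = 1"
  shows "refl_map w ` E \<in> grassmannian n d"
proof -
  obtain b where b: "orthonormal_basis E d b" using grassmannian_onb[OF E] .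
  have "dim (refl_map w ` E) = d" "subspace (refl_map w ` E)"
    using dual_frame_dim[OF onb_dual_frame[OF refl_onb[OF b w(2)]]]
      dual_frame_subspace[OF onb_dual_frame[OF refl_onb[OF b w(2)]]] by auto
  moreover have "refl_map w ` E \<subseteq> euclid n"
    using E refl_map_euclid[OF w(1)] by (auto simp: grassmannian_def)
  ultimately show ?thesis by (simp add: grassmannian_def)
qed

lemma refl_orth_proj:
  assumes E: "E \<in> grassmannian n d" and w: "w \<in> euclid n" "norm w = 1"
  shows "orth_proj (refl_map w ` E) (refl_map w x) = refl_map w (orth_proj E x)"
proof (rule orth_proj_unique)
  have sE: "subspace E" "E \<subseteq> euclid n" using E by (auto simp: grassmannian_def)
  show "subspace (refl_map w ` E)" using refl_grassmannian[OF assms] by (simp add: grassmannian_def)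
  show "refl_map w (orth_proj E x) \<in> refl_map w ` E" using orth_proj(1)[OF sE] by blast
  show "\<forall>z\<in>refl_map w ` E. orthogonal (refl_map w x - refl_map w (orth_proj E x)) z"
    using orth_proj(2)[OF sE, of _ x] refl_map_inner[OF w(2)]
    by (auto simp: orthogonal_def linear_diff[OF linear_refl_map, symmetric])
qed

text \<open>A reflection does not increase \<open>gap_dist\<close>, so it acts continuously on the
  Grassmannian. Invariance, assumed for images, is restated as an equality of push-forwards, the
  form that integrals need.\<close>

lemma haar_refl:
  assumes \<mu>: "is_grassmann_haar n d \<mu>" and w: "w \<in> euclid n" "norm w = 1"
  shows "(\<lambda>E. refl_map w ` E) \<in> measurable \<mu> \<mu>" and "distr \<mu> \<mu> (\<lambda>E. refl_map w ` E) = \<mu>"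
proof -
  let ?R = "\<lambda>E. refl_map w ` E"
  have inv: "?R (?R E) = E" for E by (simp add: image_image refl_map_involution[OF w(2)])
  have gap: "gap_dist (?R E) (?R F) \<le> gap_dist E F"
    if EF: "E \<in> grassmannian n d" "F \<in> grassmannian n d" for E F
  proof -
    have RG: "?R E \<in> grassmannian n d" "?R F \<in> grassmannian n d" using EF refl_grassmannian w by auto
    have "norm (orth_proj (?R E) x - orth_proj (?R F) x) \<le> gap_dist E F * norm x" for x
    proof -
      define y where "y = refl_map w x"
      have x: "x = refl_map w y" by (simp add: y_def refl_map_involution[OF w(2)])
      have "orth_proj (?R E) x - orth_proj (?R F) x = refl_map w (orth_proj E y - orth_proj F y)"
        unfolding x by (simp add: refl_orth_proj[OF EF(1) w] refl_orth_proj[OF EF(2) w] linear_diff[OF linear_refl_map])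
      then show ?thesis using gap_dist_bound[OF EF, of y] by (simp add: refl_map_norm[OF w(2)] x)
    qed
    then have "onorm (\<lambda>x. orth_proj (?R E) x - orth_proj (?R F) x) \<le> gap_dist E F"
      by (intro onorm_bound) (simp_all add: gap_dist_def)
    moreover have "onorm (\<lambda>x. orth_proj (?R E) x - orth_proj (?R F) x) \<ge> 0"
      using RG bounded_linear_orth_proj unfolding grassmannian_def
      by (intro onorm_pos_le bounded_linear_sub) blast+
    ultimately show ?thesis by (simp add: gap_dist_def)
  qed
  have sp: "space \<mu> = grassmannian n d" and
    st: "sets \<mu> = sigma_sets (grassmannian n d) {U. openin (grassmann_topology n d) U}"
    using \<mu> by (auto simp: is_grassmann_haar_def)
  show meas: "?R \<in> measurable \<mu> \<mu>"
  proof (rule measurable_sigma_sets[OF st])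
    show "{U. openin (grassmann_topology n d) U} \<subseteq> Pow (grassmannian n d)"
      by (auto simp: openin_grassmann)
    show "?R \<in> space \<mu> \<rightarrow> grassmannian n d" using refl_grassmannian w by (auto simp: sp)
    fix U assume U: "U \<in> {U. openin (grassmann_topology n d) U}"
    have "openin (grassmann_topology n d) (?R -` U \<inter> space \<mu>)"
      unfolding openin_grassmann
    proof (intro conjI ballI)
      fix E assume E: "E \<in> ?R -` U \<inter> space \<mu>"
      then obtain \<eta> where "\<eta> > 0" "\<And>F. F \<in> grassmannian n d \<Longrightarrow> gap_dist (?R E) F < \<eta> \<Longrightarrow> F \<in> U"
        using U by (auto simp: openin_grassmann)
      then show "\<exists>\<eta>>0. \<forall>F\<in>grassmannian n d. gap_dist E F < \<eta> \<longrightarrow> F \<in> ?R -` U \<inter> space \<mu>"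
        using gap[of E] E refl_grassmannian[OF _ w] by (intro exI[of _ \<eta>]) (fastforce simp: sp)
    qed (auto simp: sp)
    then show "?R -` U \<inter> space \<mu> \<in> sets \<mu>" by (rule haar_open[OF \<mu>])
  qed
  show "distr \<mu> \<mu> ?R = \<mu>"
  proof (rule measure_eqI)
    fix A assume "A \<in> sets (distr \<mu> \<mu> ?R)"
    then have A: "A \<in> sets \<mu>" by simp
    then have AG: "A \<subseteq> grassmannian n d" using sets.sets_into_space sp by metis
    \<comment> \<open>Preimage and image coincide because the action is an involution.\<close>
    have "?R -` A \<inter> space \<mu> = ?R ` A"
      using AG inv refl_grassmannian[OF _ w] unfolding sp by (auto simp: image_iff) metis
    then have "emeasure (distr \<mu> \<mu> ?R) A = emeasure \<mu> (?R ` A)" using A meas by (simp add: emeasure_distr)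
    also have "\<dots> = emeasure \<mu> A"
      using \<mu> A refl_map_orthogonal[OF w(2)] refl_map_image_euclid[OF w] by (auto simp: is_grassmann_haar_def)
    finally show "emeasure (distr \<mu> \<mu> ?R) A = emeasure \<mu> A" .
  qed simp
qed

lemma gaussian_refl:
  assumes e: "orthonormal_basis (euclid n) n e" and w: "w \<in> euclid n" "norm w = 1"
  shows "distr (gaussian e n) borel (refl_map w) = gaussian e n"
proof -
  have "orthonormal_basis (euclid n) n (\<lambda>i. refl_map w (e i))"
    using refl_onb[OF e w(2)] refl_map_image_euclid[OF w] by simp
  from gaussian_onb[OF this e] have "gaussian (\<lambda>i. refl_map w (e i)) n = gaussian e n" .
  moreover have "distr (gaussian e n) borel (refl_map w) = distr (gauss_coord n) borel (refl_map w \<circ> lin_comb e n)"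
    unfolding gaussian_def by (rule distr_distr) auto
  moreover have "refl_map w \<circ> lin_comb e n = lin_comb (\<lambda>i. refl_map w (e i)) n"
    by (auto simp: linear_lin_comb[OF linear_refl_map])
  ultimately show ?thesis by (simp add: gaussian_def)
qed

text \<open>
  Two measures invariant under reflections agree on cones up to an enlargement: compare both with
  the kernel of pairs of directions at small angle, whose mass near a direction is constant.
\<close>

lemma invariant_compare:
  fixes \<rho> \<gamma> :: "rseq measure"
  assumes \<rho>: "prob_space \<rho>" "sets \<rho> = sets borel" "AE x in \<rho>. x \<in> euclid n \<and> x \<noteq> 0"
    and \<gamma>: "prob_space \<gamma>" "sets \<gamma> = sets borel" "AE x in \<gamma>. x \<in> euclid n \<and> x \<noteq> 0"
    and inv: "\<And>w. w \<in> euclid n \<Longrightarrow> norm w = 1 \<Longrightarrow> distr \<rho> borel (refl_map w) = \<rho>"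
      "\<And>w. w \<in> euclid n \<Longrightarrow> norm w = 1 \<Longrightarrow> distr \<gamma> borel (refl_map w) = \<gamma>"
    and n: "n > 0" and eps: "\<epsilon> > 0"
    and pos: "\<And>r. r > 0 \<Longrightarrow> emeasure \<gamma> (ball (unit_vec 0) r) > 0"
    and A: "A \<in> sets borel" "A' \<in> sets borel"
    and AA: "\<And>x y. x \<in> A \<Longrightarrow> x \<noteq> 0 \<Longrightarrow> y \<in> euclid n \<Longrightarrow> y \<noteq> 0 \<Longrightarrow> x \<bullet> y \<ge> (1 - \<epsilon>) * norm x * norm y \<Longrightarrow> y \<in> A'"
  shows "emeasure \<rho> A \<le> emeasure \<gamma> A'"
proof -
  note [measurable_cong] = \<rho>(2) \<gamma>(2)
  note [measurable] = A
  interpret \<rho>: prob_space \<rho> by fact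
  interpret \<gamma>: prob_space \<gamma> by fact
  interpret P: pair_sigma_finite \<rho> \<gamma> ..
  \<comment> \<open>The kernel depends only on the angle between \<open>x\<close> and
    \<open>y\<close>: it is symmetric, homogeneous of degree 0 and invariant under
    reflections.\<close>
  define k :: "rseq \<Rightarrow> rseq \<Rightarrow> ennreal" where "k = (\<lambda>x y. if x \<bullet> y \<ge> (1 - \<epsilon>) * norm x * norm y then 1 else 0)"
  have ksym: "k x y = k y x" for x y by (simp add: k_def inner_commute mult_ac)
  have kscale: "k (s *\<^sub>R x) y = k x y" if "s > 0" for s x y
    using that by (simp add: k_def mult_ac)
  have krefl: "k (refl_map w x) (refl_map w y) = k x y" if "norm w = 1" for w x y
    using that by (simp add: k_def refl_map_inner refl_map_norm)
  have km [measurable]: "(\<lambda>p. k (fst p) (snd p)) \<in> borel_measurable (borel \<Otimes>\<^sub>M borel)"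
    unfolding k_def by measurable
  have km' [measurable]: "(\<lambda>y. k x y) \<in> borel_measurable borel" for x unfolding k_def by measurable
  let ?u = "unit_vec 0"
  have u: "?u \<in> euclid n" "norm ?u = 1" using n by (auto simp: unit_vec_mem norm_eq_1)
  \<comment> \<open>After normalization a reflection moves \<open>x\<close> to
    \<open>unit_vec 0\<close>, so the mass of the kernel around \<open>x\<close> is the same in all
    directions.\<close>
  have const: "(\<integral>\<^sup>+y. k x y \<partial>\<nu>) = (\<integral>\<^sup>+y. k ?u y \<partial>\<nu>)"
    if x: "x \<in> euclid n" "x \<noteq> 0" and \<nu>: "sets \<nu> = sets borel"
      "\<And>w. w \<in> euclid n \<Longrightarrow> norm w = 1 \<Longrightarrow> distr \<nu> borel (refl_map w) = \<nu>" for x and \<nu> :: "rseq measure"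
  proof -
    note [measurable_cong] = \<nu>(1)
    define x' where "x' = (1 / norm x) *\<^sub>R x"
    have x': "x' \<in> euclid n" "norm x' = norm ?u"
      using x u(2) by (auto simp: x'_def intro: subspace_scale[OF subspace_euclid])
    have "(\<integral>\<^sup>+y. k x y \<partial>\<nu>) = (\<integral>\<^sup>+y. k x' y \<partial>\<nu>)"
      using x by (simp add: x'_def kscale)
    also have "\<dots> = (\<integral>\<^sup>+y. k ?u y \<partial>\<nu>)"
    proof (cases "x' = ?u")
      case False
      obtain w where w: "w \<in> euclid n" "norm w = 1" "refl_map w x' = ?u"
        using refl_map_exists[OF x'(1) u(1) x'(2) False] by blast
      have "(\<integral>\<^sup>+y. k ?u y \<partial>\<nu>) = (\<integral>\<^sup>+y. k ?u y \<partial>distr \<nu> borel (refl_map w))" by (simp add: \<nu>(2) w)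
      also have "\<dots> = (\<integral>\<^sup>+y. k ?u (refl_map w y) \<partial>\<nu>)" by (rule nn_integral_distr) auto
      also have "\<dots> = (\<integral>\<^sup>+y. k x' y \<partial>\<nu>)" unfolding w(3)[symmetric] by (simp add: krefl w(2))
      finally show ?thesis by simp
    qed simp
    finally show ?thesis .
  qed
  define c where "c = (\<integral>\<^sup>+y. k ?u y \<partial>\<gamma>)"
  define c' where "c' = (\<integral>\<^sup>+y. k ?u y \<partial>\<rho>)"
  \<comment> \<open>The double integral of the kernel, evaluated in both orders, shows that the two
    measures give equal mass to the cap.\<close>
  have "c = (\<integral>\<^sup>+x. c \<partial>\<rho>)" by (simp add: \<rho>.emeasure_space_1)
  also have "\<dots> = (\<integral>\<^sup>+x. (\<integral>\<^sup>+y. k x y \<partial>\<gamma>) \<partial>\<rho>)"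
    unfolding c_def using \<rho>(3) by (intro nn_integral_cong_AE, eventually_elim) (simp add: const \<gamma>(2) inv(2))
  also have "\<dots> = (\<integral>\<^sup>+y. (\<integral>\<^sup>+x. k x y \<partial>\<rho>) \<partial>\<gamma>)"
    by (rule P.Fubini'[symmetric]) (use km in \<open>simp add: split_beta'\<close>)
  also have "\<dots> = (\<integral>\<^sup>+y. c' \<partial>\<gamma>)"
    unfolding c'_def using \<gamma>(3) by (intro nn_integral_cong_AE, eventually_elim) (simp add: ksym[of _ "_ :: rseq"] const \<rho>(2) inv(1) cong: nn_integral_cong)
  also have "\<dots> = c'" by (simp add: \<gamma>.emeasure_space_1)
  finally have cc: "c = c'" .
  have "c \<le> (\<integral>\<^sup>+y. 1 \<partial>\<gamma>)" unfolding c_def by (intro nn_integral_mono) (auto simp: k_def)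
  then have cfin: "c < \<infinity>" using \<gamma>.emeasure_space_1 by (simp add: order_le_less_trans)
  have cpos: "c > 0"
  proof -
    \<comment> \<open>On the ball \<open>?u \<bullet> y\<close> is at least \<open>1 - r\<close> and
      \<open>norm y\<close> at most \<open>1 + r\<close>; with \<open>2 r <= \<epsilon>\<close> this
      puts the ball inside the cap. The bound \<open>1 / 2\<close> covers the case
      \<open>\<epsilon> > 1\<close>.\<close>
    define r where "r = min (\<epsilon> / 2) (1 / 2)"
    have r: "r > 0" "r \<le> \<epsilon> / 2" "r \<le> 1 / 2" using eps by (auto simp: r_def)
    have "0 < emeasure \<gamma> (ball ?u r)" using pos r by blast
    also have "\<dots> = (\<integral>\<^sup>+y. indicator (ball ?u r) y \<partial>\<gamma>)" using \<gamma>(2) by simp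
    also have "\<dots> \<le> c" unfolding c_def
    proof (rule nn_integral_mono)
      fix y
      show "indicator (ball ?u r) y \<le> k ?u y"
      proof (cases "y \<in> ball ?u r")
        case True
        then have yu: "norm (y - ?u) \<le> r" by (simp add: dist_norm norm_minus_commute)
        have "?u \<bullet> y = 1 + ?u \<bullet> (y - ?u)" using u(2) by (simp only: inner_diff_right norm_eq_1)
        moreover have "\<bar>?u \<bullet> (y - ?u)\<bar> \<le> norm (y - ?u)"
          using Cauchy_Schwarz_ineq2[of ?u "y - ?u"] by (simp only: u(2) mult_1_left)
        ultimately have 1: "?u \<bullet> y \<ge> 1 - r" using yu u(2) by linarith
        have 2: "norm y \<le> 1 + r" using norm_triangle_ineq[of ?u "y - ?u"] yu u(2) by simp
        have "(1 - \<epsilon>) * norm y \<le> 1 - r"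
        proof (cases "\<epsilon> \<le> 1")
          case True
          then have "(1 - \<epsilon>) * norm y \<le> (1 - \<epsilon>) * (1 + r)" using 2 by (intro mult_left_mono) auto
          also have "\<dots> = 1 - r + (2 * r - \<epsilon>) - \<epsilon> * r" by (simp add: algebra_simps)
          also have "\<dots> \<le> 1 - r" using r mult_nonneg_nonneg[of \<epsilon> r] eps by linarith
          finally show ?thesis .
        next
          case False
          then have "(1 - \<epsilon>) * norm y \<le> 0" by (intro mult_nonpos_nonneg) auto
          then show ?thesis using r by linarith
        qed
        then have "k ?u y = 1" using 1 u(2) unfolding k_def by simp
        then show ?thesis by (simp add: indicator_def)
      qed simp
    qed
    finally show ?thesis .
  qed
  have "c * emeasure \<rho> A = (\<integral>\<^sup>+x. c * indicator A x \<partial>\<rho>)" by (simp add: nn_integral_cmult_indicator)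
  also have "\<dots> = (\<integral>\<^sup>+x. (\<integral>\<^sup>+y. indicator A x * k x y \<partial>\<gamma>) \<partial>\<rho>)"
    unfolding c_def using \<rho>(3)
    by (intro nn_integral_cong_AE, eventually_elim) (simp add: const \<gamma>(2) inv(2) nn_integral_cmult mult.commute)
  also have "\<dots> = (\<integral>\<^sup>+y. (\<integral>\<^sup>+x. indicator A x * k x y \<partial>\<rho>) \<partial>\<gamma>)"
    by (rule P.Fubini'[symmetric]) (use km in \<open>simp add: split_beta'\<close>)
  also have "\<dots> \<le> (\<integral>\<^sup>+y. (\<integral>\<^sup>+x. indicator A' y * k x y \<partial>\<rho>) \<partial>\<gamma>)"
  proof (rule nn_integral_mono_AE)
    show "AE y in \<gamma>. (\<integral>\<^sup>+x. indicator A x * k x y \<partial>\<rho>) \<le> (\<integral>\<^sup>+x. indicator A' y * k x y \<partial>\<rho>)"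
      using \<gamma>(3)
    proof eventually_elim
      case (elim y)
      show ?case
      proof (rule nn_integral_mono_AE)
        show "AE x in \<rho>. indicator A x * k x y \<le> indicator A' y * k x y"
          using \<rho>(3)
        proof eventually_elim
          case (elim x)
          show ?case using AA[of x y] elim \<open>y \<in> euclid n \<and> y \<noteq> 0\<close> by (auto simp: indicator_def k_def)
        qed
      qed
    qed
  qed
  also have "\<dots> = (\<integral>\<^sup>+y. c' * indicator A' y \<partial>\<gamma>)"
  proof (rule nn_integral_cong_AE)
    show "AE y in \<gamma>. (\<integral>\<^sup>+x. indicator A' y * k x y \<partial>\<rho>) = c' * indicator A' y"
      using \<gamma>(3)
    proof eventually_elim
      case (elim y)
      have "(\<integral>\<^sup>+x. k x y \<partial>\<rho>) = (\<integral>\<^sup>+x. k y x \<partial>\<rho>)" by (simp add: ksym[of _ y])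
      also have "\<dots> = c'" unfolding c'_def using elim by (intro const \<rho>(2) inv(1)) auto
      finally have "(\<integral>\<^sup>+x. k x y \<partial>\<rho>) = c'" .
      then show ?case by (cases "y \<in> A'") auto
    qed
  qed
  also have "\<dots> = c' * emeasure \<gamma> A'" by (simp add: nn_integral_cmult_indicator)
  finally have "c * emeasure \<rho> A \<le> c * emeasure \<gamma> A'" by (simp add: cc)
  then show ?thesis using cpos cfin
    by (simp add: ennreal_mult_le_mult_iff)
qed

section \<open>Semicontinuity of the isotropy constant\<close>

lemma nn_integral_frame_translate:
  assumes w: "dual_frame E d w v" and u: "u \<in> E" and f: "f \<in> borel_measurable borel"
  shows "(\<integral>\<^sup>+x. f (x + u) \<partial>frame_measure w d) = (\<integral>\<^sup>+x. f x \<partial>frame_measure w d)"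
proof -
  have "(\<integral>\<^sup>+x. f x \<partial>frame_measure w d) = (\<integral>\<^sup>+x. f x \<partial>distr (frame_measure w d) borel (\<lambda>x. x + u))"
    by (simp add: frame_translate[OF w u])
  also have "\<dots> = (\<integral>\<^sup>+x. f (x + u) \<partial>frame_measure w d)" using f by (intro nn_integral_distr) auto
  finally show ?thesis by simp
qed

text \<open>A vector of \<open>E\<close> is moved by at most half its norm under the projection to
  \<open>E0\<close>, so the projection is injective on \<open>E\<close>; equality of dimensions
  makes it onto.\<close>

lemma grassmannian_near_bij:
  assumes E: "E \<in> grassmannian n d" and E0: "E0 \<in> grassmannian n d" and near: "gap_dist E0 E \<le> 1 / 2"
  shows "\<And>x. x \<in> E \<Longrightarrow> norm x \<le> 2 * norm (orth_proj E0 x)" and "bij_betw (orth_proj E0) E E0"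
proof -
  have sE: "subspace E" "E \<subseteq> euclid n" and sE0: "subspace E0" "E0 \<subseteq> euclid n"
    using E E0 by (auto simp: grassmannian_def)
  obtain b where b: "orthonormal_basis E d b" using grassmannian_onb[OF E] .
  obtain b0 where b0: "orthonormal_basis E0 d b0" using grassmannian_onb[OF E0] .
  note db = onb_dual_frame[OF b]
  show nrm: "norm x \<le> 2 * norm (orth_proj E0 x)" if "x \<in> E" for x
  proof -
    have "norm (orth_proj E0 x - x) \<le> gap_dist E0 E * norm x"
      using gap_dist_bound[OF E0 E, of x] orth_proj_fixed[OF sE(1) that] by simp
    also have "\<dots> \<le> 1 / 2 * norm x" using near by (intro mult_right_mono) auto
    finally show ?thesis using norm_triangle_ineq3[of "orth_proj E0 x" x] by linarith
  qed
  have lin: "linear (orth_proj E0)" by (rule orth_proj_linear[OF E0])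
  have "\<exists>v. dual_frame E0 d (\<lambda>i. orth_proj E0 (b i)) v"
  proof (rule dual_frame_exists[OF b0])
    fix t i assume t: "lin_comb (\<lambda>i. orth_proj E0 (b i)) d t = 0" and i: "i < d"
    have "orth_proj E0 (lin_comb b d t) = 0" using t by (simp add: linear_lin_comb[OF lin])
    then have "lin_comb b d t = 0" using nrm[OF dual_frame_mem[OF db], of t] by simp
    then show "t i = 0" using dual_frame_coeff[OF db i, of t] by simp
  qed (rule orth_proj(1)[OF sE0])
  then obtain v where v: "dual_frame E0 d (\<lambda>i. orth_proj E0 (b i)) v" by blast
  show "bij_betw (orth_proj E0) E E0"
    unfolding bij_betw_def
  proof
    show "inj_on (orth_proj E0) E"
    proof (rule inj_onI)
      fix x y assume xy: "x \<in> E" "y \<in> E" "orth_proj E0 x = orth_proj E0 y"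
      then have "orth_proj E0 (x - y) = 0" by (simp add: linear_diff[OF lin])
      then show "x = y" using nrm[OF subspace_diff[OF sE(1) xy(1,2)]] by simp
    qed
    show "orth_proj E0 ` E = E0"
    proof
      show "E0 \<subseteq> orth_proj E0 ` E"
      proof
        fix y assume y: "y \<in> E0"
        have "y = orth_proj E0 (lin_comb b d (\<lambda>i. y \<bullet> v i))"
          using dual_frame_expand[OF v y] by (simp add: linear_lin_comb[OF lin])
        then show "y \<in> orth_proj E0 ` E" using dual_frame_mem[OF db] by blast
      qed
    qed (use orth_proj(1)[OF sE0] in auto)
  qed
qed

lemma hull_near:
  fixes K :: "rseq set"
  assumes "convex K" "x \<in> K" "(1 / \<epsilon>) *\<^sub>R y \<in> K" "\<epsilon> > 0"
  shows "(1 / (1 + \<epsilon>)) *\<^sub>R (x + y) \<in> K"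
proof -
  have "(1 / (1 + \<epsilon>)) *\<^sub>R x + (\<epsilon> / (1 + \<epsilon>)) *\<^sub>R ((1 / \<epsilon>) *\<^sub>R y) \<in> K"
    using assms(4) by (intro convexD[OF assms(1-3)]) (auto simp: field_simps)
  then show ?thesis using assms(4) by (simp add: scaleR_add_right)
qed

text \<open>Upper semicontinuity, which makes the exceptional sets measurable. For \<open>E\<close>
  near \<open>E0\<close> the projection to \<open>E0\<close> carries \<open>K\<close> to a body
  between \<open>K0 / (1 + \<epsilon>)\<close> and \<open>(1 + \<epsilon>) K0\<close>; inserting the
  isotropic position of \<open>K0\<close> as test map into the variational bound transfers the
  bound.\<close>

lemma isotropy_open:
  assumes V: "good_vertices n V" and d: "d > 0"
  shows "openin (grassmann_topology n d) {E \<in> grassmannian n d. isotropy_constant E (convex hull (orth_proj E ` V)) < C}"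
  unfolding openin_grassmann
proof (intro conjI ballI)
  fix E0 assume "E0 \<in> {E \<in> grassmannian n d. isotropy_constant E (convex hull (orth_proj E ` V)) < C}"
  then have E0: "E0 \<in> grassmannian n d" and LC: "isotropy_constant E0 (convex hull (orth_proj E0 ` V)) < C" by auto
  define K0 where "K0 = convex hull (orth_proj E0 ` V)"
  define L0 where "L0 = isotropy_constant E0 K0"
  obtain r where r: "r > 0" "ball 0 r \<inter> euclid n \<subseteq> convex hull V" using V by (auto simp: good_vertices_def)
  have Vn: "norm a \<le> 2" if "a \<in> V" for a
  proof -
    have "(norm (\<Sum>{a}))\<^sup>2 \<le> 4 * real (card {a})" using V that unfolding good_vertices_def by blast
    then have "(norm a)\<^sup>2 \<le> 2\<^sup>2" by simp
    then show ?thesis by (rule power2_le_imp_le) simp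
  qed
  obtain b0 where b0: "orthonormal_basis E0 d b0" using grassmannian_onb[OF E0] .
  note db0 = onb_dual_frame[OF b0]
  have sE0: "subspace E0" "E0 \<subseteq> euclid n" using E0 by (auto simp: grassmannian_def)
  have cb0: "convex_body E0 K0" unfolding K0_def by (rule proj_convex_body[OF E0 V])
  have ball0: "ball 0 r \<inter> E0 \<subseteq> K0" unfolding K0_def by (rule proj_ball[OF E0 r(2)])
  obtain T a0 where T: "linear T" "bij_betw T E0 E0" "a0 \<in> E0" and iso: "isotropic_body E0 ((\<lambda>x. a0 + T x) ` K0) L0"
    using isotropy_constant_position[OF b0 d cb0] unfolding L0_def by blast
  define K1 where "K1 = (\<lambda>x. a0 + T x) ` K0"
  have L0: "L0 > 0" "L0 < C" using iso LC by (auto simp: isotropic_body_def L0_def K0_def)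
  \<comment> \<open>The volume of the test image loses a factor
    \<open>(1 + \<epsilon>)^(2 d)\<close>, and the power \<open>1 + 2 / d\<close> turns this into
    the exponent \<open>2 d + 4\<close>.\<close>
  have "((\<lambda>\<epsilon>. L0\<^sup>2 * (1 + \<epsilon>) ^ (2 * d + 4)) \<longlongrightarrow> L0\<^sup>2 * (1 + 0) ^ (2 * d + 4)) (at_right 0)"
    by (intro tendsto_intros)
  moreover have "L0\<^sup>2 < C\<^sup>2" using L0 by (intro power_strict_mono) auto
  ultimately have "eventually (\<lambda>\<epsilon>. L0\<^sup>2 * (1 + \<epsilon>) ^ (2 * d + 4) < C\<^sup>2) (at_right 0)"
    by (intro order_tendstoD(2)[where y = "L0\<^sup>2 * (1 + 0) ^ (2 * d + 4)"]) auto
  then obtain \<epsilon> where eps: "\<epsilon> > 0" "L0\<^sup>2 * (1 + \<epsilon>) ^ (2 * d + 4) < C\<^sup>2"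
    unfolding eventually_at_right_field by (metis dense zero_less_one)
  \<comment> \<open>Vertices have norm at most 2, hence are displaced by at most
    \<open>2 \<eta>\<close>, which is \<open>r / 4\<close> after division by \<epsilon>. The bound
    \<open>1 / 2\<close> is for \<open>grassmannian_near_bij\<close>.\<close>
  define \<eta> where "\<eta> = min (1 / 2) (\<epsilon> * r / 8)"
  have eta: "\<eta> > 0" "\<eta> \<le> 1 / 2" "8 * \<eta> \<le> \<epsilon> * r" using eps r by (auto simp: \<eta>_def)
  show "\<exists>\<eta>>0. \<forall>F\<in>grassmannian n d. gap_dist E0 F < \<eta> \<longrightarrow>
      F \<in> {E \<in> grassmannian n d. isotropy_constant E (convex hull (orth_proj E ` V)) < C}"
  proof (intro exI[of _ \<eta>] conjI ballI impI eta)
    fix E assume E: "E \<in> grassmannian n d" and near: "gap_dist E0 E < \<eta>"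
    have nearh: "gap_dist E0 E \<le> 1 / 2" using near eta by linarith
    have sE: "subspace E" "E \<subseteq> euclid n" using E by (auto simp: grassmannian_def)
    obtain b where b: "orthonormal_basis E d b" using grassmannian_onb[OF E] .
    define P0 where "P0 = orth_proj E0"
    define P where "P = orth_proj E"
    define K where "K = convex hull (P ` V)"
    define L where "L = isotropy_constant E K"
    have linP0: "linear P0" and linP: "linear P" unfolding P0_def P_def using orth_proj_linear E E0 by auto
    note bij = grassmannian_near_bij[OF E E0 nearh, folded P0_def]
    have PE: "P x \<in> E" and P0E: "P0 x \<in> E0" for x
      unfolding P_def P0_def using orth_proj(1)[OF sE] orth_proj(1)[OF sE0] by auto
    have cb: "convex_body E K" unfolding K_def P_def by (rule proj_convex_body[OF E V])
    have ballE: "ball 0 r \<inter> E \<subseteq> K" unfolding K_def P_def by (rule proj_ball[OF E r(2)])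
    have cvx: "convex K" "convex K0" using cb cb0 by (auto simp: convex_body_def)
    \<comment> \<open>The displacement in \<open>E0\<close> of the projected vertex when the
      projection passes through \<open>E\<close>; a small error is absorbed by the ball of radius
      \<open>r\<close> inside both polytopes.\<close>
    define \<delta> where "\<delta> = (\<lambda>a. P0 (P a) - P0 a)"
    have \<delta>E: "\<delta> a \<in> E0" for a unfolding \<delta>_def by (intro subspace_diff[OF sE0(1)] P0E)
    have \<delta>n: "norm (\<delta> a) \<le> 2 * \<eta>" if "a \<in> V" for a
    proof -
      have "P0 (P0 a) = P0 a" using orth_proj_fixed[OF sE0(1) P0E[of a]] by (simp only: P0_def)
      then have "\<delta> a = P0 (P a - P0 a)" by (simp add: \<delta>_def linear_diff[OF linP0])
      then have "norm (\<delta> a) \<le> norm (P a - P0 a)"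
        using orth_proj_norm_le[OF E0, folded P0_def, of "P a - P0 a"] by simp
      also have "\<dots> \<le> gap_dist E0 E * norm a"
        using gap_dist_bound[OF E0 E, of a] unfolding P0_def P_def by (simp add: norm_minus_commute)
      also have "\<dots> \<le> \<eta> * 2" using near Vn[OF that] eta by (intro mult_mono) auto
      finally show ?thesis by simp
    qed
    have \<delta>\<epsilon>: "norm ((s / \<epsilon>) *\<^sub>R \<delta> a) < r / 2" if "a \<in> V" "\<bar>s\<bar> = 1" for a s
    proof -
      have "norm ((s / \<epsilon>) *\<^sub>R \<delta> a) \<le> 2 * \<eta> / \<epsilon>" using \<delta>n[OF that(1)] that(2) eps by (simp add: divide_right_mono)
      also have "\<dots> \<le> r / 4" using eta(3) eps by (simp add: field_simps)
      also have "\<dots> < r / 2" using r by simp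
      finally show ?thesis .
    qed
    have sub1: "(1 / (1 + \<epsilon>)) *\<^sub>R P0 x \<in> K0" if "x \<in> K" for x
    proof -
      have lin1: "linear (\<lambda>x. (1 / (1 + \<epsilon>)) *\<^sub>R P0 x)"
        by (rule linear_compose[unfolded o_def, OF linP0 linear_scale_self])
      have "P ` V \<subseteq> (\<lambda>x. (1 / (1 + \<epsilon>)) *\<^sub>R P0 x) -` K0"
      proof clarify
        fix a assume a: "a \<in> V"
        have "P0 a \<in> K0" using a by (simp add: K0_def P0_def hull_inc)
        moreover have "(1 / \<epsilon>) *\<^sub>R \<delta> a \<in> K0"
          using ball0 \<delta>\<epsilon>[OF a, of 1] r \<delta>E subspace_scale[OF sE0(1)] by (auto simp del: norm_scaleR)
        ultimately have "(1 / (1 + \<epsilon>)) *\<^sub>R (P0 a + \<delta> a) \<in> K0" using hull_near[OF cvx(2)] eps by blast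
        then show "P a \<in> (\<lambda>x. (1 / (1 + \<epsilon>)) *\<^sub>R P0 x) -` K0" by (simp add: \<delta>_def)
      qed
      then have "K \<subseteq> (\<lambda>x. (1 / (1 + \<epsilon>)) *\<^sub>R P0 x) -` K0"
        unfolding K_def by (rule hull_minimal) (rule convex_linear_vimage[OF lin1 cvx(2)])
      then show ?thesis using that by auto
    qed
    have sub2: "\<exists>x\<in>K. y = (1 + \<epsilon>) *\<^sub>R P0 x" if "y \<in> K0" for y
    proof -
      have lin2: "linear (\<lambda>x. (1 + \<epsilon>) *\<^sub>R P0 x)"
        by (rule linear_compose[unfolded o_def, OF linP0 linear_scale_self])
      have "orth_proj E0 ` V \<subseteq> (\<lambda>x. (1 + \<epsilon>) *\<^sub>R P0 x) ` K"
      proof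
        fix y assume "y \<in> orth_proj E0 ` V"
        then obtain a where a: "a \<in> V" "y = P0 a" by (auto simp: P0_def)
        \<comment> \<open>The correction is pulled back to \<open>E\<close>, which at most doubles
          its norm; this is why it was kept below \<open>r / 2\<close>.\<close>
        have "(- 1 / \<epsilon>) *\<^sub>R \<delta> a \<in> E0" by (intro subspace_scale[OF sE0(1)] \<delta>E)
        then obtain x where x: "x \<in> E" "P0 x = (- 1 / \<epsilon>) *\<^sub>R \<delta> a" using bij(2) by (auto simp: bij_betw_def)
        have "norm x < r" using bij(1)[OF x(1)] \<delta>\<epsilon>[OF a(1), of "-1"] unfolding x(2) by linarith
        then have "x \<in> K" using ballE x(1) by auto
        moreover have "P a \<in> K" using a by (simp add: K_def hull_inc)
        ultimately have "(1 / (1 + \<epsilon>)) *\<^sub>R (P a + \<epsilon> *\<^sub>R x) \<in> K"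
          using eps by (intro hull_near[OF cvx(1), of _ \<epsilon>]) auto
        moreover have "y = (1 + \<epsilon>) *\<^sub>R P0 ((1 / (1 + \<epsilon>)) *\<^sub>R (P a + \<epsilon> *\<^sub>R x))"
          using eps by (simp add: linear_scale[OF linP0] linear_add[OF linP0] x(2) a(2) \<delta>_def)
        ultimately show "y \<in> (\<lambda>x. (1 + \<epsilon>) *\<^sub>R P0 x) ` K" by blast
      qed
      then have "K0 \<subseteq> (\<lambda>x. (1 + \<epsilon>) *\<^sub>R P0 x) ` K"
        unfolding K0_def by (rule hull_minimal) (rule convex_linear_image[OF lin2 cvx(1)])
      then show ?thesis using that by auto
    qed
    \<comment> \<open>The isotropic position of \<open>K0\<close> after the projection, shrunk by
      \<open>1 + \<epsilon>\<close> so that the image \<open>Q\<close> stays inside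
      \<open>K1\<close>.\<close>
    define S where "S = (\<lambda>x. (1 / (1 + \<epsilon>)) *\<^sub>R T (P0 x))"
    have linS: "linear S" unfolding S_def
      by (rule linear_compose[unfolded o_def, OF linear_compose[unfolded o_def, OF linP0 T(1)] linear_scale_self])
    have bij_sc: "bij_betw (\<lambda>x. (1 / (1 + \<epsilon>)) *\<^sub>R x) E0 E0"
      using eps sE0(1)
      by (intro bij_betw_byWitness[where f' = "\<lambda>x. (1 + \<epsilon>) *\<^sub>R x"]) (auto simp: subspace_scale)
    have bijS: "bij_betw S E E0"
      using bij_betw_trans[OF bij_betw_trans[OF bij(2) T(2)] bij_sc] by (simp add: S_def o_def)
    define Q where "Q = (\<lambda>x. a0 + S x) ` K"
    note le = isotropy_constant_le[OF b b0 d cb linS bijS T(3) Q_def, folded L_def]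
    let ?M = "frame_measure b0 d"
    have cQ: "compact Q" "Q \<subseteq> E0" using le(3) by (auto simp: convex_body_def)
    have [measurable]: "Q \<in> sets borel" using cQ by (simp add: borel_compact)
    have cb1: "convex_body E0 K1" using iso by (simp add: isotropic_body_def K1_def)
    have cK1: "compact K1" using cb1 by (simp add: convex_body_def)
    have [measurable]: "K1 \<in> sets borel" using cK1 by (simp add: borel_compact)
    have QK1: "Q \<subseteq> K1"
    proof
      fix y assume "y \<in> Q"
      then obtain x where x: "x \<in> K" "y = a0 + S x" by (auto simp: Q_def)
      have "y = a0 + T ((1 / (1 + \<epsilon>)) *\<^sub>R P0 x)" by (simp add: x(2) S_def linear_scale[OF T(1)])
      then show "y \<in> K1" using sub1[OF x(1)] by (auto simp: K1_def)
    qed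
    define m where "m = measure ?M Q"
    have em: "emeasure ?M Q = ennreal m" "m > 0"
      unfolding m_def using convex_body_vol[OF db0 le(3)] by auto
    \<comment> \<open>\<open>Q\<close> contains \<open>K1\<close> shrunk about \<open>a0\<close> by
      this factor: one \<open>1 + \<epsilon>\<close> is built into \<open>S\<close>, the other comes
      from \<open>sub2\<close>.\<close>
    define s where "s = 1 / (1 + \<epsilon>)\<^sup>2"
    have s: "s > 0" using eps by (simp add: s_def)
    have vol1: "emeasure ?M K1 = 1"
    proof -
      have "measure (subspace_lborel E0) K1 = 1" using iso by (simp add: isotropic_body_def K1_def)
      then show ?thesis using convex_body_vol(1)[OF db0 cb1] measure_subspace_lborel[OF b0, of K1] cb1
        by (simp add: convex_body_def)
    qed
    have "1 \<le> (\<integral>\<^sup>+z. indicator Q (s *\<^sub>R (z + (- a0)) + a0) \<partial>?M)"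
    proof -
      have "z \<in> K1 \<Longrightarrow> s *\<^sub>R (z + (- a0)) + a0 \<in> Q" for z
      proof -
        assume "z \<in> K1"
        then obtain y where y: "y \<in> K0" "z = a0 + T y" by (auto simp: K1_def)
        obtain x where x: "x \<in> K" "y = (1 + \<epsilon>) *\<^sub>R P0 x" using sub2[OF y(1)] by blast
        have "s *\<^sub>R T y = S x"
          using eps by (simp add: s_def S_def x(2) linear_scale[OF T(1)] power2_eq_square)
        then show "s *\<^sub>R (z + (- a0)) + a0 \<in> Q" using x(1) by (auto simp: Q_def y(2) add.commute)
      qed
      then have "(\<integral>\<^sup>+z. indicator K1 z \<partial>?M) \<le> (\<integral>\<^sup>+z. indicator Q (s *\<^sub>R (z + (- a0)) + a0) \<partial>?M)"
        by (intro nn_integral_mono) (auto simp: indicator_def)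
      then show ?thesis using vol1 by simp
    qed
    also have "\<dots> = (\<integral>\<^sup>+z. indicator Q (s *\<^sub>R z + a0) \<partial>?M)"
      using T(3) sE0(1) by (intro nn_integral_frame_translate[OF db0]) (auto simp: subspace_neg)
    also have "\<dots> = ennreal (1 / s ^ d) * (\<integral>\<^sup>+z. indicator Q (z + a0) \<partial>?M)"
      by (rule nn_integral_frame_scale[OF db0 s, of "\<lambda>z. indicator Q (z + a0)"]) measurable
    also have "(\<integral>\<^sup>+z. indicator Q (z + a0) \<partial>?M) = ennreal m"
      using nn_integral_frame_translate[OF db0 T(3), of "indicator Q"] em(1) by simp
    finally have "1 \<le> (1 / s ^ d) * m" using s em(2) by (simp add: ennreal_mult[symmetric])
    then have ms: "m \<ge> s ^ d" using s by (simp add: field_simps)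
    have "real d * L\<^sup>2 * m powr (1 + 2 / d) \<le> (LINT y|?M. indicator Q y * (norm y)\<^sup>2)"
      unfolding m_def by (rule le(1))
    also have "\<dots> \<le> (LINT y|?M. indicator K1 y * (norm y)\<^sup>2)"
      using QK1 by (intro integral_mono integrable_compact[OF db0 cQ(1)] integrable_compact[OF db0 cK1] continuous_intros)
        (auto simp: indicator_def)
    also have "\<dots> = real d * L0\<^sup>2" by (rule isotropic_norm_integral[OF b0 iso[folded K1_def]])
    finally have "L\<^sup>2 * m powr (1 + 2 / d) \<le> L0\<^sup>2" using d by (simp add: mult.assoc)
    moreover have "s ^ (d + 2) \<le> m powr (1 + 2 / d)"
    proof -
      have "real (d + 2) = real d * (1 + 2 / real d)" using d by (simp add: distrib_left)
      then have "s ^ (d + 2) = s powr (real d * (1 + 2 / real d))"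
        using powr_realpow[OF s, of "d + 2"] by simp
      also have "\<dots> = (s ^ d) powr (1 + 2 / d)" unfolding powr_realpow[OF s, symmetric] powr_powr ..
      also have "\<dots> \<le> m powr (1 + 2 / d)" using ms s by (intro powr_mono2) auto
      finally show ?thesis .
    qed
    ultimately have "L\<^sup>2 * s ^ (d + 2) \<le> L0\<^sup>2" by (meson mult_left_mono order_trans zero_le_power2)
    then have "L\<^sup>2 \<le> L0\<^sup>2 * (1 / s ^ (d + 2))" using s by (simp add: field_simps)
    also have "1 / s ^ (d + 2) = ((1 + \<epsilon>)\<^sup>2) ^ (d + 2)" by (simp add: s_def power_one_over)
    also have "\<dots> = (1 + \<epsilon>) ^ (2 * (d + 2))" by (rule power_mult[symmetric])
    also have "2 * (d + 2) = 2 * d + 4" by simp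
    finally have "L\<^sup>2 < C\<^sup>2" using eps(2) by simp
    then have "L < C" using L0 by (simp add: power_less_imp_less_base)
    then show "E \<in> {E \<in> grassmannian n d. isotropy_constant E (convex hull (orth_proj E ` V)) < C}"
      using E by (simp add: L_def K_def P_def)
  qed
qed auto

section \<open>Gaussian estimates\<close>

lemma gaussian_ball_ge:
  assumes b: "orthonormal_basis E d b" and d: "d > 0" and z: "z \<in> E" and \<rho>: "\<rho> > 0"
  shows "emeasure (gaussian b d) (ball z \<rho>)
     \<ge> ennreal (exp (- (norm z + \<rho>)\<^sup>2 / 2) / sqrt (2 * pi) ^ d * (\<rho> / sqrt d) ^ d)"
proof -
  note db = onb_dual_frame[OF b]
  define q where "q = exp (- (norm z + \<rho>)\<^sup>2 / 2) / sqrt (2 * pi) ^ d"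
  have q: "q > 0" by (simp add: q_def)
  have "ennreal ((\<rho> / sqrt d) ^ d) \<le> emeasure (frame_measure b d) (ball 0 \<rho>)"
    by (rule ball_volume_ge[OF b d \<rho>]) auto
  also have "\<dots> = (\<integral>\<^sup>+x. indicator (ball 0 \<rho>) x \<partial>frame_measure b d)" by simp
  also have "\<dots> = (\<integral>\<^sup>+x. indicator (ball z \<rho>) (x + z) \<partial>frame_measure b d)"
    by (intro nn_integral_cong) (auto simp: indicator_def dist_norm)
  also have "\<dots> = emeasure (frame_measure b d) (ball z \<rho>)"
    by (subst nn_integral_frame_translate[OF db z borel_measurable_indicator]) auto
  finally have vol: "ennreal ((\<rho> / sqrt d) ^ d) \<le> emeasure (frame_measure b d) (ball z \<rho>)" .
  have "ennreal (q * (\<rho> / sqrt d) ^ d) = ennreal q * ennreal ((\<rho> / sqrt d) ^ d)"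
    using q \<rho> by (intro ennreal_mult) auto
  also have "\<dots> \<le> ennreal q * emeasure (frame_measure b d) (ball z \<rho>)" using vol by (rule mult_left_mono) simp
  also have "\<dots> = (\<integral>\<^sup>+x. ennreal q * indicator (ball z \<rho>) x \<partial>frame_measure b d)"
    by (simp add: nn_integral_cmult_indicator)
  also have "\<dots> \<le> (\<integral>\<^sup>+x. ennreal (gauss_dens d x) * indicator (ball z \<rho>) x \<partial>frame_measure b d)"
  proof (rule nn_integral_mono)
    fix x
    show "ennreal q * indicator (ball z \<rho>) x \<le> ennreal (gauss_dens d x) * indicator (ball z \<rho>) x"
    proof (cases "x \<in> ball z \<rho>")
      case True
      then have "norm x \<le> norm z + \<rho>" using norm_triangle_ineq[of z "x - z"] by (simp add: dist_norm norm_minus_commute)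
      then have "(norm x)\<^sup>2 \<le> (norm z + \<rho>)\<^sup>2" by (intro power_mono) auto
      then have "q \<le> gauss_dens d x" unfolding q_def gauss_dens_def by (intro divide_right_mono) auto
      then show ?thesis using True by (simp add: ennreal_leI)
    qed simp
  qed
  also have "\<dots> = emeasure (gaussian b d) (ball z \<rho>)"
    unfolding gaussian_density[OF b] by (rule emeasure_density[symmetric]) auto
  finally show ?thesis by (simp add: q_def)
qed

lemma AE_gaussian:
  assumes b: "orthonormal_basis E d b" and d: "d > 0"
  shows "AE x in gaussian b d. x \<in> E \<and> x \<noteq> 0"
proof -
  note db = onb_dual_frame[OF b]
  have "b 0 \<in> E" "b 0 \<bullet> b 0 = 1" using db d by (auto simp: dual_frame_def)
  then have "b 0 \<in> E" "b 0 \<noteq> 0" by auto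
  from hyperplane_null[OF db this] AE_frame[OF db] have "AE x in frame_measure b d. x \<in> E \<and> x \<noteq> 0"
    by eventually_elim auto
  then show ?thesis unfolding gaussian_density[OF b] by (subst AE_density) auto
qed

text \<open>Chernoff bounds with the exponents \<open>1 / 4\<close> and \<open>- 1\<close>; the two
  constants rest on \<open>2 <= e <= 3\<close>.\<close>

lemma gaussian_norm_tails:
  assumes b: "orthonormal_basis E d b"
  shows "emeasure (gaussian b d) {x. (norm x)\<^sup>2 < real d / 4} \<le> ennreal (exp (- real d / 4))"
    and "emeasure (gaussian b d) {x. (norm x)\<^sup>2 > 4 * real d} \<le> ennreal (exp (- real d / 2))"
    and "emeasure (gaussian b d) {x. (norm x)\<^sup>2 > s} \<le> ennreal (exp (real d / 2 - s / 4))"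
proof -
  have up: "emeasure (gaussian b d) {x. (norm x)\<^sup>2 > s} \<le> ennreal (exp (real d / 2 - s / 4))" for s
  proof -
    have "emeasure (gaussian b d) {x. (norm x)\<^sup>2 > s} = (\<integral>\<^sup>+x. indicator {x. (norm x)\<^sup>2 > s} x \<partial>gaussian b d)"
      by (rule nn_integral_indicator[symmetric]) measurable
    also have "\<dots> \<le> (\<integral>\<^sup>+x. ennreal (exp (- s / 4)) * ennreal (exp (1 / 4 * (norm x)\<^sup>2)) \<partial>gaussian b d)"
    proof (rule nn_integral_mono)
      fix x
      show "indicator {x. (norm x)\<^sup>2 > s} x \<le> ennreal (exp (- s / 4)) * ennreal (exp (1 / 4 * (norm x)\<^sup>2))"
        by (auto simp: indicator_def ennreal_mult[symmetric] exp_add[symmetric])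
    qed
    also have "\<dots> = ennreal (exp (- s / 4)) * ennreal ((1 / sqrt (1 - 2 * (1 / 4))) ^ d)"
      using gaussian_mgf[OF b, of "1 / 4"] by (subst nn_integral_cmult) auto
    also have "\<dots> \<le> ennreal (exp (- s / 4)) * ennreal (exp (1 / 2) ^ d)"
    proof (intro mult_left_mono ennreal_leI power_mono)
      have "2 \<le> exp (1::real)" using exp_ge_add_one_self[of "1::real"] by simp
      then have "sqrt 2 \<le> sqrt (exp 1)" by simp
      also have "sqrt (exp 1) = exp (1 / 2 :: real)"
        by (rule real_sqrt_unique) (simp_all add: exp_double[symmetric] power2_eq_square exp_add[symmetric])
      finally have "sqrt 2 \<le> exp (1 / 2 :: real)" .
      moreover have "1 / sqrt (1 - 2 * (1 / 4)) = sqrt 2" by (simp add: real_sqrt_divide)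
      ultimately show "1 / sqrt (1 - 2 * (1 / 4)) \<le> exp (1 / 2 :: real)" by simp
    qed auto
    also have "\<dots> = ennreal (exp (real d / 2 - s / 4))"
      by (simp add: ennreal_mult[symmetric] exp_of_nat_mult[symmetric] exp_add[symmetric])
    finally show ?thesis .
  qed
  show "emeasure (gaussian b d) {x. (norm x)\<^sup>2 > s} \<le> ennreal (exp (real d / 2 - s / 4))" by (rule up)
  show "emeasure (gaussian b d) {x. (norm x)\<^sup>2 > 4 * real d} \<le> ennreal (exp (- real d / 2))"
    using up[of "4 * real d"] by simp
  have "emeasure (gaussian b d) {x. (norm x)\<^sup>2 < real d / 4} = (\<integral>\<^sup>+x. indicator {x. (norm x)\<^sup>2 < real d / 4} x \<partial>gaussian b d)"
    by (rule nn_integral_indicator[symmetric]) measurable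
  also have "\<dots> \<le> (\<integral>\<^sup>+x. ennreal (exp (real d / 4)) * ennreal (exp (- 1 * (norm x)\<^sup>2)) \<partial>gaussian b d)"
  proof (rule nn_integral_mono)
    fix x
    show "indicator {x. (norm x)\<^sup>2 < real d / 4} x \<le> ennreal (exp (real d / 4)) * ennreal (exp (- 1 * (norm x)\<^sup>2))"
      by (auto simp: indicator_def ennreal_mult[symmetric] exp_add[symmetric])
  qed
  also have "\<dots> = ennreal (exp (real d / 4)) * ennreal ((1 / sqrt (1 - 2 * (- 1))) ^ d)"
    using gaussian_mgf[OF b, of "- 1"] by (subst nn_integral_cmult) auto
  also have "\<dots> \<le> ennreal (exp (real d / 4)) * ennreal (exp (- 1 / 2) ^ d)"
  proof (intro mult_left_mono ennreal_leI power_mono)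
    have "exp (1 / 2 :: real) = sqrt (exp 1)"
      by (rule real_sqrt_unique[symmetric]) (simp_all add: exp_double[symmetric] power2_eq_square exp_add[symmetric])
    also have "\<dots> \<le> sqrt 3" using exp_le by simp
    finally show "1 / sqrt (1 - 2 * (- 1)) \<le> exp (- 1 / 2 :: real)"
      by (simp add: exp_minus field_simps)
  qed auto
  also have "\<dots> = ennreal (exp (- real d / 4))"
    by (simp add: ennreal_mult[symmetric] exp_of_nat_mult[symmetric] exp_add[symmetric])
  finally show "emeasure (gaussian b d) {x. (norm x)\<^sup>2 < real d / 4} \<le> ennreal (exp (- real d / 4))" .
qed

text \<open>By reflection invariance of \<mu> the probability is the same for every nonzero
  \<open>v\<close>, so \<open>v\<close> may be replaced by a Gaussian vector \<open>g\<close>. For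
  fixed \<open>E\<close> the projection of \<open>g\<close> is Gaussian in dimension
  \<open>d\<close>, and the norm of \<open>g\<close> itself is rarely small.\<close>

lemma projection_tail:
  assumes \<mu>: "is_grassmann_haar n d \<mu>" and v: "v \<in> euclid n" and n: "n > 0" and s: "s \<ge> 0"
  shows "emeasure \<mu> {E \<in> grassmannian n d. (norm (orth_proj E v))\<^sup>2 > s / real n * (norm v)\<^sup>2}
     \<le> ennreal (exp (- real n / 4) + exp (real d / 2 - s / 16))"
proof (cases "v = 0")
  case True
  have "norm (orth_proj E v) = 0" if "E \<in> grassmannian n d" for E
    using orth_proj_norm_le[OF that, of v] True by simp
  then have eq: "{E \<in> grassmannian n d. (norm (orth_proj E v))\<^sup>2 > s / real n * (norm v)\<^sup>2} = {}"
    using True by auto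
  show ?thesis unfolding eq by simp
next
  case False
  note sp = haar_space[OF \<mu>]
  interpret \<mu>: prob_space \<mu> by (rule sp)
  let ?\<gamma> = "gaussian unit_vec n"
  interpret \<gamma>: prob_space ?\<gamma> by (rule prob_space_gaussian)
  interpret P: pair_sigma_finite ?\<gamma> \<mu> ..
  define q where "q = (\<lambda>v E. if (norm (orth_proj E v))\<^sup>2 > s / real n * (norm v)\<^sup>2 then 1 else 0 :: ennreal)"
  have [measurable]: "(\<lambda>E. orth_proj E v) \<in> borel_measurable \<mu>" for v by (rule measurable_proj[OF \<mu>])
  have [measurable]: "(\<lambda>(E, g). orth_proj E g) \<in> borel_measurable (\<mu> \<Otimes>\<^sub>M ?\<gamma>)"
    by (rule measurable_proj_pair[OF \<mu>]) simp
  have [measurable]: "(\<lambda>(g, E). orth_proj E g) \<in> borel_measurable (?\<gamma> \<Otimes>\<^sub>M \<mu>)"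
    using measurable_compose[OF measurable_pair_swap' measurable_proj_pair[OF \<mu>, of ?\<gamma>]] by (simp add: split_beta')
  have qm1 [measurable]: "q v \<in> borel_measurable \<mu>" for v unfolding q_def by measurable
  have qm: "(\<lambda>p. q (fst p) (snd p)) \<in> borel_measurable (?\<gamma> \<Otimes>\<^sub>M \<mu>)"
  proof -
    have "(\<lambda>p. orth_proj (snd p) (fst p)) \<in> borel_measurable (?\<gamma> \<Otimes>\<^sub>M \<mu>)"
      using \<open>(\<lambda>(g, E). orth_proj E g) \<in> borel_measurable (?\<gamma> \<Otimes>\<^sub>M \<mu>)\<close> by (simp add: split_beta')
    then show ?thesis unfolding q_def by measurable
  qed
  have inv: "(\<integral>\<^sup>+E. q v E \<partial>\<mu>) = (\<integral>\<^sup>+E. q v' E \<partial>\<mu>)" if vv: "v \<in> euclid n" "v' \<in> euclid n" "norm v = norm v'" for v v'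
  proof (cases "v = v'")
    case False
    obtain w where w: "w \<in> euclid n" "norm w = 1" "refl_map w v = v'" using refl_map_exists[OF vv False] by blast
    have "(\<integral>\<^sup>+E. q v' E \<partial>\<mu>) = (\<integral>\<^sup>+E. q v' E \<partial>distr \<mu> \<mu> (\<lambda>E. refl_map w ` E))" by (simp add: haar_refl(2)[OF \<mu> w(1,2)])
    also have "\<dots> = (\<integral>\<^sup>+E. q v' (refl_map w ` E) \<partial>\<mu>)" by (rule nn_integral_distr[OF haar_refl(1)[OF \<mu> w(1,2)]]) simp
    also have "\<dots> = (\<integral>\<^sup>+E. q v E \<partial>\<mu>)"
      by (intro nn_integral_cong) (simp add: q_def w(3)[symmetric] refl_orth_proj[OF _ w(1,2)] sp(2) refl_map_norm[OF w(2)])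
    finally show ?thesis by simp
  qed simp
  have scale: "q (c *\<^sub>R v) E = q v E" if "c > 0" "E \<in> grassmannian n d" for c v E
  proof -
    have "(norm (orth_proj E (c *\<^sub>R v)))\<^sup>2 = c\<^sup>2 * (norm (orth_proj E v))\<^sup>2"
      "s / real n * (norm (c *\<^sub>R v))\<^sup>2 = c\<^sup>2 * (s / real n * (norm v)\<^sup>2)" "c\<^sup>2 > 0"
      using that(1) by (simp_all add: linear_scale[OF orth_proj_linear[OF that(2)]] power_mult_distrib)
    then show ?thesis by (simp only: q_def mult_less_cancel_left_pos)
  qed
  have const: "(\<integral>\<^sup>+E. q g E \<partial>\<mu>) = (\<integral>\<^sup>+E. q v E \<partial>\<mu>)" if g: "g \<in> euclid n" "g \<noteq> 0" for g
  proof -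
    define c where "c = norm v / norm g"
    have c: "c > 0" using g False by (simp add: c_def)
    have "(\<integral>\<^sup>+E. q g E \<partial>\<mu>) = (\<integral>\<^sup>+E. q (c *\<^sub>R g) E \<partial>\<mu>)"
      by (intro nn_integral_cong) (simp add: scale[OF c] sp(2))
    also have "\<dots> = (\<integral>\<^sup>+E. q v E \<partial>\<mu>)"
      using g v by (intro inv) (auto simp: c_def subspace_scale[OF subspace_euclid])
    finally show ?thesis .
  qed
  have "emeasure \<mu> {E \<in> grassmannian n d. (norm (orth_proj E v))\<^sup>2 > s / real n * (norm v)\<^sup>2} = (\<integral>\<^sup>+E. q v E \<partial>\<mu>)"
  proof -
    define A where "A = {E \<in> grassmannian n d. (norm (orth_proj E v))\<^sup>2 > s / real n * (norm v)\<^sup>2}"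
    have "{E \<in> space \<mu>. (norm (orth_proj E v))\<^sup>2 > s / real n * (norm v)\<^sup>2} \<in> sets \<mu>" by measurable
    then have "A \<in> sets \<mu>" by (simp only: A_def sp(2))
    then have "emeasure \<mu> A = (\<integral>\<^sup>+E. indicator A E \<partial>\<mu>)" by simp
    also have "\<dots> = (\<integral>\<^sup>+E. q v E \<partial>\<mu>)"
      by (intro nn_integral_cong) (simp add: A_def q_def sp(2) indicator_def)
    finally show ?thesis by (simp only: A_def)
  qed
  also have "\<dots> = (\<integral>\<^sup>+g. (\<integral>\<^sup>+E. q v E \<partial>\<mu>) \<partial>?\<gamma>)" using \<gamma>.emeasure_space_1 by simp
  also have "\<dots> = (\<integral>\<^sup>+g. (\<integral>\<^sup>+E. q g E \<partial>\<mu>) \<partial>?\<gamma>)"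
    using AE_gaussian[OF onb_euclid n] by (intro nn_integral_cong_AE, eventually_elim) (simp add: const)
  also have "\<dots> = (\<integral>\<^sup>+E. (\<integral>\<^sup>+g. q g E \<partial>?\<gamma>) \<partial>\<mu>)"
    by (rule P.Fubini'[symmetric]) (use qm in \<open>simp add: split_beta'\<close>)
  also have "\<dots> \<le> (\<integral>\<^sup>+E. ennreal (exp (- real n / 4) + exp (real d / 2 - s / 16)) \<partial>\<mu>)"
  proof (rule nn_integral_mono)
    fix E assume "E \<in> space \<mu>"
    then have E: "E \<in> grassmannian n d" by (simp add: sp)
    obtain b where b: "orthonormal_basis E d b" using grassmannian_onb[OF E] .
    have [measurable]: "orth_proj E \<in> borel_measurable borel" by (rule measurable_orth_proj[OF b])
    \<comment> \<open>If \<open>(norm g)^2\<close> is at least \<open>n / 4\<close>, the event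
      forces the squared norm of the projection above \<open>s / 4\<close>.\<close>
    have "(\<integral>\<^sup>+g. q g E \<partial>?\<gamma>) \<le> (\<integral>\<^sup>+g. indicator {x. (norm x)\<^sup>2 < real n / 4} g + indicator {x. (norm x)\<^sup>2 > s / 4} (orth_proj E g) \<partial>?\<gamma>)"
    proof (rule nn_integral_mono)
      fix g
      show "q g E \<le> indicator {x. (norm x)\<^sup>2 < real n / 4} g + indicator {x. (norm x)\<^sup>2 > s / 4} (orth_proj E g)"
      proof (cases "(norm g)\<^sup>2 < real n / 4")
        case False
        then have "s / real n * (real n / 4) \<le> s / real n * (norm g)\<^sup>2" using s by (intro mult_left_mono) auto
        then have "s / 4 \<le> s / real n * (norm g)\<^sup>2" using n by simp
        then have "\<not> (norm (orth_proj E g))\<^sup>2 > s / 4 \<Longrightarrow> \<not> (norm (orth_proj E g))\<^sup>2 > s / real n * (norm g)\<^sup>2"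
          by linarith
        then show ?thesis unfolding q_def by (cases "(norm (orth_proj E g))\<^sup>2 > s / 4") (simp_all add: indicator_def)
      qed (auto simp: q_def indicator_def)
    qed
    also have "\<dots> = emeasure ?\<gamma> {x. (norm x)\<^sup>2 < real n / 4} + (\<integral>\<^sup>+g. indicator {x. (norm x)\<^sup>2 > s / 4} (orth_proj E g) \<partial>?\<gamma>)"
      by (subst nn_integral_add) auto
    also have "(\<integral>\<^sup>+g. indicator {x. (norm x)\<^sup>2 > s / 4} (orth_proj E g) \<partial>?\<gamma>) = (\<integral>\<^sup>+x. indicator {x. (norm x)\<^sup>2 > s / 4} x \<partial>distr ?\<gamma> borel (orth_proj E))"
      by (rule nn_integral_distr[symmetric]) auto
    also have "\<dots> = emeasure (gaussian b d) {x. (norm x)\<^sup>2 > s / 4}"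
      using E by (subst orth_proj_gaussian[OF b _ onb_euclid]) (auto simp: grassmannian_def)
    also have "emeasure ?\<gamma> {x. (norm x)\<^sup>2 < real n / 4} + \<dots> \<le> ennreal (exp (- real n / 4)) + ennreal (exp (real d / 2 - (s / 4) / 4))"
      by (intro add_mono gaussian_norm_tails[OF onb_euclid] gaussian_norm_tails[OF b])
    also have "\<dots> = ennreal (exp (- real n / 4) + exp (real d / 2 - s / 16))"
      by (simp add: ennreal_plus[symmetric] del: ennreal_plus)
    finally show "(\<integral>\<^sup>+g. q g E \<partial>?\<gamma>) \<le> ennreal (exp (- real n / 4) + exp (real d / 2 - s / 16))" .
  qed
  also have "\<dots> = ennreal (exp (- real n / 4) + exp (real d / 2 - s / 16))"
    by (simp add: \<mu>.emeasure_space_1)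
  finally show ?thesis .
qed

section \<open>Vectors with few large coordinates\<close>

definition count_ge :: "(nat \<Rightarrow> rseq) \<Rightarrow> nat \<Rightarrow> real \<Rightarrow> rseq \<Rightarrow> real" where
  "count_ge e n s x = (\<Sum>i<n. if x \<bullet> e i \<ge> s then 1 else 0)"

lemma measurable_count_ge [measurable]:
  assumes [measurable]: "f \<in> borel_measurable M" "g \<in> borel_measurable M"
  shows "(\<lambda>x. count_ge e n (f x) (g x)) \<in> borel_measurable M"
  unfolding count_ge_def by measurable

lemma count_ge_mono:
  assumes "\<And>i. i < n \<Longrightarrow> y \<bullet> e i \<ge> s' \<Longrightarrow> x \<bullet> e i \<ge> s"
  shows "count_ge e n s' y \<le> count_ge e n s x"
  unfolding count_ge_def using assms by (intro sum_mono) auto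

text \<open>Chernoff bound for a binomial variable: \<open>exp\<close> of minus the count has mean
  at most \<open>exp (- n p / 2)\<close>, and Markov's inequality at \<open>n p / 4\<close> leaves
  half of the exponent.\<close>

lemma gaussian_count:
  assumes e: "orthonormal_basis (euclid n) n e" and p: "0 \<le> p" "p \<le> measure std_normal {s..}"
  shows "emeasure (gaussian e n) {y. count_ge e n s y \<le> real n * p / 4} \<le> ennreal (exp (- real n * p / 4))"
proof -
  interpret N: prob_space std_normal by (rule prob_space_std_normal)
  define f where "f = (\<lambda>x::real. exp (if x \<ge> s then - 1 else 0 :: real))"
  have one: "(\<integral>\<^sup>+x. ennreal (f x) \<partial>std_normal) \<le> ennreal (exp (- p / 2))"
  proof -
    have "(\<integral>\<^sup>+x. ennreal (f x) \<partial>std_normal) = (\<integral>\<^sup>+x. ennreal (exp (- 1)) * indicator {s..} x + indicator {..<s} x \<partial>std_normal)"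
      by (intro nn_integral_cong) (auto simp: f_def indicator_def)
    also have "\<dots> = ennreal (exp (- 1)) * emeasure std_normal {s..} + emeasure std_normal {..<s}"
      by (subst nn_integral_add) (auto simp: nn_integral_cmult_indicator)
    also have "\<dots> = ennreal (exp (- 1) * measure std_normal {s..} + measure std_normal {..<s})"
      by (simp add: N.emeasure_eq_measure ennreal_mult)
    also have "\<dots> \<le> ennreal (exp (- p / 2))"
    proof (rule ennreal_leI)
      have "measure std_normal {..<s} = 1 - measure std_normal {s..}"
        using N.prob_compl[of "{s..}"] by (simp add: Compl_eq_Diff_UNIV[symmetric])
      moreover have "exp (- 1 :: real) \<le> 1 / 2"
      proof -
        have "2 \<le> exp (1::real)" using exp_ge_add_one_self[of "1::real"] by simp
        then show ?thesis by (simp add: exp_minus field_simps)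
      qed
      then have "exp (- 1) * measure std_normal {s..} \<le> 1 / 2 * measure std_normal {s..}"
        by (intro mult_right_mono) auto
      ultimately have "exp (- 1) * measure std_normal {s..} + measure std_normal {..<s} \<le> 1 + - p / 2"
        using p(2) by linarith
      also have "\<dots> \<le> exp (- p / 2)" by (rule exp_ge_add_one_self)
      finally show "exp (- 1) * measure std_normal {s..} + measure std_normal {..<s} \<le> exp (- p / 2)" .
    qed
    finally show ?thesis .
  qed
  have "emeasure (gaussian e n) {y. count_ge e n s y \<le> real n * p / 4}
     = (\<integral>\<^sup>+y. indicator {y. count_ge e n s y \<le> real n * p / 4} y \<partial>gaussian e n)"
    by (rule nn_integral_indicator[symmetric]) measurable
  also have "\<dots> \<le> (\<integral>\<^sup>+y. ennreal (exp (real n * p / 4)) * ennreal (exp (- count_ge e n s y)) \<partial>gaussian e n)"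
    by (intro nn_integral_mono) (auto simp: indicator_def ennreal_mult[symmetric] exp_add[symmetric])
  also have "\<dots> = ennreal (exp (real n * p / 4)) * (\<integral>\<^sup>+y. ennreal (exp (- count_ge e n s y)) \<partial>gaussian e n)"
    by (rule nn_integral_cmult) measurable
  also have "(\<integral>\<^sup>+y. ennreal (exp (- count_ge e n s y)) \<partial>gaussian e n) = (\<integral>\<^sup>+t. ennreal (exp (- count_ge e n s (lin_comb e n t))) \<partial>gauss_coord n)"
    by (rule nn_integral_gaussian) measurable
  also have "\<dots> = (\<integral>\<^sup>+t. (\<Prod>i<n. ennreal (f (t i))) \<partial>gauss_coord n)"
  proof (rule nn_integral_cong)
    fix t
    have "- count_ge e n s (lin_comb e n t) = (\<Sum>i<n. if t i \<ge> s then - 1 else 0)"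
      unfolding count_ge_def sum_negf[symmetric]
      using dual_frame_coeff[OF onb_dual_frame[OF e], of _ t] by (intro sum.cong) auto
    then show "ennreal (exp (- count_ge e n s (lin_comb e n t))) = (\<Prod>i<n. ennreal (f (t i)))"
      by (simp add: f_def prod_ennreal exp_sum)
  qed
  also have "\<dots> = (\<Prod>i<n. \<integral>\<^sup>+x. ennreal (f x) \<partial>std_normal)"
  proof (rule product_sigma_finite.product_nn_integral_prod)
    show "product_sigma_finite (\<lambda>_::nat. std_normal)"
      using product_prob_space_std_normal by (simp add: product_prob_space_def)
    have "f \<in> borel_measurable borel" unfolding f_def by measurable
    then show "(\<lambda>x. ennreal (f x)) \<in> borel_measurable std_normal" for i :: nat by simp
  qed simp
  also have "\<dots> \<le> (\<Prod>i<n. ennreal (exp (- p / 2)))"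
    unfolding prod_constant by (rule power_mono_ennreal[OF one])
  also have "\<dots> = ennreal (exp (- real n * p / 2))"
    by (simp add: ennreal_power exp_of_nat_mult[symmetric])
  also have "ennreal (exp (real n * p / 4)) * ennreal (exp (- real n * p / 2)) = ennreal (exp (- real n * p / 4))"
    by (simp add: ennreal_mult[symmetric] exp_add[symmetric])
  finally show ?thesis by (simp add: mult_left_mono)
qed

text \<open>On an interval of length 1 to the right of \<open>s\<close> the exponent
  \<open>x^2 / 2\<close> is at most \<open>s^2 + 1\<close>; the 9 collects \<open>e <= 3\<close> and
  \<open>sqrt (2 pi) <= 3\<close>.\<close>

lemma std_normal_tail_ge:
  assumes "s \<ge> 0"
  shows "exp (- s\<^sup>2) / 9 \<le> measure std_normal {s..}"
proof -
  interpret N: prob_space std_normal by (rule prob_space_std_normal)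
  have "ennreal (exp (- s\<^sup>2) / 9) = (\<integral>\<^sup>+x. ennreal (exp (- s\<^sup>2) / 9) * indicator {s..s + 1} x \<partial>lborel)"
    by (simp add: nn_integral_cmult_indicator)
  also have "\<dots> \<le> (\<integral>\<^sup>+x. ennreal (std_normal_density x) * indicator {s..} x \<partial>lborel)"
  proof (rule nn_integral_mono)
    fix x
    show "ennreal (exp (- s\<^sup>2) / 9) * indicator {s..s + 1} x \<le> ennreal (std_normal_density x) * indicator {s..} x"
    proof (cases "x \<in> {s..s + 1}")
      case True
      have "x\<^sup>2 \<le> (s + 1)\<^sup>2" using True assms by (intro power_mono) auto
      also have "\<dots> \<le> 2 * s\<^sup>2 + 2" using sum_squares_bound[of s 1] by (simp add: power2_eq_square algebra_simps)
      finally have "- s\<^sup>2 - 1 \<le> - x\<^sup>2 / 2" by simp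
      then have "exp (- s\<^sup>2) * exp (- 1) \<le> exp (- x\<^sup>2 / 2)" by (simp add: exp_add[symmetric])
      moreover have "exp (- 1 :: real) \<ge> 1 / 3" using exp_le by (simp add: exp_minus field_simps)
      then have "exp (- s\<^sup>2) * (1 / 3) \<le> exp (- s\<^sup>2) * exp (- 1)" by (intro mult_left_mono) auto
      ultimately have "exp (- s\<^sup>2) / 3 \<le> exp (- x\<^sup>2 / 2)" by linarith
      moreover have "sqrt (2 * pi) \<le> 3" using pi_less_4 by (intro real_le_lsqrt) auto
      ultimately have "(exp (- s\<^sup>2) / 3) / 3 \<le> exp (- x\<^sup>2 / 2) / sqrt (2 * pi)" by (intro frac_le) auto
      then have "exp (- s\<^sup>2) / 9 \<le> std_normal_density x" by (simp add: std_normal_density_def)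
      then show ?thesis using True by (simp add: ennreal_leI)
    qed simp
  qed
  also have "\<dots> = emeasure std_normal {s..}" by (rule emeasure_density[symmetric]) auto
  finally show ?thesis by (simp add: N.emeasure_eq_measure)
qed

text \<open>
  Around a unit vector of \<open>E\<close> with only small coordinates, the vectors with few large coordinates
  fill a cone whose Gaussian measure in \<open>E\<close> is exponential in \<open>d\<close>; on average over \<open>E\<close> this
  measure is the one in the whole space, which is much smaller.
\<close>

lemma small_coordinates_cone:
  assumes b: "orthonormal_basis E d b" and d: "d > 0" and e: "orthonormal_basis (euclid n) n e" and En: "E \<subseteq> euclid n"
    and \<theta>: "\<theta> \<in> E" "norm \<theta> = 1" "\<And>i. i < n \<Longrightarrow> \<theta> \<bullet> e i < t" and t: "t > 0" and \<delta>: "0 < \<delta>" "\<delta> \<le> 1 / 2"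
    and K: "\<delta>\<^sup>2 \<le> t\<^sup>2 * K"
  shows "ennreal ((\<delta> / 27) ^ d) \<le> emeasure (gaussian b d) {x. x \<noteq> 0 \<and> count_ge e n (4 * t * norm x) x \<le> K}"
proof -
  \<comment> \<open>At norm at most \<open>2 * sqrt d\<close> the Gaussian density is only
    exponentially small in \<open>d\<close>: \<open>e^(-2) >= 1/9\<close> and
    \<open>sqrt (2 pi) <= 3\<close> give the 27, and the volume of the ball gives
    \<delta>\<open>^d\<close>.\<close>
  let ?B = "ball (sqrt d *\<^sub>R \<theta>) (sqrt d * \<delta>)"
  have sd: "sqrt d > 0" using d by simp
  have "(\<delta> / 27) ^ d \<le> exp (- (norm (sqrt d *\<^sub>R \<theta>) + sqrt d * \<delta>)\<^sup>2 / 2) / sqrt (2 * pi) ^ d * (sqrt d * \<delta> / sqrt d) ^ d"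
  proof -
    have "norm (sqrt d *\<^sub>R \<theta>) + sqrt d * \<delta> = sqrt d * (1 + \<delta>)" using \<theta>(2) by (simp add: distrib_left)
    then have "(norm (sqrt d *\<^sub>R \<theta>) + sqrt d * \<delta>)\<^sup>2 = real d * (1 + \<delta>)\<^sup>2" by (simp add: power_mult_distrib)
    also have "\<dots> \<le> real d * 2\<^sup>2" using \<delta> by (intro mult_left_mono power_mono) auto
    finally have "exp (- (real d * 2)) \<le> exp (- (norm (sqrt d *\<^sub>R \<theta>) + sqrt d * \<delta>)\<^sup>2 / 2)" by simp
    moreover have "(1 / 9) ^ d \<le> exp (- (real d * 2))"
    proof -
      have "exp (2::real) = exp 1 * exp 1" by (simp add: exp_add[symmetric])
      also have "\<dots> \<le> 3 * 3" using exp_le by (intro mult_mono) auto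
      finally have "1 / 9 \<le> exp (- 2 :: real)" by (simp add: exp_minus field_simps)
      then have "(1 / 9) ^ d \<le> exp (- 2 :: real) ^ d" by (intro power_mono) auto
      then show ?thesis by (simp add: exp_of_nat_mult[symmetric])
    qed
    moreover have "sqrt (2 * pi) ^ d \<le> 3 ^ d" using pi_less_4 by (intro power_mono real_le_lsqrt) auto
    ultimately have "(1 / 9) ^ d / 3 ^ d \<le> exp (- (norm (sqrt d *\<^sub>R \<theta>) + sqrt d * \<delta>)\<^sup>2 / 2) / sqrt (2 * pi) ^ d"
      by (intro frac_le) (simp_all only: exp_ge_zero zero_less_power real_sqrt_gt_zero pi_gt_zero mult_pos_pos zero_less_numeral order_trans)
    then have "((1 / 9) ^ d / 3 ^ d) * \<delta> ^ d \<le> exp (- (norm (sqrt d *\<^sub>R \<theta>) + sqrt d * \<delta>)\<^sup>2 / 2) / sqrt (2 * pi) ^ d * \<delta> ^ d"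
      using \<delta> by (intro mult_right_mono) auto
    moreover have "((1 / 9) ^ d / 3 ^ d) * \<delta> ^ d = (\<delta> / 27) ^ d"
      by (simp add: power_divide power_mult_distrib[symmetric])
    ultimately show ?thesis using sd by simp
  qed
  then have "ennreal ((\<delta> / 27) ^ d) \<le> emeasure (gaussian b d) ?B"
    using gaussian_ball_ge[OF b d, of "sqrt d *\<^sub>R \<theta>" "sqrt d * \<delta>"] \<theta>(1) \<delta>(1) sd
      subspace_scale[OF dual_frame_subspace[OF onb_dual_frame[OF b]]]
    by (meson ennreal_leI mult_pos_pos order_trans)
  also have "\<dots> \<le> emeasure (gaussian b d) {x. x \<noteq> 0 \<and> count_ge e n (4 * t * norm x) x \<le> K}"
  proof (rule emeasure_mono_AE)
    show "AE x in gaussian b d. x \<in> ?B \<longrightarrow> x \<in> {x. x \<noteq> 0 \<and> count_ge e n (4 * t * norm x) x \<le> K}"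
      using AE_gaussian[OF b d]
    proof eventually_elim
      case (elim x)
      show ?case
      proof
        assume x: "x \<in> ?B"
        define y where "y = x - sqrt d *\<^sub>R \<theta>"
        have y: "norm y < sqrt d * \<delta>" using x by (simp add: y_def dist_norm norm_minus_commute)
        have yn: "y \<in> euclid n"
          using elim \<theta>(1) En unfolding y_def by (intro subspace_diff[OF subspace_euclid] subspace_scale[OF subspace_euclid]) auto
        have "sqrt d * \<delta> \<le> sqrt d * (1 / 2)" using \<delta>(2) sd by (intro mult_left_mono) auto
        then have "norm y < sqrt d / 2" using y by linarith
        moreover have "sqrt d = norm (x - y)" using \<theta>(2) by (simp add: y_def)
        ultimately have nx: "norm x \<ge> sqrt d / 2" using norm_triangle_ineq4[of x y] by linarith
        \<comment> \<open>The multiple of \<theta> has coordinates below \<open>sqrt d * t\<close>,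
          so every large coordinate of \<open>x\<close> must come from the perturbation
          \<open>y\<close> and uses at least \<open>t^2 d\<close> of
          \<open>(norm y)^2 <= d \<delta>^2\<close>.\<close>
        have "t\<^sup>2 * real d * count_ge e n (4 * t * norm x) x = (\<Sum>i<n. if x \<bullet> e i \<ge> 4 * t * norm x then t\<^sup>2 * real d else 0)"
          unfolding count_ge_def sum_distrib_left by (intro sum.cong) auto
        also have "\<dots> \<le> (\<Sum>i<n. (y \<bullet> e i)\<^sup>2)"
        proof (rule sum_mono)
          fix i assume i: "i \<in> {..<n}"
          show "(if x \<bullet> e i \<ge> 4 * t * norm x then t\<^sup>2 * real d else 0) \<le> (y \<bullet> e i)\<^sup>2"
          proof (cases "x \<bullet> e i \<ge> 4 * t * norm x")
            case True
            have "4 * t * (sqrt d / 2) \<le> 4 * t * norm x" using nx t by (intro mult_left_mono) auto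
            then have "2 * (sqrt d * t) \<le> 4 * t * norm x" by (simp only: mult_ac)
            moreover have "sqrt d * (\<theta> \<bullet> e i) \<le> sqrt d * t" using \<theta>(3)[of i] i sd by (intro mult_left_mono) auto
            moreover have "y \<bullet> e i = x \<bullet> e i - sqrt d * (\<theta> \<bullet> e i)" by (simp add: y_def inner_diff_left)
            ultimately have "y \<bullet> e i \<ge> sqrt d * t" using True by linarith
            then have "y \<bullet> e i \<ge> t * sqrt d" by (simp only: mult.commute)
            then have "(t * sqrt d)\<^sup>2 \<le> (y \<bullet> e i)\<^sup>2" using t by (intro power_mono) auto
            then show ?thesis by (simp add: power_mult_distrib)
          qed simp
        qed
        also have "\<dots> = (norm y)\<^sup>2" by (rule onb_norm_inner[OF e yn, symmetric])
        also have "\<dots> \<le> (sqrt d * \<delta>)\<^sup>2" using y by (intro power_mono) auto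
        also have "\<dots> = real d * \<delta>\<^sup>2" by (simp add: power_mult_distrib)
        also have "\<dots> \<le> real d * (t\<^sup>2 * K)" using K by (intro mult_left_mono) auto
        finally have "(t\<^sup>2 * real d) * count_ge e n (4 * t * norm x) x \<le> (t\<^sup>2 * real d) * K" by (simp add: mult_ac)
        then have "count_ge e n (4 * t * norm x) x \<le> K" using t d by simp
        then show "x \<in> {x. x \<noteq> 0 \<and> count_ge e n (4 * t * norm x) x \<le> K}" using elim by simp
      qed
    qed
    show "{x. x \<noteq> 0 \<and> count_ge e n (4 * t * norm x) x \<le> K} \<in> sets (gaussian b d)" by measurable
  qed
  finally show ?thesis .
qed

text \<open>\<rho> is the law of a Gaussian vector projected to an independent random
  \<open>E\<close>. It inherits invariance under reflections from both factors, so
  \<open>invariant_compare\<close> can replace it on cones by the Gaussian measure of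
  n-space.\<close>

lemma projected_gaussian:
  assumes \<mu>: "is_grassmann_haar n d \<mu>" and d: "d > 0" and e: "orthonormal_basis (euclid n) n e"
  defines "\<rho> \<equiv> distr (\<mu> \<Otimes>\<^sub>M gaussian e n) borel (\<lambda>(E, g). orth_proj E g)"
  shows "prob_space \<rho>" and "sets \<rho> = sets borel"
    and "B \<in> sets borel \<Longrightarrow> emeasure \<rho> B = (\<integral>\<^sup>+E. emeasure (gaussian e n) (orth_proj E -` B) \<partial>\<mu>)"
    and "AE x in \<rho>. x \<in> euclid n \<and> x \<noteq> 0"
    and "w \<in> euclid n \<Longrightarrow> norm w = 1 \<Longrightarrow> distr \<rho> borel (refl_map w) = \<rho>"
proof -
  let ?\<gamma> = "gaussian e n"
  note sp = haar_space[OF \<mu>]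
  interpret \<mu>: prob_space \<mu> by (rule sp)
  interpret \<gamma>: prob_space ?\<gamma> by (rule prob_space_gaussian)
  interpret P: pair_prob_space \<mu> ?\<gamma> ..
  have pm: "(\<lambda>(E, g). orth_proj E g) \<in> borel_measurable (\<mu> \<Otimes>\<^sub>M ?\<gamma>)"
    by (rule measurable_proj_pair[OF \<mu>]) simp
  show "prob_space \<rho>" unfolding \<rho>_def by (rule P.prob_space_distr[OF pm])
  show sr: "sets \<rho> = sets borel" by (simp add: \<rho>_def)
  define S where "S = (\<lambda>B. (\<lambda>(E, g). orth_proj E g) -` B \<inter> space (\<mu> \<Otimes>\<^sub>M ?\<gamma>))"
  have S: "S B \<in> sets (\<mu> \<Otimes>\<^sub>M ?\<gamma>)" if "B \<in> sets borel" for B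
    unfolding S_def by (rule measurable_sets[OF pm that])
  have PS: "Pair E -` S B = orth_proj E -` B" if "E \<in> space \<mu>" for E B
    using that by (auto simp: S_def space_pair_measure)
  have hm: "(\<lambda>E. emeasure ?\<gamma> (orth_proj E -` B)) \<in> borel_measurable \<mu>" if "B \<in> sets borel" for B
    using \<gamma>.measurable_emeasure_Pair[OF S[OF that]] PS by (simp cong: measurable_cong)
  have em: "emeasure \<rho> B = (\<integral>\<^sup>+E. emeasure ?\<gamma> (orth_proj E -` B) \<partial>\<mu>)" if "B \<in> sets borel" for B
  proof -
    have "emeasure \<rho> B = emeasure (\<mu> \<Otimes>\<^sub>M ?\<gamma>) (S B)"
      unfolding \<rho>_def S_def by (rule emeasure_distr[OF pm that])
    also have "\<dots> = (\<integral>\<^sup>+E. emeasure ?\<gamma> (Pair E -` S B) \<partial>\<mu>)"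
      by (rule \<gamma>.emeasure_pair_measure_alt[OF S[OF that]])
    finally show ?thesis using PS by (simp cong: nn_integral_cong)
  qed
  then show "B \<in> sets borel \<Longrightarrow> emeasure \<rho> B = (\<integral>\<^sup>+E. emeasure ?\<gamma> (orth_proj E -` B) \<partial>\<mu>)" .
  show "AE x in \<rho>. x \<in> euclid n \<and> x \<noteq> 0"
  proof (rule AE_I)
    let ?N = "{x. \<not> (x \<in> euclid n \<and> x \<noteq> 0)}"
    have cl: "euclid n \<in> sets borel" by (rule borel_dual_frame[OF onb_dual_frame[OF e]])
    then show N: "?N \<in> sets \<rho>" unfolding sr by measurable
    show "{x \<in> space \<rho>. \<not> (x \<in> euclid n \<and> x \<noteq> 0)} \<subseteq> ?N" by auto
    have "emeasure ?\<gamma> (orth_proj E -` ?N) = 0" if "E \<in> space \<mu>" for E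
    proof -
      have E: "E \<in> grassmannian n d" using that by (simp add: sp)
      obtain b where b: "orthonormal_basis E d b" using grassmannian_onb[OF E] .
      have En: "E \<subseteq> euclid n" using E by (simp add: grassmannian_def)
      have "emeasure ?\<gamma> (orth_proj E -` ?N) = emeasure (distr ?\<gamma> borel (orth_proj E)) ?N"
        using N measurable_orth_proj[OF b] by (subst emeasure_distr) (auto simp: sr)
      also have "\<dots> = emeasure (gaussian b d) ?N" by (simp add: orth_proj_gaussian[OF b En e])
      also have "\<dots> = 0"
      proof -
        have "AE x in gaussian b d. \<not> \<not> (x \<in> euclid n \<and> x \<noteq> 0)"
          using AE_gaussian[OF b d] En by (auto elim: eventually_mono)
        from emeasure_eq_0_AE[OF this] show ?thesis by simp
      qed
      finally show ?thesis .
    qed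
    then show "emeasure \<rho> ?N = 0" using N by (subst em) (auto simp: sr cong: nn_integral_cong)
  qed
  show "distr \<rho> borel (refl_map w) = \<rho>" if w: "w \<in> euclid n" "norm w = 1"
  proof (rule measure_eqI)
    fix B assume "B \<in> sets (distr \<rho> borel (refl_map w))"
    then have B: "B \<in> sets borel" by simp
    have UB: "refl_map w -` B \<in> sets borel" using measurable_sets[OF measurable_refl_map B] by simp
    have "emeasure (distr \<rho> borel (refl_map w)) B = emeasure \<rho> (refl_map w -` B)"
      using B sr sets_eq_imp_space_eq[OF sr] by (subst emeasure_distr) (auto cong: measurable_cong_sets)
    also have "\<dots> = (\<integral>\<^sup>+E. emeasure ?\<gamma> (orth_proj E -` refl_map w -` B) \<partial>\<mu>)" by (rule em[OF UB])
    \<comment> \<open>The reflection is moved from the vector to the subspace; Gaussian invariance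
      pays for the vector, and Haar invariance for the subspace in the next step.\<close>
    also have "\<dots> = (\<integral>\<^sup>+E. emeasure ?\<gamma> (orth_proj (refl_map w ` E) -` B) \<partial>\<mu>)"
    proof (rule nn_integral_cong)
      fix E assume "E \<in> space \<mu>"
      then have E: "E \<in> grassmannian n d" by (simp add: sp)
      obtain b where b: "orthonormal_basis E d b" using grassmannian_onb[OF E] .
      have m: "orth_proj (refl_map w ` E) -` B \<in> sets borel"
        using measurable_sets[OF measurable_orth_proj[OF refl_onb[OF b w(2)]] B] by simp
      have "emeasure ?\<gamma> (orth_proj (refl_map w ` E) -` B) = emeasure (distr ?\<gamma> borel (refl_map w)) (orth_proj (refl_map w ` E) -` B)"
        by (simp add: gaussian_refl[OF e w])
      also have "\<dots> = emeasure ?\<gamma> (refl_map w -` orth_proj (refl_map w ` E) -` B)"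
        using m by (subst emeasure_distr) auto
      also have "refl_map w -` orth_proj (refl_map w ` E) -` B = orth_proj E -` refl_map w -` B"
        by (auto simp: refl_orth_proj[OF E w])
      finally show "emeasure ?\<gamma> (orth_proj E -` refl_map w -` B) = emeasure ?\<gamma> (orth_proj (refl_map w ` E) -` B)"
        by simp
    qed
    also have "\<dots> = (\<integral>\<^sup>+E. emeasure ?\<gamma> (orth_proj E -` B) \<partial>distr \<mu> \<mu> (\<lambda>E. refl_map w ` E))"
      by (subst nn_integral_distr[OF haar_refl(1)[OF \<mu> w]]) (use hm[OF B] in auto)
    also have "\<dots> = emeasure \<rho> B" by (simp add: haar_refl(2)[OF \<mu> w] em[OF B])
    finally show "emeasure (distr \<rho> borel (refl_map w)) B = emeasure \<rho> B" .
  qed (simp add: sr)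
qed

text \<open>The condition on the angle puts the normalized vectors within distance \<open>t\<close>,
  so each coordinate changes by at most \<open>t\<close>, from \<open>5 t\<close> to
  \<open>4 t\<close>.\<close>

lemma cone_closeness:
  assumes "x \<noteq> 0" "y \<noteq> 0" "x \<bullet> y \<ge> (1 - t\<^sup>2 / 2) * norm x * norm y" "t > 0" "norm u = 1"
    and y: "y \<bullet> u \<ge> 5 * t * norm y"
  shows "x \<bullet> u \<ge> 4 * t * norm x"
proof -
  define x' where "x' = (1 / norm x) *\<^sub>R x"
  define y' where "y' = (1 / norm y) *\<^sub>R y"
  have n: "norm x' = 1" "norm y' = 1" using assms(1,2) by (auto simp: x'_def y'_def)
  have "x' \<bullet> y' = (x \<bullet> y) / (norm x * norm y)" by (simp add: x'_def y'_def)
  also have "\<dots> \<ge> 1 - t\<^sup>2 / 2" using assms(1-3) by (simp add: pos_le_divide_eq mult.assoc)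
  finally have xy: "x' \<bullet> y' \<ge> 1 - t\<^sup>2 / 2" .
  have "(norm (x' - y'))\<^sup>2 = (norm x')\<^sup>2 + (norm y')\<^sup>2 - 2 * (x' \<bullet> y')"
    by (simp add: power2_norm_eq_inner inner_diff_left inner_diff_right inner_commute)
  also have "\<dots> \<le> t\<^sup>2" using xy n by simp
  finally have "norm (x' - y') \<le> t" by (rule power2_le_imp_le) (use assms(4) in simp)
  moreover have "\<bar>(x' - y') \<bullet> u\<bar> \<le> norm (x' - y') * norm u" by (rule Cauchy_Schwarz_ineq2)
  ultimately have "x' \<bullet> u \<ge> y' \<bullet> u - t" using assms(5) by (simp add: inner_diff_left)
  moreover have "y' \<bullet> u \<ge> 5 * t" using y assms(2) by (simp add: y'_def pos_le_divide_eq)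
  ultimately have "x' \<bullet> u \<ge> 4 * t" by simp
  then show ?thesis using assms(1) by (simp add: x'_def pos_le_divide_eq)
qed

text \<open>Every \<open>E\<close> in the bad set contributes at least
  \<open>(\<delta> / 27)^d\<close> to the mass of the cone \<open>A\<close> under \<rho>; the total
  mass is at most that of the enlarged cone \<open>A'\<close> under the Gaussian measure of n-space,
  where coordinates are independent.\<close>

lemma small_inradius_rare:
  assumes \<mu>: "is_grassmann_haar n d \<mu>" and d: "d > 0" and n: "n > 0" and e: "orthonormal_basis (euclid n) n e"
    and \<BB>: "\<BB> \<in> sets \<mu>" "\<And>E. E \<in> \<BB> \<Longrightarrow> \<exists>\<theta>\<in>E. norm \<theta> = 1 \<and> (\<forall>i<n. \<theta> \<bullet> e i < t)"
    and t: "t > 0" and \<delta>: "0 < \<delta>" "\<delta> \<le> 1 / 2"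
    and p: "0 \<le> p" "p \<le> measure std_normal {10 * t * sqrt n..}" and K: "\<delta>\<^sup>2 \<le> t\<^sup>2 * (real n * p / 4)"
  shows "emeasure \<mu> \<BB> \<le> ennreal ((27 / \<delta>) ^ d * (exp (- real n / 2) + exp (- real n * p / 4)))"
proof -
  let ?\<gamma> = "gaussian e n"
  note sp = haar_space[OF \<mu>]
  define K0 where "K0 = real n * p / 4"
  define A where "A = {x. x \<noteq> 0 \<and> count_ge e n (4 * t * norm x) x \<le> K0}"
  define A' where "A' = {x. count_ge e n (5 * t * norm x) x \<le> K0}"
  have mA: "A \<in> sets borel" "A' \<in> sets borel" unfolding A_def A'_def by measurable
  define \<rho> where "\<rho> = distr (\<mu> \<Otimes>\<^sub>M ?\<gamma>) borel (\<lambda>(E, g). orth_proj E g)"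
  note pg = projected_gaussian[OF \<mu> d e, folded \<rho>_def]
  have eu: "norm (e i) = 1" if "i < n" for i using e that by (auto simp: orthonormal_basis_def norm_eq_1)
  have "ennreal ((\<delta> / 27) ^ d) * emeasure \<mu> \<BB> = (\<integral>\<^sup>+E. ennreal ((\<delta> / 27) ^ d) * indicator \<BB> E \<partial>\<mu>)"
    using \<BB>(1) by (simp add: nn_integral_cmult_indicator)
  also have "\<dots> \<le> (\<integral>\<^sup>+E. emeasure ?\<gamma> (orth_proj E -` A) \<partial>\<mu>)"
  proof (rule nn_integral_mono)
    fix E assume "E \<in> space \<mu>"
    then have E: "E \<in> grassmannian n d" by (simp add: sp)
    show "ennreal ((\<delta> / 27) ^ d) * indicator \<BB> E \<le> emeasure ?\<gamma> (orth_proj E -` A)"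
    proof (cases "E \<in> \<BB>")
      case True
      obtain \<theta> where \<theta>: "\<theta> \<in> E" "norm \<theta> = 1" "\<And>i. i < n \<Longrightarrow> \<theta> \<bullet> e i < t" using \<BB>(2)[OF True] by blast
      obtain b where b: "orthonormal_basis E d b" using grassmannian_onb[OF E] .
      have En: "E \<subseteq> euclid n" using E by (simp add: grassmannian_def)
      have "ennreal ((\<delta> / 27) ^ d) \<le> emeasure (gaussian b d) A"
        unfolding A_def by (rule small_coordinates_cone[OF b d e En \<theta> t \<delta>]) (use K in \<open>simp_all add: K0_def\<close>)
      also have "\<dots> = emeasure (distr ?\<gamma> borel (orth_proj E)) A" by (simp add: orth_proj_gaussian[OF b En e])
      also have "\<dots> = emeasure ?\<gamma> (orth_proj E -` A)"
        using mA measurable_orth_proj[OF b] by (subst emeasure_distr) auto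
      finally show ?thesis using True by simp
    qed simp
  qed
  also have "\<dots> = emeasure \<rho> A" by (rule pg(3)[OF mA(1), symmetric])
  also have "\<dots> \<le> emeasure ?\<gamma> A'"
  proof (rule invariant_compare[OF pg(1,2,4) prob_space_gaussian sets_gaussian AE_gaussian[OF e n] pg(5) gaussian_refl[OF e] n])
    show "t\<^sup>2 / 2 > 0" using t by simp
    show "A \<in> sets borel" "A' \<in> sets borel" by (fact mA)+
    show "emeasure ?\<gamma> (ball (unit_vec 0) r) > 0" if "r > 0" for r
    proof -
      have "0 < exp (- (norm (unit_vec 0) + r)\<^sup>2 / 2) / sqrt (2 * pi) ^ n * (r / sqrt n) ^ n"
        using that n by simp
      then have "0 < ennreal (exp (- (norm (unit_vec 0) + r)\<^sup>2 / 2) / sqrt (2 * pi) ^ n * (r / sqrt n) ^ n)"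
        by (metis ennreal_0 ennreal_less_iff order_refl)
      also have "\<dots> \<le> emeasure ?\<gamma> (ball (unit_vec 0) r)"
        by (rule gaussian_ball_ge[OF e n unit_vec_mem[OF n] that])
      finally show ?thesis .
    qed
    fix x y assume xy: "x \<in> A" "x \<noteq> 0" "y \<in> euclid n" "y \<noteq> 0" "x \<bullet> y \<ge> (1 - t\<^sup>2 / 2) * norm x * norm y"
    have "count_ge e n (5 * t * norm y) y \<le> count_ge e n (4 * t * norm x) x"
      using cone_closeness[OF xy(2,4,5) t eu] by (intro count_ge_mono) auto
    then show "y \<in> A'" using xy(1) by (simp add: A_def A'_def)
  qed
  \<comment> \<open>Outside the first event the norm is at most \<open>2 * sqrt n\<close>, which
    turns the homogeneous threshold \<open>5 t norm y\<close> into the fixed one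
    \<open>10 t sqrt n\<close>.\<close>
  also have "\<dots> \<le> emeasure ?\<gamma> ({x. (norm x)\<^sup>2 > 4 * real n} \<union> {y. count_ge e n (10 * t * sqrt n) y \<le> real n * p / 4})"
  proof (rule emeasure_mono)
    show "A' \<subseteq> {x. (norm x)\<^sup>2 > 4 * real n} \<union> {y. count_ge e n (10 * t * sqrt n) y \<le> real n * p / 4}"
    proof clarify
      fix y assume y: "y \<in> A'" and nc: "\<not> count_ge e n (10 * t * sqrt n) y \<le> real n * p / 4"
      show "4 * real n < (norm y)\<^sup>2"
      proof (rule ccontr)
        assume "\<not> ?thesis"
        then have "(norm y)\<^sup>2 \<le> (2 * sqrt n)\<^sup>2" by (simp add: power_mult_distrib)
        then have "norm y \<le> 2 * sqrt n" by (rule power2_le_imp_le) simp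
        then have "5 * t * norm y \<le> 5 * t * (2 * sqrt n)" using t by (intro mult_left_mono) auto
        then have "count_ge e n (10 * t * sqrt n) y \<le> count_ge e n (5 * t * norm y) y"
          by (intro count_ge_mono) auto
        then show False using y nc by (simp add: A'_def K0_def)
      qed
    qed
  qed measurable
  also have "\<dots> \<le> emeasure ?\<gamma> {x. (norm x)\<^sup>2 > 4 * real n} + emeasure ?\<gamma> {y. count_ge e n (10 * t * sqrt n) y \<le> real n * p / 4}"
    by (rule emeasure_subadditive) measurable
  also have "\<dots> \<le> ennreal (exp (- real n / 2)) + ennreal (exp (- real n * p / 4))"
    by (intro add_mono gaussian_norm_tails(2)[OF e] gaussian_count[OF e p])
  also have "\<dots> = ennreal (exp (- real n / 2) + exp (- real n * p / 4))"
    by (simp add: ennreal_plus[symmetric] del: ennreal_plus)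
  finally have "ennreal ((\<delta> / 27) ^ d) * emeasure \<mu> \<BB> \<le> ennreal (exp (- real n / 2) + exp (- real n * p / 4))" .
  then have "ennreal ((27 / \<delta>) ^ d) * (ennreal ((\<delta> / 27) ^ d) * emeasure \<mu> \<BB>)
     \<le> ennreal ((27 / \<delta>) ^ d) * ennreal (exp (- real n / 2) + exp (- real n * p / 4))"
    by (rule mult_left_mono) simp
  moreover have "ennreal ((27 / \<delta>) ^ d) * ennreal ((\<delta> / 27) ^ d) = 1"
    using \<delta>(1) by (simp add: ennreal_mult[symmetric] power_mult_distrib[symmetric])
  moreover have "ennreal ((27 / \<delta>) ^ d) * ennreal (exp (- real n / 2) + exp (- real n * p / 4))
      = ennreal ((27 / \<delta>) ^ d * (exp (- real n / 2) + exp (- real n * p / 4)))"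
    using \<delta>(1) by (intro ennreal_mult[symmetric] add_nonneg_nonneg) auto
  ultimately show ?thesis by (simp only: mult.assoc[symmetric] mult_1_left)
qed

section \<open>Projections to dimensions much smaller than n\<close>

text \<open>Every set counted has weight \<open>x^(card I) >= x^d\<close> with
  \<open>x = d / n\<close>, and the weights of all subsets sum to
  \<open>(1 + x)^(card V) <= exp (2 d)\<close>.\<close>

lemma card_small_subsets:
  assumes V: "finite V" "card V \<le> 2 * n" and d: "d > 0" "d \<le> n"
  shows "real (card {I. I \<subseteq> V \<and> card I \<le> d}) \<le> exp (real d * ln (real n / real d) + 2 * real d)"
proof -
  define x where "x = real d / real n"
  have x: "x > 0" "x \<le> 1" using d by (auto simp: x_def)
  have fin: "finite {I. I \<subseteq> V \<and> card I \<le> d}" by (rule finite_subset[of _ "Pow V"]) (use V in auto)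
  have "real (card {I. I \<subseteq> V \<and> card I \<le> d}) * x ^ d = (\<Sum>I\<in>{I. I \<subseteq> V \<and> card I \<le> d}. x ^ d)" by simp
  also have "\<dots> \<le> (\<Sum>I\<in>{I. I \<subseteq> V \<and> card I \<le> d}. x ^ card I)"
    using x by (intro sum_mono power_decreasing) auto
  also have "\<dots> \<le> (\<Sum>I\<in>Pow V. x ^ card I)"
    using x V by (intro sum_mono2) auto
  also have "\<dots> = (\<Prod>a\<in>V. x + 1)" by (subst prod_add[OF V(1)]) simp
  also have "\<dots> = (1 + x) ^ card V" by (simp add: add.commute)
  also have "\<dots> \<le> (1 + x) ^ (2 * n)" using x V(2) by (intro power_increasing) auto
  also have "\<dots> \<le> exp x ^ (2 * n)" using x by (intro power_mono exp_ge_add_one_self) auto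
  also have "\<dots> = exp (2 * real d)" using d by (simp add: exp_of_nat_mult[symmetric] x_def)
  finally have "real (card {I. I \<subseteq> V \<and> card I \<le> d}) \<le> exp (2 * real d) * (1 / x ^ d)"
    using x by (simp add: pos_le_divide_eq)
  also have "1 / x ^ d = exp (real d * ln (real n / real d))"
  proof -
    have "exp (real d * ln (real n / real d)) = exp (ln (real n / real d)) ^ d" by (simp add: exp_of_nat_mult)
    also have "exp (ln (real n / real d)) = real n / real d" using d by simp
    finally show ?thesis by (simp add: x_def power_divide)
  qed
  finally show ?thesis by (simp add: exp_add mult.commute)
qed

text \<open>The conditions on \<open>q = n / d\<close> under which the final exponents close: the
  second lets \<open>exp (- n / 4)\<close> beat the number of subsets, the third lets
  \<open>exp (- n p / 4)\<close> beat \<open>(27 / \<delta>)^d\<close>.\<close>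

lemma threshold_exists:
  "\<exists>q0::real. q0 \<ge> 1 \<and> (\<forall>q\<ge>q0. ln q \<ge> 4 \<and> ln q + 2 \<le> q / 8 \<and> 9 + ln q / 8 \<le> q powr (3 / 4) / 72)"
proof -
  have "eventually (\<lambda>q::real. ln q \<ge> 4) at_top"
    and "eventually (\<lambda>q::real. ln q + 2 \<le> q / 8) at_top"
    and "eventually (\<lambda>q::real. 9 + ln q / 8 \<le> q powr (3 / 4) / 72) at_top"
    by real_asymp+
  then have "eventually (\<lambda>q::real. ln q \<ge> 4 \<and> ln q + 2 \<le> q / 8 \<and> 9 + ln q / 8 \<le> q powr (3 / 4) / 72) at_top"
    by eventually_elim auto
  then obtain q0 where "\<forall>q\<ge>q0. ln q \<ge> 4 \<and> ln q + 2 \<le> q / 8 \<and> 9 + ln q / 8 \<le> q powr (3 / 4) / (72::real)"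
    unfolding eventually_at_top_linorder by blast
  then show ?thesis by (intro exI[of _ "max 1 q0"]) auto
qed

lemma large_sums_rare:
  assumes \<mu>: "is_grassmann_haar n d \<mu>" and V: "good_vertices n V" and d: "d > 0" "d \<le> n"
    and s: "s \<ge> 0"
  defines "U \<equiv> \<Union>I\<in>{I. I \<subseteq> V \<and> card I \<le> d}. {E \<in> grassmannian n d. (norm (orth_proj E (\<Sum>I)))\<^sup>2 > s / real n * (norm (\<Sum>I))\<^sup>2}"
  shows "U \<in> sets \<mu>" and "emeasure \<mu> U \<le> ennreal (exp (real d * ln (real n / real d) + 2 * real d) * (exp (- real n / 4) + exp (real d / 2 - s / 16)))"
proof -
  define \<I> where "\<I> = {I. I \<subseteq> V \<and> card I \<le> d}"
  have V': "finite V" "V \<subseteq> euclid n" "card V \<le> 2 * n" using V by (auto simp: good_vertices_def)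
  have fin: "finite \<I>" unfolding \<I>_def by (rule finite_subset[of _ "Pow V"]) (use V' in auto)
  note sp = haar_space[OF \<mu>]
  have [measurable]: "(\<lambda>E. orth_proj E v) \<in> borel_measurable \<mu>" for v by (rule measurable_proj[OF \<mu>])
  have m: "{E \<in> grassmannian n d. (norm (orth_proj E v))\<^sup>2 > s / real n * (norm v)\<^sup>2} \<in> sets \<mu>" for v
  proof -
    have "{E \<in> space \<mu>. (norm (orth_proj E v))\<^sup>2 > s / real n * (norm v)\<^sup>2} \<in> sets \<mu>" by measurable
    then show ?thesis by (simp only: sp(2))
  qed
  show "U \<in> sets \<mu>" unfolding U_def \<I>_def[symmetric] by (rule sets.finite_UN[OF fin m])
  have "emeasure \<mu> U \<le> (\<Sum>I\<in>\<I>. emeasure \<mu> {E \<in> grassmannian n d. (norm (orth_proj E (\<Sum>I)))\<^sup>2 > s / real n * (norm (\<Sum>I))\<^sup>2})"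
    unfolding U_def \<I>_def[symmetric] by (rule emeasure_subadditive_finite[OF fin]) (use m in blast)
  also have "\<dots> \<le> (\<Sum>I\<in>\<I>. ennreal (exp (- real n / 4) + exp (real d / 2 - s / 16)))"
  proof (rule sum_mono)
    fix I assume "I \<in> \<I>"
    then have "\<Sum>I \<in> euclid n" using V'(2) by (intro subspace_sum[OF subspace_euclid]) (auto simp: \<I>_def)
    then show "emeasure \<mu> {E \<in> grassmannian n d. (norm (orth_proj E (\<Sum>I)))\<^sup>2 > s / real n * (norm (\<Sum>I))\<^sup>2}
        \<le> ennreal (exp (- real n / 4) + exp (real d / 2 - s / 16))"
      using d s by (intro projection_tail[OF \<mu>]) auto
  qed
  also have "\<dots> = ennreal (real (card \<I>) * (exp (- real n / 4) + exp (real d / 2 - s / 16)))"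
    by (simp add: ennreal_of_nat_eq_real_of_nat ennreal_mult del: ennreal_plus)
  also have "\<dots> \<le> ennreal (exp (real d * ln (real n / real d) + 2 * real d) * (exp (- real n / 4) + exp (real d / 2 - s / 16)))"
    using card_small_subsets[OF V'(1,3) d] unfolding \<I>_def
    by (intro ennreal_leI mult_right_mono) (auto intro: add_nonneg_nonneg)
  finally show "emeasure \<mu> U \<le> ennreal (exp (real d * ln (real n / real d) + 2 * real d) * (exp (- real n / 4) + exp (real d / 2 - s / 16)))" .
qed

text \<open>The deterministic part: the inradius \<open>t\<close> gives the root of volume
  \<open>t / sqrt d\<close>, and the control of sums gives the second moment with
  \<open>B = 8 s d / n\<close>.\<close>

lemma isotropy_bounded_by_events:
  assumes E: "E \<in> grassmannian n d" and V: "good_vertices n V" and d: "d > 0" and n: "n > 0"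
    and e: "\<And>i. i < n \<Longrightarrow> e i \<in> V"
    and sums: "\<And>I. I \<subseteq> V \<Longrightarrow> card I \<le> d \<Longrightarrow> (norm (orth_proj E (\<Sum>I)))\<^sup>2 \<le> s / real n * (norm (\<Sum>I))\<^sup>2"
    and t: "t > 0" and s: "s \<ge> 0" and inr: "\<And>\<theta>. \<theta> \<in> E \<Longrightarrow> norm \<theta> = 1 \<Longrightarrow> \<exists>i<n. \<theta> \<bullet> e i \<ge> t"
  shows "(isotropy_constant E (convex hull (orth_proj E ` V)))\<^sup>2 \<le> 16 * s / (real d * real n * t\<^sup>2)"
proof -
  obtain b where b: "orthonormal_basis E d b" using grassmannian_onb[OF E] .
  have sE: "subspace E" "E \<subseteq> euclid n" using E by (auto simp: grassmannian_def)
  let ?K = "convex hull (orth_proj E ` V)"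
  define L where "L = isotropy_constant E ?K"
  have cb: "convex_body E ?K" by (rule proj_convex_body[OF E V])
  have V': "(norm (\<Sum>I))\<^sup>2 \<le> 4 * real (card I)" if "I \<subseteq> V" for I using V that by (simp add: good_vertices_def)
  have ball: "ball 0 t \<inter> E \<subseteq> ?K"
  proof (rule ball_subset_hull[OF sE(1)])
    show "finite (orth_proj E ` V)" using V by (simp add: good_vertices_def)
    show "orth_proj E ` V \<subseteq> E" using orth_proj(1)[OF sE] by auto
    show "orth_proj E ` V \<noteq> {}" using e[OF n] by auto
    fix \<theta> assume \<theta>: "\<theta> \<in> E" "norm \<theta> = 1"
    obtain i where i: "i < n" "\<theta> \<bullet> e i \<ge> t" using inr[OF \<theta>] by blast
    \<comment> \<open>For \<theta> in \<open>E\<close> the projection is invisible, so the support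
      function of the projected polytope is read off from the coordinates of \<theta>.\<close>
    have "\<theta> \<bullet> orth_proj E (e i) = \<theta> \<bullet> e i"
      using orth_proj(2)[OF sE \<theta>(1), of "e i"] by (simp add: orthogonal_def inner_diff_left inner_diff_right inner_commute[of _ \<theta>])
    then show "\<exists>a\<in>orth_proj E ` V. \<theta> \<bullet> a \<ge> t" using i e by force
  qed
  have "?K \<in> sets borel" using cb by (auto simp: convex_body_def borel_compact)
  then have "ennreal ((t / sqrt d) ^ d) \<le> emeasure (frame_measure b d) ?K"
    by (intro ball_volume_ge[OF b d t ball])
  then have vol: "(t / sqrt d) ^ d \<le> measure (frame_measure b d) ?K"
    using convex_body_vol[OF onb_dual_frame[OF b] cb] by simp
  have "real d ^ 3 * (t / sqrt d)\<^sup>2 * L\<^sup>2 \<le> 2 * (8 * s * real d / real n)"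
    unfolding L_def
  proof (rule isotropy_constant_bound[OF E d b V vol])
    show "t / sqrt d > 0" using t d by simp
    show "0 \<le> 8 * s * real d / real n" using s by simp
    fix I assume I: "I \<subseteq> V" "card I = d"
    have *: "(norm (orth_proj E (\<Sum>J)))\<^sup>2 \<le> s / real n * (4 * real (card J))" if "J \<subseteq> V" "card J \<le> d" for J
    proof -
      have "s / real n * (norm (\<Sum>J))\<^sup>2 \<le> s / real n * (4 * real (card J))"
        using V'[OF that(1)] s by (intro mult_left_mono) auto
      then show ?thesis using sums[OF that] by linarith
    qed
    have "(\<Sum>a\<in>I. (norm (orth_proj E a))\<^sup>2) \<le> (\<Sum>a\<in>I. s / real n * 4)"
    proof (rule sum_mono)
      fix a assume "a \<in> I"
      then show "(norm (orth_proj E a))\<^sup>2 \<le> s / real n * 4" using *[of "{a}"] I d by auto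
    qed
    then have "(\<Sum>a\<in>I. (norm (orth_proj E a))\<^sup>2) \<le> s / real n * (4 * real d)" using I(2) by (simp add: mult_ac)
    moreover have "(norm (orth_proj E (\<Sum>I)))\<^sup>2 \<le> s / real n * (4 * real d)" using *[of I] I by simp
    moreover have "s / real n * (4 * real d) + s / real n * (4 * real d) = 8 * s * real d / real n" by (simp add: field_simps)
    ultimately show "(norm (orth_proj E (\<Sum>I)))\<^sup>2 + (\<Sum>a\<in>I. (norm (orth_proj E a))\<^sup>2) \<le> 8 * s * real d / real n"
      by linarith
  qed
  moreover have "real d ^ 3 * (t / sqrt d)\<^sup>2 * L\<^sup>2 = real d * (real d * t\<^sup>2 * L\<^sup>2)"
    using d by (simp add: power_divide power3_eq_cube)
  moreover have "2 * (8 * s * real d / real n) = real d * (16 * s / real n)" by simp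
  ultimately have "real d * (real d * t\<^sup>2 * L\<^sup>2) \<le> real d * (16 * s / real n)" by linarith
  then have "real d * t\<^sup>2 * L\<^sup>2 \<le> 16 * s / real n" by (rule mult_left_le_imp_le) (use d in simp)
  then have "L\<^sup>2 \<le> (16 * s / real n) / (real d * t\<^sup>2)" using d t by (subst pos_le_divide_eq) (simp_all add: mult_ac)
  then show ?thesis by (simp add: L_def mult_ac)
qed

text \<open>Off the event \<open>U\<close> of large sums, a large isotropy constant forces a unit
  vector of \<open>E\<close> with all coordinates below \<open>t\<close>, which is rare. The
  remainder balances the parameters \<open>s\<close>, \<open>t\<close>, \<open>p\<close> and
  \<delta>.\<close>

lemma large_codim:
  assumes \<mu>: "is_grassmann_haar n d \<mu>" and V: "good_vertices n V" and d: "d > 0" "d \<le> n"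
    and q: "q = real n / real d" "ln q \<ge> 4" "ln q + 2 \<le> q / 8" "9 + ln q / 8 \<le> q powr (3 / 4) / 72" "q \<ge> 1"
    and C: "C > 640"
  shows "measure \<mu> {E \<in> grassmannian n d. \<not> isotropy_constant E (convex hull (orth_proj E ` V)) < C}
     \<le> 4 * exp (- (1 / 192) * max (ln (real n)) (real d))"
proof -
  note sp = haar_space[OF \<mu>]
  interpret \<mu>: prob_space \<mu> by (rule sp)
  have n: "n > 0" using d by simp
  obtain e where e: "orthonormal_basis (euclid n) n e" "\<And>i. i < n \<Longrightarrow> e i \<in> V"
    using V by (auto simp: good_vertices_def)
  \<comment> \<open>\<open>s / 16 = 4 d ln q\<close> pays for the entropy
    \<open>d ln q + 2 d\<close> and for \<open>d / 2\<close>, leaving an exponent of at most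
    \<open>- d ln q\<close>.\<close>
  define s where "s = 64 * real d * ln q"
  have s: "s \<ge> 0" using q by (simp add: s_def)
  define U where "U = (\<Union>I\<in>{I. I \<subseteq> V \<and> card I \<le> d}. {E \<in> grassmannian n d. (norm (orth_proj E (\<Sum>I)))\<^sup>2 > s / real n * (norm (\<Sum>I))\<^sup>2})"
  note U = large_sums_rare[OF \<mu> V d s, folded U_def]
  define bad where "bad = {E \<in> grassmannian n d. \<not> isotropy_constant E (convex hull (orth_proj E ` V)) < C}"
  have bad: "bad \<in> sets \<mu>"
  proof -
    have "{E \<in> grassmannian n d. isotropy_constant E (convex hull (orth_proj E ` V)) < C} \<in> sets \<mu>"
      by (rule haar_open[OF \<mu> isotropy_open[OF V d(1)]])
    then have "space \<mu> - {E \<in> grassmannian n d. isotropy_constant E (convex hull (orth_proj E ` V)) < C} \<in> sets \<mu>" by auto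
    moreover have "space \<mu> - {E \<in> grassmannian n d. isotropy_constant E (convex hull (orth_proj E ` V)) < C} = bad"
      by (auto simp: sp bad_def)
    ultimately show ?thesis by simp
  qed
  \<comment> \<open>Chosen such that \<open>10 t sqrt n = sqrt (ln q) / 2\<close>, where a normal
    variable still has the tail \<open>q^(-1/4) / 9\<close>, which is \<open>p\<close>.\<close>
  define t where "t = sqrt (ln q) / (20 * sqrt n)"
  have t: "t > 0" using q n by (simp add: t_def)
  have t2: "t\<^sup>2 = ln q / (400 * real n)" using q by (simp add: t_def power_divide power_mult_distrib)
  define p where "p = q powr (- 1 / 4) / 9"
  have p0: "p \<ge> 0" by (simp add: p_def)
  have p1: "p \<le> measure std_normal {10 * t * sqrt n..}"
  proof -
    have a: "10 * t * sqrt n = sqrt (ln q) / 2" using n by (simp add: t_def)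
    have b: "p = exp (- (sqrt (ln q) / 2)\<^sup>2) / 9"
      using q(2,5) by (simp add: p_def powr_def power_divide)
    show ?thesis unfolding a b using std_normal_tail_ge[of "sqrt (ln q) / 2"] q(2) by simp
  qed
  \<comment> \<open>The largest \<delta> that the condition on the number of large coordinates
    allows.\<close>
  define \<delta> where "\<delta> = sqrt (t\<^sup>2 * (real n * p / 4))"
  have q0: "q > 0" using q by simp
  have delta2: "\<delta>\<^sup>2 = ln q * q powr (- 1 / 4) / 14400"
  proof -
    have "\<delta>\<^sup>2 = t\<^sup>2 * (real n * p / 4)" using p0 by (simp add: \<delta>_def)
    then show ?thesis using n by (simp add: t2 p_def)
  qed
  have delta: "\<delta> > 0" using t n q0 by (simp add: \<delta>_def p_def)
  have delta_half: "\<delta> \<le> 1 / 2"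
  proof (rule power2_le_imp_le)
    have "ln q = 4 * ln (q powr (1 / 4))" using q0 by (simp add: ln_powr)
    also have "\<dots> \<le> 4 * q powr (1 / 4)" using ln_le_minus_one[of "q powr (1 / 4)"] q0 by simp
    finally have "ln q * q powr (- 1 / 4) \<le> 4 * q powr (1 / 4) * q powr (- 1 / 4)" by (intro mult_right_mono) auto
    also have "\<dots> = 4" using q0 by (simp add: powr_minus)
    finally show "\<delta>\<^sup>2 \<le> (1 / 2)\<^sup>2" unfolding delta2 by (simp add: power2_eq_square)
  qed simp
  have "emeasure \<mu> (bad - U) \<le> ennreal ((27 / \<delta>) ^ d * (exp (- real n / 2) + exp (- real n * p / 4)))"
  proof (rule small_inradius_rare[OF \<mu> d(1) n e(1) _ _ t delta delta_half p0 p1])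
    show "bad - U \<in> sets \<mu>" using bad U(1) by auto
    show "\<delta>\<^sup>2 \<le> t\<^sup>2 * (real n * p / 4)" using p0 by (simp add: \<delta>_def)
    fix E assume E: "E \<in> bad - U"
    then have EG: "E \<in> grassmannian n d" by (simp add: bad_def)
    show "\<exists>\<theta>\<in>E. norm \<theta> = 1 \<and> (\<forall>i<n. \<theta> \<bullet> e i < t)"
    proof (rule ccontr)
      assume nex: "\<not> ?thesis"
      define L where "L = isotropy_constant E (convex hull (orth_proj E ` V))"
      have "L\<^sup>2 \<le> 16 * s / (real d * real n * t\<^sup>2)"
        unfolding L_def
      proof (rule isotropy_bounded_by_events[OF EG V d(1) n e(2) _ t s])
        show "(norm (orth_proj E (\<Sum>I)))\<^sup>2 \<le> s / real n * (norm (\<Sum>I))\<^sup>2" if "I \<subseteq> V" "card I \<le> d" for I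
          using E EG that by (auto simp: U_def not_less)
        show "\<exists>i<n. \<theta> \<bullet> e i \<ge> t" if "\<theta> \<in> E" "norm \<theta> = 1" for \<theta>
          using nex that by (auto simp: not_less)
      qed
      \<comment> \<open>The logarithms cancel here: \<open>16 * 64 * 400 = 640^2\<close>.\<close>
      also have "\<dots> = 640\<^sup>2" using d n q(2) by (simp add: s_def t2)
      finally have "L \<le> 640" by (rule power2_le_imp_le) simp
      then show False using E C by (simp add: bad_def L_def)
    qed
  qed
  moreover have "emeasure \<mu> bad \<le> emeasure \<mu> (U \<union> (bad - U))" using bad U(1) by (intro emeasure_mono) auto
  moreover have "emeasure \<mu> (U \<union> (bad - U)) \<le> emeasure \<mu> U + emeasure \<mu> (bad - U)"
    using bad U(1) by (intro emeasure_subadditive) auto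
  ultimately have "emeasure \<mu> bad \<le> ennreal (exp (real d * ln (real n / real d) + 2 * real d) * (exp (- real n / 4) + exp (real d / 2 - s / 16)))
     + ennreal ((27 / \<delta>) ^ d * (exp (- real n / 2) + exp (- real n * p / 4)))"
    using U(2) by (meson add_mono order_trans)
  also have "\<dots> = ennreal (exp (real d * ln q + 2 * real d) * (exp (- real n / 4) + exp (real d / 2 - s / 16))
     + (27 / \<delta>) ^ d * (exp (- real n / 2) + exp (- real n * p / 4)))"
    using delta by (subst ennreal_plus[symmetric]) (auto simp: q(1) intro!: mult_nonneg_nonneg add_nonneg_nonneg)
  finally have "measure \<mu> bad \<le> exp (real d * ln q + 2 * real d) * (exp (- real n / 4) + exp (real d / 2 - s / 16))
     + (27 / \<delta>) ^ d * (exp (- real n / 2) + exp (- real n * p / 4))"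
    unfolding \<mu>.emeasure_eq_measure
    using delta by (subst (asm) ennreal_le_iff) (auto intro!: mult_nonneg_nonneg add_nonneg_nonneg)
  also have "\<dots> = exp (real d * ln q + 2 * real d - real n / 4) + exp (real d * ln q + 2 * real d + (real d / 2 - s / 16))
     + ((27 / \<delta>) ^ d * exp (- real n / 2) + (27 / \<delta>) ^ d * exp (- real n * p / 4))"
    by (simp add: distrib_left exp_add[symmetric])
  also have "\<dots> \<le> 4 * exp (- (1 / 192) * max (ln (real n)) (real d))"
  proof -
    define m where "m = max (ln (real n)) (real d)"
    \<comment> \<open>All exponents are compared with \<open>Y\<close>: \<open>n p = Y / 9\<close>,
      the factor \<open>(27 / \<delta>)^d\<close> is at most \<open>exp (Y / 72)\<close>, and
      \<open>m <= 8/3 Y\<close>. So \<open>Y / 72 - Y / 36 = - Y / 72\<close> is at most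
      \<open>- m / 192\<close>, the origin of the rate \<open>1 / 192\<close>.\<close>
    define Y where "Y = real d * q powr (3 / 4)"
    have nq: "real n = real d * q" using d q(1) by simp
    have d1: "real d \<ge> 1" using d by simp
    have lnn: "ln (real n) = ln (real d) + ln q" using d q0 by (simp add: nq ln_mult)
    have lnd: "ln (real d) \<le> real d" using ln_le_minus_one[of "real d"] d by simp
    have lnq: "ln q \<le> real d * ln q" using d1 q(2) by (simp add: mult_right_mono[of 1 "real d" "ln q", simplified])
    have dlnq: "4 * real d \<le> real d * ln q" using q(2) d by simp
    have m1: "m \<le> 2 * (real d * ln q)"
      unfolding m_def by (rule max.boundedI) (use lnn lnd lnq dlnq d1 in linarith)+
    have Y1: "3 / 4 * (real d * ln q) \<le> Y"
    proof -
      have "3 / 4 * ln q = ln (q powr (3 / 4))" using q0 by (simp add: ln_powr)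
      also have "\<dots> \<le> q powr (3 / 4)" using ln_le_minus_one[of "q powr (3 / 4)"] q0 by simp
      finally have "real d * (3 / 4 * ln q) \<le> Y" unfolding Y_def by (intro mult_left_mono) auto
      then show ?thesis by (simp add: mult_ac)
    qed
    have Y2: "Y \<le> real n"
    proof -
      have "q powr (3 / 4) \<le> q powr 1" using q(5) by (intro powr_mono) auto
      then show ?thesis using q0 unfolding Y_def nq by (intro mult_left_mono) auto
    qed
    have mY: "m \<le> 8 / 3 * Y" using m1 Y1 by linarith
    have m0: "m \<ge> 0" using d1 by (simp add: m_def)
    have "real d * (ln q + 2) \<le> real d * (q / 8)" using q(3) by (intro mult_left_mono) auto
    then have "real d * ln q + 2 * real d - real n / 4 \<le> - real n / 8" by (simp add: nq algebra_simps)
    then have 1: "exp (real d * ln q + 2 * real d - real n / 4) \<le> exp (- (1 / 192) * m)"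
      using Y2 mY m0 by simp
    have "real d * ln q + 2 * real d + (real d / 2 - s / 16) \<le> - (real d * ln q)"
      unfolding s_def using dlnq d1 by simp
    then have 2: "exp (real d * ln q + 2 * real d + (real d / 2 - s / 16)) \<le> exp (- (1 / 192) * m)"
      using m1 m0 by simp
    have dl: "(27 / \<delta>) ^ d \<le> exp (Y / 72)"
    proof -
      have "\<delta>\<^sup>2 \<ge> (q powr (- 1 / 8) / 120)\<^sup>2"
      proof -
        have "(q powr (- 1 / 8) / 120)\<^sup>2 = q powr (- 1 / 4) / 14400"
          by (simp add: power_divide power2_eq_square powr_add[symmetric])
        also have "\<dots> \<le> ln q * q powr (- 1 / 4) / 14400"
          using mult_right_mono[of 1 "ln q" "q powr (- 1 / 4)"] q(2) by simp
        finally show ?thesis by (simp add: delta2)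
      qed
      then have "q powr (- 1 / 8) / 120 \<le> \<delta>" by (rule power2_le_imp_le) (use delta in simp)
      then have "27 / \<delta> \<le> 27 / (q powr (- 1 / 8) / 120)" using q0 delta by (intro divide_left_mono) auto
      also have "\<dots> = 3240 * q powr (1 / 8)" using q0 by (simp add: powr_minus field_simps)
      also have "\<dots> \<le> exp 9 * exp (ln q / 8)"
      proof (intro mult_mono)
        \<comment> \<open>\<open>(5 / 2)^9\<close> exceeds \<open>27 * 120 = 3240\<close>, which
          explains the summand 9 in the threshold.\<close>
        have "exp (1::real) \<ge> 5 / 2"
          using exp_lower_Taylor_quadratic[of "1::real"] by simp
        then have "(5 / 2) ^ 9 \<le> exp (1::real) ^ 9" by (intro power_mono) auto
        also have "exp (1::real) ^ 9 = exp 9" using exp_of_nat_mult[of 9 "1::real"] by simp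
        finally show "3240 \<le> exp (9::real)" by (simp add: power_divide)
        show "q powr (1 / 8) \<le> exp (ln q / 8)" using q0 by (simp add: powr_def)
      qed auto
      also have "\<dots> = exp (9 + ln q / 8)" by (simp add: exp_add)
      also have "\<dots> \<le> exp (q powr (3 / 4) / 72)" using q(4) by simp
      finally have "(27 / \<delta>) ^ d \<le> exp (q powr (3 / 4) / 72) ^ d" using delta by (intro power_mono) auto
      then show ?thesis by (simp add: Y_def exp_of_nat_mult[symmetric])
    qed
    have "(27 / \<delta>) ^ d * exp (- real n / 2) \<le> exp (Y / 72) * exp (- real n / 2)"
      using dl by (rule mult_right_mono) simp
    also have "\<dots> = exp (Y / 72 - real n / 2)" by (simp add: exp_add[symmetric])
    also have "\<dots> \<le> exp (- (1 / 192) * m)" using Y2 mY m0 by simp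
    finally have 3: "(27 / \<delta>) ^ d * exp (- real n / 2) \<le> exp (- (1 / 192) * m)" .
    have np: "real n * p = Y / 9"
    proof -
      have "q * q powr (- 1 / 4) = q powr 1 * q powr (- 1 / 4)" using q0 by simp
      also have "\<dots> = q powr (3 / 4)" unfolding powr_add[symmetric] by simp
      finally show ?thesis by (simp add: nq p_def Y_def)
    qed
    have "(27 / \<delta>) ^ d * exp (- real n * p / 4) \<le> exp (Y / 72) * exp (- real n * p / 4)"
      using dl by (rule mult_right_mono) simp
    also have "\<dots> = exp (Y / 72 - real n * p / 4)" by (simp add: exp_add[symmetric])
    also have "\<dots> \<le> exp (- (1 / 192) * m)"
    proof -
      have "Y / 72 - real n * p / 4 = - Y / 72" unfolding np by simp
      then show ?thesis using mY m0 by simp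
    qed
    finally have 4: "(27 / \<delta>) ^ d * exp (- real n * p / 4) \<le> exp (- (1 / 192) * m)" .
    show ?thesis using 1 2 3 4 unfolding m_def[symmetric] by linarith
  qed
  finally show ?thesis by (simp only: bad_def)
qed

section \<open>The vertices of the cross-polytope and of the regular simplex\<close>

lemma norm_sum_orthonormal:
  fixes A :: "'a::real_inner set"
  assumes "finite A" "\<And>x. x \<in> A \<Longrightarrow> norm x = 1" "\<And>x y. x \<in> A \<Longrightarrow> y \<in> A \<Longrightarrow> x \<noteq> y \<Longrightarrow> x \<bullet> y = 0"
  shows "(norm (\<Sum>A))\<^sup>2 = real (card A)"
proof -
  have "(norm (\<Sum>x\<in>A. x))\<^sup>2 = (\<Sum>x\<in>A. (norm x)\<^sup>2)"
    using assms by (intro norm_sum_Pythagorean) (auto simp: pairwise_def orthogonal_def)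
  then show ?thesis using assms(2) by simp
qed

lemma norm_add_sq_le: "(norm (x + y))\<^sup>2 \<le> 2 * (norm x)\<^sup>2 + 2 * (norm (y::'a::real_inner))\<^sup>2"
proof -
  have "2 * (norm x)\<^sup>2 + 2 * (norm y)\<^sup>2 - (norm (x + y))\<^sup>2 = (norm (x - y))\<^sup>2"
    by (simp add: power2_norm_eq_inner inner_add_left inner_add_right inner_diff_left inner_diff_right inner_commute)
  then show ?thesis using zero_le_power2[of "norm (x - y)"] by linarith
qed

lemma convex_weighted_mem:
  fixes K :: "'a::real_vector set"
  assumes K: "convex K" "0 \<in> K" and A: "finite A" "\<And>i. i \<in> A \<Longrightarrow> y i \<in> K" "\<And>i. i \<in> A \<Longrightarrow> 0 \<le> w i" "sum w A \<le> 1"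
  shows "(\<Sum>i\<in>A. w i *\<^sub>R y i) \<in> K"
proof (cases "sum w A = 0")
  case True
  then have "w i = 0" if "i \<in> A" for i using A that by (simp add: sum_nonneg_eq_0_iff)
  then show ?thesis using K by simp
next
  case False
  define s where "s = sum w A"
  have s: "s > 0" using False A(3) sum_nonneg[of A w] by (simp add: s_def)
  have "(\<Sum>i\<in>A. (w i / s) *\<^sub>R y i) \<in> K"
    using A s K by (intro convex_sum) (auto simp: sum_divide_distrib[symmetric] s_def)
  then have "s *\<^sub>R (\<Sum>i\<in>A. (w i / s) *\<^sub>R y i) + (1 - s) *\<^sub>R 0 \<in> K"
    using K s A(4) by (intro convexD) (auto simp: s_def)
  then show ?thesis using s by (simp add: scaleR_sum_right)
qed

lemma sum_coord_unit_vec: "x \<in> euclid n \<Longrightarrow> (\<Sum>i<n. coord x i *\<^sub>R unit_vec i) = x"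
  using dual_frame_expand[OF onb_dual_frame[OF onb_euclid]] by (simp add: lin_comb_def)

definition cross_vertices :: "nat \<Rightarrow> rseq set" where
  "cross_vertices n = unit_vec ` {..<n} \<union> (\<lambda>i. - unit_vec i) ` {..<n}"

lemma convex_cross_polytope: "convex (cross_polytope n)"
proof (rule convexI)
  fix x y u v assume x: "x \<in> cross_polytope n" and y: "y \<in> cross_polytope n" and uv: "(0::real) \<le> u" "0 \<le> v" "u + v = 1"
  have "(\<Sum>i<n. \<bar>coord (u *\<^sub>R x + v *\<^sub>R y) i\<bar>) \<le> (\<Sum>i<n. u * \<bar>coord x i\<bar> + v * \<bar>coord y i\<bar>)"
  proof (rule sum_mono)
    fix i
    show "\<bar>coord (u *\<^sub>R x + v *\<^sub>R y) i\<bar> \<le> u * \<bar>coord x i\<bar> + v * \<bar>coord y i\<bar>"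
      using abs_triangle_ineq[of "u * coord x i" "v * coord y i"] uv by (simp add: abs_mult)
  qed
  also have "\<dots> = u * (\<Sum>i<n. \<bar>coord x i\<bar>) + v * (\<Sum>i<n. \<bar>coord y i\<bar>)"
    by (simp add: sum.distrib sum_distrib_left)
  also have "\<dots> \<le> u * 1 + v * 1"
    using x y uv by (intro add_mono mult_left_mono) (auto simp: cross_polytope_def)
  finally show "u *\<^sub>R x + v *\<^sub>R y \<in> cross_polytope n"
    using x y uv by (simp add: cross_polytope_def subspace_add subspace_scale subspace_euclid)
qed

lemma cross_polytope_hull:
  assumes "n > 0"
  shows "cross_polytope n = convex hull (cross_vertices n)"
proof
  show "convex hull (cross_vertices n) \<subseteq> cross_polytope n"
  proof (rule hull_minimal)
    show "cross_vertices n \<subseteq> cross_polytope n"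
      using subspace_neg[OF subspace_euclid]
      by (auto simp: cross_vertices_def cross_polytope_def unit_vec_mem if_distrib cong: if_cong)
  qed (rule convex_cross_polytope)
  show "cross_polytope n \<subseteq> convex hull (cross_vertices n)"
  proof
    fix x assume x: "x \<in> cross_polytope n"
    have mem: "unit_vec i \<in> convex hull (cross_vertices n)" "- unit_vec i \<in> convex hull (cross_vertices n)" if "i < n" for i
      using that by (auto intro!: hull_inc simp: cross_vertices_def)
    have "(1 / 2) *\<^sub>R unit_vec 0 + (1 / 2) *\<^sub>R (- unit_vec 0) \<in> convex hull (cross_vertices n)"
      using mem[OF assms] by (intro convexD) auto
    then have 0: "0 \<in> convex hull (cross_vertices n)" by simp
    have "x = (\<Sum>i<n. coord x i *\<^sub>R unit_vec i)" using x by (simp add: sum_coord_unit_vec cross_polytope_def)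
    also have "\<dots> = (\<Sum>i<n. \<bar>coord x i\<bar> *\<^sub>R (if coord x i \<ge> 0 then unit_vec i else - unit_vec i))"
      by (intro sum.cong) auto
    also have "\<dots> \<in> convex hull (cross_vertices n)"
      using x mem by (intro convex_weighted_mem 0) (auto simp: cross_polytope_def)
    finally show "x \<in> convex hull (cross_vertices n)" .
  qed
qed

lemma abs_coord_le_norm: "\<bar>coord x i\<bar> \<le> norm x"
  using Cauchy_Schwarz_ineq2[of x "unit_vec i"] by (simp add: norm_eq_sqrt_inner[of "unit_vec i"])

text \<open>A subset of the vertices splits into one of the \<open>unit_vec i\<close> and one of
  their negatives, each orthonormal; \<open>norm_add_sq_le\<close> joins the two sums.\<close>

lemma good_cross_vertices:
  assumes "n > 0"
  shows "good_vertices n (cross_vertices n)"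
  unfolding good_vertices_def
proof (intro conjI allI impI exI)
  show "finite (cross_vertices n)" by (simp add: cross_vertices_def)
  show "cross_vertices n \<subseteq> euclid n"
    using subspace_neg[OF subspace_euclid] by (auto simp: cross_vertices_def unit_vec_mem)
  have "card (cross_vertices n) \<le> card (unit_vec ` {..<n}) + card ((\<lambda>i. - unit_vec i) ` {..<n})"
    unfolding cross_vertices_def by (rule card_Un_le)
  also have "\<dots> \<le> n + n" using card_image_le[of "{..<n}"] by (intro add_mono) (auto intro: order_trans)
  finally show "card (cross_vertices n) \<le> 2 * n" by simp
  show "orthonormal_basis (euclid n) n unit_vec" by (rule onb_euclid)
  show "unit_vec i \<in> cross_vertices n" if "i < n" for i using that by (simp add: cross_vertices_def)
  show "0 < 1 / real n" using assms by simp
  show "ball 0 (1 / real n) \<inter> euclid n \<subseteq> convex hull cross_vertices n"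
  proof
    fix x assume x: "x \<in> ball 0 (1 / real n) \<inter> euclid n"
    have "(\<Sum>i<n. \<bar>coord x i\<bar>) \<le> (\<Sum>i<n. 1 / real n)"
      using x order_trans[OF abs_coord_le_norm[of x]] by (intro sum_mono) auto
    then show "x \<in> convex hull cross_vertices n"
      unfolding cross_polytope_hull[OF assms, symmetric] using x assms by (simp add: cross_polytope_def)
  qed
  fix I assume I: "I \<subseteq> cross_vertices n"
  have fI: "finite I" using I by (rule finite_subset) (simp add: cross_vertices_def)
  define J where "J = I \<inter> unit_vec ` {..<n}"
  have IJ: "I - J \<subseteq> (\<lambda>i. - unit_vec i) ` {..<n}" "J \<subseteq> I" "finite J" using I fI by (auto simp: J_def cross_vertices_def)
  have "(norm (\<Sum>J))\<^sup>2 = real (card J)"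
    using IJ by (intro norm_sum_orthonormal) (auto simp: J_def norm_eq_1)
  moreover have "(norm (\<Sum>(I - J)))\<^sup>2 = real (card (I - J))"
  proof (rule norm_sum_orthonormal)
    fix x y assume "x \<in> I - J"
    then obtain i where i: "x = - unit_vec i" using IJ(1) by blast
    then show "norm x = 1" by (simp add: norm_eq_1)
    assume "y \<in> I - J" "x \<noteq> y"
    moreover from this obtain j where "y = - unit_vec j" using IJ(1) by blast
    ultimately show "x \<bullet> y = 0" using i by auto
  qed (use fI in simp)
  moreover have "(norm (\<Sum>I))\<^sup>2 \<le> 2 * (norm (\<Sum>(I - J)))\<^sup>2 + 2 * (norm (\<Sum>J))\<^sup>2"
    unfolding sum.subset_diff[OF IJ(2) fI] by (rule norm_add_sq_le)
  moreover have "real (card I) = real (card (I - J)) + real (card J)"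
    using card_Diff_subset[OF IJ(3,2)] card_mono[OF fI IJ(2)] by simp
  ultimately show "(norm (\<Sum>I))\<^sup>2 \<le> 4 * real (card I)" by linarith
qed

section \<open>The regular simplex\<close>

lemma orthonormal_basis_euclid:
  assumes mem: "\<And>i. i < n \<Longrightarrow> e i \<in> euclid n" and orth: "\<And>i j. i < n \<Longrightarrow> j < n \<Longrightarrow> e i \<bullet> e j = (if i = j then 1 else 0)"
  shows "orthonormal_basis (euclid n) n e"
proof -
  have "\<exists>v. dual_frame (euclid n) n e v"
  proof (rule dual_frame_exists[OF onb_euclid mem])
    fix t i assume t: "lin_comb e n t = 0" and i: "i < n"
    have "lin_comb e n t \<bullet> e i = (\<Sum>j<n. t j * (if j = i then 1 else 0))"
      unfolding lin_comb_def inner_sum_left using i orth by (intro sum.cong) auto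
    then show "t i = 0" using t i by (simp add: if_distrib cong: if_cong)
  qed
  then show ?thesis using orth dual_frame_span unfolding orthonormal_basis_def by blast
qed

text \<open>
  A regular simplex is a homothet of the convex hull of an orthonormal basis \<open>e\<close> of n-space and the
  point \<open>f = - \<Sum>e / (sqrt (n + 1) + 1)\<close>, whose distance to each \<open>e i\<close> is again \<open>sqrt 2\<close>.
\<close>

definition simplex_apex :: "nat \<Rightarrow> (nat \<Rightarrow> rseq) \<Rightarrow> rseq" where
  "simplex_apex n e = - ((1 / (sqrt (real n + 1) + 1)) *\<^sub>R (\<Sum>i<n. e i))"

text \<open>All vertices except the apex are orthonormal and the apex has norm at most 1, so it
  changes the bound on subset sums only by a factor. The ball comes from explicit barycentric
  coordinates.\<close>

lemma good_simplex_vertices: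
  assumes n: "n > 0" and e: "orthonormal_basis (euclid n) n e"
  shows "good_vertices n (insert (simplex_apex n e) (e ` {..<n}))"
  unfolding good_vertices_def
proof (intro conjI allI impI exI)
  define s where "s = sqrt (real n + 1)"
  define f where "f = simplex_apex n e"
  have f: "f = - ((1 / (s + 1)) *\<^sub>R (\<Sum>i<n. e i))" by (simp add: f_def simplex_apex_def s_def)
  have s: "s \<ge> 0" "s\<^sup>2 = real n + 1" by (auto simp: s_def)
  note de = onb_dual_frame[OF e]
  have ee: "e i \<bullet> e j = (if i = j then 1 else 0)" if "i < n" "j < n" for i j
    using e that by (simp add: orthonormal_basis_def)
  have em: "e i \<in> euclid n" if "i < n" for i using de that by (simp add: dual_frame_def)
  show "finite (insert (simplex_apex n e) (e ` {..<n}))" by simp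
  show "insert (simplex_apex n e) (e ` {..<n}) \<subseteq> euclid n"
    unfolding f_def[symmetric] f using em by (auto intro!: subspace_neg subspace_scale subspace_sum subspace_euclid)
  show "card (insert (simplex_apex n e) (e ` {..<n})) \<le> 2 * n"
    using card_insert_le_m1[of "Suc n"] card_image_le[of "{..<n}" e] n
    by (simp add: card_insert_if)
  show "orthonormal_basis (euclid n) n e" by (rule e)
  show "e i \<in> insert (simplex_apex n e) (e ` {..<n})" if "i < n" for i using that by simp
  have norm_f: "(norm f)\<^sup>2 \<le> 1"
  proof -
    have "inj_on e {..<n}" by (rule dual_frame_inj[OF de])
    then have "(norm (\<Sum>i<n. e i))\<^sup>2 = real (card (e ` {..<n}))"
      using ee by (subst sum.reindex[of e "{..<n}" "\<lambda>x. x", simplified, symmetric], simp)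
        (rule norm_sum_orthonormal, auto simp: norm_eq_1 split: if_splits)
    also have "\<dots> = s\<^sup>2 - 1" using card_image[OF \<open>inj_on e {..<n}\<close>] s by simp
    finally have "(norm f)\<^sup>2 = (s\<^sup>2 - 1) / (s + 1)\<^sup>2"
      using s by (simp add: f power_mult_distrib power_divide)
    also have "\<dots> \<le> 1"
      using s(1) zero_less_power[of "s + 1" 2] by (subst pos_divide_le_eq) (auto simp: power2_eq_square algebra_simps)
    finally show ?thesis .
  qed
  \<comment> \<open>Solves \<open>1 - n \<rho> = \<rho> (n + s + 1)\<close>, so that the weight
    \<open>c\<close> below is at least \<rho> and outweighs every coordinate
    \<open>t i\<close>.\<close>
  define \<rho> where "\<rho> = 1 / (2 * real n + s + 1)"
  show "0 < 1 / (2 * real n + s + 1)" using s by (simp add: add_nonneg_pos)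
  have \<rho>: "\<rho> > 0" using s by (simp add: \<rho>_def add_nonneg_pos)
  show "ball 0 (1 / (2 * real n + s + 1)) \<inter> euclid n \<subseteq> convex hull (insert (simplex_apex n e) (e ` {..<n}))"
    unfolding f_def[symmetric] \<rho>_def[symmetric]
  proof
    fix x assume x: "x \<in> ball 0 \<rho> \<inter> euclid n"
    define t where "t = (\<lambda>i. x \<bullet> e i)"
    have xt: "x = (\<Sum>i<n. t i *\<^sub>R e i)"
      using dual_frame_expand[OF de, of x] x by (simp add: lin_comb_def t_def)
    have ti: "\<bar>t i\<bar> \<le> \<rho>" if "i < n" for i
    proof -
      have "\<bar>t i\<bar> \<le> norm x * norm (e i)" unfolding t_def by (rule Cauchy_Schwarz_ineq2)
      also have "norm (e i) = 1" using ee that by (simp add: norm_eq_1)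
      finally show ?thesis using x by simp
    qed
    \<comment> \<open>The vectors \<open>e i\<close> and \<open>s + 1\<close> times the apex sum to
      0, so adding this relation \<open>c\<close> times leaves \<open>x\<close> unchanged;
      \<open>c\<close> is chosen such that the weights sum to 1.\<close>
    define c where "c = (1 - (\<Sum>i<n. t i)) / (real n + s + 1)"
    have "(\<Sum>i<n. t i) \<le> (\<Sum>i<n. \<rho>)" using ti by (intro sum_mono) (auto simp: abs_le_iff)
    then have "(\<Sum>i<n. t i) \<le> n * \<rho>" by simp
    moreover have "1 - n * \<rho> = \<rho> * (real n + s + 1)" using s by (simp add: \<rho>_def field_simps)
    ultimately have c: "c \<ge> \<rho>" unfolding c_def using s by (subst pos_le_divide_eq) auto
    have cs: "(\<Sum>i<n. t i) + n * c + c * (s + 1) = 1"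
    proof -
      have "c * (real n + s + 1) = 1 - (\<Sum>i<n. t i)" using s by (simp add: c_def)
      then show ?thesis by (simp add: algebra_simps)
    qed
    define w where "w = (\<lambda>i. if i < n then t i + c else c * (s + 1))"
    define g where "g = (\<lambda>i. if i < n then e i else f)"
    have "(\<Sum>i<Suc n. w i *\<^sub>R g i) = (\<Sum>i<n. (t i + c) *\<^sub>R e i) + (c * (s + 1)) *\<^sub>R f"
      by (simp add: w_def g_def)
    also have "\<dots> = x"
      using s unfolding f by (simp add: scaleR_add_left sum.distrib xt[symmetric] scaleR_sum_right[symmetric])
    finally have "x = (\<Sum>i<Suc n. w i *\<^sub>R g i)" by simp
    also have "\<dots> \<in> convex hull (insert f (e ` {..<n}))"
    proof (rule convex_sum)
      show "(\<Sum>i<Suc n. w i) = 1" using cs by (simp add: w_def sum.distrib)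
      show "0 \<le> w i" if "i \<in> {..<Suc n}" for i
        using ti[of i] c \<rho> s that by (auto simp: w_def abs_le_iff)
      show "g i \<in> convex hull (insert f (e ` {..<n}))" for i by (auto simp: g_def intro!: hull_inc)
    qed auto
    finally show "x \<in> convex hull (insert f (e ` {..<n}))" .
  qed
  fix I assume I: "I \<subseteq> insert (simplex_apex n e) (e ` {..<n})"
  have fI: "finite I" using I by (rule finite_subset) simp
  have "(norm (\<Sum>(I - {f})))\<^sup>2 = real (card (I - {f}))"
  proof (rule norm_sum_orthonormal)
    fix x y assume "x \<in> I - {f}"
    then obtain i where i: "i < n" "x = e i" using I by (auto simp: f_def)
    then show "norm x = 1" using ee by (simp add: norm_eq_1)
    assume "y \<in> I - {f}" "x \<noteq> y"
    moreover from this obtain j where "j < n" "y = e j" using I by (auto simp: f_def)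
    ultimately show "x \<bullet> y = 0" using i ee by auto
  qed (use fI in simp)
  note J = this
  show "(norm (\<Sum>I))\<^sup>2 \<le> 4 * real (card I)"
  proof (cases "f \<in> I")
    case True
    have "(norm (f + \<Sum>(I - {f})))\<^sup>2 \<le> 2 * (norm f)\<^sup>2 + 2 * (norm (\<Sum>(I - {f})))\<^sup>2" by (rule norm_add_sq_le)
    moreover have "f + \<Sum>(I - {f}) = \<Sum>I" using sum.remove[OF fI True, of "\<lambda>x. x"] by simp
    moreover have "card I = Suc (card (I - {f}))" by (rule card.remove[OF fI True])
    ultimately show ?thesis using norm_f J by simp
  qed (use J in simp)
qed

text \<open>The edge vectors \<open>u i\<close> from one vertex have equal norms and equal mutual
  inner products. Subtracting a multiple of their sum from each makes them orthogonal, and the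
  common multiple becomes the shift \<open>z\<close>.\<close>

lemma regular_simplex_homothet:
  assumes n: "n > 0" and S: "regular_simplex n S"
  obtains e z \<alpha> where "orthonormal_basis (euclid n) n e" "z \<in> euclid n" "\<alpha> \<noteq> 0"
    "S = (\<lambda>x. z + \<alpha> *\<^sub>R x) ` (convex hull (insert (simplex_apex n e) (e ` {..<n})))"
proof -
  obtain W r where W: "W \<subseteq> euclid n" "card W = n + 1" "\<And>v w. v \<in> W \<Longrightarrow> w \<in> W \<Longrightarrow> v \<noteq> w \<Longrightarrow> dist v w = r" "S = convex hull W"
    using S by (auto simp: regular_simplex_def)
  have "finite W" using W(2) by (intro card_ge_0_finite) simp
  then obtain a where "bij_betw a {0..<n + 1} W" using ex_bij_betw_nat_finite[of W] W(2) by auto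
  then have a: "inj_on a {0..<n + 1}" "a ` {0..<n + 1} = W" by (auto simp: bij_betw_def)
  have aW: "a i \<in> W" if "i \<le> n" for i using a(2) that by auto
  have ad: "dist (a i) (a j) = r" if "i \<le> n" "j \<le> n" "i \<noteq> j" for i j
    using that a(1) aW by (intro W(3)) (auto simp: inj_on_def)
  have r: "r > 0"
  proof -
    have "a 0 \<noteq> a n" using inj_onD[OF a(1), of 0 n] n by auto
    then show ?thesis using ad[of 0 n] n by auto
  qed
  define u where "u i = a i - a n" for i
  define U where "U = (\<Sum>i<n. u i)"
  have uu: "u i \<bullet> u j = r\<^sup>2 / 2 * (if i = j then 2 else 1)" if ij: "i < n" "j < n" for i j
  proof -
    have nu: "u i \<bullet> u i = r\<^sup>2" if "i < n" for i
      using ad[of i n] that by (simp add: u_def dist_norm power2_norm_eq_inner[symmetric])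
    show ?thesis
    proof (cases "i = j")
      case False
      have "r\<^sup>2 = (norm (u i - u j))\<^sup>2" using ad[of i j] ij False by (simp add: u_def dist_norm)
      also have "\<dots> = u i \<bullet> u i + u j \<bullet> u j - 2 * (u i \<bullet> u j)"
        by (simp add: power2_norm_eq_inner inner_diff_left inner_diff_right inner_commute)
      finally show ?thesis using False nu ij by simp
    qed (use nu ij in simp)
  qed
  have uU: "u i \<bullet> U = r\<^sup>2 / 2 * (real n + 1)" if "i < n" for i
  proof -
    have "u i \<bullet> U = (\<Sum>j<n. r\<^sup>2 / 2 * (if i = j then 2 else 1))"
      unfolding U_def inner_sum_right using uu that by (intro sum.cong) auto
    also have "\<dots> = r\<^sup>2 / 2 * (\<Sum>j<n. 1 + (if i = j then 1 else 0))"
      unfolding sum_distrib_left by (intro sum.cong) auto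
    also have "\<dots> = r\<^sup>2 / 2 * (real n + 1)" using that by (simp add: sum.distrib)
    finally show ?thesis .
  qed
  have UU: "U \<bullet> U = r\<^sup>2 / 2 * (real n + 1) * real n"
  proof -
    have "U \<bullet> U = (\<Sum>i<n. u i \<bullet> U)" by (simp add: U_def inner_sum_left)
    then show ?thesis using uU by simp
  qed
  define s where "s = sqrt (real n + 1)"
  have s: "s > 0" "real n = s\<^sup>2 - 1" by (auto simp: s_def)
  \<comment> \<open>The smaller root of
    \<open>1 - 2 \<kappa> (n + 1) + \<kappa>^2 (n + 1) n = 0\<close>, which is the condition that
    the vectors \<open>e i\<close> are orthogonal.\<close>
  define \<kappa> where "\<kappa> = 1 / (s * (s + 1))"
  define \<alpha> where "\<alpha> = r / sqrt 2"
  have \<alpha>: "\<alpha> > 0" "\<alpha>\<^sup>2 = r\<^sup>2 / 2" using r by (auto simp: \<alpha>_def power_divide)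
  define e where "e i = (1 / \<alpha>) *\<^sub>R (u i - \<kappa> *\<^sub>R U)" for i
  have nk: "\<kappa> * real n = (s - 1) / s"
  proof -
    have "real n = (s - 1) * (s + 1)" using s(2) by (simp add: power2_eq_square algebra_simps)
    then show ?thesis using s(1) by (simp add: \<kappa>_def)
  qed
  have k: "1 - 2 * \<kappa> * (real n + 1) + \<kappa>\<^sup>2 * (real n + 1) * real n = 0"
  proof -
    have "\<kappa> * (real n + 1) = s / (s + 1)" using s by (simp add: \<kappa>_def power2_eq_square)
    with nk have "1 - 2 * \<kappa> * (real n + 1) + \<kappa>\<^sup>2 * (real n + 1) * real n = 1 - 2 * (s / (s + 1)) + s / (s + 1) * ((s - 1) / s)"
      by (metis (no_types, lifting) mult.assoc mult.left_commute power2_eq_square)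
    also have "s / (s + 1) * ((s - 1) / s) = (s - 1) / (s + 1)" using s(1) by simp
    also have "1 - 2 * (s / (s + 1)) + (s - 1) / (s + 1) = 0" using s(1) by (simp add: field_simps)
    finally show ?thesis .
  qed
  have "e i \<bullet> e j = (if i = j then 1 else 0)" if "i < n" "j < n" for i j
  proof -
    have "e i \<bullet> e j = (1 / \<alpha>\<^sup>2) * (u i \<bullet> u j - \<kappa> * (u i \<bullet> U) - \<kappa> * (u j \<bullet> U) + \<kappa>\<^sup>2 * (U \<bullet> U))"
      by (simp add: e_def inner_diff_left inner_diff_right inner_commute power2_eq_square algebra_simps)
    also have "\<dots> = (if i = j then 2 else 1) - 2 * \<kappa> * (real n + 1) + \<kappa>\<^sup>2 * (real n + 1) * real n"
      using r by (simp add: uu[OF that] uU[OF that(1)] uU[OF that(2)] UU \<alpha>(2) field_simps)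
    also have "\<dots> = (if i = j then 1 else 0)" using k by (auto split: if_splits)
    finally show ?thesis .
  qed
  moreover have mem: "a i \<in> euclid n" if "i \<le> n" for i using aW[OF that] W(1) by auto
  have Um: "U \<in> euclid n" unfolding U_def u_def using mem
    by (intro subspace_sum subspace_diff subspace_euclid) auto
  have "e i \<in> euclid n" if "i < n" for i
    unfolding e_def u_def using mem that Um by (intro subspace_scale subspace_diff subspace_euclid) auto
  ultimately have e: "orthonormal_basis (euclid n) n e" by (intro orthonormal_basis_euclid)
  define z where "z = a n + \<kappa> *\<^sub>R U"
  have z: "z \<in> euclid n" unfolding z_def using mem Um by (intro subspace_add subspace_scale subspace_euclid) auto
  have ae: "z + \<alpha> *\<^sub>R e i = a i" for i using \<alpha>(1) by (simp add: z_def e_def u_def)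
  have af: "z + \<alpha> *\<^sub>R simplex_apex n e = a n"
  proof -
    have "(\<Sum>i<n. e i) = (1 / \<alpha>) *\<^sub>R (U - (real n * \<kappa>) *\<^sub>R U)"
      by (simp add: e_def scaleR_sum_right[symmetric] sum_subtractf U_def sum_constant_scaleR)
    also have "U - (real n * \<kappa>) *\<^sub>R U = (1 - real n * \<kappa>) *\<^sub>R U" by (simp add: scaleR_diff_left)
    also have "1 - real n * \<kappa> = 1 / s"
      using nk s(1) by (simp add: mult.commute[of "real n"] field_simps)
    finally have "\<alpha> *\<^sub>R simplex_apex n e = - (\<kappa> *\<^sub>R U)"
      using \<alpha>(1) by (simp add: simplex_apex_def s_def[symmetric] \<kappa>_def mult.commute)
    then show ?thesis by (simp add: z_def)
  qed
  have "W = a ` {0..<n + 1}" by (rule a(2)[symmetric])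
  also have "{0..<n + 1} = insert n {..<n}" by auto
  also have "a ` \<dots> = (\<lambda>x. z + \<alpha> *\<^sub>R x) ` insert (simplex_apex n e) (e ` {..<n})"
    by (simp add: image_image ae af)
  finally have "S = (\<lambda>x. z + \<alpha> *\<^sub>R x) ` (convex hull (insert (simplex_apex n e) (e ` {..<n})))"
    unfolding W(4) by (simp only: convex_hull_affinity)
  then show thesis using that[OF e z _ ] \<alpha>(1) by (metis less_irrefl)
qed

lemma isotropy_constant_simplex_projection:
  assumes n: "n > 0" and S: "regular_simplex n S"
  obtains V where "good_vertices n V"
    "\<And>E d. E \<in> grassmannian n d \<Longrightarrow> isotropy_constant E (orth_proj E ` S) = isotropy_constant E (convex hull (orth_proj E ` V))"
proof -
  obtain e z \<alpha> where e: "orthonormal_basis (euclid n) n e" and z: "z \<in> euclid n" and \<alpha>: "\<alpha> \<noteq> 0"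
    and Seq: "S = (\<lambda>x. z + \<alpha> *\<^sub>R x) ` (convex hull (insert (simplex_apex n e) (e ` {..<n})))"
    using regular_simplex_homothet[OF n S] .
  define V where "V = insert (simplex_apex n e) (e ` {..<n})"
  show thesis
  proof
    show "good_vertices n V" unfolding V_def by (rule good_simplex_vertices[OF n e])
    fix E d assume E: "E \<in> grassmannian n d"
    then have sE: "subspace E" "E \<subseteq> euclid n" by (auto simp: grassmannian_def)
    note lin = orth_proj_linear[OF E]
    have "orth_proj E ` S = (\<lambda>x. orth_proj E z + \<alpha> *\<^sub>R x) ` (orth_proj E ` (convex hull V))"
      by (simp add: Seq V_def image_image linear_add[OF lin] linear_scale[OF lin])
    then show "isotropy_constant E (orth_proj E ` S) = isotropy_constant E (convex hull (orth_proj E ` V))"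
      using isotropy_constant_affine[OF sE(1) orth_proj(1)[OF sE] \<alpha>] by (simp add: orth_proj_hull[OF E])
  qed
qed

section \<open>Uniform constants for all dimensions and both polytopes\<close>

lemma bad_projections_rare:
  obtains C :: real where "C > 0"
    "\<And>n d \<mu> V. is_grassmann_haar n d \<mu> \<Longrightarrow> good_vertices n V \<Longrightarrow> d > 0 \<Longrightarrow> d \<le> n \<Longrightarrow>
       measure \<mu> {E \<in> grassmannian n d. \<not> isotropy_constant E (convex hull (orth_proj E ` V)) < C}
         \<le> 4 * exp (- (1 / 192) * max (ln (real n)) (real d))"
proof -
  obtain q0 :: real where q0: "q0 \<ge> 1"
    "\<And>q. q \<ge> q0 \<Longrightarrow> ln q \<ge> 4 \<and> ln q + 2 \<le> q / 8 \<and> 9 + ln q / 8 \<le> q powr (3 / 4) / 72"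
    using threshold_exists by blast
  \<comment> \<open>641 exceeds the 640 of \<open>large_codim\<close>, and the summand 1 makes the
    bound for bounded \<open>n / d\<close> strict.\<close>
  define C where "C = max 641 (sqrt (16 * q0\<^sup>2 * 36 powr q0) + 1)"
  show thesis
  proof
    show "C > 0" by (simp add: C_def)
    fix n d \<mu> V
    assume \<mu>: "is_grassmann_haar n d \<mu>" and V: "good_vertices n V" and d: "(d::nat) > 0" "d \<le> n"
    show "measure \<mu> {E \<in> grassmannian n d. \<not> isotropy_constant E (convex hull (orth_proj E ` V)) < C}
         \<le> 4 * exp (- (1 / 192) * max (ln (real n)) (real d))"
    proof (cases "real n \<le> q0 * real d")
      case True
      have "isotropy_constant E (convex hull (orth_proj E ` V)) < C" if "E \<in> grassmannian n d" for E
      proof -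
        have "isotropy_constant E (convex hull (orth_proj E ` V)) \<le> sqrt (16 * q0\<^sup>2 * 36 powr q0)"
          by (rule real_le_rsqrt[OF isotropy_constant_small_codim[OF that d(1) V True]])
        then show ?thesis by (simp add: C_def)
      qed
      then have "{E \<in> grassmannian n d. \<not> isotropy_constant E (convex hull (orth_proj E ` V)) < C} = {}" by auto
      then show ?thesis by (simp only: measure_empty) simp
    next
      case False
      then have "real n / real d \<ge> q0" using d by (simp add: pos_le_divide_eq)
      from q0(2)[OF this] show ?thesis
        using q0(1) \<open>real n / real d \<ge> q0\<close> by (intro large_codim[OF \<mu> V d refl]) (auto simp: C_def)
    qed
  qed
qed

theorem proposition3p3:
  shows "\<exists>C c1 c2 :: real. C > 0 \<and> c1 > 0 \<and> c2 > 0 \<and>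
    (\<forall>(n::nat) (d::nat) (\<mu> :: rseq set measure) (S :: rseq set).
       1 \<le> d \<and> d \<le> n \<and> is_grassmann_haar n d \<mu> \<and>
       regular_simplex n S \<and> has_barycenter (euclid n) S 0 \<longrightarrow>
       measure \<mu> {E \<in> grassmannian n d.
           isotropy_constant E (orth_proj E ` cross_polytope n) < C \<and>
           isotropy_constant E (orth_proj E ` S) < C}
         > 1 - c1 * exp (- c2 * max (ln (real n)) (real d)))"
proof -
  obtain C :: real where C: "C > 0"
    "\<And>n d \<mu> V. is_grassmann_haar n d \<mu> \<Longrightarrow> good_vertices n V \<Longrightarrow> d > 0 \<Longrightarrow> d \<le> n \<Longrightarrow>
       measure \<mu> {E \<in> grassmannian n d. \<not> isotropy_constant E (convex hull (orth_proj E ` V)) < C}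
         \<le> 4 * exp (- (1 / 192) * max (ln (real n)) (real d))"
    by (rule bad_projections_rare) blast
  show ?thesis
  \<comment> \<open>Each polytope has an exceptional set of measure at most 4 times the exponential;
    9 exceeds 8 and makes the inequality strict.\<close>
  proof (rule exI[of _ C], rule exI[of _ 9], rule exI[of _ "1 / 192"], intro conjI allI impI)
    fix n d and \<mu> :: "rseq set measure" and S :: "rseq set"
    assume asm: "1 \<le> d \<and> d \<le> n \<and> is_grassmann_haar n d \<mu> \<and> regular_simplex n S \<and> has_barycenter (euclid n) S 0"
    then have d: "d > 0" "d \<le> n" and n: "n > 0" and \<mu>: "is_grassmann_haar n d \<mu>" and S: "regular_simplex n S" by auto
    interpret prob_space \<mu> by (rule haar_space[OF \<mu>])
    obtain V where V: "good_vertices n V"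
      "\<And>E d. E \<in> grassmannian n d \<Longrightarrow> isotropy_constant E (orth_proj E ` S) = isotropy_constant E (convex hull (orth_proj E ` V))"
      using isotropy_constant_simplex_projection[OF n S] by metis
    define G where "G V = {E \<in> grassmannian n d. isotropy_constant E (convex hull (orth_proj E ` V)) < C}" for V
    have bad: "measure \<mu> (space \<mu> - G W) \<le> 4 * exp (- (1 / 192) * max (ln (real n)) (real d))"
      and G: "G W \<in> sets \<mu>" if W: "good_vertices n W" for W
    proof -
      have "space \<mu> - G W = {E \<in> grassmannian n d. \<not> isotropy_constant E (convex hull (orth_proj E ` W)) < C}"
        by (auto simp: haar_space[OF \<mu>] G_def)
      then show "measure \<mu> (space \<mu> - G W) \<le> 4 * exp (- (1 / 192) * max (ln (real n)) (real d))"
        using C(2)[OF \<mu> W d] by simp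
      show "G W \<in> sets \<mu>" unfolding G_def by (rule haar_open[OF \<mu> isotropy_open[OF W d(1)]])
    qed
    note X = good_cross_vertices[OF n]
    have eq: "{E \<in> grassmannian n d. isotropy_constant E (orth_proj E ` cross_polytope n) < C \<and> isotropy_constant E (orth_proj E ` S) < C}
        = G (cross_vertices n) \<inter> G V"
      unfolding G_def cross_polytope_hull[OF n] by (auto simp: V(2) orth_proj_hull)
    have "measure \<mu> (space \<mu> - (G (cross_vertices n) \<inter> G V))
       \<le> measure \<mu> (space \<mu> - G (cross_vertices n)) + measure \<mu> (space \<mu> - G V)"
      unfolding Diff_Int using G[OF X] G[OF V(1)] by (intro measure_Un_le) auto
    moreover have "measure \<mu> (space \<mu> - (G (cross_vertices n) \<inter> G V)) = 1 - measure \<mu> (G (cross_vertices n) \<inter> G V)"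
      using G[OF X] G[OF V(1)] by (intro prob_compl) auto
    moreover have "exp (- (1 / 192) * max (ln (real n)) (real d)) > 0" by simp
    ultimately show "1 - 9 * exp (- (1 / 192) * max (ln (real n)) (real d))
       < measure \<mu> {E \<in> grassmannian n d. isotropy_constant E (orth_proj E ` cross_polytope n) < C \<and> isotropy_constant E (orth_proj E ` S) < C}"
      unfolding eq using bad[OF X] bad[OF V(1)] by linarith
  qed (use C in auto)
qed

end
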